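(* Let $N\ge1$ be an integer and $p\in[1+\frac4N,3+\frac4N]$. Then there exists $\hat c>0$ such that for all $c\in(0,\hat c)$ the functional $\mathcal{E}$, restricted to $\sigma(c)$, has no critical points.
   Context: For $c>0$, $$\sigma(c)=\Big\{u\in H^1(\mathbb{R}^N):\int_{\mathbb{R}^N}|u|^2|\nabla u|^2dx<\infty,\ \|u\|_{L^2(\mathbb{R}^N)}^2=c\Big\},$$ $$\mathcal{E}(u)=\frac12\int_{\mathbb{R}^N}|\nabla u|^2dx+\int_{\mathbb{R}^N}|u|^2|\nabla u|^2dx-\frac1{p+1}\int_{\mathbb{R}^N}|u|^{p+1}dx.$$ A critical point of $\mathcal{E}$ restricted to $\sigma(c)$ is a $u\in\sigma(c)$ for which there is a Lagrange multiplier $\lambda\in\mathbb{R}$ such that $u$ satisfies, in the weak (distributional) sense in $\mathbb{R}^N$, $$-\Delta u-\lambda u-u\,\Delta|u|^2=|u|^{p-1}u.$$ *)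

theory Defs
  imports "HOL-Analysis.Analysis"
begin

text \<open>
  Functions are real-valued; an element of a Lebesgue or Sobolev space is given by any
  Lebesgue measurable representative. The space \<open>R^N\<close> is \<^typ>\<open>real ^ 'n\<close>, so that
  \<open>N = CARD('n) \<ge> 1\<close>.
\<close>

definition grad :: "(real ^ 'n \<Rightarrow> real) \<Rightarrow> real ^ 'n \<Rightarrow> real ^ 'n" where
  "grad f x = (\<chi> i. frechet_derivative f (at x) (axis i 1))"

primrec C_k :: "nat \<Rightarrow> (real ^ 'n \<Rightarrow> real) \<Rightarrow> bool" where
  "C_k 0 f \<longleftrightarrow> continuous_on UNIV f"
| "C_k (Suc k) f \<longleftrightarrow> (\<forall>x. f differentiable (at x)) \<and> (\<forall>i. C_k k (\<lambda>x. grad f x $ i))"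

definition test_functions :: "(real ^ 'n \<Rightarrow> real) set" where
  "test_functions = {\<phi>. (\<forall>k. C_k k \<phi>) \<and> compact (closure {x. \<phi> x \<noteq> 0})}"

definition locally_integrable ::
  "(real ^ 'n \<Rightarrow> 'b :: {banach, second_countable_topology}) \<Rightarrow> bool" where
  "locally_integrable f \<longleftrightarrow> (\<forall>K. compact K \<longrightarrow> set_integrable lebesgue K f)"

definition square_integrable ::
  "(real ^ 'n \<Rightarrow> 'b :: {banach, second_countable_topology}) \<Rightarrow> bool" where
  "square_integrable f \<longleftrightarrow>
     f \<in> borel_measurable lebesgue \<and> integrable lebesgue (\<lambda>x. (norm (f x))\<^sup>2)"

definition has_weak_gradient ::
  "(real ^ 'n \<Rightarrow> real) \<Rightarrow> (real ^ 'n \<Rightarrow> real ^ 'n) \<Rightarrow> bool" where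
  "has_weak_gradient u g \<longleftrightarrow>
     locally_integrable u \<and> locally_integrable g \<and>
     (\<forall>\<phi>\<in>test_functions. \<forall>i.
        (\<integral>x. u x * grad \<phi> x $ i \<partial>lebesgue) = - (\<integral>x. g x $ i * \<phi> x \<partial>lebesgue))"

text \<open>
  Weak gradients are unique up to null sets, so the integrals below do not depend on the
  representative chosen here.
\<close>
definition weak_grad :: "(real ^ 'n \<Rightarrow> real) \<Rightarrow> real ^ 'n \<Rightarrow> real ^ 'n" where
  "weak_grad u = (SOME g. has_weak_gradient u g)"

definition H1 :: "(real ^ 'n \<Rightarrow> real) set" where
  "H1 = {u. square_integrable u \<and> (\<exists>g. has_weak_gradient u g \<and> square_integrable g)}"

definition sigma :: "real \<Rightarrow> (real ^ 'n \<Rightarrow> real) set" where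
  "sigma c = {u \<in> H1.
     integrable lebesgue (\<lambda>x. \<bar>u x\<bar>\<^sup>2 * (norm (weak_grad u x))\<^sup>2) \<and>
     (\<integral>x. \<bar>u x\<bar>\<^sup>2 \<partial>lebesgue) = c}"

definition energy :: "real \<Rightarrow> (real ^ 'n \<Rightarrow> real) \<Rightarrow> real" where
  "energy p u =
     1 / 2 * (\<integral>x. (norm (weak_grad u x))\<^sup>2 \<partial>lebesgue)
     + (\<integral>x. \<bar>u x\<bar>\<^sup>2 * (norm (weak_grad u x))\<^sup>2 \<partial>lebesgue)
     - 1 / (p + 1) * (\<integral>x. \<bar>u x\<bar> powr (p + 1) \<partial>lebesgue)"

text \<open>
  Weak form of \<open>- \<Delta>u - \<mu>u - u \<Delta>|u|^2 = |u|^(p-1) u\<close>. The term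
  \<open>- u \<Delta>|u|^2\<close> is paired with \<open>\<phi>\<close> as the integral of
  \<open>\<nabla>(u^2) \<bullet> \<nabla>(u \<phi>) = 2 u^2 \<nabla>u \<bullet> \<nabla>\<phi> + 2 u |\<nabla>u|^2 \<phi>\<close>.
\<close>
definition weak_solution :: "real \<Rightarrow> real \<Rightarrow> (real ^ 'n \<Rightarrow> real) \<Rightarrow> bool" where
  "weak_solution p \<mu> u \<longleftrightarrow>
     (\<forall>\<phi>\<in>test_functions.
        (\<integral>x. weak_grad u x \<bullet> grad \<phi> x \<partial>lebesgue)
        - \<mu> * (\<integral>x. u x * \<phi> x \<partial>lebesgue)
        + 2 * (\<integral>x. \<bar>u x\<bar>\<^sup>2 * (weak_grad u x \<bullet> grad \<phi> x)
                 + u x * (norm (weak_grad u x))\<^sup>2 * \<phi> x \<partial>lebesgue)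
        = (\<integral>x. \<bar>u x\<bar> powr (p - 1) * u x * \<phi> x \<partial>lebesgue))"

text \<open>
  Critical points of the restriction of \<^const>\<open>energy\<close> to \<^term>\<open>sigma c\<close> are by
  definition the elements of \<^term>\<open>sigma c\<close> that satisfy the Euler-Lagrange equation
  weakly for some multiplier. For \<open>p\<close> between \<open>1\<close> and \<open>3 + 4/N\<close>, all integrals in
  \<^const>\<open>energy\<close> and \<^const>\<open>weak_solution\<close> converge absolutely on \<^term>\<open>sigma c\<close>.
\<close>
definition constrained_critical_point ::
  "real \<Rightarrow> real \<Rightarrow> (real ^ 'n \<Rightarrow> real) \<Rightarrow> bool" where
  "constrained_critical_point p c u \<longleftrightarrow> u \<in> sigma c \<and> (\<exists>\<mu>. weak_solution p \<mu> u)"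

end

theory Submission
  imports Defs
begin

text \<open>
  Testing the equation with \<open>u\<close> gives the Nehari identity and testing it with \<open>x \<bullet> \<nabla>u\<close> the
  Pohozaev identity; eliminating the multiplier leaves
  \<open>\<integral>|\<nabla>u|^2 + (N + 2) \<integral>u^2 |\<nabla>u|^2 = N (p - 1) / (2 (p + 1)) \<integral>|u|^(p + 1)\<close>. Since
  \<open>|u|^(p + 1) \<le> |u|^(2 + 4/N) + |u|^(4 + 4/N)\<close>, the Gagliardo-Nirenberg inequality for \<open>u\<close> in
  terms of its \<open>L^2\<close> norm and for \<open>u^2\<close> in terms of its \<open>L^1\<close> norm bounds the right-hand side by
  \<open>C c^(2/N)\<close> times the left-hand side, which is impossible for small \<open>c\<close>.

  Neither test is admissible for a mere weak solution. Formally
  \<open>v = \<integral>\<^sub>0\<^sup>u sqrt (1 + 2 s^2) ds\<close> solves the semilinear equation \<open>- \<Delta>v = f\<close> with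
  \<open>f, \<nabla>v \<in> L^2\<close>, for which both identities follow by mollification. The original equation only
  says that \<open>z = u + 2/3 u^3\<close> has an integrable Laplacian; passing from \<open>z\<close> to \<open>v\<close> is a
  renormalization argument, in which the possible concentration of \<open>|\<nabla>z|^2\<close> along mollifications
  is controlled by testing with a slowly increasing bounded function of \<open>z\<close>.
\<close>

section \<open>Smooth bump functions\<close>

text \<open>The weight \<open>sqrt (1 + 2 s^2)\<close> is dictated by the energy: it gives
  \<open>|\<nabla>v|^2 = |\<nabla>u|^2 + 2 u^2 |\<nabla>u|^2\<close>, which is exactly what
  membership in \<open>sigma c\<close> controls, whereas
  \<open>|\<nabla>z|^2 = (1 + 2 u^2)^2 |\<nabla>u|^2\<close> contains
  \<open>u^4 |\<nabla>u|^2\<close>, about which nothing is known. This is why z cannot be tested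
  directly and why the passage to v has to be justified. The upper bound on p acts twice. It places
  \<open>p + 1\<close> below \<open>4 + 4/N\<close>, and it makes \<open>f\<close> square
  integrable: f grows like \<open>|u|^(p - 1)\<close>, and \<open>2 (p - 1) \<le> 4 + 8/N\<close> is
  the exponent that Gagliardo-Nirenberg gives for \<open>u^2\<close> once \<open>u^2\<close> is
  known to lie in \<open>L^2\<close>. The Gagliardo-Nirenberg inequality is obtained by one argument
  for all dimensions: truncate at height l, choose a cube so large that the mean of the truncation
  over it is at most l/4, compare each point of the superlevel set with that mean by translations,
  and integrate the resulting bounds over all heights l.\<close>

lemma grad_eq_of_GDERIV:
  fixes f :: "real ^ 'n \<Rightarrow> real"
  assumes "GDERIV f x :> D"
  shows "grad f x = D"
proof -
  have "frechet_derivative f (at x) = (\<lambda>h. h \<bullet> D)"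
    using assms frechet_derivative_at unfolding gderiv_def by metis
  then show ?thesis by (simp add: grad_def vec_eq_iff inner_axis' )
qed

lemma GDERIV_grad:
  fixes f :: "real ^ 'n \<Rightarrow> real"
  assumes "f differentiable (at x)"
  shows "GDERIV f x :> grad f x"
proof -
  let ?L = "frechet_derivative f (at x)"
  have d: "(f has_derivative ?L) (at x)" using assms frechet_derivative_works by blast
  have l: "linear ?L" using d has_derivative_linear by blast
  have "?L h = h \<bullet> grad f x" for h
  proof -
    have "?L h = ?L (\<Sum>i\<in>UNIV. h $ i *\<^sub>R axis i 1)"
      by (simp add: basis_expansion scalar_mult_eq_scaleR[symmetric])
    also have "\<dots> = (\<Sum>i\<in>UNIV. h $ i * ?L (axis i 1))"
      using l by (simp add: linear_sum linear_cmul)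
    finally show ?thesis by (simp add: inner_vec_def grad_def)
  qed
  then have "?L = (\<lambda>h. h \<bullet> grad f x)" by auto
  with d show ?thesis by (simp add: gderiv_def)
qed

lemma GDERIV_imp_differentiable: "GDERIV f x :> D \<Longrightarrow> f differentiable (at x)"
  unfolding gderiv_def differentiable_def by blast

lemma C_k_Suc_D:
  fixes f :: "real ^ 'n \<Rightarrow> real"
  shows "C_k (Suc k) f \<Longrightarrow> C_k k f"
proof (induction k arbitrary: f)
  case 0
  then show ?case
    by (auto intro!: differentiable_imp_continuous_on simp: differentiable_on_def differentiable_at_withinI)
next
  case (Suc k)
  then show ?case by (metis C_k.simps(2))
qed

lemma C_k_SucI:
  fixes f :: "real ^ 'n \<Rightarrow> real"
  assumes "\<And>x. GDERIV f x :> D x" "\<And>i. C_k k (\<lambda>x. D x $ i)"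
  shows "C_k (Suc k) f"
proof -
  have "grad f = D" using grad_eq_of_GDERIV[OF assms(1)] by blast
  then show ?thesis using assms GDERIV_imp_differentiable[OF assms(1)] by auto
qed

lemma C_k_SucD:
  fixes f :: "real ^ 'n \<Rightarrow> real"
  assumes "C_k (Suc k) f"
  shows "GDERIV f x :> grad f x" "C_k k (\<lambda>x. grad f x $ i)"
  using assms GDERIV_grad by auto

lemma C_k_const: "C_k k (\<lambda>x::real^'n. c)"
proof (induction k arbitrary: c)
  case (Suc k)
  have "GDERIV (\<lambda>x::real^'n. c) x :> 0" for x by (rule GDERIV_const)
  from C_k_SucI[OF this] Suc show ?case by simp
qed simp

lemma C_k_nth: "C_k k (\<lambda>x::real^'n. x $ j)"
proof (cases k)
  case (Suc k)
  have "GDERIV (\<lambda>x::real^'n. x $ j) x :> axis j 1" for x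
    unfolding gderiv_def by (auto simp: inner_axis intro!: bounded_linear_imp_has_derivative bounded_linear_vec_nth)
  from C_k_SucI[OF this] Suc show ?thesis using C_k_const by blast
qed (simp add: continuous_on_vec_lambda continuous_on_component)

lemma C_k_add:
  fixes f g :: "real ^ 'n \<Rightarrow> real"
  shows "C_k k f \<Longrightarrow> C_k k g \<Longrightarrow> C_k k (\<lambda>x. f x + g x)"
proof (induction k arbitrary: f g)
  case 0
  then show ?case by (auto intro: continuous_on_add)
next
  case (Suc k)
  have "GDERIV (\<lambda>x. f x + g x) x :> grad f x + grad g x" for x
    using Suc.prems C_k_SucD GDERIV_add by blast
  from C_k_SucI[OF this] show ?case using Suc by simp
qed

lemma C_k_mult:
  fixes f g :: "real ^ 'n \<Rightarrow> real"
  shows "C_k k f \<Longrightarrow> C_k k g \<Longrightarrow> C_k k (\<lambda>x. f x * g x)"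
proof (induction k arbitrary: f g)
  case 0
  then show ?case by (auto intro: continuous_on_mult)
next
  case (Suc k)
  have "GDERIV (\<lambda>x. f x * g x) x :> f x *\<^sub>R grad g x + g x *\<^sub>R grad f x" for x
    using Suc.prems C_k_SucD GDERIV_mult by blast
  from C_k_SucI[OF this] show ?case
    using Suc C_k_Suc_D[OF Suc.prems(1)] C_k_Suc_D[OF Suc.prems(2)] by (simp add: C_k_add)
qed

lemma GDERIV_affine:
  fixes f :: "'a::real_inner \<Rightarrow> real"
  assumes "GDERIV f (a *\<^sub>R x + b) :> D"
  shows "GDERIV (\<lambda>x. f (a *\<^sub>R x + b)) x :> a *\<^sub>R D"
proof -
  have "((\<lambda>x. a *\<^sub>R x + b) has_derivative (\<lambda>h. a *\<^sub>R h)) (at x)"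
    by (auto intro!: derivative_eq_intros)
  from has_derivative_compose[OF this assms[unfolded gderiv_def]]
  show ?thesis by (simp add: gderiv_def)
qed

lemma C_k_affine:
  fixes f :: "real ^ 'n \<Rightarrow> real"
  shows "C_k k f \<Longrightarrow> C_k k (\<lambda>x. f (a *\<^sub>R x + b))"
proof (induction k arbitrary: f)
  case 0
  then show ?case
    by (auto intro!: continuous_on_compose2[of UNIV f] continuous_intros)
next
  case (Suc k)
  have "GDERIV (\<lambda>x. f (a *\<^sub>R x + b)) x :> a *\<^sub>R grad f (a *\<^sub>R x + b)" for x
    using Suc.prems C_k_SucD GDERIV_affine by blast
  then show ?case
    by (rule C_k_SucI)
       (use Suc.IH[OF C_k_SucD(2)[OF Suc.prems]] in \<open>auto intro!: C_k_mult C_k_const simp del: C_k.simps\<close>)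
qed

text \<open>The negative powers of t close the family under differentiation: the derivative of
  \<open>flat j\<close> is a combination of \<open>flat (j + 2)\<close> and
  \<open>flat (j + 1)\<close>, so smoothness of every order follows by a single induction.\<close>

definition flat :: "nat \<Rightarrow> real \<Rightarrow> real" where
  "flat j t = (if t > 0 then (1 / t) ^ j * exp (- 1 / t) else 0)"

text \<open>With y = 1/t, the term of degree j + 2 of the exponential series alone gives the bound.
  The quadratic decay at 0 is what makes the derivative there vanish.\<close>

lemma flat_le: "\<bar>flat j t\<bar> \<le> fact (j + 2) * t\<^sup>2"
proof (cases "t > 0")
  case True
  define y where "y = 1 / t"
  have y: "y > 0" using True by (simp add: y_def)
  have sm: "summable (\<lambda>n. y ^ n /\<^sub>R fact n)" by (rule summable_exp_generic)
  have "y ^ (j+2) / fact (j+2) = (\<Sum>n\<in>{j+2}. y ^ n /\<^sub>R fact n)" by (simp add: field_simps)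
  also have "\<dots> \<le> exp y"
    unfolding exp_def by (rule sum_le_suminf[OF sm]) (use y in auto)
  finally have "y ^ (j+2) \<le> fact (j+2) * exp y" by (simp add: pos_divide_le_eq mult.commute del: fact_Suc power_Suc)
  then have "y ^ j * exp (- y) \<le> fact (j+2) * (1/y)^2"
    using y by (simp add: field_simps exp_minus power_add power2_eq_square)
  then show ?thesis using True by (simp add: flat_def y_def)
qed (simp add: flat_def)

lemma DERIV_flat: "DERIV (flat j) t :> flat (j + 2) t - real j * flat (j + 1) t"
proof (cases t "0::real" rule: linorder_cases)
  case less
  have "DERIV (\<lambda>t. 0) t :> (0::real)" by simp
  then have "DERIV (flat j) t :> 0"
    by (rule DERIV_cong_ev[THEN iffD1, rotated 3])
       (use less in \<open>auto simp: flat_def eventually_nhds_metric dist_real_def intro!: exI[of _ "-t"]\<close>)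
  then show ?thesis using less by (simp add: flat_def)
next
  case equal
  have "((\<lambda>h. (flat j h) / h) \<longlongrightarrow> 0) (at 0)"
  proof (rule Lim_null_comparison)
    show "\<forall>\<^sub>F h in at 0. norm (flat j h / h) \<le> fact (j+2) * \<bar>h\<bar>"
    proof (rule always_eventually, rule allI)
      fix h :: real
      have "\<bar>flat j h\<bar> / \<bar>h\<bar> \<le> fact (j+2) * h\<^sup>2 / \<bar>h\<bar>"
        by (rule divide_right_mono[OF flat_le]) simp
      also have "\<dots> = fact (j+2) * \<bar>h\<bar>" by (cases "h = 0") (auto simp: power2_eq_square abs_if)
      finally show "norm (flat j h / h) \<le> fact (j+2) * \<bar>h\<bar>" by simp
    qed
    show "((\<lambda>h::real. fact (j+2) * \<bar>h\<bar>) \<longlongrightarrow> 0) (at 0)"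
      by (auto intro!: tendsto_eq_intros)
  qed
  then show ?thesis using equal by (simp add: has_field_derivative_iff flat_def)
next
  case greater
  have "real j * (1 / t) ^ (j - 1) * (1 / t)\<^sup>2 = real j * (1 / t) ^ (j + 1)"
    by (cases j) (auto simp: power2_eq_square)
  moreover have d1: "DERIV (\<lambda>t. 1 / t) t :> - ((1 / t)\<^sup>2)"
    using greater by (auto intro!: derivative_eq_intros simp: power2_eq_square)
  have "DERIV (\<lambda>t. (1 / t) ^ j * exp (- (1 / t))) t :>
      (1 / t) ^ j * (exp (- (1 / t)) * (1 / t)\<^sup>2) - real j * (1 / t) ^ (j - 1) * (1 / t)\<^sup>2 * exp (- (1 / t))"
    using DERIV_mult[OF DERIV_power[OF d1, of j] DERIV_fun_exp[OF DERIV_minus[OF d1]]]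
    by (simp add: algebra_simps)
  ultimately have "DERIV (\<lambda>t. (1 / t) ^ j * exp (- 1 / t)) t :> flat (j + 2) t - real j * flat (j + 1) t"
    using greater by (simp add: flat_def power2_eq_square algebra_simps)
  then show ?thesis
    by (rule DERIV_cong_ev[THEN iffD1, rotated 3])
       (use greater in \<open>auto simp: flat_def eventually_nhds_metric dist_real_def intro!: exI[of _ t]\<close>)
qed

text \<open>\<open>bump 0\<close> is the classical profile \<open>exp (- 1 / (1 - |x|^2))\<close> on
  the unit ball; the larger indices occur in its derivatives.\<close>

definition bump :: "nat \<Rightarrow> real ^ 'n \<Rightarrow> real" where
  "bump j x = flat j (1 - x \<bullet> x)"

lemma GDERIV_bump:
  "GDERIV (bump j) x :> (bump (j+2) x - real j * bump (j+1) x) *\<^sub>R (-2) *\<^sub>R x"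
proof -
  have "GDERIV (\<lambda>x. 1 - x \<bullet> x) x :> (- 2) *\<^sub>R x"
    unfolding gderiv_def by (auto intro!: derivative_eq_intros simp: inner_commute algebra_simps)
  from GDERIV_DERIV_compose[OF this DERIV_flat[of j]]
  show ?thesis by (simp only: bump_def[abs_def])
qed

lemma C_k_bump: "C_k k (bump j :: real ^ 'n \<Rightarrow> real)"
proof (induction k arbitrary: j)
  case 0
  have "isCont (bump j) x" for x :: "real^'n"
    using GDERIV_bump has_derivative_continuous unfolding gderiv_def by blast
  then show ?case by (simp add: continuous_at_imp_continuous_on)
next
  case (Suc k)
  have *: "a - real j * b = a + (- real j) * b" for a b by simp
  show ?case
    apply (rule C_k_SucI[OF GDERIV_bump])
    using Suc unfolding vector_scaleR_component * real_scaleR_def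
    by (intro C_k_mult C_k_add C_k_const C_k_nth)
qed

lemma bump_nonneg: "bump j x \<ge> 0" by (simp add: bump_def flat_def)
lemma bump_pos: "norm x < 1 \<Longrightarrow> bump j x > 0"
  by (simp add: bump_def flat_def power2_norm_eq_inner[symmetric] power_less_one_iff)
lemma bump_zero: "norm x \<ge> 1 \<Longrightarrow> bump j x = 0"
  by (simp add: bump_def flat_def power2_norm_eq_inner[symmetric] not_less)

section \<open>Mollification\<close>

text \<open>A factor c of modulus 1 covers translations (c = 1) and reflections (c = -1) by one
  change of variables.\<close>

lemma lborel_distr_isometry:
  fixes t :: "'a::euclidean_space"
  assumes "\<bar>c\<bar> = 1"
  shows "distr lborel borel (\<lambda>x. t + c *\<^sub>R x) = lborel"
  using assms by (subst lborel_affine[of c t]) (auto simp: density_1)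

lemma nn_integral_lborel_isometry:
  fixes t :: "'a::euclidean_space"
  assumes "\<bar>c\<bar> = 1" "f \<in> borel_measurable borel"
  shows "(\<integral>\<^sup>+x. f (t + c *\<^sub>R x) \<partial>lborel) = (\<integral>\<^sup>+x. f x \<partial>lborel)"
  using assms(2) by (subst (2) lborel_distr_isometry[OF assms(1), of t, symmetric], subst nn_integral_distr) auto

lemma integral_lborel_isometry:
  fixes t :: "'a::euclidean_space" and f :: "'a \<Rightarrow> 'b::{banach, second_countable_topology}"
  assumes "\<bar>c\<bar> = 1" "f \<in> borel_measurable borel"
  shows "(LBINT x. f (t + c *\<^sub>R x)) = (LBINT x. f x)"
  using assms(2) by (subst (2) lborel_distr_isometry[OF assms(1), of t, symmetric], subst integral_distr) auto

lemma integrable_lborel_isometry: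
  fixes t :: "'a::euclidean_space" and f :: "'a \<Rightarrow> 'b::{banach, second_countable_topology}"
  assumes "\<bar>c\<bar> = 1" "f \<in> borel_measurable borel"
  shows "integrable lborel (\<lambda>x. f (t + c *\<^sub>R x)) \<longleftrightarrow> integrable lborel f"
  using assms(2) by (subst (2) lborel_distr_isometry[OF assms(1), of t, symmetric], subst integrable_distr_eq) auto

lemma integral_lborel_reflect:
  fixes t :: "'a::euclidean_space" and f :: "'a \<Rightarrow> 'b::{banach, second_countable_topology}"
  assumes "f \<in> borel_measurable borel"
  shows "(LBINT x. f (t - x)) = (LBINT x. f x)"
  using integral_lborel_isometry[of "-1" f t] assms by simp

text \<open>Borel rather than Lebesgue measurability, so that compositions and the joint
  measurability required by Fubini come for free. Lebesgue measurable functions are exchanged for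
  Borel representatives only at the very end.\<close>

definition loc_L1 :: "('a::euclidean_space \<Rightarrow> 'b::{banach, second_countable_topology}) \<Rightarrow> bool" where
  "loc_L1 f \<longleftrightarrow> f \<in> borel_measurable borel \<and>
     (\<forall>R. integrable lborel (\<lambda>x. indicat_real (cball 0 R) x *\<^sub>R f x))"

lemma loc_L1_measurable: "loc_L1 f \<Longrightarrow> f \<in> borel_measurable borel"
  by (simp add: loc_L1_def)

text \<open>The typical \<open>h\<close> is a locally integrable \<open>f\<close> multiplied by a
  bounded factor of bounded support.\<close>

lemma loc_L1_integrable_bound:
  fixes f :: "'a::euclidean_space \<Rightarrow> 'b::{banach, second_countable_topology}"
    and h :: "'a \<Rightarrow> 'c::{banach, second_countable_topology}"
  assumes "loc_L1 f" "h \<in> borel_measurable borel"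
    and bd: "\<And>x. norm x \<le> R \<Longrightarrow> norm (h x) \<le> M * norm (f x)" and 0: "\<And>x. R < norm x \<Longrightarrow> h x = 0"
  shows "integrable lborel h"
proof (rule Bochner_Integration.integrable_bound)
  show "integrable lborel (\<lambda>x. M *\<^sub>R (indicat_real (cball 0 R) x *\<^sub>R f x))"
    using assms(1) unfolding loc_L1_def by (intro integrable_scaleR_right) auto
  show "AE x in lborel. norm (h x) \<le> norm (M *\<^sub>R (indicat_real (cball 0 R) x *\<^sub>R f x))"
  proof (rule AE_I2)
    fix x
    show "norm (h x) \<le> norm (M *\<^sub>R (indicat_real (cball 0 R) x *\<^sub>R f x))"
    proof (cases "norm x \<le> R")
      case True
      have "M * norm (f x) \<le> \<bar>M\<bar> * norm (f x)" by (intro mult_right_mono) auto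
      then show ?thesis using bd[OF True] True by simp
    qed (use 0[of x] in simp)
  qed
qed (use assms in simp)

lemma loc_L1I_bound:
  fixes f :: "'a::euclidean_space \<Rightarrow> 'b::{banach, second_countable_topology}"
    and h :: "'a \<Rightarrow> 'c::{banach, second_countable_topology}"
  assumes "loc_L1 f" "h \<in> borel_measurable borel" "\<And>x. norm (h x) \<le> M * norm (f x)"
  shows "loc_L1 h"
  unfolding loc_L1_def
proof (intro conjI allI)
  fix R
  show "integrable lborel (\<lambda>x. indicat_real (cball 0 R) x *\<^sub>R h x)"
    by (rule loc_L1_integrable_bound[OF assms(1), where R=R and M=M])
       (use assms in \<open>auto intro!: borel_measurable_scaleR borel_measurable_indicator\<close>)
qed (use assms in simp)

lemma integrable_imp_loc_L1:
  assumes "integrable lborel f"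
  shows "loc_L1 f"
  unfolding loc_L1_def using assms
  by (auto intro!: integrable_mult_indicator[of _ lborel, simplified] simp: borel_measurable_integrable)

lemma loc_L1_add: "loc_L1 f \<Longrightarrow> loc_L1 g \<Longrightarrow> loc_L1 (\<lambda>x. f x + g x)"
  unfolding loc_L1_def by (auto simp: scaleR_add_right)

lemma loc_L1_diff: "loc_L1 f \<Longrightarrow> loc_L1 g \<Longrightarrow> loc_L1 (\<lambda>x. f x - g x)"
  unfolding loc_L1_def by (auto simp: scaleR_diff_right)

lemma loc_L1_norm: "loc_L1 f \<Longrightarrow> loc_L1 (\<lambda>x. norm (f x))"
  by (rule loc_L1I_bound[where M=1]) (auto dest: loc_L1_measurable)

lemma loc_L1_const: "loc_L1 (\<lambda>x::'a::euclidean_space. c :: 'b::{banach, second_countable_topology})"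
  unfolding loc_L1_def 
  by (auto intro!: integrable_scaleR_left integrable_real_indicator emeasure_bounded_finite)

lemma loc_L1_scaleR: "loc_L1 f \<Longrightarrow> loc_L1 (\<lambda>x. c *\<^sub>R f x)"
  by (rule loc_L1I_bound[where M="\<bar>c\<bar>"]) (auto dest: loc_L1_measurable)

lemma loc_L1I_bounded:
  fixes h :: "'a::euclidean_space \<Rightarrow> 'c::{banach, second_countable_topology}"
  assumes "h \<in> borel_measurable borel" "\<And>x. norm (h x) \<le> M"
  shows "loc_L1 h"
  by (rule loc_L1I_bound[OF loc_L1_const[of "1::real"], where M=M]) (use assms in auto)

lemma loc_L1_square:
  fixes f :: "'a::euclidean_space \<Rightarrow> 'b::{banach, second_countable_topology}"
  assumes "f \<in> borel_measurable borel" "integrable lborel (\<lambda>x. (norm (f x))\<^sup>2)"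
  shows "loc_L1 f"
proof -
  have "loc_L1 (\<lambda>x. 1 + (norm (f x))\<^sup>2)"
    by (intro loc_L1_add loc_L1_const integrable_imp_loc_L1 assms)
  then show ?thesis
  proof (rule loc_L1I_bound[where M=1])
    fix x
    have "2 * norm (f x) \<le> 1 + (norm (f x))\<^sup>2"
      using zero_le_power2[of "norm (f x) - 1"] by (simp add: power2_diff)
    moreover have "norm (1 + (norm (f x))\<^sup>2) = 1 + (norm (f x))\<^sup>2" by simp
    ultimately show "norm (f x) \<le> 1 * norm (1 + (norm (f x))\<^sup>2)"
      using norm_ge_zero[of "f x"] by linarith
  qed (use assms in simp)
qed

section \<open>Compactly supported C1 functions\<close>

lemma continuous_compact_support_bounded:
  fixes \<phi> :: "'a::euclidean_space \<Rightarrow> 'b::real_normed_vector"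
  assumes "continuous_on UNIV \<phi>" "\<And>x. R < norm x \<Longrightarrow> \<phi> x = 0"
  obtains M where "M > 0" "\<And>x. norm (\<phi> x) \<le> M"
proof -
  have "compact (\<phi> ` cball 0 R)"
    using assms by (intro compact_continuous_image) (auto intro: continuous_on_subset)
  then obtain M where M: "M > 0" "\<And>x. x \<in> cball 0 R \<Longrightarrow> norm (\<phi> x) \<le> M"
    using compact_imp_bounded bounded_pos by (metis image_eqI)
  have "norm (\<phi> x) \<le> M" for x
    by (cases "norm x \<le> R") (use M assms(2)[of x] in auto)
  with M show ?thesis using that by blast
qed

text \<open>Larger than \<open>test_functions\<close> and stable under products with every C1
  function, in particular with nonlinear functions of a mollified solution. The gradient is an
  explicit argument, so that it can be read off from product and chain rules.\<close>

definition C1c :: "('a::euclidean_space \<Rightarrow> real) \<Rightarrow> ('a \<Rightarrow> 'a) \<Rightarrow> bool" where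
  "C1c \<phi> \<psi> \<longleftrightarrow> (\<forall>x. GDERIV \<phi> x :> \<psi> x) \<and> continuous_on UNIV \<psi> \<and> (\<exists>R. \<forall>x. R < norm x \<longrightarrow> \<phi> x = 0)"

lemma GDERIV_continuous_on: "(\<And>x. GDERIV \<phi> x :> \<psi> x) \<Longrightarrow> continuous_on UNIV \<phi>"
  by (meson GDERIV_imp_differentiable continuous_at_imp_continuous_on differentiable_imp_continuous_within)

lemma GDERIV_unique: "GDERIV f x :> a \<Longrightarrow> GDERIV f x :> b \<Longrightarrow> a = b"
  unfolding gderiv_def by (drule (1) has_derivative_unique) (metis vector_eq_rdot inner_commute)

lemma GDERIV_zero_outside:
  fixes \<phi> :: "'a::euclidean_space \<Rightarrow> real"
  assumes "GDERIV \<phi> x :> D" "\<And>x. R < norm x \<Longrightarrow> \<phi> x = 0" "R < norm x"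
  shows "D = 0"
proof -
  have o: "open {x::'a. R < norm x}" by (intro open_Collect_less continuous_intros)
  have "GDERIV \<phi> x :> 0"
    unfolding gderiv_def
  proof (rule has_derivative_transform_within_open[OF _ o])
    show "((\<lambda>_. 0) has_derivative (\<lambda>h. h \<bullet> 0)) (at x)" by simp
  qed (use assms in auto)
  then show ?thesis using assms(1) GDERIV_unique by blast
qed

text \<open>The Lipschitz estimate is the mean value inequality with the bounded gradient; a single
  \<open>M\<close> serves the function, its gradient and its increments.\<close>

lemma C1c_E:
  assumes "C1c \<phi> \<psi>"
  obtains R M where "R > 0" "M > 0" "\<And>x. R < norm x \<Longrightarrow> \<phi> x = 0" "\<And>x. R < norm x \<Longrightarrow> \<psi> x = 0"
    "\<And>x. \<bar>\<phi> x\<bar> \<le> M" "\<And>x. norm (\<psi> x) \<le> M" "\<And>x y. \<bar>\<phi> x - \<phi> y\<bar> \<le> M * norm (x - y)"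
    "continuous_on UNIV \<phi>" "continuous_on UNIV \<psi>" "\<And>x. GDERIV \<phi> x :> \<psi> x"
proof -
  from assms obtain R0 where R0: "\<And>x. GDERIV \<phi> x :> \<psi> x" "continuous_on UNIV \<psi>" "\<And>x. R0 < norm x \<Longrightarrow> \<phi> x = 0"
    unfolding C1c_def by blast
  define R where "R = max R0 1"
  have R: "R > 0" "\<And>x. R < norm x \<Longrightarrow> \<phi> x = 0" using R0 by (auto simp: R_def)
  have R': "\<psi> x = 0" if "R < norm x" for x using GDERIV_zero_outside[OF R0(1) R(2) that] .
  have c: "continuous_on UNIV \<phi>" using GDERIV_continuous_on R0(1) by blast
  obtain M1 where M1: "M1 > 0" "\<And>x. norm (\<phi> x) \<le> M1" using continuous_compact_support_bounded[OF c R(2)] by metis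
  obtain M2 where M2: "M2 > 0" "\<And>x. norm (\<psi> x) \<le> M2" using continuous_compact_support_bounded[OF R0(2) R'] by metis
  have lip: "\<bar>\<phi> x - \<phi> y\<bar> \<le> M2 * norm (x - y)" for x y
  proof -
    have "norm (\<phi> x - \<phi> y) \<le> M2 * norm (x - y)"
    proof (rule differentiable_bound[of UNIV \<phi> "\<lambda>x h. h \<bullet> \<psi> x"])
      fix x
      show "onorm (\<lambda>h. h \<bullet> \<psi> x) \<le> M2"
        by (rule onorm_le) (metis M2(2) Cauchy_Schwarz_ineq2 mult.commute mult_right_mono norm_ge_zero order_trans real_norm_def)
    qed (use R0 in \<open>auto simp: gderiv_def\<close>)
    then show ?thesis by simp
  qed
  have "\<bar>\<phi> x - \<phi> y\<bar> \<le> max M1 M2 * norm (x - y)" for x y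
    using lip[of x y] by (meson max.cobounded2 mult_right_mono norm_ge_zero order_trans)
  with R R' c R0 M1 M2 show ?thesis
    by (intro that[of R "max M1 M2"]) (auto simp: less_max_iff_disj le_max_iff_disj)
qed

lemma C1c_mult_left:
  assumes "C1c \<phi> \<psi>" "\<And>x. GDERIV f x :> g x" "continuous_on UNIV g"
  shows "C1c (\<lambda>x. f x * \<phi> x) (\<lambda>x. f x *\<^sub>R \<psi> x + \<phi> x *\<^sub>R g x)"
proof -
  obtain R where R: "\<And>x. R < norm x \<Longrightarrow> \<phi> x = 0" using assms(1) unfolding C1c_def by blast
  have "continuous_on UNIV f" "continuous_on UNIV \<phi>" "continuous_on UNIV \<psi>"
    using assms GDERIV_continuous_on unfolding C1c_def by blast+
  then show ?thesis
    using assms R unfolding C1c_def by (auto intro!: GDERIV_mult continuous_intros exI[of _ R])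
qed

lemma C1c_affine:
  assumes "C1c \<phi> \<psi>" "a \<noteq> 0"
  shows "C1c (\<lambda>x. \<phi> (a *\<^sub>R x + b)) (\<lambda>x. a *\<^sub>R \<psi> (a *\<^sub>R x + b))"
proof -
  obtain R where R: "\<And>x. R < norm x \<Longrightarrow> \<phi> x = 0" using assms(1) unfolding C1c_def by blast
  have "\<phi> (a *\<^sub>R x + b) = 0" if "(R + norm b) / \<bar>a\<bar> < norm x" for x
  proof -
    have "R + norm b < norm (a *\<^sub>R x)" using that assms(2) by (simp add: field_simps)
    also have "norm (a *\<^sub>R x) \<le> norm (a *\<^sub>R x + b) + norm b"
      using norm_triangle_ineq4[of "a *\<^sub>R x + b" b] by simp
    finally show ?thesis using R by auto
  qed
  then show ?thesis using assms unfolding C1c_def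
    by (auto intro!: GDERIV_affine continuous_intros continuous_on_compose2[of UNIV \<psi>])
qed

text \<open>Continuity is tested along a convergent sequence. Such a sequence is bounded by some B,
  which confines all integrands to the ball of radius R + B, where \<open>f\<close> supplies an
  integrable majorant.\<close>

lemma integral_param_continuous:
  fixes h :: "'a::euclidean_space \<Rightarrow> 'a \<Rightarrow> 'c::{banach, second_countable_topology}"
    and f :: "'a \<Rightarrow> 'b::{banach, second_countable_topology}"
  assumes "loc_L1 f" "\<And>x. h x \<in> borel_measurable borel"
    and c: "\<And>y. continuous_on UNIV (\<lambda>x. h x y)"
    and bd: "\<And>x y. norm (h x y) \<le> M * norm (f y)" and 0: "\<And>x y. R < norm (x - y) \<Longrightarrow> h x y = 0"
  shows "continuous_on UNIV (\<lambda>x. LBINT y. h x y)"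
  unfolding continuous_on_eq_continuous_at[OF open_UNIV] continuous_at_sequentially
proof (intro ballI allI impI, unfold o_def)
  fix x and s :: "nat \<Rightarrow> 'a" assume s: "s \<longlonglongrightarrow> x"
  then have "bounded (range s)" by (rule convergent_imp_bounded)
  then obtain B where B: "\<And>n. norm (s n) \<le> B" unfolding bounded_iff by auto
  let ?w = "\<lambda>y. \<bar>M\<bar> * (norm (indicat_real (cball 0 (R + B)) y *\<^sub>R f y))"
  show "(\<lambda>n. LBINT y. h (s n) y) \<longlonglongrightarrow> (LBINT y. h x y)"
  proof (rule integral_dominated_convergence[where w="?w"])
    show "AE y in lborel. (\<lambda>n. h (s n) y) \<longlonglongrightarrow> h x y"
      using c s by (auto intro!: continuous_on_tendsto_compose[OF c])
    show "integrable lborel ?w"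
      using assms(1) unfolding loc_L1_def by (intro integrable_mult_right integrable_norm) auto
    fix n
    show "AE y in lborel. norm (h (s n) y) \<le> ?w y"
    proof (rule AE_I2)
      fix y
      have *: "norm (h (s n) y) \<le> \<bar>M\<bar> * norm (f y)"
        using bd[of "s n" y] by (meson abs_ge_self mult_right_mono norm_ge_zero order_trans)
      show "norm (h (s n) y) \<le> ?w y"
      proof (cases "norm y \<le> R + B")
        case False
        have "norm y \<le> norm (s n - y) + norm (s n)" by norm
        then show ?thesis using 0[of "s n" y] False B[of n] by auto
      qed (use * in simp)
    qed
  qed (use assms in auto)
qed

text \<open>Differentiation under the integral sign falls on the smooth factor only, so
  \<open>f\<close> may be merely locally integrable: the first-order remainders of the kernel,
  divided by the increment, tend to 0 pointwise and are dominated.\<close>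

lemma GDERIV_convolution:
  fixes \<kappa> :: "'a::euclidean_space \<Rightarrow> real"
  assumes k: "C1c \<kappa> \<kappa>'" and f: "loc_L1 f"
  shows "GDERIV (\<lambda>x. LBINT y. \<kappa> (x - y) * f y) x :> (LBINT y. f y *\<^sub>R \<kappa>' (x - y))"
proof -
  obtain R M where R: "R > 0" "M > 0" "\<And>x. R < norm x \<Longrightarrow> \<kappa> x = 0" "\<And>x. R < norm x \<Longrightarrow> \<kappa>' x = 0"
    "\<And>x. \<bar>\<kappa> x\<bar> \<le> M" "\<And>x. norm (\<kappa>' x) \<le> M" "\<And>x y. \<bar>\<kappa> x - \<kappa> y\<bar> \<le> M * norm (x - y)"
    "continuous_on UNIV \<kappa>" "continuous_on UNIV \<kappa>'" "\<And>x. GDERIV \<kappa> x :> \<kappa>' x"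
    using C1c_E[OF k] by metis
  have [measurable]: "f \<in> borel_measurable borel" "\<kappa> \<in> borel_measurable borel" "\<kappa>' \<in> borel_measurable borel"
    using f R by (auto simp: loc_L1_def borel_measurable_continuous_onI)
  have far: "R < norm (x - y)" if "R + norm x < norm y" for x y :: 'a
    using that norm_triangle_ineq2[of y x] by (simp add: norm_minus_commute)
  have i1: "integrable lborel (\<lambda>y. \<kappa> (x - y) * f y)" for x
    by (rule loc_L1_integrable_bound[OF f, where R="R + norm x" and M=M])
       (use R far in \<open>auto simp: abs_mult mult_right_mono\<close>)
  have i2: "integrable lborel (\<lambda>y. f y *\<^sub>R \<kappa>' (x - y))" for x
    by (rule loc_L1_integrable_bound[OF f, where R="R + norm x" and M=M])
       (use R far in \<open>auto simp: mult.commute[of M] intro!: mult_left_mono\<close>)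
  let ?D = "LBINT y. f y *\<^sub>R \<kappa>' (x - y)"
  let ?F = "\<lambda>x. LBINT y. \<kappa> (x - y) * f y"
  have "((\<lambda>h. norm (?F (x + h) - ?F x - h \<bullet> ?D) / norm h) \<longlongrightarrow> 0) (at 0)"
    unfolding tendsto_at_iff_sequentially o_def
  proof (intro allI impI)
    fix s :: "nat \<Rightarrow> 'a" assume s: "\<forall>n. s n \<in> UNIV - {0}" "s \<longlonglongrightarrow> 0"
    obtain B where B: "\<And>n. norm (s n) \<le> B"
      using convergent_imp_bounded[OF s(2)] unfolding bounded_iff by auto
    let ?q = "\<lambda>n y. f y * ((\<kappa> (x + s n - y) - \<kappa> (x - y) - s n \<bullet> \<kappa>' (x - y)) / norm (s n))"
    \<comment> \<open>One \<open>M\<close> comes from the Lipschitz bound on the increment of the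
      kernel, the other from the bound on its gradient; \<open>B\<close> bounds all increments
      \<open>s n\<close>, hence the region where the remainder can be nonzero.\<close>
    let ?w = "\<lambda>y. (2 * M) * (norm (indicat_real (cball 0 (R + norm x + B)) y *\<^sub>R f y))"
    have L: "(\<lambda>n. LBINT y. ?q n y) \<longlonglongrightarrow> (\<integral>y. 0 \<partial>(lborel :: 'a measure))"
    proof (rule integral_dominated_convergence[where w="?w"])
      show "AE y in lborel. (\<lambda>n. ?q n y) \<longlonglongrightarrow> 0"
      proof (rule AE_I2)
        fix y
        have "((\<lambda>h. norm (\<kappa> (x - y + h) - \<kappa> (x - y) - h \<bullet> \<kappa>' (x - y)) / norm h) \<longlongrightarrow> 0) (at 0)"
          using R(10)[of "x - y"] unfolding gderiv_def has_derivative_at by simp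
        then have "(\<lambda>n. norm (\<kappa> (x - y + s n) - \<kappa> (x - y) - s n \<bullet> \<kappa>' (x - y)) / norm (s n)) \<longlonglongrightarrow> 0"
          unfolding tendsto_at_iff_sequentially o_def using s by blast
        then have "(\<lambda>n. norm ((\<kappa> (x + s n - y) - \<kappa> (x - y) - s n \<bullet> \<kappa>' (x - y)) / norm (s n))) \<longlonglongrightarrow> 0"
          by (simp add: algebra_simps)
        then show "(\<lambda>n. ?q n y) \<longlonglongrightarrow> 0"
          unfolding tendsto_norm_zero_iff by (rule tendsto_mult_right_zero)
      qed
      show "integrable lborel ?w"
        using f unfolding loc_L1_def by (intro integrable_mult_right integrable_norm) auto
      fix n
      show "AE y in lborel. norm (?q n y) \<le> ?w y"
      proof (rule AE_I2)
        fix y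
        have "\<bar>\<kappa> (x + s n - y) - \<kappa> (x - y)\<bar> \<le> M * norm (s n)"
          using R(7)[of "x + s n - y" "x - y"] by simp
        moreover have "\<bar>s n \<bullet> \<kappa>' (x - y)\<bar> \<le> M * norm (s n)"
          using Cauchy_Schwarz_ineq2[of "s n" "\<kappa>' (x - y)"] R(6)[of "x - y"]
          by (metis mult.commute mult_left_mono norm_ge_zero order_trans)
        ultimately have "\<bar>\<kappa> (x + s n - y) - \<kappa> (x - y) - s n \<bullet> \<kappa>' (x - y)\<bar> / norm (s n) \<le> 2 * M"
          using s by (simp add: divide_le_eq)
        from mult_left_mono[OF this abs_ge_zero[of "f y"]]
        have *: "norm (?q n y) \<le> 2 * M * norm (f y)"
          by (simp add: abs_mult mult.commute)
        show "norm (?q n y) \<le> ?w y"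
        proof (cases "norm y \<le> R + norm x + B")
          case False
          have "R + norm x < norm y" "R + norm (x + s n) < norm y"
            using False B[of n] norm_triangle_ineq[of x "s n"] norm_ge_zero[of "s n"] by linarith+
          then have z: "?q n y = 0" using far[of x y] far[of "x + s n" y] R by simp
          show ?thesis unfolding z using R(2) by simp
        qed (use * in simp)
      qed
    qed (use R in auto)
    have eq: "norm (?F (x + s n) - ?F x - s n \<bullet> ?D) / norm (s n) = norm (LBINT y. ?q n y)" for n
    proof -
      have "?F (x + s n) - ?F x - s n \<bullet> ?D =
        (LBINT y. \<kappa> (x + s n - y) * f y - \<kappa> (x - y) * f y - s n \<bullet> (f y *\<^sub>R \<kappa>' (x - y)))"
        using i1 i2 integral_inner_right[OF i2[of x], of "s n"]
        by (simp add: integrable_inner_right del: inner_scaleR_right)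
      also have "\<dots> = (LBINT y. norm (s n) * ?q n y)"
        using s by (intro Bochner_Integration.integral_cong) (auto simp: field_simps)
      finally show ?thesis using s by (simp add: abs_mult)
    qed
    show "(\<lambda>n. norm (?F (x + s n) - ?F x - s n \<bullet> ?D) / norm (s n)) \<longlonglongrightarrow> 0"
      unfolding eq using tendsto_norm[OF L] by simp
  qed
  then show ?thesis
    unfolding gderiv_def has_derivative_at by (auto intro: bounded_linear_inner_left)
qed

lemma C_k_imp_C1c:
  fixes \<kappa> :: "real ^ 'n \<Rightarrow> real"
  assumes "\<And>k. C_k k \<kappa>" "\<And>x. R < norm x \<Longrightarrow> \<kappa> x = 0"
  shows "C1c \<kappa> (grad \<kappa>)"
proof -
  have "continuous_on UNIV (grad \<kappa>)"
    using assms(1)[of "Suc 0"] by (subst continuous_on_componentwise) (auto simp: Basis_vec_def inner_axis)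
  then show ?thesis
    using C_k_SucD(1)[OF assms(1)] assms(2) unfolding C1c_def by blast
qed

lemma test_function_iff:
  fixes \<kappa> :: "real ^ 'n \<Rightarrow> real"
  shows "\<kappa> \<in> test_functions \<longleftrightarrow> (\<forall>k. C_k k \<kappa>) \<and> (\<exists>R. \<forall>x. R < norm x \<longrightarrow> \<kappa> x = 0)"
proof -
  have "compact (closure {x. \<kappa> x \<noteq> 0}) \<longleftrightarrow> (\<exists>R. \<forall>x. R < norm x \<longrightarrow> \<kappa> x = 0)"
    unfolding compact_closure bounded_iff by (auto simp: not_le[symmetric])
  then show ?thesis by (simp add: test_functions_def)
qed

lemma test_function_C1c: "\<kappa> \<in> test_functions \<Longrightarrow> C1c \<kappa> (grad \<kappa>)"
  using test_function_iff C_k_imp_C1c by blast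

section \<open>The mollifying kernels\<close>

abbreviation eps :: "nat \<Rightarrow> real" where
  "eps n \<equiv> 1 / real (Suc n)"

text \<open>The summand \<open>+ 0\<close> keeps the argument in the form
  \<open>a *\<^sub>R x + b\<close> to which \<open>C_k_affine\<close> and
  \<open>GDERIV_affine\<close> apply. Dividing by the integral normalizes the mass to 1, so no power
  of the scale appears.\<close>

definition rho :: "nat \<Rightarrow> real ^ 'n \<Rightarrow> real" where
  "rho n x = bump 0 (real (Suc n) *\<^sub>R x + 0) / (LBINT y. bump 0 (real (Suc n) *\<^sub>R y + 0 :: real ^ 'n))"

lemma bump_scaled:
  fixes n defines "f \<equiv> (\<lambda>y::real^'n. bump 0 (real (Suc n) *\<^sub>R y + 0) :: real)"
  shows "\<And>k. C_k k f" "\<And>x. 1 / real (Suc n) < norm x \<Longrightarrow> f x = 0" "\<And>x. f x \<ge> 0" "integrable lborel f" "(LBINT y. f y) > 0"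
proof -
  show C: "C_k k f" for k unfolding f_def by (rule C_k_affine[OF C_k_bump])
  show 0: "1 / real (Suc n) < norm x \<Longrightarrow> f x = 0" for x
    unfolding f_def by (rule bump_zero) (simp add: pos_divide_less_eq mult.commute del: of_nat_Suc)
  show nn: "f x \<ge> 0" for x by (simp add: f_def bump_nonneg)
  have c: "continuous_on UNIV f" using C[of 0] by simp
  obtain M where "\<And>x. norm (f x) \<le> M" using continuous_compact_support_bounded[OF c 0] by metis
  then show i: "integrable lborel f"
    by (intro loc_L1_integrable_bound[OF loc_L1_const[of "1::real"], of f "1 / real (Suc n)" M])
       (use 0 c in \<open>auto intro: borel_measurable_continuous_onI\<close>)
  \<comment> \<open>A vanishing integral would make the nonnegative \<open>f\<close> zero almost
    everywhere, but it is positive on a whole ball, and a nonempty open set is not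
    negligible.\<close>
  have "(LBINT y. f y) \<noteq> 0"
  proof
    assume "(LBINT y. f y) = 0"
    then have "AE x in lborel. f x = 0"
      using integral_nonneg_eq_0_iff_AE[OF i] nn by simp
    then obtain N where N: "N \<in> null_sets lborel" "{x. f x \<noteq> 0} \<subseteq> N"
      by (auto simp: eventually_ae_filter)
    then have "negligible N" using null_sets_completionI negligible_iff_null_sets by blast
    then have "negligible {x. f x \<noteq> 0}" using N(2) negligible_subset by blast
    moreover have "ball 0 (eps n) \<subseteq> {x. f x \<noteq> 0}"
    proof
      fix x :: "real^'n" assume "x \<in> ball 0 (eps n)"
      then have "real (Suc n) * norm x < 1" by (simp add: pos_less_divide_eq mult.commute del: of_nat_Suc)
      then have "norm (real (Suc n) *\<^sub>R x) < 1" by (simp only: norm_scaleR abs_of_nat)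
      from bump_pos[OF this, of 0] show "x \<in> {x. f x \<noteq> 0}" by (simp add: f_def)
    qed
    ultimately have "negligible (ball (0::real^'n) (eps n))" by (rule negligible_subset)
    then show False by (simp add: open_not_negligible)
  qed
  moreover have "(LBINT y. f y) \<ge> 0" by (rule integral_nonneg_AE) (simp add: nn)
  ultimately show "(LBINT y. f y) > 0" by simp
qed

lemma rho_C_k: "C_k k (rho n)"
  unfolding rho_def[abs_def] divide_inverse by (intro C_k_mult C_k_const bump_scaled)
lemma rho_zero: "1 / real (Suc n) < norm x \<Longrightarrow> rho n x = 0"
  using bump_scaled(2)[of n x] by (simp add: rho_def)
lemma rho_zero': "1 < norm x \<Longrightarrow> rho n x = 0"
proof (rule rho_zero)
  assume "1 < norm x"
  moreover have "1 / real (Suc n) \<le> 1" by simp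
  ultimately show "1 / real (Suc n) < norm x" by linarith
qed
lemma rho_nonneg: "rho n x \<ge> 0"
  using bump_scaled(3)[of n x] bump_scaled(5)[of n, where ?'n='a] by (simp add: rho_def)
lemma rho_abs [simp]: "\<bar>rho n x\<bar> = rho n x" by (rule abs_of_nonneg[OF rho_nonneg])
lemma rho_minus: "rho n (- x) = rho n x" by (simp add: rho_def bump_def)
lemma rho_diff_commute: "rho n (x - y) = rho n (y - x)" using rho_minus[of n "x - y"] by simp
lemma rho_integrable: "integrable lborel (rho n)"
  unfolding rho_def[abs_def] by (intro integrable_divide bump_scaled)
lemma rho_integral: "(\<integral>x. rho n x \<partial>(lborel :: (real^'n) measure)) = 1"
  using bump_scaled(5)[of n, where ?'n='n] by (simp add: rho_def[abs_def])
lemma rho_C1c: "C1c (rho n) (grad (rho n))"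
  using C_k_imp_C1c[OF rho_C_k rho_zero] .
lemma rho_continuous: "continuous_on UNIV (rho n)" using rho_C_k[of 0] by simp
lemma rho_measurable[measurable]: "rho n \<in> borel_measurable borel"
  by (rule borel_measurable_continuous_onI[OF rho_continuous])
lemma rho_bounded: obtains M where "M > 0" "\<And>x::real^'n. rho n x \<le> M"
proof -
  obtain M where "M > 0" "\<And>x::real^'n. norm (rho n x) \<le> M"
    using continuous_compact_support_bounded[of "rho n :: real^'n \<Rightarrow> real" 1] rho_continuous rho_zero' by blast
  then show ?thesis using that by simp
qed

text \<open>All derivatives fall on the kernel, so the induction generalizes over the kernel while
  \<open>f\<close> stays fixed and only locally integrable.\<close>

lemma C_k_convolution:
  fixes \<kappa> :: "real ^ 'n \<Rightarrow> real"
  assumes "\<And>k. C_k k \<kappa>" "\<And>x. R < norm x \<Longrightarrow> \<kappa> x = 0" "loc_L1 f"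
  shows "C_k k (\<lambda>x. LBINT y. \<kappa> (x - y) * f y)"
  using assms(1,2)
proof (induction k arbitrary: \<kappa>)
  case 0
  have c: "continuous_on UNIV \<kappa>" using 0(1)[of 0] by simp
  have [measurable]: "\<kappa> \<in> borel_measurable borel" "f \<in> borel_measurable borel"
    using c assms(3) by (auto intro: borel_measurable_continuous_onI loc_L1_measurable)
  obtain M where "\<And>x. norm (\<kappa> x) \<le> M" using continuous_compact_support_bounded[OF c 0(2)] by metis
  then have "continuous_on UNIV (\<lambda>x. LBINT y. \<kappa> (x - y) * f y)"
    by (intro integral_param_continuous[OF assms(3), where M=M and R=R])
       (use c 0 in \<open>auto intro!: continuous_intros continuous_on_compose2[of UNIV \<kappa>] simp: abs_mult mult_right_mono\<close>)
  then show ?case by simp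
next
  case (Suc k)
  have C: "C1c \<kappa> (grad \<kappa>)" using Suc by (blast intro: C_k_imp_C1c)
  have g: "\<And>k i. C_k k (\<lambda>x. grad \<kappa> x $ i)" using Suc.prems(1) C_k_SucD(2) by blast
  have z: "grad \<kappa> x = 0" if "R < norm x" for x
    using GDERIV_zero_outside[OF C_k_SucD(1)[OF Suc.prems(1)] Suc.prems(2) that] .
  obtain M where M: "\<And>x. norm (grad \<kappa> x) \<le> M" and c: "continuous_on UNIV (grad \<kappa>)" using C1c_E[OF C] by metis
  have [measurable]: "grad \<kappa> \<in> borel_measurable borel" "f \<in> borel_measurable borel"
    using c assms(3) by (auto intro: borel_measurable_continuous_onI loc_L1_measurable)
  have i: "integrable lborel (\<lambda>y. f y *\<^sub>R grad \<kappa> (x - y))" for x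
  proof (rule loc_L1_integrable_bound[OF assms(3), where R="R + norm x" and M=M])
    fix y show "norm (f y *\<^sub>R grad \<kappa> (x - y)) \<le> M * norm (f y)"
      using M by (auto simp: mult.commute[of M] intro!: mult_left_mono)
    show "R + norm x < norm y \<Longrightarrow> f y *\<^sub>R grad \<kappa> (x - y) = 0"
      using z[of "x - y"] norm_triangle_ineq2[of y x] by (simp add: norm_minus_commute)
  qed simp
  show ?case
  proof (rule C_k_SucI)
    show "GDERIV (\<lambda>x. LBINT y. \<kappa> (x - y) * f y) x :> (LBINT y. f y *\<^sub>R grad \<kappa> (x - y))" for x
      by (rule GDERIV_convolution[OF C assms(3)])
    fix j
    have "(LBINT y. f y *\<^sub>R grad \<kappa> (x - y)) $ j = (LBINT y. grad \<kappa> (x - y) $ j * f y)" for x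
      using integral_bounded_linear[OF bounded_linear_vec_nth i] by (simp add: mult.commute)
    then show "C_k k (\<lambda>x. (LBINT y. f y *\<^sub>R grad \<kappa> (x - y)) $ j)"
      using Suc.IH[OF g, of j] z by simp
  qed
qed

text \<open>Stated for values in a Banach space, so that functions and their gradients are smoothed
  by the same operator.\<close>

definition moll :: "nat \<Rightarrow> (real ^ 'n \<Rightarrow> 'b::{banach, second_countable_topology}) \<Rightarrow> real ^ 'n \<Rightarrow> 'b" where
  "moll n f x = (LBINT y. rho n (x - y) *\<^sub>R f y)"

lemma moll_eq:
  assumes [measurable]: "f \<in> borel_measurable borel"
  shows "moll n f x = (LBINT y. rho n y *\<^sub>R f (x - y))"
proof -
  have "(\<lambda>y. rho n y *\<^sub>R f (x - y)) \<in> borel_measurable borel" by measurable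
  from integral_lborel_reflect[OF this, of x] show ?thesis
    unfolding moll_def diff_diff_eq2 add_diff_cancel_left' .
qed

lemma moll_integrable:
  assumes "loc_L1 f"
  shows "integrable lborel (\<lambda>y. rho n (x - y) *\<^sub>R f y)"
proof -
  have [measurable]: "f \<in> borel_measurable borel" using assms by (rule loc_L1_measurable)
  obtain M where M: "\<And>x::real^'a. rho n x \<le> M" using rho_bounded by metis
  show ?thesis
  proof (rule loc_L1_integrable_bound[OF assms, where R="1 + norm x" and M=M])
    fix y show "norm (rho n (x - y) *\<^sub>R f y) \<le> M * norm (f y)"
      using M rho_nonneg by (auto intro!: mult_right_mono)
    show "1 + norm x < norm y \<Longrightarrow> rho n (x - y) *\<^sub>R f y = 0"
      using rho_zero'[of "x - y"] norm_triangle_ineq2[of y x] by (simp add: norm_minus_commute)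
  qed simp
qed

lemma moll_continuous:
  assumes "loc_L1 f"
  shows "continuous_on UNIV (moll n f)"
proof -
  have [measurable]: "f \<in> borel_measurable borel" using assms by (rule loc_L1_measurable)
  obtain M where M: "\<And>x::real^'a. rho n x \<le> M" using rho_bounded by metis
  show ?thesis unfolding moll_def[abs_def]
    by (rule integral_param_continuous[OF assms, where R=1 and M=M])
       (use M rho_nonneg in \<open>auto intro!: continuous_intros continuous_on_compose2[OF rho_continuous] mult_right_mono rho_zero'\<close>)
qed

lemma continuous_loc_L1:
  fixes f :: "'a::euclidean_space \<Rightarrow> 'b::{banach, second_countable_topology}"
  assumes "continuous_on UNIV f"
  shows "loc_L1 f"
  unfolding loc_L1_def
proof (intro conjI allI)
  show m: "f \<in> borel_measurable borel" using assms by (rule borel_measurable_continuous_onI)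
  fix R
  have "compact (f ` cball 0 R)"
    using assms by (intro compact_continuous_image) (auto intro: continuous_on_subset)
  then obtain M where M: "\<And>x. x \<in> cball 0 R \<Longrightarrow> norm (f x) \<le> M"
    using compact_imp_bounded bounded_pos by (metis image_eqI)
  show "integrable lborel (\<lambda>x. indicat_real (cball 0 R) x *\<^sub>R f x)"
    by (rule loc_L1_integrable_bound[OF loc_L1_const[of "1::real"], of _ R M])
       (use M m in \<open>auto intro!: borel_measurable_scaleR borel_measurable_indicator\<close>)
qed

lemma moll_loc_L1: "loc_L1 f \<Longrightarrow> loc_L1 (moll n f)"
  by (rule continuous_loc_L1[OF moll_continuous])

lemma moll_zero:
  assumes "\<And>x. R < norm x \<Longrightarrow> f x = 0" "R + 1 < norm x"
  shows "moll n f x = 0"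
proof -
  have z: "rho n (x - y) *\<^sub>R f y = 0" for y
    using assms(1)[of y] assms(2) rho_zero'[of "x - y" n] norm_triangle_ineq2[of x y] by force
  show ?thesis unfolding moll_def z by simp
qed

lemma rho_shift_integral: "integrable lborel (\<lambda>y. rho n (x - y))" "(LBINT y. rho n (x - y)) = 1"
proof -
  show "integrable lborel (\<lambda>y. rho n (x - y))"
    using integrable_lborel_isometry[of "-1" "rho n" x] rho_integrable[of n] by simp
  show "(LBINT y. rho n (x - y)) = 1"
    unfolding integral_lborel_reflect[OF rho_measurable] by (rule rho_integral)
qed

lemma moll_norm_le: "loc_L1 f \<Longrightarrow> norm (moll n f x) \<le> moll n (\<lambda>y. norm (f y)) x"
  unfolding moll_def by (rule order_trans[OF integral_norm_bound]) simp

lemma moll_bounded: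
  assumes "f \<in> borel_measurable borel" "\<And>x. norm (f x) \<le> M"
  shows "norm (moll n f x) \<le> M"
proof -
  have l: "loc_L1 f" using loc_L1I_bounded assms by blast
  have "norm (moll n f x) \<le> (LBINT y. rho n (x - y) * norm (f y))"
    using moll_norm_le[OF l, of n x] by (simp add: moll_def)
  also have "\<dots> \<le> (LBINT y. rho n (x - y) * M)"
    using moll_integrable[OF loc_L1_norm[OF l], of n x] rho_shift_integral[of n x] assms rho_nonneg
    by (intro integral_mono) (auto intro!: mult_left_mono)
  also have "\<dots> = M" using rho_shift_integral[of n x] by simp
  finally show ?thesis .
qed

text \<open>Since \<open>rho n\<close> is a probability density, the error is an average of
  \<open>f y - f x\<close> over the support of the kernel, which shrinks into any neighbourhood of
  x.\<close>

lemma moll_tendsto: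
  fixes f :: "real ^ 'n \<Rightarrow> 'b::{banach, second_countable_topology}"
  assumes f: "loc_L1 f" and c: "isCont f x"
  shows "(\<lambda>n. moll n f x) \<longlonglongrightarrow> f x"
  unfolding LIMSEQ_iff
proof (intro allI impI)
  fix e :: real assume e: "e > 0"
  then obtain d where d: "d > 0" "\<And>y. dist y x < d \<Longrightarrow> dist (f y) (f x) < e / 2"
    using c unfolding continuous_at_eps_delta by (metis half_gt_zero)
  obtain n0 where n0: "1 / real (Suc n0) < d" using d(1) nat_approx_posE by blast
  have "norm (moll n f x - f x) < e" if "n \<ge> n0" for n
  proof -
    have "1 / real (Suc n) \<le> 1 / real (Suc n0)" using that by (simp add: frac_le)
    then have small: "rho n (x - y) \<noteq> 0 \<Longrightarrow> norm (f y - f x) \<le> e / 2" for y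
      using n0 rho_zero[of n "x - y"] d(2)[of y] by (fastforce simp: dist_norm norm_minus_commute)
    have i: "integrable lborel (\<lambda>y. rho n (x - y) *\<^sub>R (f y - f x))"
      by (rule moll_integrable[OF loc_L1_diff[OF f loc_L1_const]])
    have "moll n f x - f x = (LBINT y. rho n (x - y) *\<^sub>R (f y - f x))"
      using moll_integrable[OF f, of n x] rho_shift_integral[of n x]
      by (simp add: moll_def scaleR_diff_right)
    also have "norm \<dots> \<le> (LBINT y. norm (rho n (x - y) *\<^sub>R (f y - f x)))"
      by (rule integral_norm_bound)
    also have "\<dots> \<le> (LBINT y. rho n (x - y) * (e / 2))"
    proof (rule integral_mono)
      fix y show "norm (rho n (x - y) *\<^sub>R (f y - f x)) \<le> rho n (x - y) * (e / 2)"
        using small[of y] rho_nonneg[of n "x - y"] by (cases "rho n (x - y) = 0") (auto intro!: mult_left_mono)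
    qed (use integrable_norm[OF i] rho_shift_integral[of n x] in auto)
    also have "\<dots> = e / 2" using rho_shift_integral[of n x] by simp
    finally show ?thesis using e by simp
  qed
  then show "\<exists>no. \<forall>n\<ge>no. norm (moll n f x - f x) < e" by blast
qed

text \<open>The bridge between the two classes of test functions: the mollification of a
  \<open>C1c\<close> function is smooth and so admissible in the given weak formulation. Smoothness
  comes from differentiating the kernel; commutation with the gradient comes from exchanging roles
  and differentiating \<open>\<phi>\<close>.\<close>

lemma moll_C1c:
  assumes "C1c \<phi> \<psi>"
  shows "moll n \<phi> \<in> test_functions" "C1c (moll n \<phi>) (moll n \<psi>)" "grad (moll n \<phi>) x = moll n \<psi> x"
proof -
  obtain R where R: "\<And>x. R < norm x \<Longrightarrow> \<phi> x = 0" and c: "continuous_on UNIV \<phi>" "continuous_on UNIV \<psi>"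
    using C1c_E[OF assms] by metis
  have l: "loc_L1 \<phi>" "loc_L1 \<psi>" using c continuous_loc_L1 by auto
  have "moll n \<phi> = (\<lambda>x. LBINT y. rho n (x - y) * \<phi> y)"
    by (simp add: moll_def[abs_def])
  then have "\<forall>k. C_k k (moll n \<phi>)"
    by (simp add: C_k_convolution[where \<kappa>="rho n" and R=1, OF rho_C_k rho_zero' l(1)])
  moreover have z: "\<forall>x. R + 1 < norm x \<longrightarrow> moll n \<phi> x = 0" using moll_zero[of R \<phi>] R by blast
  ultimately show "moll n \<phi> \<in> test_functions"
    unfolding test_function_iff by blast
  have e: "moll n \<phi> = (\<lambda>x. LBINT y. \<phi> (x - y) * rho n y)"
    "moll n \<psi> = (\<lambda>x. LBINT y. rho n y *\<^sub>R \<psi> (x - y))"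
    using l by (auto simp: moll_eq[OF loc_L1_measurable] mult.commute)
  have D: "GDERIV (moll n \<phi>) x :> moll n \<psi> x" for x
    unfolding e by (rule GDERIV_convolution[OF assms integrable_imp_loc_L1[OF rho_integrable]])
  show "grad (moll n \<phi>) x = moll n \<psi> x" by (rule grad_eq_of_GDERIV[OF D])
  show "C1c (moll n \<phi>) (moll n \<psi>)"
    unfolding C1c_def using D moll_continuous[OF l(2), of n] z by blast
qed

lemma rho_pair_measurable [measurable]:
  "(\<lambda>(x, y). rho n (x - y)) \<in> borel_measurable (borel \<Otimes>\<^sub>M borel)"
  by (subst borel_prod) (auto intro!: borel_measurable_continuous_onI continuous_intros
      continuous_on_compose2[OF rho_continuous] simp: case_prod_beta)

lemma nn_integral_rho: "(\<integral>\<^sup>+x. ennreal (rho n (x - y)) \<partial>lborel) = 1"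
proof -
  have "integrable lborel (\<lambda>x. rho n (x - y))" "(LBINT x. rho n (x - y)) = 1"
    using rho_shift_integral[of n y] by (simp_all add: rho_diff_commute[of n y])
  then show ?thesis by (subst nn_integral_eq_integral) (auto simp: rho_nonneg)
qed

text \<open>Tonelli together with the unit mass of \<open>rho n\<close>; this is the source of the
  contraction property in \<open>L^1\<close>.\<close>

lemma nn_integral_kernel:
  assumes [measurable]: "h \<in> borel_measurable borel"
  shows "(\<integral>\<^sup>+x. \<integral>\<^sup>+y. ennreal (rho n (x - y)) * h y \<partial>lborel \<partial>lborel) = (\<integral>\<^sup>+y. h y \<partial>lborel)"
proof -
  have "(\<integral>\<^sup>+x. \<integral>\<^sup>+y. ennreal (rho n (x - y)) * h y \<partial>lborel \<partial>lborel) =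
    (\<integral>\<^sup>+y. \<integral>\<^sup>+x. ennreal (rho n (x - y)) * h y \<partial>lborel \<partial>lborel)"
    by (rule lborel_pair.Fubini') measurable
  also have "\<dots> = (\<integral>\<^sup>+y. h y \<partial>lborel)"
    by (subst nn_integral_multc) (auto simp: nn_integral_rho)
  finally show ?thesis .
qed

lemma moll_norm_nn:
  assumes "loc_L1 f"
  shows "ennreal (norm (moll n f x)) \<le> (\<integral>\<^sup>+y. ennreal (rho n (x - y)) * ennreal (norm (f y)) \<partial>lborel)"
  unfolding moll_def
  using integral_norm_bound_ennreal[OF moll_integrable[OF assms, of n x]]
  by (simp add: ennreal_mult rho_nonneg)

lemma moll_L1:
  assumes "integrable lborel f"
  shows "integrable lborel (moll n f)" "(LBINT x. norm (moll n f x)) \<le> (LBINT x. norm (f x))"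
proof -
  have l: "loc_L1 f" using integrable_imp_loc_L1[OF assms] .
  have [measurable]: "f \<in> borel_measurable borel" "moll n f \<in> borel_measurable borel"
    using l moll_loc_L1[OF l] by (auto intro: loc_L1_measurable)
  have b: "(\<integral>\<^sup>+x. norm (moll n f x) \<partial>lborel) \<le> (\<integral>\<^sup>+y. norm (f y) \<partial>lborel)"
    using nn_integral_mono[of lborel "\<lambda>x. norm (moll n f x)", OF moll_norm_nn[OF l]]
    by (subst (asm) nn_integral_kernel) auto
  then show i: "integrable lborel (moll n f)"
    using assms by (intro integrableI_bounded) (auto simp: integrable_iff_bounded intro: le_less_trans)
  show "(LBINT x. norm (moll n f x)) \<le> (LBINT x. norm (f x))"
    using b i assms by (simp add: nn_integral_eq_integral)
qed

text \<open>Jensen's inequality for the square, in the form that the variance of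
  \<open>norm (f y)\<close> under the probability density \<open>rho n (x - y)\<close> is
  nonnegative.\<close>

lemma moll_norm_square_le:
  assumes f: "loc_L1 f" and f2: "loc_L1 (\<lambda>x. (norm (f x))\<^sup>2)"
  shows "(norm (moll n f x))\<^sup>2 \<le> moll n (\<lambda>x. (norm (f x))\<^sup>2) x"
proof -
  let ?m = "moll n (\<lambda>y. norm (f y)) x"
  have l: "loc_L1 (\<lambda>x. norm (f x))" using f by (rule loc_L1_norm)
  note i = moll_integrable[OF l, of n x] moll_integrable[OF f2, of n x] rho_shift_integral[of n x]
  have "0 \<le> (LBINT y. rho n (x - y) * (norm (f y) - ?m)\<^sup>2)"
    by (rule integral_nonneg_AE) (auto simp: rho_nonneg)
  also have "\<dots> = (LBINT y. rho n (x - y) *\<^sub>R (norm (f y))\<^sup>2 - (2 * ?m) * (rho n (x - y) *\<^sub>R norm (f y)) + ?m\<^sup>2 * rho n (x - y))"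
    by (rule Bochner_Integration.integral_cong) (auto simp: algebra_simps power2_diff power2_eq_square)
  also have "\<dots> = moll n (\<lambda>x. (norm (f x))\<^sup>2) x - 2 * ?m * ?m + ?m\<^sup>2"
    using i by (simp add: moll_def)
  finally have "?m\<^sup>2 \<le> moll n (\<lambda>x. (norm (f x))\<^sup>2) x" by (simp add: power2_eq_square)
  moreover have "(norm (moll n f x))\<^sup>2 \<le> ?m\<^sup>2"
    using moll_norm_le[OF f] by (intro power_mono) auto
  ultimately show ?thesis by linarith
qed

text \<open>For an indicator function, outer regularity of \<open>A\<close> and of its complement
  yields open sets \<open>U\<close> and \<open>V\<close>, and a Urysohn function agrees with the
  indicator off \<open>U \<inter> V\<close>, which has small measure. The bound \<open>M\<close> is
  kept because \<open>moll_L1_loc_lim\<close> uses it as a majorant.\<close>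

lemma L1_dense_continuous:
  fixes f :: "'a::euclidean_space \<Rightarrow> 'b::{banach, second_countable_topology}"
  assumes "integrable lborel f" "e > 0"
  shows "\<exists>g M. continuous_on UNIV g \<and> (\<forall>x. norm (g x) \<le> M) \<and> integrable lborel g \<and>
    (LBINT x. norm (f x - g x)) < e"
  using assms
proof (induction arbitrary: e rule: integrable_induct)
  case (base A c)
  \<comment> \<open>The resulting error is at most \<open>norm c * (2 * d)\<close>, which this
    choice keeps below e; the summand 1 also covers \<open>c = 0\<close>.\<close>
  define d where "d = e / (2 * (norm c + 1))"
  have d: "d > 0" using base by (simp add: d_def add_nonneg_pos)
  have A: "A \<in> sets borel" "- A \<in> sets borel" using base by auto
  obtain U where U: "open U" "A \<subseteq> U" "emeasure lborel (U - A) < d" using outer_regular_lborel[OF A(1) d] by blast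
  obtain V where V: "open V" "- A \<subseteq> V" "emeasure lborel (V - - A) < d" using outer_regular_lborel[OF A(2) d] by blast
  obtain g :: "'a \<Rightarrow> real" where g: "continuous_on UNIV g" "\<And>x. g x \<in> closed_segment 1 0"
    "\<And>x. x \<in> - V \<Longrightarrow> g x = 1" "\<And>x. x \<in> - U \<Longrightarrow> g x = 0"
    using Urysohn[of "- V" "- U" "1::real" 0] U V by (auto simp: closed_Compl)
  have g01: "0 \<le> g x" "g x \<le> 1" for x using g(2)[of x] by (auto simp: closed_segment_eq_real_ivl)
  have [measurable]: "g \<in> borel_measurable borel" "U \<in> sets borel" "V \<in> sets borel" "A \<in> sets borel"
    using g U V A by (auto intro: borel_measurable_continuous_onI)
  have "emeasure lborel U \<le> emeasure lborel A + emeasure lborel (U - A)"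
    using U(2) by (subst plus_emeasure) (auto simp: Un_absorb1)
  also have "\<dots> < \<infinity>" using base(2) U(3) by (simp add: less_top ennreal_add_less_top) (metis ennreal_less_top less_trans)
  finally have Ufin: "emeasure lborel U < \<infinity>" .
  let ?B = "U \<inter> V"
  have "?B = (U - A) \<union> (V - - A)" using U V by auto
  then have "emeasure lborel ?B \<le> emeasure lborel (U - A) + emeasure lborel (V - - A)"
    using emeasure_subadditive[of "U - A" lborel "V - - A"] by auto
  also have "\<dots> < ennreal d + ennreal d" using U(3) V(3) by (rule add_strict_mono)
  also have "\<dots> = ennreal (2 * d)" using d by (simp flip: ennreal_plus)
  finally have Bm: "emeasure lborel ?B < ennreal (2 * d)" .
  then have Bfin: "emeasure lborel ?B < \<infinity>" by (metis ennreal_less_top less_trans infinity_ennreal_def)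
  have Bm': "measure lborel ?B < 2 * d" using Bm Bfin d
    by (metis emeasure_eq_ennreal_measure ennreal_less_iff infinity_ennreal_def less_irrefl measure_nonneg)
  have gi: "integrable lborel g"
    by (rule Bochner_Integration.integrable_bound[OF integrable_real_indicator[of U lborel]])
       (use Ufin g01 g(4) in \<open>auto simp: indicator_def\<close>)
  have *: "norm (indicat_real A x *\<^sub>R c - g x *\<^sub>R c) \<le> norm c * indicator ?B x" for x
  proof (cases "x \<in> ?B")
    case True
    have "\<bar>indicat_real A x - g x\<bar> \<le> 1" using g01[of x] by (auto simp: indicator_def)
    then have "norm ((indicat_real A x - g x) *\<^sub>R c) \<le> 1 * norm c" unfolding norm_scaleR by (rule mult_right_mono) simp
    then show ?thesis using True by (simp add: scaleR_diff_left)
  next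
    case False
    then have "indicat_real A x = g x" using g(3,4)[of x] U V by (auto simp: indicator_def)
    then show ?thesis by simp
  qed
  have iA: "integrable lborel (\<lambda>x. indicat_real A x *\<^sub>R c)"
    using base by (intro integrable_scaleR_left integrable_real_indicator) auto
  have "(LBINT x. norm (indicat_real A x *\<^sub>R c - g x *\<^sub>R c)) \<le> (LBINT x. norm c * indicator ?B x)"
    using iA gi Bfin by (intro integral_mono *) auto
  also have "\<dots> = norm c * measure lborel ?B" by simp
  also have "\<dots> \<le> norm c * (2 * d)" using Bm' by (intro mult_left_mono) auto
  also have "\<dots> < e" using base(3) by (simp add: d_def field_simps add_pos_nonneg)
  finally show ?case
    using g01 gi g(1) by (intro exI[of _ "\<lambda>x. g x *\<^sub>R c"] exI[of _ "norm c"])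
      (auto intro!: continuous_intros mult_left_le_one_le)
next
  case (add f g)
  from add.IH(1)[of "e/2"] obtain f' Mf where f': "continuous_on UNIV f'" "\<And>x. norm (f' x) \<le> Mf" "integrable lborel f'"
    "(LBINT x. norm (f x - f' x)) < e/2" using add.prems by auto
  from add.IH(2)[of "e/2"] obtain g' Mg where g': "continuous_on UNIV g'" "\<And>x. norm (g' x) \<le> Mg" "integrable lborel g'"
    "(LBINT x. norm (g x - g' x)) < e/2" using add.prems by auto
  have "(LBINT x. norm (f x + g x - (f' x + g' x))) \<le> (LBINT x. norm (f x - f' x) + norm (g x - g' x))"
    using add f' g' by (intro integral_mono) (auto intro!: norm_diff_triangle_ineq)
  also have "\<dots> < e" using add.hyps f' g' by simp
  finally show ?case using f' g'
    by (intro exI[of _ "\<lambda>x. f' x + g' x"] exI[of _ "Mf + Mg"]) (auto intro!: continuous_intros norm_add_rule_thm)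
next
  case (lim f s)
  have "(\<lambda>i. LBINT x. norm (f x - s i x)) \<longlonglongrightarrow> (\<integral>x. 0 \<partial>(lborel :: 'a measure))"
  proof (rule integral_dominated_convergence[where w="\<lambda>x. 3 * norm (f x)"])
    show "AE x in lborel. (\<lambda>i. norm (f x - s i x)) \<longlonglongrightarrow> 0"
    proof (rule AE_I2)
      fix x
      have "(\<lambda>i. norm (f x - s i x)) \<longlonglongrightarrow> norm (f x - f x)"
        using lim.hyps(2)[of x] by (intro tendsto_intros) auto
      then show "(\<lambda>i. norm (f x - s i x)) \<longlonglongrightarrow> 0" by simp
    qed
    fix i
    show "AE x in lborel. norm (norm (f x - s i x)) \<le> 3 * norm (f x)"
    proof (rule AE_I2)
      fix x show "norm (norm (f x - s i x)) \<le> 3 * norm (f x)"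
        using lim.hyps(3)[of x i] norm_triangle_ineq4[of "f x" "s i x"] by simp
    qed
  qed (use lim in auto)
  then have "eventually (\<lambda>i. (LBINT x. norm (f x - s i x)) < e/2) sequentially"
    using lim.prems by (intro order_tendstoD) auto
  then obtain i where i: "(LBINT x. norm (f x - s i x)) < e/2" by (meson eventually_sequentially order_refl)
  from lim.IH[of "e/2" i] obtain g M where g: "continuous_on UNIV g" "\<And>x. norm (g x) \<le> M" "integrable lborel g"
    "(LBINT x. norm (s i x - g x)) < e/2" using lim.prems by auto
  have "(LBINT x. norm (f x - g x)) \<le> (LBINT x. norm (f x - s i x) + norm (s i x - g x))"
    using lim g by (intro integral_mono) (auto intro: norm_triangle_le[of "f x - s i x" "s i x - g x" for x, simplified])
  also have "\<dots> < e" using lim.hyps g i by simp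
  finally show ?case using g by blast
qed

section \<open>Convergence in the mean on balls\<close>

abbreviation indb :: "real \<Rightarrow> 'a::euclidean_space \<Rightarrow> real" where
  "indb R \<equiv> indicat_real (cball 0 R)"

lemma loc_L1_indb: "loc_L1 f \<Longrightarrow> integrable lborel (\<lambda>x. indb R x *\<^sub>R f x)"
  by (simp add: loc_L1_def)

lemma loc_L1_indb_norm: "loc_L1 f \<Longrightarrow> integrable lborel (\<lambda>x. indb R x * norm (f x))"
  using loc_L1_indb[OF loc_L1_norm] by simp

text \<open>Local integrability of the terms and of the limit belongs to the notion: the Bochner
  integral of a nonintegrable function is 0, so convergence of the integrals alone would be
  void.\<close>

definition L1_loc_lim :: "(nat \<Rightarrow> 'a::euclidean_space \<Rightarrow> 'b::{banach, second_countable_topology}) \<Rightarrow> ('a \<Rightarrow> 'b) \<Rightarrow> bool" where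
  "L1_loc_lim F f \<longleftrightarrow> (\<forall>n. loc_L1 (F n)) \<and> loc_L1 f \<and> (\<forall>R. (\<lambda>n. LBINT x. indb R x * norm (F n x - f x)) \<longlonglongrightarrow> 0)"

text \<open>The kernels live in the unit ball, so values of \<open>f\<close> beyond radius
  \<open>R + 1\<close> are not seen. This reduces local statements to globally integrable
  functions.\<close>

lemma moll_cut:
  assumes "norm x \<le> R"
  shows "moll n (\<lambda>y. indb (R + 1) y *\<^sub>R f y) x = moll n f x"
  unfolding moll_def
proof (rule Bochner_Integration.integral_cong[OF refl])
  fix y show "rho n (x - y) *\<^sub>R indb (R + 1) y *\<^sub>R f y = rho n (x - y) *\<^sub>R f y"
    using rho_zero'[of "x - y" n] assms norm_triangle_ineq2[of y x]
    by (cases "norm y \<le> R + 1") (auto simp: norm_minus_commute)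
qed

lemma moll_diff: "loc_L1 f \<Longrightarrow> loc_L1 g \<Longrightarrow> moll n (\<lambda>x. f x - g x) x = moll n f x - moll n g x"
  using moll_integrable[of f, where n=n and x=x] moll_integrable[of g, where n=n and x=x] by (simp add: moll_def scaleR_diff_right)

text \<open>Cut \<open>f\<close> off outside a larger ball and approximate it in \<open>L^1\<close>
  by a bounded continuous \<open>g\<close>. The contraction property controls the mollified error,
  dominated convergence handles \<open>g\<close>; each of the three terms is below e/3.\<close>

lemma moll_L1_loc_lim:
  fixes f :: "real ^ 'n \<Rightarrow> 'b::{banach, second_countable_topology}"
  assumes f: "loc_L1 f"
  shows "L1_loc_lim (\<lambda>n. moll n f) f"
  unfolding L1_loc_lim_def
proof (intro conjI allI)
  show "loc_L1 (moll n f)" for n using moll_loc_L1[OF f] .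
  fix R
  let ?f = "\<lambda>y. indb (R + 1) y *\<^sub>R f y"
  have fi: "integrable lborel ?f" using f loc_L1_indb by blast
  show "(\<lambda>n. LBINT x. indb R x * norm (moll n f x - f x)) \<longlonglongrightarrow> 0"
  proof (rule LIMSEQ_I)
    fix e :: real assume e: "e > 0"
    obtain g M where g: "continuous_on UNIV g" "\<And>x. norm (g x) \<le> M" "integrable lborel g"
      "(LBINT x. norm (?f x - g x)) < e / 3" using L1_dense_continuous[OF fi, of "e/3"] e by auto
    have gl: "loc_L1 g" using continuous_loc_L1[OF g(1)] .
    have [measurable]: "g \<in> borel_measurable borel" "moll n g \<in> borel_measurable borel" for n
      using gl moll_loc_L1[OF gl] loc_L1_measurable by auto
    have "(\<lambda>n. LBINT x. indb R x * norm (moll n g x - g x)) \<longlonglongrightarrow> (\<integral>x. 0 \<partial>(lborel::(real^'n) measure))"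
    proof (rule integral_dominated_convergence[where w="\<lambda>x. indb R x * (2 * M)"])
      show "AE x in lborel. (\<lambda>n. indb R x * norm (moll n g x - g x)) \<longlonglongrightarrow> 0"
      proof (rule AE_I2)
        fix x
        have "(\<lambda>n. indb R x * norm (moll n g x - g x)) \<longlonglongrightarrow> indb R x * norm (g x - g x)"
          using g(1) by (intro tendsto_intros moll_tendsto[OF gl]) (simp add: continuous_on_eq_continuous_at)
        then show "(\<lambda>n. indb R x * norm (moll n g x - g x)) \<longlonglongrightarrow> 0" by simp
      qed
      show "integrable lborel (\<lambda>x. indb R x * (2 * M))"
        using loc_L1_indb[OF loc_L1_const[of "2 * M"], of R] by simp
      fix n
      have "norm (moll n g x) \<le> M" for x by (rule moll_bounded) (use g in auto)
      then have "norm (moll n g x - g x) \<le> 2 * M" for x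
        using norm_triangle_ineq4[of "moll n g x" "g x"] g(2)[of x] by (smt (verit))
      then show "AE x in lborel. norm (indb R x * norm (moll n g x - g x)) \<le> indb R x * (2 * M)"
        by (auto simp: indicator_def)
    qed (auto intro!: borel_measurable_times borel_measurable_indicator)
    then have "eventually (\<lambda>n. (LBINT x. indb R x * norm (moll n g x - g x)) < e/3) sequentially"
      using e by (intro order_tendstoD) auto
    then obtain n0 where n0: "\<And>n. n \<ge> n0 \<Longrightarrow> (LBINT x. indb R x * norm (moll n g x - g x)) < e/3"
      unfolding eventually_sequentially by blast
    have "norm ((LBINT x. indb R x * norm (moll n f x - f x)) - 0) < e" if "n \<ge> n0" for n
    proof -
      let ?h = "\<lambda>x. ?f x - g x"
      have hi: "integrable lborel ?h" using fi g by auto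
      have p: "indb R x * norm (moll n f x - f x) \<le> norm (moll n ?h x) + indb R x * norm (moll n g x - g x) + norm (?h x)" for x
      proof (cases "norm x \<le> R")
        case True
        have "moll n f x - f x = moll n ?h x + (moll n g x - g x) - ?h x"
          using True moll_cut[OF True, of n f] moll_diff[OF integrable_imp_loc_L1[OF fi] gl, where n=n and x=x] by simp
        then show ?thesis using True
            norm_triangle_ineq4[of "moll n ?h x + (moll n g x - g x)" "?h x"] norm_triangle_ineq[of "moll n ?h x" "moll n g x - g x"]
          by simp
      qed simp
      have i1: "integrable lborel (\<lambda>x. indb R x * norm (moll n g x - g x))" "integrable lborel (\<lambda>x. indb R x * norm (moll n f x - f x))"
        by (auto intro!: loc_L1_indb_norm loc_L1_diff moll_loc_L1 gl f)
      have "(LBINT x. indb R x * norm (moll n f x - f x)) \<le>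
        (LBINT x. norm (moll n ?h x) + indb R x * norm (moll n g x - g x) + norm (?h x))"
        using i1 hi moll_L1[OF hi, of n] by (intro integral_mono p) auto
      also have "\<dots> = (LBINT x. norm (moll n ?h x)) + (LBINT x. indb R x * norm (moll n g x - g x)) + (LBINT x. norm (?h x))"
        using i1 hi moll_L1(1)[OF hi, of n] by simp
      also have "\<dots> < e" using n0[OF that] moll_L1(2)[OF hi, of n] g(4) by linarith
      finally show ?thesis by simp
    qed
    then show "\<exists>no. \<forall>n\<ge>no. norm ((LBINT x. indb R x * norm (moll n f x - f x)) - 0) < e" by blast
  qed
qed (rule f)

section \<open>Local convergence in the mean\<close>

text \<open>Lets information about subsequences of subsequences, as in \<open>AE_subseq_lim\<close>,
  yield convergence of the full sequence of integrals: otherwise some subsequence would stay at a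
  fixed distance from the limit.\<close>

lemma LIMSEQ_subsubseq:
  fixes a :: "nat \<Rightarrow> real"
  assumes "\<And>r :: nat \<Rightarrow> nat. strict_mono r \<Longrightarrow> \<exists>s :: nat \<Rightarrow> nat. strict_mono s \<and> (\<lambda>n. a (r (s n))) \<longlonglongrightarrow> l"
  shows "a \<longlonglongrightarrow> l"
proof (rule ccontr)
  assume "\<not> a \<longlonglongrightarrow> l"
  then obtain e where e: "e > 0" "\<And>N. \<exists>n\<ge>N. e \<le> \<bar>a n - l\<bar>"
    unfolding LIMSEQ_iff by (auto simp: not_less)
  then have "infinite {n. e \<le> \<bar>a n - l\<bar>}"
    unfolding infinite_nat_iff_unbounded_le by auto
  then obtain r :: "nat \<Rightarrow> nat" where r: "strict_mono r" "\<And>n. e \<le> \<bar>a (r n) - l\<bar>"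
    using infinite_enumerate by blast
  obtain s where "(\<lambda>n. a (r (s n))) \<longlonglongrightarrow> l" using assms[OF r(1)] by blast
  then have "eventually (\<lambda>n. dist (a (r (s n))) l < e) sequentially" using e(1) by (rule tendstoD)
  then obtain n where "dist (a (r (s n))) l < e" by (meson eventually_sequentially order_refl)
  then show False using r(2)[of "s n"] by (simp add: dist_real_def)
qed

text \<open>Convergence in measure on bounded sets, encoded by almost everywhere convergent
  subsequences of subsequences; this avoids passing to subsequences in later statements.\<close>
definition AE_subseq_lim :: "(nat \<Rightarrow> 'a::euclidean_space \<Rightarrow> 'b::metric_space) \<Rightarrow> ('a \<Rightarrow> 'b) \<Rightarrow> bool" where
  "AE_subseq_lim F f \<longleftrightarrow> (\<forall>R r. strict_mono (r :: nat \<Rightarrow> nat) \<longrightarrow>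
     (\<exists>s :: nat \<Rightarrow> nat. strict_mono s \<and> (AE x in lborel. norm x \<le> R \<longrightarrow> (\<lambda>n. F (r (s n)) x) \<longlonglongrightarrow> f x)))"

lemma AE_subseq_lim_const: "AE_subseq_lim (\<lambda>n. f) f"
  unfolding AE_subseq_lim_def using strict_mono_id by auto

lemma AE_subseq_lim_pointwise: "(\<And>x. (\<lambda>n. F n x) \<longlonglongrightarrow> f x) \<Longrightarrow> AE_subseq_lim F f"
  unfolding AE_subseq_lim_def
proof (intro allI impI exI[of _ id] conjI AE_I2)
  fix r :: "nat \<Rightarrow> nat" and x :: 'a
  assume "\<And>x. (\<lambda>n. F n x) \<longlonglongrightarrow> f x" "strict_mono r"
  then have "((\<lambda>n. F n x) \<circ> r) \<longlonglongrightarrow> f x" by (intro LIMSEQ_subseq_LIMSEQ)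
  then show "(\<lambda>n. F (r (id n)) x) \<longlonglongrightarrow> f x" by (simp add: o_def)
qed (auto simp: strict_mono_def)

text \<open>Two successive extractions: the subsequence for \<open>G\<close> is taken inside the one
  already found for \<open>F\<close>, after which both converge at almost every point and continuity
  applies.\<close>

lemma AE_subseq_lim_compose2:
  assumes "AE_subseq_lim F f" "AE_subseq_lim G g"
    and c: "\<And>a b. isCont (\<lambda>p. h (fst p) (snd p)) (a, b)"
  shows "AE_subseq_lim (\<lambda>n x. h (F n x) (G n x)) (\<lambda>x. h (f x) (g x))"
  unfolding AE_subseq_lim_def
proof (intro allI impI)
  fix R and r :: "nat \<Rightarrow> nat" assume r: "strict_mono r"
  obtain s1 :: "nat \<Rightarrow> nat" where s1: "strict_mono s1" "AE x in lborel. norm x \<le> R \<longrightarrow> (\<lambda>n. F (r (s1 n)) x) \<longlonglongrightarrow> f x"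
    using assms(1) r unfolding AE_subseq_lim_def by blast
  have "strict_mono (r \<circ> s1)" using r s1(1) by (rule strict_mono_o)
  then obtain s2 :: "nat \<Rightarrow> nat" where s2: "strict_mono s2" "AE x in lborel. norm x \<le> R \<longrightarrow> (\<lambda>n. G ((r \<circ> s1) (s2 n)) x) \<longlonglongrightarrow> g x"
    using assms(2) unfolding AE_subseq_lim_def by blast
  have "AE x in lborel. norm x \<le> R \<longrightarrow> (\<lambda>n. h (F (r ((s1 \<circ> s2) n)) x) (G (r ((s1 \<circ> s2) n)) x)) \<longlonglongrightarrow> h (f x) (g x)"
    using s1(2) s2(2)
  proof eventually_elim
    case (elim x)
    show ?case
    proof
    assume "norm x \<le> R"
    with elim have "(\<lambda>n. F (r (s1 n)) x) \<longlonglongrightarrow> f x" by blast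
    from LIMSEQ_subseq_LIMSEQ[OF this s2(1)] have "(\<lambda>n. F (r (s1 (s2 n))) x) \<longlonglongrightarrow> f x" by (simp add: o_def)
    moreover have "(\<lambda>n. G (r (s1 (s2 n))) x) \<longlonglongrightarrow> g x" using elim \<open>norm x \<le> R\<close> by simp
    ultimately have "(\<lambda>n. (F (r (s1 (s2 n))) x, G (r (s1 (s2 n))) x)) \<longlonglongrightarrow> (f x, g x)" by (rule tendsto_Pair)
    from isCont_tendsto_compose[OF c this]
    show "(\<lambda>n. h (F (r ((s1 \<circ> s2) n)) x) (G (r ((s1 \<circ> s2) n)) x)) \<longlonglongrightarrow> h (f x) (g x)" by simp
    qed
  qed
  then show "\<exists>s. strict_mono s \<and> (AE x in lborel. norm x \<le> R \<longrightarrow> (\<lambda>n. h (F (r (s n)) x) (G (r (s n)) x)) \<longlonglongrightarrow> h (f x) (g x))"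
    using strict_mono_o[OF s1(1) s2(1)] by blast
qed

lemma AE_subseq_lim_compose:
  assumes "AE_subseq_lim F f" "\<And>a. isCont h a"
  shows "AE_subseq_lim (\<lambda>n x. h (F n x)) (\<lambda>x. h (f x))"
proof (rule AE_subseq_lim_compose2[OF assms(1) assms(1), of "\<lambda>a b. h a"])
  fix a b
  show "isCont (\<lambda>p. h (fst p)) (a, b)"
    by (rule continuous_within_compose3[where g=h and f=fst]) (auto intro!: continuous_intros assms)
qed

lemma L1_loc_limD: "L1_loc_lim F f \<Longrightarrow> loc_L1 (F n)" "L1_loc_lim F f \<Longrightarrow> loc_L1 f"
  by (auto simp: L1_loc_lim_def)

lemma L1_loc_lim_AE_subseq_lim:
  fixes F :: "nat \<Rightarrow> 'a::euclidean_space \<Rightarrow> 'b::{banach, second_countable_topology}"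
  assumes "L1_loc_lim F f"
  shows "AE_subseq_lim F f"
  unfolding AE_subseq_lim_def
proof (intro allI impI)
  fix R and r :: "nat \<Rightarrow> nat" assume r: "strict_mono r"
  let ?u = "\<lambda>n x. indb R x *\<^sub>R (F (r n) x - f x)"
  have "(\<lambda>n. LBINT x. indb R x * norm (F n x - f x)) \<longlonglongrightarrow> 0" using assms by (simp add: L1_loc_lim_def)
  from LIMSEQ_subseq_LIMSEQ[OF this r] have "(\<lambda>n. LBINT x. norm (?u n x)) \<longlonglongrightarrow> 0"
    by (simp add: o_def)
  moreover have "integrable lborel (?u n)" for n using assms by (intro loc_L1_indb loc_L1_diff) (auto simp: L1_loc_lim_def)
  ultimately obtain s :: "nat \<Rightarrow> nat" where s: "strict_mono s" "AE x in lborel. (\<lambda>n. ?u (s n) x) \<longlonglongrightarrow> 0"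
    using tendsto_L1_AE_subseq[of lborel ?u] by blast
  have "AE x in lborel. norm x \<le> R \<longrightarrow> (\<lambda>n. F (r (s n)) x) \<longlonglongrightarrow> f x"
    using s(2) by eventually_elim (auto simp: LIM_zero_iff)
  then show "\<exists>s. strict_mono s \<and> (AE x in lborel. norm x \<le> R \<longrightarrow> (\<lambda>n. F (r (s n)) x) \<longlonglongrightarrow> f x)"
    using s(1) by blast
qed

text \<open>Dominated convergence in the generalized form of Pratt: the majorants may vary with n as
  long as they converge locally in \<open>L^1\<close> themselves. Mollified functions come with
  mollified majorants, so the classical form would not suffice.\<close>

lemma L1_loc_lim_dominated:
  fixes Y :: "nat \<Rightarrow> 'a::euclidean_space \<Rightarrow> 'b::{banach, second_countable_topology}"
  assumes Y: "AE_subseq_lim Y y" and m: "\<And>n. Y n \<in> borel_measurable borel" and y: "loc_L1 y"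
    and bd: "\<And>n x. norm (Y n x) \<le> B n x" and B: "L1_loc_lim B b"
  shows "L1_loc_lim Y y"
  unfolding L1_loc_lim_def
proof (intro conjI allI)
  have lB: "loc_L1 (B n)" "loc_L1 b" for n using B by (auto simp: L1_loc_lim_def)
  show lY: "loc_L1 (Y n)" for n
    by (rule loc_L1I_bound[OF lB(1)[of n], where M=1]) (use m bd[of n] in \<open>auto intro: order_trans[OF _ abs_ge_self]\<close>)
  fix R
  show "(\<lambda>n. LBINT x. indb R x * norm (Y n x - y x)) \<longlonglongrightarrow> 0"
  proof (rule LIMSEQ_subsubseq)
    fix r :: "nat \<Rightarrow> nat" assume r: "strict_mono r"
    obtain s :: "nat \<Rightarrow> nat" where s: "strict_mono s" "AE x in lborel. norm x \<le> R \<longrightarrow> (\<lambda>n. Y (r (s n)) x) \<longlonglongrightarrow> y x"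
      using Y r unfolding AE_subseq_lim_def by blast
    define k where "k = (\<lambda>n. r (s n))"
    let ?w = "\<lambda>x. indb R x * norm (\<bar>b x\<bar> + norm (y x))"
    let ?a = "\<lambda>n x. indb R x * norm (Y (k n) x - y x)"
    let ?d = "\<lambda>n x. indb R x * norm (B (k n) x - b x)"
    have wi: "integrable lborel ?w" using loc_L1_indb_norm[OF loc_L1_add[OF loc_L1_norm[OF lB(2)] loc_L1_norm[OF y]]] by simp
    have ai: "integrable lborel (?a n)" for n by (intro loc_L1_indb_norm loc_L1_diff lY y)
    have di: "integrable lborel (?d n)" for n by (intro loc_L1_indb_norm loc_L1_diff lB)
    have "(\<lambda>n. LBINT x. min (?a n x) (?w x)) \<longlonglongrightarrow> (\<integral>x. 0 \<partial>(lborel :: 'a measure))"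
    proof (rule integral_dominated_convergence[where w="?w"])
      show "AE x in lborel. (\<lambda>n. min (?a n x) (?w x)) \<longlonglongrightarrow> 0"
        using s(2)
      proof eventually_elim
        case (elim x)
        show ?case
        proof (cases "norm x \<le> R")
          case True
          then have "(\<lambda>n. Y (k n) x) \<longlonglongrightarrow> y x" using elim by (simp add: k_def)
          then have "(\<lambda>n. min (?a n x) (?w x)) \<longlonglongrightarrow> min (indb R x * norm (y x - y x)) (?w x)"
            by (intro tendsto_intros)
          then show ?thesis by (simp add: min_def)
        qed simp
      qed
      fix n
      show "AE x in lborel. norm (min (?a n x) (?w x)) \<le> ?w x"
        by (rule AE_I2) (auto simp: indicator_def min_def)
    qed (use wi ai in \<open>auto intro!: borel_measurable_min borel_measurable_integrable\<close>)
    then have 1: "(\<lambda>n. LBINT x. min (?a n x) (?w x)) \<longlonglongrightarrow> 0" by simp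
    have "(\<lambda>n. LBINT x. indb R x * norm (B n x - b x)) \<longlonglongrightarrow> 0" using B by (simp add: L1_loc_lim_def)
    moreover have "strict_mono k" unfolding k_def using strict_mono_o[OF r s(1)] by (simp add: o_def)
    ultimately have 2: "(\<lambda>n. LBINT x. ?d n x) \<longlonglongrightarrow> 0" using LIMSEQ_subseq_LIMSEQ unfolding o_def by fast
    \<comment> \<open>The difference is split at the fixed integrable height \<open>?w\<close>. The
      part below it is covered by ordinary dominated convergence, and the excess is at most the
      distance of the majorants from their limit.\<close>
    have p: "?a n x \<le> min (?a n x) (?w x) + ?d n x" for n x
    proof (cases "norm x \<le> R")
      case True
      have "norm (Y (k n) x - y x) \<le> B (k n) x + norm (y x)"
        using norm_triangle_ineq4[of "Y (k n) x" "y x"] bd[of "k n" x] by linarith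
      also have "\<dots> \<le> \<bar>b x\<bar> + norm (y x) + norm (B (k n) x - b x)" by simp
      finally show ?thesis using True by (simp add: min_def)
    qed simp
    have "(\<lambda>n. LBINT x. ?a n x) \<longlonglongrightarrow> 0"
    proof (rule tendsto_sandwich[OF _ _ tendsto_const])
      show "(\<lambda>n. (LBINT x. min (?a n x) (?w x)) + (LBINT x. ?d n x)) \<longlonglongrightarrow> 0"
        using tendsto_add[OF 1 2] by simp
      show "\<forall>\<^sub>F n in sequentially. (LBINT x. ?a n x) \<le> (LBINT x. min (?a n x) (?w x)) + (LBINT x. ?d n x)"
      proof (rule always_eventually, rule allI)
        fix n
        have mi: "integrable lborel (\<lambda>x. min (?a n x) (?w x))" using ai wi by (intro integrable_min)
        have "(LBINT x. ?a n x) \<le> (LBINT x. min (?a n x) (?w x) + ?d n x)"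
          by (rule integral_mono[OF ai Bochner_Integration.integrable_add[OF mi di] p])
        then show "(LBINT x. ?a n x) \<le> (LBINT x. min (?a n x) (?w x)) + (LBINT x. ?d n x)"
          using mi di by simp
      qed
      show "\<forall>\<^sub>F n in sequentially. 0 \<le> (LBINT x. ?a n x)"
        by (rule always_eventually, rule allI, rule integral_nonneg_AE) auto
    qed
    then show "\<exists>s. strict_mono s \<and> (\<lambda>n. LBINT x. indb R x * norm (Y (r (s n)) x - y x)) \<longlonglongrightarrow> 0"
      using s(1) unfolding k_def by blast
  qed
qed (rule y)

lemma L1_loc_lim_const: "loc_L1 f \<Longrightarrow> L1_loc_lim (\<lambda>n. f) f"
  by (simp add: L1_loc_lim_def)

lemma L1_loc_lim_add:
  assumes "L1_loc_lim F f" "L1_loc_lim G g"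
  shows "L1_loc_lim (\<lambda>n x. F n x + G n x) (\<lambda>x. f x + g x)"
  unfolding L1_loc_lim_def
proof (intro conjI allI)
  note l = L1_loc_limD[OF assms(1)] L1_loc_limD[OF assms(2)]
  show "loc_L1 (\<lambda>x. F n x + G n x)" "loc_L1 (\<lambda>x. f x + g x)" for n using l by (auto intro: loc_L1_add)
  fix R
  let ?a = "\<lambda>n x. indb R x * norm (F n x - f x)" and ?b = "\<lambda>n x. indb R x * norm (G n x - g x)"
  have i: "integrable lborel (?a n)" "integrable lborel (?b n)" for n
    using l by (auto intro!: loc_L1_indb_norm loc_L1_diff)
  have 0: "(\<lambda>n. (LBINT x. ?a n x) + (LBINT x. ?b n x)) \<longlonglongrightarrow> 0"
    using assms tendsto_add[of "\<lambda>n. LBINT x. ?a n x" 0 sequentially "\<lambda>n. LBINT x. ?b n x" 0]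
    unfolding L1_loc_lim_def by auto
  show "(\<lambda>n. LBINT x. indb R x * norm (F n x + G n x - (f x + g x))) \<longlonglongrightarrow> 0"
  proof (rule tendsto_sandwich[OF _ _ tendsto_const 0])
    show "\<forall>\<^sub>F n in sequentially. (LBINT x. indb R x * norm (F n x + G n x - (f x + g x)))
        \<le> (LBINT x. ?a n x) + (LBINT x. ?b n x)"
    proof (rule always_eventually, rule allI)
      fix n
      have "(LBINT x. indb R x * norm (F n x + G n x - (f x + g x))) \<le> (LBINT x. ?a n x + ?b n x)"
        using i by (intro integral_mono loc_L1_indb_norm loc_L1_diff loc_L1_add l)
           (auto simp: indicator_def intro!: norm_diff_triangle_ineq)
      then show "(LBINT x. indb R x * norm (F n x + G n x - (f x + g x)))
        \<le> (LBINT x. ?a n x) + (LBINT x. ?b n x)" using i by simp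
    qed
    show "\<forall>\<^sub>F n in sequentially. 0 \<le> (LBINT x. indb R x * norm (F n x + G n x - (f x + g x)))"
      by (rule always_eventually, rule allI, rule integral_nonneg_AE) auto
  qed
qed

lemma L1_loc_lim_norm:
  assumes "L1_loc_lim F f"
  shows "L1_loc_lim (\<lambda>n x. norm (F n x)) (\<lambda>x. norm (f x))"
  unfolding L1_loc_lim_def
proof (intro conjI allI)
  note l = L1_loc_limD[OF assms]
  show "loc_L1 (\<lambda>x. norm (F n x))" "loc_L1 (\<lambda>x. norm (f x))" for n using l by (auto intro: loc_L1_norm)
  fix R
  have 0: "(\<lambda>n. LBINT x. indb R x * norm (F n x - f x)) \<longlonglongrightarrow> 0" using assms by (simp add: L1_loc_lim_def)
  show "(\<lambda>n. LBINT x. indb R x * norm (norm (F n x) - norm (f x))) \<longlonglongrightarrow> 0"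
  proof (rule tendsto_sandwich[OF _ _ tendsto_const 0])
    show "\<forall>\<^sub>F n in sequentially. (LBINT x. indb R x * norm (norm (F n x) - norm (f x)))
        \<le> (LBINT x. indb R x * norm (F n x - f x))"
      by (rule always_eventually, rule allI, intro integral_mono loc_L1_indb_norm loc_L1_diff loc_L1_norm l)
         (auto simp: indicator_def norm_triangle_ineq3)
    show "\<forall>\<^sub>F n in sequentially. 0 \<le> (LBINT x. indb R x * norm (norm (F n x) - norm (f x)))"
      by (rule always_eventually, rule allI, rule integral_nonneg_AE) auto
  qed
qed

lemma L1_loc_lim_scaleR:
  assumes "L1_loc_lim F f"
  shows "L1_loc_lim (\<lambda>n x. c *\<^sub>R F n x) (\<lambda>x. c *\<^sub>R f x)"
  unfolding L1_loc_lim_def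
proof (intro conjI allI)
  note l = L1_loc_limD[OF assms]
  show "loc_L1 (\<lambda>x. c *\<^sub>R F n x)" "loc_L1 (\<lambda>x. c *\<^sub>R f x)" for n using l by (auto intro: loc_L1_scaleR)
  fix R
  have "(\<lambda>n. \<bar>c\<bar> * (LBINT x. indb R x * norm (F n x - f x))) \<longlonglongrightarrow> \<bar>c\<bar> * 0"
    using assms unfolding L1_loc_lim_def by (intro tendsto_intros) auto
  moreover have "(LBINT x. indb R x * norm (c *\<^sub>R F n x - c *\<^sub>R f x)) = \<bar>c\<bar> * (LBINT x. indb R x * norm (F n x - f x))" for n
    by (subst integral_mult_right_zero[symmetric], rule Bochner_Integration.integral_cong)
       (simp_all flip: scaleR_diff_right)
  ultimately show "(\<lambda>n. LBINT x. indb R x * norm (c *\<^sub>R F n x - c *\<^sub>R f x)) \<longlonglongrightarrow> 0" by simp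
qed

text \<open>A bounded factor converging in measure against a factor converging locally in
  \<open>L^1\<close>: a constant multiple of \<open>norm (G n x)\<close> is a convergent majorant of
  the product.\<close>

lemma L1_loc_lim_bilinear:
  fixes pr :: "'b::{banach, second_countable_topology} \<Rightarrow> 'c::{banach, second_countable_topology} \<Rightarrow> 'd::{banach, second_countable_topology}"
  assumes pr: "bounded_bilinear pr" and P: "AE_subseq_lim \<Phi> \<phi>" "\<And>n. \<Phi> n \<in> borel_measurable borel" "\<phi> \<in> borel_measurable borel"
    and bd: "\<And>n x. norm (\<Phi> n x) \<le> M" "\<And>x. norm (\<phi> x) \<le> M" and G: "L1_loc_lim G g"
  shows "L1_loc_lim (\<lambda>n x. pr (\<Phi> n x) (G n x)) (\<lambda>x. pr (\<phi> x) (g x))"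
proof -
  interpret bounded_bilinear pr by fact
  obtain K where K: "K > 0" "\<And>a b. norm (pr a b) \<le> norm a * norm b * K" using pos_bounded by blast
  have le: "norm (pr a b) \<le> (M * K) * norm b" if "norm a \<le> M" for a b
  proof -
    have "norm a * norm b * K \<le> M * norm b * K" using that K(1) by (intro mult_right_mono) auto
    with K(2)[of a b] show ?thesis by (simp add: mult_ac)
  qed
  have c: "isCont (\<lambda>p. pr (fst p) (snd p)) q" for q
    by (intro bounded_bilinear.continuous[OF pr] continuous_intros)
  have cU: "continuous_on UNIV (\<lambda>p. pr (fst p) (snd p))" using c by (simp add: continuous_at_imp_continuous_on)
  have mm: "(\<lambda>x. pr (A x) (B x)) \<in> borel_measurable borel"
    if "A \<in> borel_measurable borel" "B \<in> borel_measurable borel" for A and B :: "'a \<Rightarrow> _"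
    using borel_measurable_continuous_Pair[OF that cU] by simp
  note l = L1_loc_limD[OF G]
  show ?thesis
  proof (rule L1_loc_lim_dominated)
    show "AE_subseq_lim (\<lambda>n x. pr (\<Phi> n x) (G n x)) (\<lambda>x. pr (\<phi> x) (g x))"
      by (rule AE_subseq_lim_compose2[where h=pr, OF P(1) L1_loc_lim_AE_subseq_lim[OF G] c])
    show "L1_loc_lim (\<lambda>n x. (M * K) *\<^sub>R norm (G n x)) (\<lambda>x. (M * K) *\<^sub>R norm (g x))"
      by (intro L1_loc_lim_scaleR L1_loc_lim_norm G)
    show "loc_L1 (\<lambda>x. pr (\<phi> x) (g x))"
      by (rule loc_L1I_bound[OF l(2), where M="M * K"]) (use l[THEN loc_L1_measurable] P bd le in \<open>auto intro!: mm\<close>)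
  qed (use l[THEN loc_L1_measurable] P bd le in \<open>auto intro!: mm\<close>)
qed

lemmas L1_loc_lim_mult = L1_loc_lim_bilinear[OF bounded_bilinear_scaleR]
  and L1_loc_lim_inner = L1_loc_lim_bilinear[OF bounded_bilinear_inner]

lemma integral_indb:
  assumes "\<And>x. R < norm x \<Longrightarrow> f x = 0"
  shows "(LBINT x. f x) = (LBINT x. indb R x *\<^sub>R f x)"
  using assms by (intro Bochner_Integration.integral_cong) (auto simp: indicator_def not_le)

lemma L1_loc_lim_integral:
  fixes Y :: "nat \<Rightarrow> 'a::euclidean_space \<Rightarrow> 'b::{banach, second_countable_topology}"
  assumes Y: "L1_loc_lim Y y" and 0: "\<And>n x. R < norm x \<Longrightarrow> Y n x = 0" "\<And>x. R < norm x \<Longrightarrow> y x = 0"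
  shows "(\<lambda>n. LBINT x. Y n x) \<longlonglongrightarrow> (LBINT x. y x)"
proof -
  note l = L1_loc_limD[OF Y]
  have "(\<lambda>n. (LBINT x. Y n x) - (LBINT x. y x)) \<longlonglongrightarrow> 0"
  proof (rule Lim_null_comparison)
    show "(\<lambda>n. LBINT x. indb R x * norm (Y n x - y x)) \<longlonglongrightarrow> 0" using Y by (simp add: L1_loc_lim_def)
    show "\<forall>\<^sub>F n in sequentially. norm ((LBINT x. Y n x) - (LBINT x. y x)) \<le> (LBINT x. indb R x * norm (Y n x - y x))"
    proof (rule always_eventually, rule allI)
      fix n
      have "(LBINT x. Y n x) - (LBINT x. y x) = (LBINT x. indb R x *\<^sub>R (Y n x - y x))"
        using integral_indb[of R "Y n"] integral_indb[of R y] 0 loc_L1_indb[OF l(1), of R n] loc_L1_indb[OF l(2), of R]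
        by (simp add: scaleR_diff_right)
      also have "norm \<dots> \<le> (LBINT x. norm (indb R x *\<^sub>R (Y n x - y x)))" by (rule integral_norm_bound)
      finally show "norm ((LBINT x. Y n x) - (LBINT x. y x)) \<le> (LBINT x. indb R x * norm (Y n x - y x))" by simp
    qed
  qed
  then show ?thesis by (simp add: LIM_zero_iff)
qed

text \<open>Jensen's inequality provides the mollification of \<open>|f|^2\<close> as a convergent
  majorant.\<close>

lemma moll_square_L1_loc_lim:
  assumes f: "loc_L1 f" and f2: "loc_L1 (\<lambda>x. (norm (f x))\<^sup>2)"
  shows "L1_loc_lim (\<lambda>n x. (norm (moll n f x))\<^sup>2) (\<lambda>x. (norm (f x))\<^sup>2)"
proof (rule L1_loc_lim_dominated[OF _ _ f2 _ moll_L1_loc_lim[OF f2]])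
  show "AE_subseq_lim (\<lambda>n x. (norm (moll n f x))\<^sup>2) (\<lambda>x. (norm (f x))\<^sup>2)"
    by (rule AE_subseq_lim_compose[OF L1_loc_lim_AE_subseq_lim[OF moll_L1_loc_lim[OF f]]]) (intro continuous_intros)
  show "(\<lambda>x. (norm (moll n f x))\<^sup>2) \<in> borel_measurable borel" for n
    using loc_L1_measurable[OF moll_loc_L1[OF f, of n]] by simp
qed (use moll_norm_square_le[OF f f2] in simp)

text \<open>Local convergence in \<open>L^2\<close> is expressed through convergence of the
  functions and of their squared norms; Young's inequality turns the latter into a convergent
  majorant for the product.\<close>

lemma L1_loc_lim_square_bilinear:
  fixes pr :: "'b::{banach, second_countable_topology} \<Rightarrow> 'c::{banach, second_countable_topology} \<Rightarrow> 'd::{banach, second_countable_topology}"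
  assumes pr: "bounded_bilinear pr" and F: "L1_loc_lim F f" "L1_loc_lim (\<lambda>n x. (norm (F n x))\<^sup>2) (\<lambda>x. (norm (f x))\<^sup>2)"
    and G: "L1_loc_lim G g" "L1_loc_lim (\<lambda>n x. (norm (G n x))\<^sup>2) (\<lambda>x. (norm (g x))\<^sup>2)"
  shows "L1_loc_lim (\<lambda>n x. pr (F n x) (G n x)) (\<lambda>x. pr (f x) (g x))"
proof -
  interpret bounded_bilinear pr by fact
  obtain K where K: "K > 0" "\<And>a b. norm (pr a b) \<le> norm a * norm b * K" using pos_bounded by blast
  have le: "norm (pr a b) \<le> K * ((norm a)\<^sup>2 + (norm b)\<^sup>2)" for a b
  proof -
    have "norm a * norm b \<le> (norm a)\<^sup>2 + (norm b)\<^sup>2"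
      using zero_le_power2[of "norm a - norm b"] mult_nonneg_nonneg[OF norm_ge_zero[of a] norm_ge_zero[of b]]
      unfolding power2_diff by linarith
    then have "norm a * norm b * K \<le> ((norm a)\<^sup>2 + (norm b)\<^sup>2) * K" using K(1) by (intro mult_right_mono) auto
    with K(2)[of a b] show ?thesis by (simp add: mult.commute)
  qed
  have c: "isCont (\<lambda>p. pr (fst p) (snd p)) q" for q
    by (intro bounded_bilinear.continuous[OF pr] continuous_intros)
  have cU: "continuous_on UNIV (\<lambda>p. pr (fst p) (snd p))" using c by (simp add: continuous_at_imp_continuous_on)
  have mm: "(\<lambda>x. pr (A x) (B x)) \<in> borel_measurable borel"
    if "A \<in> borel_measurable borel" "B \<in> borel_measurable borel" for A and B :: "'a \<Rightarrow> _"
    using borel_measurable_continuous_Pair[OF that cU] by simp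
  note l = L1_loc_limD[OF F(1)] L1_loc_limD[OF G(1)] L1_loc_limD[OF F(2)] L1_loc_limD[OF G(2)]
  show ?thesis
  proof (rule L1_loc_lim_dominated)
    show "AE_subseq_lim (\<lambda>n x. pr (F n x) (G n x)) (\<lambda>x. pr (f x) (g x))"
      by (rule AE_subseq_lim_compose2[where h=pr, OF L1_loc_lim_AE_subseq_lim[OF F(1)] L1_loc_lim_AE_subseq_lim[OF G(1)] c])
    show "L1_loc_lim (\<lambda>n x. K *\<^sub>R ((norm (F n x))\<^sup>2 + (norm (G n x))\<^sup>2)) (\<lambda>x. K *\<^sub>R ((norm (f x))\<^sup>2 + (norm (g x))\<^sup>2))"
      by (intro L1_loc_lim_scaleR L1_loc_lim_add F G)
    have "loc_L1 (\<lambda>x. (norm (f x))\<^sup>2 + (norm (g x))\<^sup>2)" using l by (intro loc_L1_add)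
    then show "loc_L1 (\<lambda>x. pr (f x) (g x))"
      by (rule loc_L1I_bound[where M=K]) (use l[THEN loc_L1_measurable] le in \<open>auto intro!: mm\<close>)
  qed (use l[THEN loc_L1_measurable] le in \<open>auto intro!: mm\<close>)
qed

section \<open>Weak derivatives\<close>

text \<open>Fubini and the evenness of the kernel. The bounded support of \<open>\<psi>\<close>
  makes the double integral absolutely convergent although \<open>f\<close> is only locally
  integrable.\<close>

lemma moll_adjoint:
  fixes f :: "real ^ 'n \<Rightarrow> 'b::euclidean_space"
  assumes f: "loc_L1 f" and c: "continuous_on UNIV \<psi>" and 0: "\<And>x. R < norm x \<Longrightarrow> \<psi> x = 0"
  shows "(LBINT x. moll n f x \<bullet> \<psi> x) = (LBINT y. f y \<bullet> moll n \<psi> y)"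
proof -
  obtain M where M: "M > 0" "\<And>x. norm (\<psi> x) \<le> M" using continuous_compact_support_bounded[OF c 0] by metis
  have l: "loc_L1 \<psi>" using continuous_loc_L1[OF c] .
  have [measurable]: "f \<in> borel_measurable borel" "\<psi> \<in> borel_measurable borel"
    using f l loc_L1_measurable by auto
  have sec: "integrable lborel (\<lambda>y. rho n (x - y) * (f y \<bullet> \<psi> x))" for x
    using integrable_inner_left[OF moll_integrable[OF f, of n x], of "\<psi> x"] by simp
  have int: "integrable (lborel \<Otimes>\<^sub>M lborel) (\<lambda>(x, y). rho n (x - y) * (f y \<bullet> \<psi> x))"
  proof (rule lborel_pair.Fubini_integrable)
    show "(\<lambda>(x, y). rho n (x - y) * (f y \<bullet> \<psi> x)) \<in> borel_measurable (lborel \<Otimes>\<^sub>M lborel)"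
      by measurable
    show "AE x in lborel. integrable lborel (\<lambda>y. case (x, y) of (x, y) \<Rightarrow> rho n (x - y) * (f y \<bullet> \<psi> x))"
      using sec by simp
    have b: "(LBINT y. norm (rho n (x - y) * (f y \<bullet> \<psi> x))) \<le> M * moll n (\<lambda>y. norm (f y)) x" for x
    proof -
      have "(LBINT y. norm (rho n (x - y) * (f y \<bullet> \<psi> x))) \<le> (LBINT y. M * (rho n (x - y) *\<^sub>R norm (f y)))"
      proof (rule integral_mono)
        fix y
        have "\<bar>f y \<bullet> \<psi> x\<bar> \<le> norm (f y) * M"
          by (rule order_trans[OF Cauchy_Schwarz_ineq2]) (simp add: M mult_left_mono)
        from mult_left_mono[OF this rho_nonneg[of n "x - y"]]
        show "norm (rho n (x - y) * (f y \<bullet> \<psi> x)) \<le> M * (rho n (x - y) *\<^sub>R norm (f y))"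
          by (simp add: abs_mult mult_ac)
      qed (use sec moll_integrable[OF loc_L1_norm[OF f], of n x] in auto)
      also have "\<dots> = M * moll n (\<lambda>y. norm (f y)) x" by (simp add: moll_def)
      finally show ?thesis .
    qed
    show "integrable lborel (\<lambda>x. LBINT y. norm (case (x, y) of (x, y) \<Rightarrow> rho n (x - y) * (f y \<bullet> \<psi> x)))"
    proof (rule loc_L1_integrable_bound[OF moll_loc_L1[OF loc_L1_norm[OF f], of n], where R=R and M=M])
      show "(\<lambda>x. LBINT y. norm (case (x, y) of (x, y) \<Rightarrow> rho n (x - y) * (f y \<bullet> \<psi> x))) \<in> borel_measurable borel"
        by measurable
      fix x
      have "0 \<le> (LBINT y. norm (rho n (x - y) * (f y \<bullet> \<psi> x)))" by (rule integral_nonneg_AE) auto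
      moreover have "M * moll n (\<lambda>y. norm (f y)) x \<le> M * \<bar>moll n (\<lambda>y. norm (f y)) x\<bar>" using M(1) by simp
      ultimately show "norm (LBINT y. norm (case (x, y) of (x, y) \<Rightarrow> rho n (x - y) * (f y \<bullet> \<psi> x)))
          \<le> M * norm (moll n (\<lambda>y. norm (f y)) x)"
        using b[of x] by simp
    qed (simp add: 0)
  qed
  have "(LBINT x. moll n f x \<bullet> \<psi> x) = (LBINT x. LBINT y. rho n (x - y) * (f y \<bullet> \<psi> x))"
    unfolding moll_def using moll_integrable[OF f, of n] by (simp flip: integral_inner_left)
  also have "\<dots> = (LBINT y. LBINT x. rho n (x - y) * (f y \<bullet> \<psi> x))"
    by (rule lborel_pair.Fubini_integral[OF int, symmetric])
  also have "\<dots> = (LBINT y. f y \<bullet> moll n \<psi> y)"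
  proof (rule Bochner_Integration.integral_cong[OF refl])
    fix y
    have "(LBINT x. rho n (x - y) * (f y \<bullet> \<psi> x)) = (LBINT x. f y \<bullet> (rho n (y - x) *\<^sub>R \<psi> x))"
      by (simp add: rho_diff_commute[of n y])
    also have "\<dots> = f y \<bullet> moll n \<psi> y"
      unfolding moll_def by (rule integral_inner_right) (rule moll_integrable[OF l])
    finally show "(LBINT x. rho n (x - y) * (f y \<bullet> \<psi> x)) = f y \<bullet> moll n \<psi> y" .
  qed
  finally show ?thesis .
qed

text \<open>Sign convention: \<open>- div G = k\<close>.\<close>
definition weak_divergence :: "(real ^ 'n \<Rightarrow> real ^ 'n) \<Rightarrow> (real ^ 'n \<Rightarrow> real) \<Rightarrow> bool" where
  "weak_divergence G k \<longleftrightarrow> loc_L1 G \<and> loc_L1 k \<and>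
     (\<forall>\<phi> \<psi>. C1c \<phi> \<psi> \<longrightarrow> (LBINT x. G x \<bullet> \<psi> x) = (LBINT x. k x * \<phi> x))"

text \<open>The counterpart of \<open>has_weak_gradient\<close> for Borel functions, with the larger
  class \<open>C1c\<close> of test functions and one vector-valued identity in place of one scalar
  identity per coordinate.\<close>

definition weak_gradient :: "(real ^ 'n \<Rightarrow> real) \<Rightarrow> (real ^ 'n \<Rightarrow> real ^ 'n) \<Rightarrow> bool" where
  "weak_gradient u g \<longleftrightarrow> loc_L1 u \<and> loc_L1 g \<and>
     (\<forall>\<phi> \<psi>. C1c \<phi> \<psi> \<longrightarrow> (LBINT x. u x *\<^sub>R \<psi> x) = - (LBINT x. \<phi> x *\<^sub>R g x))"

lemma L1_loc_lim_C1c: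
  assumes "L1_loc_lim G g" "C1c \<phi> \<psi>"
  shows "(\<lambda>n. LBINT x. \<psi> x \<bullet> G n x) \<longlonglongrightarrow> (LBINT x. \<psi> x \<bullet> g x)"
proof -
  obtain R M where R: "\<And>x. R < norm x \<Longrightarrow> \<psi> x = 0" "\<And>x. norm (\<psi> x) \<le> M" "continuous_on UNIV \<psi>"
    using C1c_E[OF assms(2)] by metis
  then have [measurable]: "\<psi> \<in> borel_measurable borel" by (auto intro: borel_measurable_continuous_onI)
  have "L1_loc_lim (\<lambda>n x. \<psi> x \<bullet> G n x) (\<lambda>x. \<psi> x \<bullet> g x)"
    by (rule L1_loc_lim_inner[OF AE_subseq_lim_const, of _ M]) (use R assms in auto)
  then show ?thesis by (rule L1_loc_lim_integral[where R=R]) (use R in auto)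
qed

lemma L1_loc_lim_C1c_scaleR:
  assumes "L1_loc_lim G g" "C1c \<phi> \<psi>"
  shows "(\<lambda>n. LBINT x. \<phi> x *\<^sub>R G n x) \<longlonglongrightarrow> (LBINT x. \<phi> x *\<^sub>R g x)"
proof -
  obtain R M where R: "\<And>x. R < norm x \<Longrightarrow> \<phi> x = 0" "\<And>x. \<bar>\<phi> x\<bar> \<le> M" "continuous_on UNIV \<phi>"
    using C1c_E[OF assms(2)] by metis
  then have [measurable]: "\<phi> \<in> borel_measurable borel" by (auto intro: borel_measurable_continuous_onI)
  have "L1_loc_lim (\<lambda>n x. \<phi> x *\<^sub>R G n x) (\<lambda>x. \<phi> x *\<^sub>R g x)"
    by (rule L1_loc_lim_mult[OF AE_subseq_lim_const, of _ M]) (use R assms in auto)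
  then show ?thesis by (rule L1_loc_lim_integral[where R=R]) (use R in auto)
qed

lemma L1_loc_lim_scaleR_C1c:
  assumes "L1_loc_lim G g" "C1c \<phi> \<psi>"
  shows "(\<lambda>n. LBINT x. G n x *\<^sub>R \<psi> x) \<longlonglongrightarrow> (LBINT x. g x *\<^sub>R \<psi> x)"
proof -
  obtain R M where R: "\<And>x. R < norm x \<Longrightarrow> \<psi> x = 0" "\<And>x. norm (\<psi> x) \<le> M" "continuous_on UNIV \<psi>"
    using C1c_E[OF assms(2)] by metis
  then have [measurable]: "\<psi> \<in> borel_measurable borel" by (auto intro: borel_measurable_continuous_onI)
  have "L1_loc_lim (\<lambda>n x. G n x *\<^sub>R \<psi> x) (\<lambda>x. g x *\<^sub>R \<psi> x)"
    by (rule L1_loc_lim_bilinear[OF bounded_bilinear.flip[OF bounded_bilinear_scaleR] AE_subseq_lim_const, of _ M]) (use R assms in auto)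
  then show ?thesis by (rule L1_loc_lim_integral[where R=R]) (use R in auto)
qed

text \<open>Enlarges the class of test functions: a \<open>C1c\<close> function is mollified, the
  mollifier is shifted onto \<open>G\<close> and \<open>k\<close> by \<open>moll_adjoint\<close>,
  and there it converges locally in the mean.\<close>

lemma weak_divergence_of_test_functions:
  fixes G :: "real ^ 'n \<Rightarrow> real ^ 'n"
  assumes G: "loc_L1 G" and k: "loc_L1 k"
    and eq: "\<And>\<phi>. \<phi> \<in> test_functions \<Longrightarrow> (LBINT x. G x \<bullet> grad \<phi> x) = (LBINT x. k x * \<phi> x)"
  shows "weak_divergence G k"
  unfolding weak_divergence_def
proof (intro conjI allI impI)
  fix \<phi> :: "real^'n \<Rightarrow> real" and \<psi> assume C: "C1c \<phi> \<psi>"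
  obtain R where R: "\<And>x. R < norm x \<Longrightarrow> \<phi> x = 0" "\<And>x. R < norm x \<Longrightarrow> \<psi> x = 0"
    "continuous_on UNIV \<phi>" "continuous_on UNIV \<psi>" using C1c_E[OF C] by metis
  have "grad (moll n \<phi>) = moll n \<psi>" for n using moll_C1c(3)[OF C] by auto
  then have e: "(LBINT x. G x \<bullet> moll n \<psi> x) = (LBINT x. k x \<bullet> moll n \<phi> x)" for n
    using eq[OF moll_C1c(1)[OF C, of n]] by simp
  have "(\<lambda>n. LBINT x. G x \<bullet> moll n \<psi> x) \<longlonglongrightarrow> (LBINT x. G x \<bullet> \<psi> x)"
  proof -
    have adj: "(LBINT x. G x \<bullet> moll n \<psi> x) = (LBINT x. \<psi> x \<bullet> moll n G x)" for n
      using moll_adjoint[OF G R(4,2), where n=n] by (simp add: inner_commute)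
    show ?thesis unfolding adj using L1_loc_lim_C1c[OF moll_L1_loc_lim[OF G] C] by (simp add: inner_commute)
  qed
  moreover have "(\<lambda>n. LBINT x. k x \<bullet> moll n \<phi> x) \<longlonglongrightarrow> (LBINT x. k x * \<phi> x)"
    using L1_loc_lim_C1c_scaleR[OF moll_L1_loc_lim[OF k] C] moll_adjoint[OF k R(3,1), symmetric] by (simp add: mult.commute)
  ultimately show "(LBINT x. G x \<bullet> \<psi> x) = (LBINT x. k x * \<phi> x)"
    unfolding e using LIMSEQ_unique by blast
qed fact+

lemma weak_divergence_moll:
  assumes "weak_divergence G k" "C1c \<phi> \<psi>"
  shows "(LBINT x. moll n G x \<bullet> \<psi> x) = (LBINT x. moll n k x * \<phi> x)"
proof -
  obtain R where R: "\<And>x. R < norm x \<Longrightarrow> \<phi> x = 0" "\<And>x. R < norm x \<Longrightarrow> \<psi> x = 0"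
    "continuous_on UNIV \<phi>" "continuous_on UNIV \<psi>" using C1c_E[OF assms(2)] by metis
  have l: "loc_L1 G" "loc_L1 k" using assms(1) by (auto simp: weak_divergence_def)
  have "(LBINT x. G x \<bullet> moll n \<psi> x) = (LBINT x. k x * moll n \<phi> x)"
    using assms(1) moll_C1c(2)[OF assms(2), of n] by (simp add: weak_divergence_def)
  then show ?thesis
    using moll_adjoint[OF l(1) R(4,2), where n=n] moll_adjoint[OF l(2) R(3,1), where n=n] by simp
qed

lemma borel_measurable_vec_nth [measurable (raw)]:
  fixes f :: "'a \<Rightarrow> real ^ 'n"
  assumes "f \<in> borel_measurable M"
  shows "(\<lambda>x. f x $ i) \<in> borel_measurable M"
  by (rule borel_measurable_continuous_on[OF _ assms]) (intro continuous_intros)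

lemma weak_gradient_of_test_functions:
  fixes g :: "real ^ 'n \<Rightarrow> real ^ 'n"
  assumes u: "loc_L1 u" and g: "loc_L1 g"
    and eq: "\<And>\<phi> i. \<phi> \<in> test_functions \<Longrightarrow> (LBINT x. u x * grad \<phi> x $ i) = - (LBINT x. g x $ i * \<phi> x)"
  shows "weak_gradient u g"
  unfolding weak_gradient_def
proof (intro conjI allI impI)
  fix \<phi> :: "real^'n \<Rightarrow> real" and \<psi> assume C: "C1c \<phi> \<psi>"
  obtain R M where R: "\<And>x. R < norm x \<Longrightarrow> \<phi> x = 0" "\<And>x. R < norm x \<Longrightarrow> \<psi> x = 0"
    "\<And>x. \<bar>\<phi> x\<bar> \<le> M" "\<And>x. norm (\<psi> x) \<le> M"
    "continuous_on UNIV \<phi>" "continuous_on UNIV \<psi>" using C1c_E[OF C] by metis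
  then have [measurable]: "\<phi> \<in> borel_measurable borel" "\<psi> \<in> borel_measurable borel" "u \<in> borel_measurable borel" "g \<in> borel_measurable borel"
    using u g by (auto intro: borel_measurable_continuous_onI loc_L1_measurable)
  have i1: "integrable lborel (\<lambda>x. u x *\<^sub>R \<psi> x)"
    by (rule loc_L1_integrable_bound[OF u, where R=R and M=M])
       (use R in \<open>auto simp: mult.commute[of M] intro!: mult_left_mono\<close>)
  have i2: "integrable lborel (\<lambda>x. \<phi> x *\<^sub>R g x)"
    by (rule loc_L1_integrable_bound[OF g, where R=R and M=M]) (use R in \<open>auto intro!: mult_right_mono\<close>)
  show "(LBINT x. u x *\<^sub>R \<psi> x) = - (LBINT x. \<phi> x *\<^sub>R g x)"
    unfolding vec_eq_iff
  proof
    fix i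
    \<comment> \<open>The i-th partial derivative of \<open>u\<close> is the divergence of
      \<open>u\<close> times the i-th unit vector, so the enlargement already proved for divergences
      applies.\<close>
    have "weak_divergence (\<lambda>x. u x *\<^sub>R axis i 1) (\<lambda>x. - g x $ i)"
    proof (rule weak_divergence_of_test_functions)
      show "loc_L1 (\<lambda>x. u x *\<^sub>R (axis i 1 :: real^'n))"
        by (rule loc_L1I_bound[OF u, where M=1]) (auto simp: norm_eq_sqrt_inner inner_axis_axis)
      show "loc_L1 (\<lambda>x. - g x $ i)"
        by (rule loc_L1I_bound[OF g, where M=1]) (auto simp: component_le_norm_cart intro!: borel_measurable_vec_nth)
    qed (use eq[of _ i] in \<open>simp add: inner_axis' \<close>)
    then have "(LBINT x. u x * \<psi> x $ i) = - (LBINT x. \<phi> x * g x $ i)"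
      using C by (simp add: weak_divergence_def inner_axis' mult.commute)
    then show "(LBINT x. u x *\<^sub>R \<psi> x) $ i = (- (LBINT x. \<phi> x *\<^sub>R g x)) $ i"
      using integral_bounded_linear[OF bounded_linear_vec_nth i1, of i] integral_bounded_linear[OF bounded_linear_vec_nth i2, of i]
      by simp
  qed
qed fact+

text \<open>The reflected and translated kernel \<open>rho n (x - y)\<close>, as a function of y, is
  itself an admissible test function.\<close>

lemma weak_gradient_moll:
  assumes "weak_gradient u g"
  shows "GDERIV (moll n u) x :> moll n g x"
proof -
  have l: "loc_L1 u" "loc_L1 g" using assms by (auto simp: weak_gradient_def)
  have C: "C1c (\<lambda>y. rho n ((-1) *\<^sub>R y + x)) (\<lambda>y. (-1) *\<^sub>R grad (rho n) ((-1) *\<^sub>R y + x))"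
    by (rule C1c_affine[OF rho_C1c]) simp
  have "(LBINT y. u y *\<^sub>R grad (rho n) (x - y)) = (LBINT y. rho n (x - y) *\<^sub>R g y)"
    using assms C unfolding weak_gradient_def by fastforce
  then show ?thesis
    using GDERIV_convolution[OF rho_C1c l(1), of n x] by (simp add: moll_def[abs_def])
qed

text \<open>Integration by parts: it amounts to the vanishing of the integral of the gradient of the
  compactly supported product of \<open>f\<close> and \<open>\<phi>\<close>.\<close>

lemma weak_gradient_C1:
  fixes g :: "real ^ 'n \<Rightarrow> real ^ 'n"
  assumes f: "\<And>x. GDERIV f x :> g x" and c: "continuous_on UNIV g"
  shows "weak_gradient f g"
  unfolding weak_gradient_def
proof (intro conjI allI impI)
  have cf: "continuous_on UNIV f" using GDERIV_continuous_on f by blast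
  show lf: "loc_L1 f" and lg: "loc_L1 g" using cf c continuous_loc_L1 by auto
  fix \<phi> :: "real^'n \<Rightarrow> real" and \<psi> assume C: "C1c \<phi> \<psi>"
  obtain R M where R: "\<And>x. R < norm x \<Longrightarrow> \<phi> x = 0" "\<And>x. R < norm x \<Longrightarrow> \<psi> x = 0"
    "\<And>x. \<bar>\<phi> x\<bar> \<le> M" "\<And>x. norm (\<psi> x) \<le> M"
    "continuous_on UNIV \<phi>" "continuous_on UNIV \<psi>" using C1c_E[OF C] by metis
  then have [measurable]: "\<phi> \<in> borel_measurable borel" "\<psi> \<in> borel_measurable borel" "f \<in> borel_measurable borel" "g \<in> borel_measurable borel"
    using cf c by (auto intro: borel_measurable_continuous_onI)
  have i1: "integrable lborel (\<lambda>x. f x *\<^sub>R \<psi> x)"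
    by (rule loc_L1_integrable_bound[OF lf, where R=R and M=M])
       (use R in \<open>auto simp: mult.commute[of M] intro!: mult_left_mono\<close>)
  have i2: "integrable lborel (\<lambda>x. \<phi> x *\<^sub>R g x)"
    by (rule loc_L1_integrable_bound[OF lg, where R=R and M=M]) (use R in \<open>auto intro!: mult_right_mono\<close>)
  let ?\<chi> = "\<lambda>x. f x * \<phi> x" and ?\<chi>' = "\<lambda>x. f x *\<^sub>R \<psi> x + \<phi> x *\<^sub>R g x"
  have X: "C1c ?\<chi> ?\<chi>'" by (rule C1c_mult_left[OF C f c])
  have m: "?\<chi> \<in> borel_measurable borel" "?\<chi>' \<in> borel_measurable borel" by auto
  \<comment> \<open>Convolution with the constant 1 is a constant function by translation
    invariance, yet its derivative is the integral of the gradient, which must therefore be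
    0.\<close>
  have "GDERIV (\<lambda>x. LBINT y. ?\<chi> (x - y) * 1) 0 :> (LBINT y. 1 *\<^sub>R ?\<chi>' (0 - y))"
    by (rule GDERIV_convolution[OF X loc_L1_const])
  then have "GDERIV (\<lambda>x. LBINT y. ?\<chi> y) 0 :> (LBINT y. ?\<chi>' y)"
    unfolding mult_1_right scaleR_one integral_lborel_reflect[OF m(1)] integral_lborel_reflect[OF m(2)] .
  then have "(LBINT y. ?\<chi>' y) = 0"
    using GDERIV_unique GDERIV_const by blast
  then show "(LBINT x. f x *\<^sub>R \<psi> x) = - (LBINT x. \<phi> x *\<^sub>R g x)"
    using i1 i2 by (simp add: add_eq_0_iff)
qed

lemma weak_gradient_limit:
  fixes g :: "real ^ 'n \<Rightarrow> real ^ 'n"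
  assumes w: "\<And>n. weak_gradient (U n) (G n)" and U: "L1_loc_lim U u" and G: "L1_loc_lim G g"
  shows "weak_gradient u g"
  unfolding weak_gradient_def
proof (intro conjI allI impI)
  fix \<phi> :: "real^'n \<Rightarrow> real" and \<psi> assume C: "C1c \<phi> \<psi>"
  have "(LBINT x. U n x *\<^sub>R \<psi> x) = - (LBINT x. \<phi> x *\<^sub>R G n x)" for n
    using w C by (simp add: weak_gradient_def)
  then show "(LBINT x. u x *\<^sub>R \<psi> x) = - (LBINT x. \<phi> x *\<^sub>R g x)"
    using L1_loc_lim_scaleR_C1c[OF U C] tendsto_minus[OF L1_loc_lim_C1c_scaleR[OF G C]] LIMSEQ_unique by simp
qed (use L1_loc_limD U G in blast)+

lemma L1_loc_lim_unique_AE: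
  fixes f :: "'a::euclidean_space \<Rightarrow> 'b::{banach, second_countable_topology}"
  assumes "L1_loc_lim F f" "L1_loc_lim F g"
  shows "AE x in lborel. f x = g x"
proof -
  have a: "AE x in lborel. norm x \<le> real m \<longrightarrow> f x = g x" for m
  proof -
    obtain s :: "nat \<Rightarrow> nat" where s: "strict_mono s" "AE x in lborel. norm x \<le> real m \<longrightarrow> (\<lambda>n. F (id (s n)) x) \<longlonglongrightarrow> f x"
      using L1_loc_lim_AE_subseq_lim[OF assms(1)] strict_mono_id unfolding AE_subseq_lim_def by blast
    obtain t :: "nat \<Rightarrow> nat" where t: "strict_mono t" "AE x in lborel. norm x \<le> real m \<longrightarrow> (\<lambda>n. F (s (t n)) x) \<longlonglongrightarrow> g x"
      using L1_loc_lim_AE_subseq_lim[OF assms(2)] s(1) unfolding AE_subseq_lim_def by blast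
    show ?thesis using s(2) t(2)
    proof eventually_elim
      case (elim x)
      then show ?case using LIMSEQ_subseq_LIMSEQ[OF _ t(1), of "\<lambda>n. F (s n) x" "f x"] LIMSEQ_unique
        by (auto simp: o_def)
    qed
  qed
  then have "AE x in lborel. \<forall>m. norm x \<le> real m \<longrightarrow> f x = g x"
    by (subst AE_all_countable) blast
  then show ?thesis by eventually_elim (metis real_arch_simple)
qed

text \<open>Both mollified fields are the classical gradient of the same smooth function
  \<open>moll n u\<close>, so they coincide for every n, and then so do their limits.\<close>

lemma weak_gradient_unique:
  assumes "weak_gradient u g" "weak_gradient u h"
  shows "AE x in lborel. g x = h x"
proof -
  have "moll n g = moll n h" for n
    using GDERIV_unique[OF weak_gradient_moll[OF assms(1)] weak_gradient_moll[OF assms(2)]] by auto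
  then show ?thesis
    using L1_loc_lim_unique_AE[of "\<lambda>n. moll n g" g h] moll_L1_loc_lim[of g] moll_L1_loc_lim[of h] assms by (simp add: weak_gradient_def)
qed

lemma weak_gradient_loc_L1D: "weak_gradient u g \<Longrightarrow> loc_L1 u" "weak_gradient u g \<Longrightarrow> loc_L1 g"
  by (auto simp: weak_gradient_def)

text \<open>The classical chain rule holds for \<open>moll n u\<close>. The bound on
  \<open>F'\<close> makes \<open>F\<close> grow at most linearly, so both sides have majorants that
  converge with the mollifications.\<close>

lemma weak_gradient_chain_bounded:
  assumes w: "weak_gradient u g" and F: "\<And>s. DERIV F s :> F' s" and F'c: "continuous_on UNIV F'" and bd: "\<And>s. \<bar>F' s\<bar> \<le> M"
  shows "weak_gradient (\<lambda>x. F (u x)) (\<lambda>x. F' (u x) *\<^sub>R g x)"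
proof (rule weak_gradient_limit)
  note l = weak_gradient_loc_L1D[OF w]
  have Fc: "isCont F s" for s using F DERIV_isCont by blast
  have F'c': "isCont F' s" for s using F'c by (simp add: continuous_on_eq_continuous_at)
  have [measurable]: "F \<in> borel_measurable borel" "F' \<in> borel_measurable borel" "u \<in> borel_measurable borel" "g \<in> borel_measurable borel"
    "moll n u \<in> borel_measurable borel" for n
    using Fc F'c l[THEN loc_L1_measurable] moll_loc_L1[OF l(1), THEN loc_L1_measurable]
    by (auto intro!: borel_measurable_continuous_onI continuous_at_imp_continuous_on)
  show "weak_gradient (\<lambda>x. F (moll n u x)) (\<lambda>x. F' (moll n u x) *\<^sub>R moll n g x)" for n
  proof (rule weak_gradient_C1)
    show "GDERIV (\<lambda>x. F (moll n u x)) x :> F' (moll n u x) *\<^sub>R moll n g x" for x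
      by (rule GDERIV_DERIV_compose[OF weak_gradient_moll[OF w] F])
    show "continuous_on UNIV (\<lambda>x. F' (moll n u x) *\<^sub>R moll n g x)"
      using l by (intro continuous_intros continuous_on_compose2[OF F'c] moll_continuous) auto
  qed
  have lip: "norm (F s) \<le> \<bar>F 0\<bar> + M * \<bar>s\<bar>" for s
  proof -
    have "norm (F s - F 0) \<le> M * norm (s - 0)"
    proof (rule field_differentiable_bound[of UNIV F F'])
      show "(F has_field_derivative F' z) (at z within UNIV)" for z using F by simp
    qed (use bd in auto)
    then have "\<bar>F s - F 0\<bar> \<le> M * \<bar>s\<bar>" by simp
    then show ?thesis unfolding real_norm_def by linarith
  qed
  show "L1_loc_lim (\<lambda>n x. F (moll n u x)) (\<lambda>x. F (u x))"
  proof (rule L1_loc_lim_dominated)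
    show "AE_subseq_lim (\<lambda>n x. F (moll n u x)) (\<lambda>x. F (u x))"
      by (rule AE_subseq_lim_compose[OF L1_loc_lim_AE_subseq_lim[OF moll_L1_loc_lim[OF l(1)]] Fc])
    show "norm (F (moll n u x)) \<le> \<bar>F 0\<bar> + M *\<^sub>R norm (moll n u x)" for n x using lip by simp
    show "L1_loc_lim (\<lambda>n x. \<bar>F 0\<bar> + M *\<^sub>R norm (moll n u x)) (\<lambda>x. \<bar>F 0\<bar> + M *\<^sub>R norm (u x))"
      by (intro L1_loc_lim_add L1_loc_lim_scaleR L1_loc_lim_norm L1_loc_lim_const loc_L1_const moll_L1_loc_lim l)
    have "loc_L1 (\<lambda>x. \<bar>F 0\<bar> + M *\<^sub>R norm (u x))" by (intro loc_L1_add loc_L1_const loc_L1_scaleR loc_L1_norm l)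
    then show "loc_L1 (\<lambda>x. F (u x))"
    proof (rule loc_L1I_bound[where M=1])
      show "norm (F (u x)) \<le> 1 * norm (\<bar>F 0\<bar> + M *\<^sub>R norm (u x))" for x
        using lip[of "u x"] by simp
    qed auto
  qed auto
  show "L1_loc_lim (\<lambda>n x. F' (moll n u x) *\<^sub>R moll n g x) (\<lambda>x. F' (u x) *\<^sub>R g x)"
    by (rule L1_loc_lim_mult[where M=M])
       (use bd in \<open>auto intro!: AE_subseq_lim_compose[OF L1_loc_lim_AE_subseq_lim[OF moll_L1_loc_lim[OF l(1)]] F'c'] moll_L1_loc_lim l\<close>)
qed

section \<open>Chain rule for nonlinear functions with unbounded derivative\<close>

definition trunc :: "real \<Rightarrow> real \<Rightarrow> real" where
  "trunc e s = s / (1 + (e * s)\<^sup>2)"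

lemma one_plus_square_pos: "0 < 1 + (x::real)\<^sup>2" "1 + (x::real)\<^sup>2 \<noteq> 0"
  by (auto simp: add_pos_nonneg) (smt (verit) zero_le_power2)

lemma trunc_abs_le: "\<bar>trunc e s\<bar> \<le> \<bar>s\<bar>"
  by (simp add: trunc_def abs_div divide_le_eq abs_of_pos one_plus_square_pos)
     (simp add: algebra_simps)

lemma trunc_bounded: "e > 0 \<Longrightarrow> \<bar>trunc e s\<bar> \<le> 1 / e"
proof -
  assume e: "e > 0"
  have "2 * \<bar>e * s\<bar> \<le> 1 + (e * s)\<^sup>2"
    using zero_le_power2[of "\<bar>e * s\<bar> - 1"] by (simp add: power2_diff)
  moreover have "\<bar>e * s\<bar> = e * \<bar>s\<bar>" "0 \<le> e * \<bar>s\<bar>" using e by (auto simp: abs_mult)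
  ultimately have "e * \<bar>s\<bar> \<le> 1 + (e * s)\<^sup>2" by linarith
  then have "\<bar>s\<bar> / (1 + (e * s)\<^sup>2) \<le> 1 / e"
    using e one_plus_square_pos(1)[of "e * s"] by (simp add: pos_divide_le_eq pos_le_divide_eq mult.commute)
  then show ?thesis by (simp add: trunc_def abs_div abs_of_pos one_plus_square_pos)
qed

definition trunc' :: "real \<Rightarrow> real \<Rightarrow> real" where
  "trunc' e s = (1 - (e * s)\<^sup>2) / (1 + (e * s)\<^sup>2)\<^sup>2"

lemma DERIV_trunc: "DERIV (trunc e) s :> trunc' e s"
  unfolding trunc_def trunc'_def using one_plus_square_pos[of "e * s"]
  by (auto intro!: derivative_eq_intros simp: power2_eq_square algebra_simps)

lemma trunc'_bounded: "\<bar>trunc' e s\<bar> \<le> 1"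
proof -
  have "\<bar>1 - (e * s)\<^sup>2\<bar> \<le> 1 + (e * s)\<^sup>2" by (simp add: abs_le_iff)
  also have "\<dots> \<le> (1 + (e * s)\<^sup>2)\<^sup>2" by (rule self_le_power) auto
  finally show ?thesis using one_plus_square_pos[of "e * s"] by (simp add: trunc'_def abs_div)
qed

lemma trunc'_continuous: "continuous_on UNIV (trunc' e)"
  unfolding trunc'_def using one_plus_square_pos by (intro continuous_intros) auto

lemma trunc_tendsto: "(\<lambda>n. trunc (eps n) s) \<longlonglongrightarrow> s"
  and trunc'_tendsto: "(\<lambda>n. trunc' (eps n) s) \<longlonglongrightarrow> 1"
proof -
  have "(\<lambda>n. 1 / real (Suc n) * s) \<longlonglongrightarrow> 0 * s" by (intro tendsto_intros LIMSEQ_Suc lim_1_over_n)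
  then have t: "(\<lambda>n. 1 / real (Suc n) * s) \<longlonglongrightarrow> 0" by simp
  have "(\<lambda>n. trunc (eps n) s) \<longlonglongrightarrow> s / (1 + 0\<^sup>2)"
    unfolding trunc_def by (intro tendsto_intros t) auto
  then show "(\<lambda>n. trunc (eps n) s) \<longlonglongrightarrow> s" by simp
  have "(\<lambda>n. trunc' (eps n) s) \<longlonglongrightarrow> (1 - 0\<^sup>2) / (1 + 0\<^sup>2)\<^sup>2"
    unfolding trunc'_def by (intro tendsto_intros t) auto
  then show "(\<lambda>n. trunc' (eps n) s) \<longlonglongrightarrow> 1" by simp
qed

text \<open>Composing with \<open>trunc e\<close>, which is bounded by \<open>1 / e\<close> and has
  derivative at most 1 in modulus, makes the derivative of the composition bounded. Truncation moves
  values towards 0, which is why \<open>K\<close> and \<open>L\<close> must bound \<open>F'\<close>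
  and \<open>F\<close> at all arguments of smaller modulus: they then give majorants free of
  n.\<close>

lemma weak_gradient_chain:
  assumes w: "weak_gradient u g" and F: "\<And>s. DERIV F s :> F' s" and F'c: "continuous_on UNIV F'"
    and K: "\<And>s t. \<bar>t\<bar> \<le> \<bar>s\<bar> \<Longrightarrow> \<bar>F' t\<bar> \<le> K s" "loc_L1 (\<lambda>x. K (u x) *\<^sub>R g x)" "K \<in> borel_measurable borel"
    and L: "\<And>s t. \<bar>t\<bar> \<le> \<bar>s\<bar> \<Longrightarrow> \<bar>F t\<bar> \<le> L s" "loc_L1 (\<lambda>x. L (u x))"
  shows "weak_gradient (\<lambda>x. F (u x)) (\<lambda>x. F' (u x) *\<^sub>R g x)"
proof (rule weak_gradient_limit)
  note l = weak_gradient_loc_L1D[OF w]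
  define T where "T n = trunc (eps n)" for n
  define T' where "T' n = trunc' (eps n)" for n
  have Fc: "isCont F s" for s using F DERIV_isCont by blast
  have F'c': "isCont F' s" for s using F'c by (simp add: continuous_on_eq_continuous_at)
  have Tc: "continuous_on UNIV (T n)" for n unfolding T_def by (rule DERIV_continuous_on) (use DERIV_trunc in auto)
  have T'c: "continuous_on UNIV (T' n)" for n unfolding T'_def by (rule trunc'_continuous)
  have Tle: "\<bar>T n s\<bar> \<le> \<bar>s\<bar>" for n s unfolding T_def by (rule trunc_abs_le)
  have T'le: "\<bar>T' n s\<bar> \<le> 1" for n s unfolding T'_def by (rule trunc'_bounded)
  have [measurable]: "F \<in> borel_measurable borel" "F' \<in> borel_measurable borel" "u \<in> borel_measurable borel" "g \<in> borel_measurable borel"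
    "T n \<in> borel_measurable borel" "T' n \<in> borel_measurable borel" "K \<in> borel_measurable borel" for n
    using Fc l[THEN loc_L1_measurable] K(3) borel_measurable_continuous_onI[OF F'c]
      borel_measurable_continuous_onI[OF Tc] borel_measurable_continuous_onI[OF T'c]
    by (auto intro!: borel_measurable_continuous_onI continuous_at_imp_continuous_on)
  have c2: "continuous_on UNIV (\<lambda>s. F' (T n s) * T' n s)" for n
    using Tc T'c by (intro continuous_intros continuous_on_compose2[OF F'c]) auto
  show "weak_gradient (\<lambda>x. F (T n (u x))) (\<lambda>x. (F' (T n (u x)) * T' n (u x)) *\<^sub>R g x)" for n
  proof (rule weak_gradient_chain_bounded[OF w])
    show "DERIV (\<lambda>s. F (T n s)) s :> F' (T n s) * T' n s" for s
      unfolding T_def T'_def by (rule DERIV_chain2[OF F DERIV_trunc])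
    \<comment> \<open>Since \<open>1 / eps n = Suc n\<close>, the truncation \<open>T n\<close>
      takes its values between \<open>- Suc n\<close> and \<open>Suc n\<close>.\<close>
    show "\<bar>F' (T n s) * T' n s\<bar> \<le> K (real (Suc n)) * 1" for s
      unfolding abs_mult
    proof (intro mult_mono K(1) T'le)
      show "\<bar>T n s\<bar> \<le> \<bar>real (Suc n)\<bar>" using trunc_bounded[of "1 / real (Suc n)" s] by (simp add: T_def)
      show "0 \<le> K (real (Suc n))" using K(1)[of 0 "real (Suc n)"] by simp
    qed auto
  qed (rule c2)
  have Tt: "(\<lambda>n. T n s) \<longlonglongrightarrow> s" for s unfolding T_def by (rule trunc_tendsto)
  have T't: "(\<lambda>n. T' n s) \<longlonglongrightarrow> 1" for s unfolding T'_def by (rule trunc'_tendsto)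
  have lF: "loc_L1 (\<lambda>x. F (u x))"
    by (rule loc_L1I_bound[OF L(2), where M=1]) (use L(1)[of "u x" "u x" for x] in \<open>auto intro: order_trans[OF _ abs_ge_self]\<close>)
  have lF': "loc_L1 (\<lambda>x. F' (u x) *\<^sub>R g x)"
    by (rule loc_L1I_bound[OF K(2), where M=1])
       (use K(1)[of "u x" "u x" for x] in \<open>auto intro!: mult_right_mono order_trans[OF _ abs_ge_self]\<close>)
  show "L1_loc_lim (\<lambda>n x. F (T n (u x))) (\<lambda>x. F (u x))"
  proof (rule L1_loc_lim_dominated[OF _ _ lF _ L1_loc_lim_const[OF L(2)]])
    show "AE_subseq_lim (\<lambda>n x. F (T n (u x))) (\<lambda>x. F (u x))"
      by (rule AE_subseq_lim_pointwise) (rule isCont_tendsto_compose[OF Fc Tt])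
  qed (use L Tle in auto)
  have lK: "loc_L1 (\<lambda>x. K (u x) * norm (g x))"
    by (rule loc_L1I_bound[OF K(2), where M=1]) (auto simp: abs_mult)
  show "L1_loc_lim (\<lambda>n x. (F' (T n (u x)) * T' n (u x)) *\<^sub>R g x) (\<lambda>x. F' (u x) *\<^sub>R g x)"
  proof (rule L1_loc_lim_dominated[OF _ _ lF' _ L1_loc_lim_const[OF lK]])
    show "AE_subseq_lim (\<lambda>n x. (F' (T n (u x)) * T' n (u x)) *\<^sub>R g x) (\<lambda>x. F' (u x) *\<^sub>R g x)"
    proof (rule AE_subseq_lim_pointwise)
      fix x
      have "(\<lambda>n. (F' (T n (u x)) * T' n (u x)) *\<^sub>R g x) \<longlonglongrightarrow> (F' (u x) * 1) *\<^sub>R g x"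
        by (intro tendsto_intros isCont_tendsto_compose[OF F'c' Tt] T't)
      then show "(\<lambda>n. (F' (T n (u x)) * T' n (u x)) *\<^sub>R g x) \<longlonglongrightarrow> F' (u x) *\<^sub>R g x" by simp
    qed
    fix n x
    have "\<bar>F' (T n (u x)) * T' n (u x)\<bar> \<le> K (u x) * 1"
      unfolding abs_mult using K(1)[of 0 "u x"] by (intro mult_mono K(1) T'le Tle) auto
    then show "norm ((F' (T n (u x)) * T' n (u x)) *\<^sub>R g x) \<le> K (u x) * norm (g x)"
      by (auto intro!: mult_right_mono)
  qed auto
qed

section \<open>The Gagliardo-Nirenberg inequality\<close>

text \<open>Fundamental theorem of calculus along the segment from x to x + y, followed by
  Cauchy-Schwarz; the latter appears as nonnegativity of the variance of \<open>p\<close> over the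
  unit interval, whose mean is the increment \<open>d\<close>.\<close>

lemma square_diff_le_integral:
  fixes h :: "'a::euclidean_space \<Rightarrow> real"
  assumes h: "\<And>x. GDERIV h x :> h' x" and c: "continuous_on UNIV h'"
  shows "ennreal ((h (x + y) - h x)\<^sup>2) \<le>
    (\<integral>\<^sup>+t. indicator {0..1} t * ennreal ((norm y)\<^sup>2 * (norm (h' (x + t *\<^sub>R y)))\<^sup>2) \<partial>lborel)"
proof -
  define p where "p t = y \<bullet> h' (x + t *\<^sub>R y)" for t :: real
  define d where "d = h (x + y) - h x"
  have pc: "continuous_on UNIV p" unfolding p_def
    by (intro continuous_intros continuous_on_compose2[OF c]) auto
  have D: "DERIV (\<lambda>t. h (x + t *\<^sub>R y)) t :> p t" for t
  proof -
    have "((\<lambda>t. x + t *\<^sub>R y) has_derivative (\<lambda>s. s *\<^sub>R y)) (at t)" by (auto intro!: derivative_eq_intros)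
    from has_derivative_compose[OF this h[unfolded gderiv_def]]
    show ?thesis by (simp add: has_field_derivative_def p_def mult_commute_abs)
  qed
  have bi: "has_bochner_integral lborel (\<lambda>t. p t * indicator {0..1} t) d"
    using has_bochner_integral_FTC_Icc_real[of 0 1 "\<lambda>t. h (x + t *\<^sub>R y)" p] D pc
    by (simp add: d_def continuous_on_eq_continuous_at)
  have i1: "integrable lborel (\<lambda>t. p t * indicator {0..1} t)" and e1: "(LBINT t. p t * indicator {0..1} t) = d"
    using bi by (auto simp: has_bochner_integral_iff)
  have i2: "integrable lborel (\<lambda>t. (p t)\<^sup>2 * indicator {0..1} t)"
    using borel_integrable_atLeastAtMost[of 0 1 "\<lambda>t. (p t)\<^sup>2"] pc
    by (auto simp: continuous_on_eq_continuous_at indicator_def if_distrib cong: if_cong intro!: continuous_intros)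
  have i0: "integrable lborel (\<lambda>t::real. indicator {0..1} t :: real)" by simp
  have "0 \<le> (LBINT t. (p t - d)\<^sup>2 * indicator {0..1} t)" by (rule integral_nonneg_AE) auto
  also have "\<dots> = (LBINT t. (p t)\<^sup>2 * indicator {0..1} t - (2 * d) * (p t * indicator {0..1} t) + d\<^sup>2 * indicator {0..1} t)"
    by (rule Bochner_Integration.integral_cong) (auto simp: power2_diff algebra_simps)
  also have "\<dots> = (LBINT t. (p t)\<^sup>2 * indicator {0..1} t) - 2 * d * d + d\<^sup>2"
    using i1 i2 i0 e1 by simp
  finally have "d\<^sup>2 \<le> (LBINT t. (p t)\<^sup>2 * indicator {0..1} t)" by (simp add: power2_eq_square)
  then have "ennreal (d\<^sup>2) \<le> ennreal (LBINT t. (p t)\<^sup>2 * indicator {0..1} t)" by (rule ennreal_leI)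
  also have "\<dots> = (\<integral>\<^sup>+t. ennreal ((p t)\<^sup>2 * indicator {0..1} t) \<partial>lborel)"
    by (rule nn_integral_eq_integral[symmetric]) (use i2 in auto)
  also have "\<dots> \<le> (\<integral>\<^sup>+t. indicator {0..1} t * ennreal ((norm y)\<^sup>2 * (norm (h' (x + t *\<^sub>R y)))\<^sup>2) \<partial>lborel)"
  proof (rule nn_integral_mono)
    fix t :: real
    have "(p t)\<^sup>2 \<le> (norm y)\<^sup>2 * (norm (h' (x + t *\<^sub>R y)))\<^sup>2"
      using Cauchy_Schwarz_ineq2[of y "h' (x + t *\<^sub>R y)"]
      by (metis p_def abs_ge_zero power2_abs power_mono power_mult_distrib)
    then show "ennreal ((p t)\<^sup>2 * indicator {0..1} t) \<le> indicator {0..1} t * ennreal ((norm y)\<^sup>2 * (norm (h' (x + t *\<^sub>R y)))\<^sup>2)"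
      by (auto simp: indicator_def intro!: ennreal_leI)
  qed
  finally show ?thesis by (simp add: d_def)
qed

text \<open>After Tonelli, translation invariance removes the shift by \<open>t *\<^sub>R y\<close>
  from the inner integral, and the integral over t becomes trivial.\<close>

lemma nn_integral_translate_diff:
  fixes h :: "'a::euclidean_space \<Rightarrow> real"
  assumes h: "\<And>x. GDERIV h x :> h' x" and c: "continuous_on UNIV h'"
  shows "(\<integral>\<^sup>+x. ennreal ((h (x + y) - h x)\<^sup>2) \<partial>lborel) \<le> ennreal ((norm y)\<^sup>2) * (\<integral>\<^sup>+x. ennreal ((norm (h' x))\<^sup>2) \<partial>lborel)"
proof -
  have [measurable]: "h' \<in> borel_measurable borel" using c by (rule borel_measurable_continuous_onI)
  have "(\<integral>\<^sup>+x. ennreal ((h (x + y) - h x)\<^sup>2) \<partial>lborel) \<le>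
    (\<integral>\<^sup>+x. \<integral>\<^sup>+t. indicator {0..1} t * ennreal ((norm y)\<^sup>2 * (norm (h' (x + t *\<^sub>R y)))\<^sup>2) \<partial>lborel \<partial>lborel)"
    by (intro nn_integral_mono square_diff_le_integral assms)
  also have "\<dots> = (\<integral>\<^sup>+t. \<integral>\<^sup>+x. indicator {0..1} t * ennreal ((norm y)\<^sup>2 * (norm (h' (x + t *\<^sub>R y)))\<^sup>2) \<partial>lborel \<partial>lborel)"
    by (rule lborel_pair.Fubini'[symmetric]) measurable
  also have "\<dots> = (\<integral>\<^sup>+t. indicator {0..1::real} t * (ennreal ((norm y)\<^sup>2) * (\<integral>\<^sup>+x. ennreal ((norm (h' x))\<^sup>2) \<partial>lborel)) \<partial>lborel)"
  proof (rule nn_integral_cong)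
    fix t :: real
    have "(\<integral>\<^sup>+x. ennreal ((norm (h' (t *\<^sub>R y + 1 *\<^sub>R x)))\<^sup>2) \<partial>lborel) = (\<integral>\<^sup>+x. ennreal ((norm (h' x))\<^sup>2) \<partial>lborel)"
      by (rule nn_integral_lborel_isometry[of 1 "\<lambda>x. ennreal ((norm (h' x))\<^sup>2)"]) auto
    then have "(\<integral>\<^sup>+x. ennreal ((norm (h' (x + t *\<^sub>R y)))\<^sup>2) \<partial>lborel) = (\<integral>\<^sup>+x. ennreal ((norm (h' x))\<^sup>2) \<partial>lborel)"
      by (simp add: add.commute)
    then show "(\<integral>\<^sup>+x. indicator {0..1} t * ennreal ((norm y)\<^sup>2 * (norm (h' (x + t *\<^sub>R y)))\<^sup>2) \<partial>lborel)
       = indicator {0..1} t * (ennreal ((norm y)\<^sup>2) * (\<integral>\<^sup>+x. ennreal ((norm (h' x))\<^sup>2) \<partial>lborel))"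
      by (simp add: ennreal_mult nn_integral_cmult)
  qed
  also have "\<dots> = ennreal ((norm y)\<^sup>2) * (\<integral>\<^sup>+x. ennreal ((norm (h' x))\<^sup>2) \<partial>lborel)"
    by (subst nn_integral_multc) auto
  finally show ?thesis .
qed

lemma norm_le_of_cube:
  fixes y :: "'a::euclidean_space"
  assumes "y \<in> cbox 0 (r *\<^sub>R One)"
  shows "(norm y)\<^sup>2 \<le> real DIM('a) * r\<^sup>2"
proof -
  have "0 \<le> y \<bullet> b \<and> y \<bullet> b \<le> r" if "b \<in> Basis" for b
    using assms that by (auto simp: mem_box)
  then have "(y \<bullet> b)\<^sup>2 \<le> r\<^sup>2" if "b \<in> Basis" for b using that by (simp add: power_mono)
  then have "(\<Sum>b\<in>Basis. (y \<bullet> b)\<^sup>2) \<le> (\<Sum>b\<in>(Basis::'a set). r\<^sup>2)" by (intro sum_mono)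
  moreover have "(norm y)\<^sup>2 = (\<Sum>b\<in>Basis. (y \<bullet> b)\<^sup>2)"
    by (subst power2_norm_eq_inner, subst euclidean_inner) (simp add: power2_eq_square)
  ultimately show ?thesis by simp
qed

text \<open>The mean of \<open>h\<close> over a cube of side \<open>r\<close> is at most \<open>l / 4\<close>, so on the superlevel set
  \<open>h\<close> deviates from its mean by at least \<open>l / 4\<close>.\<close>
lemma superlevel_poincare:
  fixes h :: "'a::euclidean_space \<Rightarrow> real"
  assumes h: "\<And>x. GDERIV h x :> h' x" and c: "continuous_on UNIV h'"
    and pos: "\<And>x. 0 \<le> h x" and r: "r > 0" and l: "l > 0"
    and int: "(\<integral>\<^sup>+x. ennreal (h x) \<partial>lborel) \<le> ennreal (l * r ^ DIM('a) / 4)"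
  shows "ennreal (l\<^sup>2 / 16) * emeasure lborel {x. l / 2 \<le> h x} \<le>
    ennreal (real DIM('a) * r\<^sup>2) * (\<integral>\<^sup>+x. ennreal ((norm (h' x))\<^sup>2) \<partial>lborel)"
proof -
  let ?N = "DIM('a)"
  let ?Q = "cbox (0::'a) (r *\<^sub>R One)"
  let ?E = "{x. l / 2 \<le> h x}"
  let ?D = "\<integral>\<^sup>+x. ennreal ((norm (h' x))\<^sup>2) \<partial>lborel"
  have hc: "continuous_on UNIV h" using GDERIV_continuous_on h by blast
  have [measurable]: "h' \<in> borel_measurable borel" "h \<in> borel_measurable borel"
    using c hc by (auto intro: borel_measurable_continuous_onI)
  have Q: "emeasure lborel ?Q = ennreal (r ^ ?N)"
    using r by (subst emeasure_lborel_cbox) auto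
  have low: "ennreal (l\<^sup>2 / 16 * r ^ ?N) \<le> (\<integral>\<^sup>+y. indicator ?Q y * ennreal ((h (x + y) - h x)\<^sup>2) \<partial>lborel)"
    if x: "x \<in> ?E" for x
  proof -
    let ?I = "\<integral>\<^sup>+y. indicator ?Q y * ennreal ((h (x + y) - h x)\<^sup>2) \<partial>lborel"
    \<comment> \<open>Linearization of a square: expanding
      \<open>(h x - h (x + y) - l/4)^2 \<ge> 0\<close> and using \<open>h x \<ge> l/2\<close> gives
      \<open>l^2/4 - l^2/16 = 3 l^2/16\<close> on the left. The mean of \<open>h\<close> over the
      cube then enters only linearly.\<close>
    have pw: "3 * l\<^sup>2 / 16 \<le> (h (x + y) - h x)\<^sup>2 + l / 2 * h (x + y)" for y
    proof -
      have "0 \<le> (h x - h (x + y) - l / 4)\<^sup>2" by simp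
      moreover have "l / 2 * (l / 2) \<le> l / 2 * h x" using x l by (intro mult_left_mono) auto
      ultimately show ?thesis by (simp add: power2_eq_square algebra_simps)
    qed
    have "ennreal (3 * l\<^sup>2 / 16 * r ^ ?N) = ennreal (3 * l\<^sup>2 / 16) * ennreal (r ^ ?N)"
      using r by (intro ennreal_mult) auto
    also have "\<dots> = (\<integral>\<^sup>+y. indicator ?Q y * ennreal (3 * l\<^sup>2 / 16) \<partial>lborel)"
      by (subst nn_integral_multc) (auto simp: Q mult.commute)
    also have "\<dots> \<le> (\<integral>\<^sup>+y. indicator ?Q y * ennreal ((h (x + y) - h x)\<^sup>2) + ennreal (l / 2) * ennreal (h (x + y)) \<partial>lborel)"
    proof (rule nn_integral_mono)
      fix y
      have "ennreal (3 * l\<^sup>2 / 16) \<le> ennreal ((h (x + y) - h x)\<^sup>2) + ennreal (l / 2) * ennreal (h (x + y))"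
        using pw[of y] pos l by (simp flip: ennreal_mult ennreal_plus)
      then show "indicator ?Q y * ennreal (3 * l\<^sup>2 / 16) \<le> indicator ?Q y * ennreal ((h (x + y) - h x)\<^sup>2) + ennreal (l / 2) * ennreal (h (x + y))"
        by (auto simp: indicator_def)
    qed
    also have "\<dots> = ?I + ennreal (l / 2) * (\<integral>\<^sup>+y. ennreal (h (x + y)) \<partial>lborel)"
      by (subst nn_integral_add) (auto simp: nn_integral_cmult)
    also have "(\<integral>\<^sup>+y. ennreal (h (x + y)) \<partial>lborel) = (\<integral>\<^sup>+y. ennreal (h y) \<partial>lborel)"
      using nn_integral_lborel_isometry[of 1 "\<lambda>y. ennreal (h y)" x] by simp
    also have "?I + ennreal (l / 2) * (\<integral>\<^sup>+y. ennreal (h y) \<partial>lborel) \<le> ?I + ennreal (l / 2) * ennreal (l * r ^ ?N / 4)"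
      by (intro add_left_mono mult_left_mono int) auto
    also have "ennreal (l / 2) * ennreal (l * r ^ ?N / 4) = ennreal (l\<^sup>2 / 8 * r ^ ?N)"
      using l r by (simp flip: ennreal_mult) (simp add: power2_eq_square field_simps)
    \<comment> \<open>The hypothesis on the integral of \<open>h\<close> consumes 1/8 of the
      available 3/16, which leaves the constant 1/16.\<close>
    finally have "ennreal (3 * l\<^sup>2 / 16 * r ^ ?N) \<le> ?I + ennreal (l\<^sup>2 / 8 * r ^ ?N)" .
    then have "ennreal (3 * l\<^sup>2 / 16 * r ^ ?N) - ennreal (l\<^sup>2 / 8 * r ^ ?N) \<le> ?I"
      by (subst ennreal_minus_le_iff) (auto simp: add.commute)
    moreover have "ennreal (3 * l\<^sup>2 / 16 * r ^ ?N) - ennreal (l\<^sup>2 / 8 * r ^ ?N) = ennreal (l\<^sup>2 / 16 * r ^ ?N)"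
      using l r by (subst ennreal_minus) (auto simp: field_simps)
    ultimately show ?thesis by simp
  qed
  have "ennreal (l\<^sup>2 / 16 * r ^ ?N) * emeasure lborel ?E = (\<integral>\<^sup>+x. ennreal (l\<^sup>2 / 16 * r ^ ?N) * indicator ?E x \<partial>lborel)"
    by (subst nn_integral_cmult_indicator) auto
  also have "\<dots> \<le> (\<integral>\<^sup>+x. \<integral>\<^sup>+y. indicator ?Q y * ennreal ((h (x + y) - h x)\<^sup>2) \<partial>lborel \<partial>lborel)"
    by (intro nn_integral_mono) (use low in \<open>auto simp: indicator_def\<close>)
  also have "\<dots> = (\<integral>\<^sup>+y. \<integral>\<^sup>+x. indicator ?Q y * ennreal ((h (x + y) - h x)\<^sup>2) \<partial>lborel \<partial>lborel)"
    by (rule lborel_pair.Fubini'[symmetric]) measurable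
  also have "\<dots> = (\<integral>\<^sup>+y. indicator ?Q y * (\<integral>\<^sup>+x. ennreal ((h (x + y) - h x)\<^sup>2) \<partial>lborel) \<partial>lborel)"
    by (intro nn_integral_cong nn_integral_cmult) auto
  also have "\<dots> \<le> (\<integral>\<^sup>+y. (ennreal (real ?N * r\<^sup>2) * ?D) * indicator ?Q y \<partial>lborel)"
  proof (rule nn_integral_mono)
    fix y :: 'a
    show "indicator ?Q y * (\<integral>\<^sup>+x. ennreal ((h (x + y) - h x)\<^sup>2) \<partial>lborel) \<le> (ennreal (real ?N * r\<^sup>2) * ?D) * indicator ?Q y"
    proof (cases "y \<in> ?Q")
      case True
      have "(\<integral>\<^sup>+x. ennreal ((h (x + y) - h x)\<^sup>2) \<partial>lborel) \<le> ennreal ((norm y)\<^sup>2) * ?D"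
        by (rule nn_integral_translate_diff[OF h c])
      also have "\<dots> \<le> ennreal (real ?N * r\<^sup>2) * ?D"
        by (intro mult_right_mono ennreal_leI norm_le_of_cube True) auto
      finally show ?thesis using True by simp
    qed simp
  qed
  also have "\<dots> = ennreal (real ?N * r\<^sup>2) * ?D * ennreal (r ^ ?N)"
    by (subst nn_integral_cmult_indicator) (auto simp: Q)
  finally have fin: "ennreal (l\<^sup>2 / 16 * r ^ ?N) * emeasure lborel ?E \<le> ennreal (real ?N * r\<^sup>2) * ?D * ennreal (r ^ ?N)" .
  have e: "ennreal (l\<^sup>2 / 16 * r ^ ?N) = ennreal (l\<^sup>2 / 16) * ennreal (r ^ ?N)"
    using r by (intro ennreal_mult) auto
  have "ennreal (r ^ ?N) * (ennreal (l\<^sup>2 / 16) * emeasure lborel ?E) \<le> ennreal (r ^ ?N) * (ennreal (real ?N * r\<^sup>2) * ?D)"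
    using fin unfolding e by (simp only: mult_ac)
  then show ?thesis using r by (subst (asm) ennreal_mult_le_mult_iff) auto
qed

text \<open>\<open>l * layer s l\<close> is the square of the derivative of the truncation
  \<open>s \<mapsto> l s^2 / (l^2 + s^2)\<close>, and \<open>layer s\<close> has integral \<open>2 / 3\<close> over \<open>l > 0\<close>: integrating
  the superlevel bounds against \<open>dl / l\<close> therefore recovers the full Dirichlet integral.\<close>
definition layer :: "real \<Rightarrow> real \<Rightarrow> real" where
  "layer s l = 4 * s\<^sup>2 * l ^ 5 / (l\<^sup>2 + s\<^sup>2) ^ 4"

text \<open>\<open>superlevel_poincare\<close> applied to the truncation
  \<open>l f^2 / (l^2 + f^2)\<close>, which is at least l/2 where \<open>|f| \<ge> l\<close>. The
  case q = 1 serves functions measured in \<open>L^1\<close>, the case q = 2 those measured in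
  \<open>L^2\<close>.\<close>

lemma superlevel_bound:
  fixes f :: "'a::euclidean_space \<Rightarrow> real"
  assumes f: "\<And>x. GDERIV f x :> g x" and c: "continuous_on UNIV g"
    and q: "q = 1 \<or> q = (2::nat)" and m: "m > 0" and l: "l > 0"
    and int: "(\<integral>\<^sup>+x. ennreal (\<bar>f x\<bar> ^ q) \<partial>lborel) \<le> ennreal m"
  defines "N \<equiv> real DIM('a)"
  shows "ennreal (l powr (1 + 2 * real q / N)) * emeasure lborel {x. l \<le> \<bar>f x\<bar>} \<le>
    ennreal (16 * N * (4 * m) powr (2 / N)) * (\<integral>\<^sup>+x. ennreal (layer (f x) l * (norm (g x))\<^sup>2) \<partial>lborel)"
proof -
  have N: "N > 0" by (simp add: N_def)
  \<comment> \<open>The integral of the truncation \<open>h\<close> is at most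
    \<open>l m / l^q\<close>; this side length makes that bound equal to the value
    \<open>l r^N / 4\<close> demanded by \<open>superlevel_poincare\<close>.\<close>
  define r where "r = (4 * m / l ^ q) powr (1 / N)"
  have r: "r > 0" using m l by (simp add: r_def)
  have rN: "r ^ DIM('a) = 4 * m / l ^ q"
    using r m l N by (simp add: powr_realpow[symmetric] r_def powr_powr N_def[symmetric])
  have den: "l\<^sup>2 + s\<^sup>2 > 0" "l\<^sup>2 + s\<^sup>2 \<noteq> 0" for s using l by (auto simp: add_pos_nonneg)
  define h where "h x = l * (f x)\<^sup>2 / (l\<^sup>2 + (f x)\<^sup>2)" for x
  define p where "p s = 2 * l ^ 3 * s / (l\<^sup>2 + s\<^sup>2)\<^sup>2" for s
  define h' where "h' x = p (f x) *\<^sub>R g x" for x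
  have fc: "continuous_on UNIV f" using GDERIV_continuous_on f by blast
  have [measurable]: "f \<in> borel_measurable borel" "g \<in> borel_measurable borel"
    using fc c by (auto intro: borel_measurable_continuous_onI)
  have dp: "DERIV (\<lambda>s. l * s\<^sup>2 / (l\<^sup>2 + s\<^sup>2)) s :> p s" for s
    unfolding p_def using den[of s]
    by (auto intro!: derivative_eq_intros simp: power2_eq_square power3_eq_cube algebra_simps)
  have h: "GDERIV h x :> h' x" for x
    unfolding h_def[abs_def] h'_def by (rule GDERIV_DERIV_compose[OF f dp])
  have c': "continuous_on UNIV h'"
    unfolding h'_def p_def using den by (intro continuous_intros fc c) auto
  have pos: "0 \<le> h x" for x unfolding h_def using den[of "f x"] l by simp
  \<comment> \<open>For q = 1 this is \<open>l |f| \<le> l^2 + f^2\<close>; for q = 2 it suffices to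
    drop \<open>f^2\<close> from the denominator.\<close>
  have hle: "h x \<le> l / l ^ q * \<bar>f x\<bar> ^ q" for x
    using q
  proof
    assume "q = 1"
    moreover have "l * \<bar>f x\<bar> \<le> l\<^sup>2 + (f x)\<^sup>2"
    proof -
      have "0 \<le> (l - \<bar>f x\<bar>)\<^sup>2" "0 \<le> l * \<bar>f x\<bar>" using l by auto
      then show ?thesis unfolding power2_diff power2_abs by linarith
    qed
    then have "\<bar>f x\<bar> * (l * \<bar>f x\<bar>) \<le> \<bar>f x\<bar> * (l\<^sup>2 + (f x)\<^sup>2)" by (intro mult_left_mono) auto
    then have "l * (f x)\<^sup>2 \<le> \<bar>f x\<bar> * (l\<^sup>2 + (f x)\<^sup>2)" by (simp add: power2_eq_square mult_ac)
    ultimately show ?thesis using den[of "f x"] l by (simp add: h_def pos_divide_le_eq)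
  next
    assume "q = 2"
    moreover have "l * (f x)\<^sup>2 / (l\<^sup>2 + (f x)\<^sup>2) \<le> l * (f x)\<^sup>2 / l\<^sup>2"
      using l den[of "f x"] by (intro divide_left_mono) auto
    ultimately show ?thesis by (simp add: h_def)
  qed
  have "(\<integral>\<^sup>+x. ennreal (h x) \<partial>lborel) \<le> (\<integral>\<^sup>+x. ennreal (l / l ^ q) * ennreal (\<bar>f x\<bar> ^ q) \<partial>lborel)"
    using hle l by (intro nn_integral_mono) (simp flip: ennreal_mult add: ennreal_leI)
  also have "\<dots> = ennreal (l / l ^ q) * (\<integral>\<^sup>+x. ennreal (\<bar>f x\<bar> ^ q) \<partial>lborel)" by (rule nn_integral_cmult) auto
  also have "\<dots> \<le> ennreal (l / l ^ q) * ennreal m" by (intro mult_left_mono int) auto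
  also have "\<dots> = ennreal (l * r ^ DIM('a) / 4)" using l m by (simp add: rN flip: ennreal_mult)
  finally have hint: "(\<integral>\<^sup>+x. ennreal (h x) \<partial>lborel) \<le> ennreal (l * r ^ DIM('a) / 4)" .
  have sub: "{x. l \<le> \<bar>f x\<bar>} \<subseteq> {x. l / 2 \<le> h x}"
  proof
    fix x assume "x \<in> {x. l \<le> \<bar>f x\<bar>}"
    then have "l\<^sup>2 \<le> (f x)\<^sup>2" using l by (simp add: abs_le_square_iff[symmetric])
    then have "l / 2 * (l\<^sup>2 + (f x)\<^sup>2) \<le> l * (f x)\<^sup>2" using l by (simp add: field_simps)
    then show "x \<in> {x. l / 2 \<le> h x}" using den[of "f x"] by (simp add: h_def pos_le_divide_eq)
  qed
  have sq: "(norm (h' x))\<^sup>2 = l * (layer (f x) l * (norm (g x))\<^sup>2)" for x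
    by (simp add: h'_def p_def layer_def power_mult_distrib power_divide eval_nat_numeral mult_ac)
  let ?D = "\<integral>\<^sup>+x. ennreal (layer (f x) l * (norm (g x))\<^sup>2) \<partial>lborel"
  have lay: "0 \<le> layer s l" for s using l den[of s] by (simp add: layer_def)
  have D: "(\<integral>\<^sup>+x. ennreal ((norm (h' x))\<^sup>2) \<partial>lborel) = ennreal l * ?D"
  proof -
    have [measurable]: "(\<lambda>x. layer (f x) l) \<in> borel_measurable borel" unfolding layer_def by measurable
    have "(\<integral>\<^sup>+x. ennreal ((norm (h' x))\<^sup>2) \<partial>lborel) = (\<integral>\<^sup>+x. ennreal l * ennreal (layer (f x) l * (norm (g x))\<^sup>2) \<partial>lborel)"
      unfolding sq using l by (simp add: ennreal_mult')
    also have "\<dots> = ennreal l * ?D" by (rule nn_integral_cmult) measurable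
    finally show ?thesis .
  qed
  \<comment> \<open>Turns the factor \<open>l^2 / 16\<close> into the weight
    \<open>l^(1 + 2 q / N)\<close>. On the other side the powers of l cancel:
    \<open>2 q / N - 1\<close> from \<open>K\<close>, \<open>- 2 q / N\<close> from the square of
    \<open>r\<close>, and 1 from the Dirichlet integral of \<open>h\<close>.\<close>
  define K where "K = 16 * l powr (2 * real q / N - 1)"
  have K: "K > 0" using l by (simp add: K_def)
  have r2: "r\<^sup>2 = (4 * m) powr (2 / N) * l powr (- (2 * real q / N))"
  proof -
    have "r\<^sup>2 = (4 * m / l ^ q) powr (2 / N)"
      using r by (simp add: powr_realpow[symmetric] r_def powr_powr)
    also have "\<dots> = (4 * m) powr (2 / N) / (l ^ q) powr (2 / N)" using m l by (simp add: powr_divide)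
    also have "(l ^ q) powr (2 / N) = l powr (2 * real q / N)" using l by (simp add: powr_realpow[symmetric] powr_powr mult.commute)
    finally show ?thesis by (simp add: powr_minus divide_inverse)
  qed
  have "ennreal (l powr (1 + 2 * real q / N)) * emeasure lborel {x. l \<le> \<bar>f x\<bar>} =
      ennreal K * (ennreal (l\<^sup>2 / 16) * emeasure lborel {x. l \<le> \<bar>f x\<bar>})"
  proof -
    have "l powr (1 + 2 * real q / N) = K * (l\<^sup>2 / 16)"
    proof -
      have "l powr (2 * real q / N - 1) * l powr 2 = l powr (2 * real q / N - 1 + 2)"
        by (rule powr_add[symmetric])
      also have "2 * real q / N - 1 + 2 = 1 + 2 * real q / N" by simp
      finally show ?thesis using l by (simp add: K_def)
    qed
    moreover have "ennreal (K * (l\<^sup>2 / 16)) = ennreal K * ennreal (l\<^sup>2 / 16)"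
      using K by (intro ennreal_mult) auto
    ultimately show ?thesis by (simp only: mult.assoc)
  qed
  also have "\<dots> \<le> ennreal K * (ennreal (l\<^sup>2 / 16) * emeasure lborel {x. l / 2 \<le> h x})"
    using h GDERIV_continuous_on[of h h'] by (intro mult_left_mono emeasure_mono sub) (auto intro!: borel_closed closed_Collect_le continuous_intros)
  also have "\<dots> \<le> ennreal K * (ennreal (N * r\<^sup>2) * (ennreal l * ?D))"
    using superlevel_poincare[OF h c' pos r l hint] unfolding D N_def by (intro mult_left_mono) auto
  also have "\<dots> = ennreal (16 * N * (4 * m) powr (2 / N)) * ?D"
  proof -
    have "K * (N * r\<^sup>2 * l) = 16 * N * (4 * m) powr (2 / N) * (l powr (2 * real q / N - 1) * l powr (- (2 * real q / N)) * l powr 1)"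
      using l by (simp add: K_def r2)
    also have "l powr (2 * real q / N - 1) * l powr (- (2 * real q / N)) * l powr 1 = 1"
      using l by (simp only: powr_add[symmetric]) simp
    finally have "K * (N * r\<^sup>2 * l) = 16 * N * (4 * m) powr (2 / N)" by simp
    moreover have "ennreal K * (ennreal (N * r\<^sup>2) * (ennreal l * ?D)) = ennreal (K * (N * r\<^sup>2 * l)) * ?D"
      using K N l by (simp add: ennreal_mult mult.assoc)
    ultimately show ?thesis by (simp only:)
  qed
  finally show ?thesis .
qed

lemma nn_integral_layer_le: "(\<integral>\<^sup>+l. indicator {0..} l * ennreal (layer s l) \<partial>lborel) \<le> ennreal (2 / 3)"
proof (cases "s = 0")
  case True
  then show ?thesis by (simp add: layer_def)
next
  case False
  \<comment> \<open>A primitive of \<open>layer s\<close>: in the variable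
    \<open>l^2 / (l^2 + s^2)\<close>, which runs from 0 to 1, it is two thirds of the cube.\<close>
  define F where "F l = 2 / 3 * (l\<^sup>2 / (l\<^sup>2 + s\<^sup>2)) ^ 3" for l :: real
  have den: "l\<^sup>2 + s\<^sup>2 \<noteq> 0" "l\<^sup>2 + s\<^sup>2 > 0" for l :: real
    using False by (auto simp: sum_power2_eq_zero_iff add_nonneg_pos)
  have "(\<integral>\<^sup>+l. ennreal (layer s l) * indicator {0..} l \<partial>lborel) = ennreal (2 / 3 - F 0)"
  proof (rule nn_integral_FTC_atLeast[where F=F])
    show "(\<lambda>l. layer s l) \<in> borel_measurable borel" unfolding layer_def by measurable
    fix l :: real assume l: "0 \<le> l"
    have dq: "DERIV (\<lambda>l. l\<^sup>2 / (l\<^sup>2 + s\<^sup>2)) l :> 2 * l * s\<^sup>2 / (l\<^sup>2 + s\<^sup>2)\<^sup>2"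
      using den[of l] by (auto intro!: derivative_eq_intros simp: power2_eq_square algebra_simps)
    have "DERIV F l :> 2 / 3 * (3 * (2 * l * s\<^sup>2 / (l\<^sup>2 + s\<^sup>2)\<^sup>2 * (l\<^sup>2 / (l\<^sup>2 + s\<^sup>2)) ^ 2))"
      unfolding F_def[abs_def] using DERIV_cmult[OF DERIV_power[OF dq, of 3], of "2/3"] by simp
    also have "2 / 3 * (3 * (2 * l * s\<^sup>2 / (l\<^sup>2 + s\<^sup>2)\<^sup>2 * (l\<^sup>2 / (l\<^sup>2 + s\<^sup>2)) ^ 2)) = layer s l"
      unfolding layer_def power_divide times_divide_times_eq times_divide_eq_right
      by (simp add: eval_nat_numeral mult_ac)
    finally show "DERIV F l :> layer s l" .
    show "0 \<le> layer s l" using l den[of l] by (simp add: layer_def)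
  next
    have "((\<lambda>l. s\<^sup>2 / (l\<^sup>2 + s\<^sup>2)) \<longlongrightarrow> 0) at_top"
    proof (intro tendsto_divide_0[OF tendsto_const] filterlim_at_top_imp_at_infinity filterlim_at_top_mono[OF filterlim_ident])
      show "\<forall>\<^sub>F l in at_top. l \<le> l\<^sup>2 + s\<^sup>2"
        using eventually_ge_at_top[of 1]
      proof eventually_elim
        case (elim l)
        then have "l * 1 \<le> l * l" by (intro mult_left_mono) auto
        then show ?case by (simp add: power2_eq_square add_increasing2)
      qed
    qed
    then have "((\<lambda>l. 2 / 3 * (1 - s\<^sup>2 / (l\<^sup>2 + s\<^sup>2)) ^ 3) \<longlongrightarrow> 2 / 3 * (1 - 0) ^ 3) at_top"
      by (intro tendsto_intros)
    moreover have "2 / 3 * (1 - s\<^sup>2 / (l\<^sup>2 + s\<^sup>2)) ^ 3 = F l" for l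
      using den[of l] by (simp add: F_def field_simps)
    ultimately show "(F \<longlongrightarrow> 2 / 3) at_top" by simp
  qed
  also have "F 0 = 0" by (simp add: F_def)
  finally show ?thesis by (simp add: mult.commute)
qed

text \<open>Only the levels between \<open>|s| / 2\<close> and \<open>|s|\<close> are used, away
  from the singular point 0 of the power. Since \<open>(1/2)^a \<le> 1/2\<close>, they contribute at
  least half of \<open>|s|^a / a\<close>, which explains the factor \<open>2 * a\<close>.\<close>

lemma powr_le_layer_cake:
  assumes a: "a \<ge> 1"
  shows "ennreal (\<bar>s\<bar> powr a) \<le> ennreal (2 * a) * (\<integral>\<^sup>+l. indicator {l. 0 < l \<and> l \<le> \<bar>s\<bar>} l * ennreal (l powr (a - 1)) \<partial>lborel)"
proof (cases "s = 0")
  case False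
  define t where "t = \<bar>s\<bar>"
  have t: "t > 0" using False by (simp add: t_def)
  have "(\<integral>\<^sup>+l. ennreal (l powr (a - 1)) * indicator {t/2..t} l \<partial>lborel) = ennreal (t powr a / a - (t/2) powr a / a)"
  proof (rule nn_integral_FTC_Icc[where F="\<lambda>l. l powr a / a"])
    fix l assume "l \<in> {t/2..t}"
    then have l: "l > 0" using t by simp
    show "((\<lambda>l. l powr a / a) has_real_derivative l powr (a - 1)) (at l)"
      using l a by (auto intro!: derivative_eq_intros)
  qed (use t in auto)
  moreover have "t powr a / 2 \<le> t powr a - (t/2) powr a"
  proof -
    have "(t/2) powr a = t powr a * (1/2) powr a" using t by (simp add: powr_mult[symmetric])
    also have "(1/2::real) powr a \<le> (1/2) powr 1" using a by (intro powr_mono') auto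
    finally have "(t/2) powr a \<le> t powr a / 2" using t by (simp add: mult_left_mono)
    then show ?thesis by simp
  qed
  ultimately have "ennreal (t powr a) \<le> ennreal (2 * a) * (\<integral>\<^sup>+l. ennreal (l powr (a - 1)) * indicator {t/2..t} l \<partial>lborel)"
    using a by (simp flip: ennreal_mult' add: ennreal_leI field_simps)
  also have "\<dots> \<le> ennreal (2 * a) * (\<integral>\<^sup>+l. indicator {l. 0 < l \<and> l \<le> \<bar>s\<bar>} l * ennreal (l powr (a - 1)) \<partial>lborel)"
    using t by (intro mult_left_mono nn_integral_mono) (auto simp: indicator_def t_def)
  finally show ?thesis by (simp add: t_def)
qed (use a in simp)

text \<open>The factors in order: \<open>2 * a\<close> from \<open>powr_le_layer_cake\<close> with
  \<open>a = 2 + 2 q / N\<close>, then the constant of \<open>superlevel_bound\<close> without its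
  power of m, then the integral 2/3 of \<open>layer\<close>.\<close>

definition GN :: "nat \<Rightarrow> real \<Rightarrow> real" where
  "GN q N = 2 * (2 + 2 * real q / N) * (16 * N * 4 powr (2 / N)) * (2 / 3)"

text \<open>The exponent a is the one for which \<open>a - 1 = 1 + 2 q / N\<close> is the weight in
  \<open>superlevel_bound\<close>. Integrating that bound over all levels, with Tonelli before and
  after, leaves the plain Dirichlet integral.\<close>

lemma gagliardo_nirenberg_C1:
  fixes f :: "'a::euclidean_space \<Rightarrow> real"
  assumes f: "\<And>x. GDERIV f x :> g x" and c: "continuous_on UNIV g"
    and q: "q = 1 \<or> q = (2::nat)" and m: "m > 0"
    and int: "(\<integral>\<^sup>+x. ennreal (\<bar>f x\<bar> ^ q) \<partial>lborel) \<le> ennreal m"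
  defines "N \<equiv> real DIM('a)"
  shows "(\<integral>\<^sup>+x. ennreal (\<bar>f x\<bar> powr (2 + 2 * real q / N)) \<partial>lborel) \<le>
    ennreal (GN q N * m powr (2 / N)) * (\<integral>\<^sup>+x. ennreal ((norm (g x))\<^sup>2) \<partial>lborel)"
proof -
  have N: "N > 0" by (simp add: N_def)
  define a where "a = 2 + 2 * real q / N"
  have a: "a \<ge> 1" using N by (simp add: a_def)
  define C where "C = 16 * N * (4 * m) powr (2 / N)"
  have C: "C \<ge> 0" using N by (simp add: C_def)
  have fc: "continuous_on UNIV f" using GDERIV_continuous_on f by blast
  have [measurable]: "f \<in> borel_measurable borel" "g \<in> borel_measurable borel"
    using fc c by (auto intro: borel_measurable_continuous_onI)
  have [measurable]: "(\<lambda>(s, l). layer s l) \<in> borel_measurable (borel \<Otimes>\<^sub>M borel)"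
    unfolding layer_def by measurable
  let ?G = "\<integral>\<^sup>+x. ennreal ((norm (g x))\<^sup>2) \<partial>lborel"
  have "(\<integral>\<^sup>+x. ennreal (\<bar>f x\<bar> powr a) \<partial>lborel) \<le>
    (\<integral>\<^sup>+x. ennreal (2 * a) * (\<integral>\<^sup>+l. indicator {l. 0 < l \<and> l \<le> \<bar>f x\<bar>} l * ennreal (l powr (a - 1)) \<partial>lborel) \<partial>lborel)"
    by (intro nn_integral_mono powr_le_layer_cake a)
  also have "\<dots> = (\<integral>\<^sup>+x. ennreal (2 * a) * (\<integral>\<^sup>+l. (if 0 < l \<and> l \<le> \<bar>f x\<bar> then ennreal (l powr (a - 1)) else 0) \<partial>lborel) \<partial>lborel)"
    by (intro nn_integral_cong arg_cong2[where f="(*)"]) (auto simp: indicator_def)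
  also have "\<dots> = ennreal (2 * a) * (\<integral>\<^sup>+x. \<integral>\<^sup>+l. (if 0 < l \<and> l \<le> \<bar>f x\<bar> then ennreal (l powr (a - 1)) else 0) \<partial>lborel \<partial>lborel)"
    by (rule nn_integral_cmult) measurable
  also have "(\<integral>\<^sup>+x. \<integral>\<^sup>+l. (if 0 < l \<and> l \<le> \<bar>f x\<bar> then ennreal (l powr (a - 1)) else 0) \<partial>lborel \<partial>lborel) =
    (\<integral>\<^sup>+l. \<integral>\<^sup>+x. (if 0 < l \<and> l \<le> \<bar>f x\<bar> then ennreal (l powr (a - 1)) else 0) \<partial>lborel \<partial>lborel)"
    by (rule lborel_pair.Fubini'[symmetric]) measurable
  also have "\<dots> \<le> (\<integral>\<^sup>+l. ennreal C * (\<integral>\<^sup>+x. indicator {0..} l * ennreal (layer (f x) l * (norm (g x))\<^sup>2) \<partial>lborel) \<partial>lborel)"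
  proof (rule nn_integral_mono)
    fix l :: real
    show "(\<integral>\<^sup>+x. (if 0 < l \<and> l \<le> \<bar>f x\<bar> then ennreal (l powr (a - 1)) else 0) \<partial>lborel) \<le>
      ennreal C * (\<integral>\<^sup>+x. indicator {0..} l * ennreal (layer (f x) l * (norm (g x))\<^sup>2) \<partial>lborel)"
    proof (cases "0 < l")
      case True
      have "(\<integral>\<^sup>+x. (if 0 < l \<and> l \<le> \<bar>f x\<bar> then ennreal (l powr (a - 1)) else 0) \<partial>lborel)
        = (\<integral>\<^sup>+x. ennreal (l powr (a - 1)) * indicator {x. l \<le> \<bar>f x\<bar>} x \<partial>lborel)"
        using True by (intro nn_integral_cong) (auto simp: indicator_def)
      also have "\<dots> = ennreal (l powr (1 + 2 * real q / N)) * emeasure lborel {x. l \<le> \<bar>f x\<bar>}"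
        by (subst nn_integral_cmult_indicator) (auto simp: a_def)
      also have "\<dots> \<le> ennreal C * (\<integral>\<^sup>+x. ennreal (layer (f x) l * (norm (g x))\<^sup>2) \<partial>lborel)"
        unfolding C_def N_def by (rule superlevel_bound[OF f c q m True int])
      finally show ?thesis using True by simp
    qed simp
  qed
  also have "\<dots> = ennreal C * (\<integral>\<^sup>+l. \<integral>\<^sup>+x. indicator {0..} l * ennreal (layer (f x) l * (norm (g x))\<^sup>2) \<partial>lborel \<partial>lborel)"
    by (rule nn_integral_cmult) measurable
  also have "(\<integral>\<^sup>+l. \<integral>\<^sup>+x. indicator {0..} l * ennreal (layer (f x) l * (norm (g x))\<^sup>2) \<partial>lborel \<partial>lborel)
    = (\<integral>\<^sup>+x. \<integral>\<^sup>+l. indicator {0..} l * ennreal (layer (f x) l * (norm (g x))\<^sup>2) \<partial>lborel \<partial>lborel)"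
    by (rule lborel_pair.Fubini') measurable
  also have "\<dots> \<le> (\<integral>\<^sup>+x. ennreal (2 / 3) * ennreal ((norm (g x))\<^sup>2) \<partial>lborel)"
  proof (rule nn_integral_mono)
    fix x
    have "(\<integral>\<^sup>+l. indicator {0..} l * ennreal (layer (f x) l * (norm (g x))\<^sup>2) \<partial>lborel)
      = (\<integral>\<^sup>+l. indicator {0..} l * ennreal (layer (f x) l) * ennreal ((norm (g x))\<^sup>2) \<partial>lborel)"
      by (intro nn_integral_cong) (simp add: ennreal_mult'' mult.assoc)
    also have "\<dots> = (\<integral>\<^sup>+l. indicator {0..} l * ennreal (layer (f x) l) \<partial>lborel) * ennreal ((norm (g x))\<^sup>2)"
      by (rule nn_integral_multc) measurable
    also have "\<dots> \<le> ennreal (2 / 3) * ennreal ((norm (g x))\<^sup>2)"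
      by (intro mult_right_mono nn_integral_layer_le) auto
    finally show "(\<integral>\<^sup>+l. indicator {0..} l * ennreal (layer (f x) l * (norm (g x))\<^sup>2) \<partial>lborel) \<le> ennreal (2 / 3) * ennreal ((norm (g x))\<^sup>2)" .
  qed
  also have "\<dots> = ennreal (2 / 3) * ?G" by (rule nn_integral_cmult) measurable
  finally have "(\<integral>\<^sup>+x. ennreal (\<bar>f x\<bar> powr a) \<partial>lborel) \<le> ennreal (2 * a) * (ennreal C * (ennreal (2 / 3) * ?G))"
    by (auto simp: mult_left_mono)
  also have "ennreal (2 * a) * (ennreal C * (ennreal (2 / 3) * ?G)) = ennreal (2 * a * (C * (2 / 3))) * ?G"
    using a C ennreal_mult[of "2 * a" "C * (2 / 3)"] ennreal_mult[of C "2 / 3"] by (simp only: mult.assoc)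
  also have "2 * a * (C * (2 / 3)) = GN q N * m powr (2 / N)"
    using m by (simp add: GN_def C_def a_def powr_mult)
  finally show ?thesis by (simp add: a_def)
qed

lemma integrable_of_nn_integral_le:
  fixes h :: "'a \<Rightarrow> real"
  assumes "h \<in> borel_measurable M" "\<And>x. 0 \<le> h x" "(\<integral>\<^sup>+x. ennreal (h x) \<partial>M) \<le> ennreal B" "0 \<le> B"
  shows "integrable M h" "(\<integral>x. h x \<partial>M) \<le> B"
proof -
  show i: "integrable M h"
    using assms by (intro integrableI_bounded) (auto intro: le_less_trans)
  show "(\<integral>x. h x \<partial>M) \<le> B"
    using assms nn_integral_eq_integral[OF i] by (simp add: ennreal_le_iff)
qed

text \<open>The convergent subsequence depends on the ball, so Fatou's lemma is applied on each ball
  separately and monotone convergence then exhausts the space.\<close>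

lemma AE_subseq_lim_fatou:
  fixes u :: "'a::euclidean_space \<Rightarrow> real"
  assumes A: "AE_subseq_lim U u" and m: "\<And>n. U n \<in> borel_measurable borel" "u \<in> borel_measurable borel"
    and b: "\<And>n. (\<integral>\<^sup>+x. ennreal (\<bar>U n x\<bar> powr a) \<partial>lborel) \<le> B" and a: "a > 0"
  shows "(\<integral>\<^sup>+x. ennreal (\<bar>u x\<bar> powr a) \<partial>lborel) \<le> B"
proof -
  note [measurable] = m
  have R: "(\<integral>\<^sup>+x. ennreal (\<bar>u x\<bar> powr a) * indicator (cball 0 (real k)) x \<partial>lborel) \<le> B" for k
  proof -
    obtain s :: "nat \<Rightarrow> nat" where s: "strict_mono s" "AE x in lborel. norm x \<le> real k \<longrightarrow> (\<lambda>n. U (id (s n)) x) \<longlonglongrightarrow> u x"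
      using A strict_mono_id unfolding AE_subseq_lim_def by blast
    have "(\<integral>\<^sup>+x. ennreal (\<bar>u x\<bar> powr a) * indicator (cball 0 (real k)) x \<partial>lborel) \<le>
      (\<integral>\<^sup>+x. liminf (\<lambda>n. ennreal (\<bar>U (s n) x\<bar> powr a)) \<partial>lborel)"
    proof (rule nn_integral_mono_AE)
      show "AE x in lborel. ennreal (\<bar>u x\<bar> powr a) * indicator (cball 0 (real k)) x \<le> liminf (\<lambda>n. ennreal (\<bar>U (s n) x\<bar> powr a))"
        using s(2)
      proof eventually_elim
        case (elim x)
        show ?case
        proof (cases "norm x \<le> real k")
          case True
          then have "(\<lambda>n. U (s n) x) \<longlonglongrightarrow> u x" using elim by simp
          then have "(\<lambda>n. ennreal (\<bar>U (s n) x\<bar> powr a)) \<longlonglongrightarrow> ennreal (\<bar>u x\<bar> powr a)"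
            using a by (intro tendsto_ennrealI tendsto_powr' tendsto_intros) auto
          then have "liminf (\<lambda>n. ennreal (\<bar>U (s n) x\<bar> powr a)) = ennreal (\<bar>u x\<bar> powr a)"
            by (intro lim_imp_Liminf) auto
          then show ?thesis by (simp add: indicator_def)
        qed simp
      qed
    qed
    also have "\<dots> \<le> liminf (\<lambda>n. \<integral>\<^sup>+x. ennreal (\<bar>U (s n) x\<bar> powr a) \<partial>lborel)"
      by (rule nn_integral_liminf) measurable
    also have "\<dots> \<le> B"
      by (rule order_trans[OF Liminf_mono[of _ "\<lambda>n. B"]]) (auto simp: b Liminf_const)
    finally show ?thesis .
  qed
  have "(\<integral>\<^sup>+x. ennreal (\<bar>u x\<bar> powr a) \<partial>lborel) = (SUP k. \<integral>\<^sup>+x. ennreal (\<bar>u x\<bar> powr a) * indicator (cball 0 (real k)) x \<partial>lborel)"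
  proof (subst nn_integral_monotone_convergence_SUP[symmetric])
    show "incseq (\<lambda>k x. ennreal (\<bar>u x\<bar> powr a) * indicator (cball 0 (real k)) x)"
      by (auto simp: incseq_def le_fun_def indicator_def)
    show "(\<integral>\<^sup>+x. ennreal (\<bar>u x\<bar> powr a) \<partial>lborel) = (\<integral>\<^sup>+x. (SUP k. ennreal (\<bar>u x\<bar> powr a) * indicator (cball 0 (real k)) x) \<partial>lborel)"
    proof (rule nn_integral_cong)
      fix x :: 'a
      obtain k where k: "norm x \<le> real k" using real_arch_simple by blast
      show "ennreal (\<bar>u x\<bar> powr a) = (SUP k. ennreal (\<bar>u x\<bar> powr a) * indicator (cball 0 (real k)) x)"
      proof (rule antisym)
        show "ennreal (\<bar>u x\<bar> powr a) \<le> (SUP k. ennreal (\<bar>u x\<bar> powr a) * indicator (cball 0 (real k)) x)"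
          by (rule SUP_upper2[of k]) (use k in auto)
        show "(SUP k. ennreal (\<bar>u x\<bar> powr a) * indicator (cball 0 (real k)) x) \<le> ennreal (\<bar>u x\<bar> powr a)"
          by (rule SUP_least) (auto simp: indicator_def)
      qed
    qed
  qed (auto intro!: borel_measurable_times_ennreal borel_measurable_indicator)
  also have "\<dots> \<le> B" by (rule SUP_least) (rule R)
  finally show ?thesis .
qed

lemma moll_nn_integral_power_le:
  fixes f :: "real ^ 'n \<Rightarrow> 'b::{banach, second_countable_topology}"
  assumes q: "q = 1 \<or> q = (2::nat)" and f: "loc_L1 f" and i: "integrable lborel (\<lambda>x. norm (f x) ^ q)"
  shows "(\<integral>\<^sup>+x. ennreal (norm (moll n f x) ^ q) \<partial>lborel) \<le> ennreal (LBINT x. norm (f x) ^ q)"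
proof -
  have "norm (moll n f x) ^ q \<le> moll n (\<lambda>x. norm (f x) ^ q) x" for x
    using q moll_norm_le[OF f, of n x] moll_norm_square_le[OF f, of n x] integrable_imp_loc_L1[OF i] by auto
  then have "(\<integral>\<^sup>+x. ennreal (norm (moll n f x) ^ q) \<partial>lborel) \<le> (\<integral>\<^sup>+x. ennreal (norm (moll n (\<lambda>x. norm (f x) ^ q) x)) \<partial>lborel)"
    by (intro nn_integral_mono ennreal_leI) (auto intro: order_trans[OF _ abs_ge_self])
  also have "\<dots> = ennreal (LBINT x. norm (moll n (\<lambda>x. norm (f x) ^ q) x))"
    by (rule nn_integral_eq_integral) (use moll_L1(1)[OF i, of n] in auto)
  also have "\<dots> \<le> ennreal (LBINT x. norm (f x) ^ q)"
    using moll_L1(2)[OF i, of n] by (intro ennreal_leI) simp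
  finally show ?thesis .
qed

text \<open>Mollification increases neither of the two integrals on the right, and Fatou recovers
  the left-hand side. Allowing any positive bound \<open>m\<close> in place of the integral itself
  spares a separate case for the zero function.\<close>

theorem gagliardo_nirenberg:
  fixes u :: "real ^ 'n \<Rightarrow> real"
  assumes w: "weak_gradient u g" and q: "q = 1 \<or> q = (2::nat)"
    and iu: "integrable lborel (\<lambda>x. \<bar>u x\<bar> ^ q)" and m: "(LBINT x. \<bar>u x\<bar> ^ q) \<le> m" "m > 0"
    and ig: "integrable lborel (\<lambda>x. (norm (g x))\<^sup>2)"
  defines "N \<equiv> real CARD('n)"
  shows "integrable lborel (\<lambda>x. \<bar>u x\<bar> powr (2 + 2 * real q / N))"
    and "(LBINT x. \<bar>u x\<bar> powr (2 + 2 * real q / N)) \<le> GN q N * m powr (2 / N) * (LBINT x. (norm (g x))\<^sup>2)"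
proof -
  note l = weak_gradient_loc_L1D[OF w]
  have N: "N > 0" by (simp add: N_def)
  have ND: "N = real DIM(real ^ 'n)" by (simp add: N_def)
  let ?G = "LBINT x. (norm (g x))\<^sup>2" and ?a = "2 + 2 * real q / N"
  have G: "?G \<ge> 0" by (rule integral_nonneg_AE) simp
  have GN0: "GN q N * m powr (2 / N) \<ge> 0" using N by (simp add: GN_def)
  have [measurable]: "u \<in> borel_measurable borel" "moll n u \<in> borel_measurable borel" for n
    using l moll_loc_L1[OF l(1)] loc_L1_measurable by auto
  have "(\<integral>\<^sup>+x. ennreal (\<bar>moll n u x\<bar> powr ?a) \<partial>lborel) \<le> ennreal (GN q N * m powr (2 / N) * ?G)" for n
  proof -
    have "(\<integral>\<^sup>+x. ennreal (\<bar>moll n u x\<bar> ^ q) \<partial>lborel) \<le> ennreal m"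
      using moll_nn_integral_power_le[OF q l(1), of n] iu m by (auto intro: order_trans ennreal_leI)
    then have "(\<integral>\<^sup>+x. ennreal (\<bar>moll n u x\<bar> powr ?a) \<partial>lborel)
      \<le> ennreal (GN q N * m powr (2 / N)) * (\<integral>\<^sup>+x. ennreal ((norm (moll n g x))\<^sup>2) \<partial>lborel)"
      unfolding ND by (intro gagliardo_nirenberg_C1[OF weak_gradient_moll[OF w] moll_continuous[OF l(2)] q m(2)])
    also have "\<dots> \<le> ennreal (GN q N * m powr (2 / N)) * ennreal ?G"
      using moll_nn_integral_power_le[of 2 g n] l ig by (intro mult_left_mono) auto
    finally show ?thesis using GN0 G by (simp add: ennreal_mult)
  qed
  then have "(\<integral>\<^sup>+x. ennreal (\<bar>u x\<bar> powr ?a) \<partial>lborel) \<le> ennreal (GN q N * m powr (2 / N) * ?G)"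
    using N by (intro AE_subseq_lim_fatou[OF L1_loc_lim_AE_subseq_lim[OF moll_L1_loc_lim[OF l(1)]]]) (auto intro: add_pos_nonneg)
  from integrable_of_nn_integral_le[OF _ _ this]
  show "integrable lborel (\<lambda>x. \<bar>u x\<bar> powr ?a)" "(LBINT x. \<bar>u x\<bar> powr ?a) \<le> GN q N * m powr (2 / N) * ?G"
    using GN0 G by auto
qed

section \<open>Renormalization\<close>

lemma DERIV_pos_part_square: "DERIV (\<lambda>t::real. (max 0 t)\<^sup>2) t :> 2 * max 0 t"
proof (cases t "0::real" rule: linorder_cases)
  case less
  have "DERIV (\<lambda>t. 0) t :> (0::real)" by simp
  then have "DERIV (\<lambda>t::real. (max 0 t)\<^sup>2) t :> 0"
    by (rule DERIV_cong_ev[THEN iffD1, rotated 3])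
       (use less in \<open>auto simp: eventually_nhds_metric dist_real_def intro!: exI[of _ "-t"]\<close>)
  then show ?thesis using less by simp
next
  case equal
  have "((\<lambda>h::real. (max 0 h)\<^sup>2 / h) \<longlongrightarrow> 0) (at 0)"
  proof (rule Lim_null_comparison)
    show "\<forall>\<^sub>F h in at (0::real). norm ((max 0 h)\<^sup>2 / h) \<le> \<bar>h\<bar>"
      by (rule always_eventually) (auto simp: max_def power2_eq_square)
    show "((\<lambda>h::real. \<bar>h\<bar>) \<longlongrightarrow> 0) (at 0)" by (auto intro!: tendsto_eq_intros)
  qed
  then show ?thesis using equal by (simp add: has_field_derivative_iff)
next
  case greater
  have "DERIV (\<lambda>t. t\<^sup>2) t :> 2 * t" by (auto intro!: derivative_eq_intros)
  then have "DERIV (\<lambda>t::real. (max 0 t)\<^sup>2) t :> 2 * t"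
    by (rule DERIV_cong_ev[THEN iffD1, rotated 3])
       (use greater in \<open>auto simp: eventually_nhds_metric dist_real_def intro!: exI[of _ t]\<close>)
  then show ?thesis using greater by simp
qed

text \<open>The square of the positive part is C1 with an explicit gradient, which is all that
  \<open>C1c\<close> asks for; the support is the ball of radius \<open>1 / e\<close>.\<close>

definition cutoff :: "real \<Rightarrow> 'a::euclidean_space \<Rightarrow> real" where
  "cutoff e x = (max 0 (1 - (e * norm x)\<^sup>2))\<^sup>2"

definition cutoff' :: "real \<Rightarrow> 'a::euclidean_space \<Rightarrow> 'a" where
  "cutoff' e x = (- 4 * e\<^sup>2 * max 0 (1 - (e * norm x)\<^sup>2)) *\<^sub>R x"

lemma cutoff_C1c:
  assumes "e > 0"
  shows "C1c (cutoff e) (cutoff' e :: 'a::euclidean_space \<Rightarrow> 'a)"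
  unfolding C1c_def
proof (intro conjI allI exI[of _ "1 / e"] impI)
  fix x :: 'a
  have "GDERIV (\<lambda>x. 1 - e\<^sup>2 * (x \<bullet> x)) x :> (- 2 * e\<^sup>2) *\<^sub>R x"
    unfolding gderiv_def by (auto intro!: derivative_eq_intros simp: inner_commute)
  from GDERIV_DERIV_compose[OF this DERIV_pos_part_square]
  show "GDERIV (cutoff e) x :> cutoff' e x"
    by (simp add: cutoff_def[abs_def] cutoff'_def power_mult_distrib power2_norm_eq_inner algebra_simps)
next
  show "continuous_on UNIV (cutoff' e :: 'a \<Rightarrow> 'a)" unfolding cutoff'_def by (intro continuous_intros)
next
  fix x :: 'a assume "1 / e < norm x"
  then have "1 < e * norm x" using assms by (simp add: pos_divide_less_eq mult.commute)
  then have "1 \<le> (e * norm x)\<^sup>2" by simp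
  then show "cutoff e x = 0" by (simp add: cutoff_def)
qed

lemma cutoff_bounds: "0 \<le> cutoff e x" "cutoff e x \<le> 1"
proof -
  show "0 \<le> cutoff e x" by (simp add: cutoff_def)
  have "max 0 (1 - (e * norm x)\<^sup>2) \<le> 1" by simp
  then show "cutoff e x \<le> 1" unfolding cutoff_def by (intro power_le_one) auto
qed

lemma cutoff_lower:
  assumes "e * norm x \<le> 1 / 2" "e > 0"
  shows "1 \<le> 2 * cutoff e x"
proof -
  have "(e * norm x)\<^sup>2 \<le> (1/2)\<^sup>2" using assms by (intro power_mono) auto
  then have "3/4 \<le> max 0 (1 - (e * norm x)\<^sup>2)" by (simp add: power2_eq_square)
  then have "(3/4)\<^sup>2 \<le> cutoff e x" unfolding cutoff_def by (rule power_mono) simp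
  then show ?thesis by (simp add: power2_eq_square)
qed

lemma cutoff_tendsto: "(\<lambda>n. cutoff (eps n) x) \<longlonglongrightarrow> 1"
  and cutoff'_tendsto: "(\<lambda>n. cutoff' (eps n) x) \<longlonglongrightarrow> 0"
  and cutoff'_inner_tendsto: "(\<lambda>n. x \<bullet> cutoff' (eps n) x) \<longlonglongrightarrow> 0"
proof -
  have e: "(\<lambda>n. 1 / real (Suc n)) \<longlonglongrightarrow> 0" by (intro LIMSEQ_Suc lim_1_over_n)
  have "(\<lambda>n. cutoff (eps n) x) \<longlonglongrightarrow> (max 0 (1 - (0 * norm x)\<^sup>2))\<^sup>2"
    unfolding cutoff_def by (intro tendsto_intros e)
  then show "(\<lambda>n. cutoff (eps n) x) \<longlonglongrightarrow> 1" by simp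
  have "(\<lambda>n. cutoff' (eps n) x) \<longlonglongrightarrow> (- 4 * 0\<^sup>2 * max 0 (1 - (0 * norm x)\<^sup>2)) *\<^sub>R x"
    unfolding cutoff'_def by (intro tendsto_intros e)
  then show c: "(\<lambda>n. cutoff' (eps n) x) \<longlonglongrightarrow> 0" by simp
  show "(\<lambda>n. x \<bullet> cutoff' (eps n) x) \<longlonglongrightarrow> 0"
    using tendsto_inner[OF tendsto_const c, of x] by simp
qed

text \<open>The second bound is invariant under scaling, hence uniform in e. It dominates the error
  terms of the Pohozaev identity, where the gradient of the cutoff is multiplied by x.\<close>

lemma cutoff'_norm_le:
  assumes "e > 0"
  shows "norm (cutoff' e x) \<le> 4 * e" "norm x * norm (cutoff' e x) \<le> 4"
proof -
  define s where "s = e * norm x"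
  have s: "s \<ge> 0" using assms by (simp add: s_def)
  have b: "max 0 (1 - s\<^sup>2) * s \<le> 1 \<and> max 0 (1 - s\<^sup>2) * s\<^sup>2 \<le> 1"
  proof (cases "s \<le> 1")
    case True
    then have "s\<^sup>2 \<le> 1" "0 \<le> s\<^sup>2" using s by (auto simp: power_le_one)
    then have "max 0 (1 - s\<^sup>2) = 1 - s\<^sup>2" "0 \<le> 1 - s\<^sup>2" "1 - s\<^sup>2 \<le> 1" by auto
    then show ?thesis using s True \<open>s\<^sup>2 \<le> 1\<close> by (simp only:) (simp add: mult_le_one)
  next
    case False
    then have "1 \<le> s\<^sup>2" by simp
    then show ?thesis by simp
  qed
  have n1: "norm (cutoff' e x) = 4 * e * (max 0 (1 - s\<^sup>2) * s)"
    unfolding cutoff'_def norm_scaleR using assms s_def by (simp add: abs_mult power2_eq_square[of e])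
  have n2: "norm x * norm (cutoff' e x) = 4 * (max 0 (1 - s\<^sup>2) * s\<^sup>2)"
  proof -
    have "norm x * norm (cutoff' e x) = 4 * (max 0 (1 - s\<^sup>2) * (e\<^sup>2 * (norm x)\<^sup>2))"
      unfolding cutoff'_def norm_scaleR using s_def by (simp add: abs_mult power2_eq_square[of "norm x"])
    then show ?thesis by (simp add: s_def power_mult_distrib)
  qed
  show "norm (cutoff' e x) \<le> 4 * e"
    using n1 mult_left_mono[OF conjunct1[OF b], of "4 * e"] assms by linarith
  show "norm x * norm (cutoff' e x) \<le> 4" using n2 b by linarith
qed

section \<open>Damping functions and their monotone companions\<close>

definition damp :: "real \<Rightarrow> real \<Rightarrow> real" where
  "damp e s = 1 / (1 + (e * s)\<^sup>2)"

definition damp' :: "real \<Rightarrow> real \<Rightarrow> real" where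
  "damp' e s = - 2 * e\<^sup>2 * s / (1 + (e * s)\<^sup>2)\<^sup>2"

text \<open>Made so that its derivative is positive and dominates \<open>|damp' e s|\<close>, while
  \<open>ramp\<close> itself stays bounded by 2 and tends to 0 pointwise as e tends to 0.\<close>

definition ramp :: "real \<Rightarrow> real \<Rightarrow> real" where
  "ramp e s = 2 * (e * s) / sqrt (1 + (e * s)\<^sup>2)"

definition ramp' :: "real \<Rightarrow> real \<Rightarrow> real" where
  "ramp' e s = 2 * e / ((1 + (e * s)\<^sup>2) * sqrt (1 + (e * s)\<^sup>2))"

lemma DERIV_damp: "DERIV (damp e) s :> damp' e s"
  unfolding damp_def[abs_def] damp'_def using one_plus_square_pos[of "e * s"]
  by (auto intro!: derivative_eq_intros simp: power2_eq_square)

lemma damp'_continuous: "continuous_on UNIV (damp' e)"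
  unfolding damp'_def using one_plus_square_pos by (intro continuous_intros) auto

lemma damp_bounds: "0 \<le> damp e s" "damp e s \<le> 1" "\<bar>damp e s\<bar> \<le> 1"
  using one_plus_square_pos[of "e * s"] by (auto simp: damp_def)

lemma DERIV_ramp: "DERIV (ramp e) s :> ramp' e s"
proof -
  define r where "r = sqrt (1 + (e * s)\<^sup>2)"
  have pos: "1 + (e * s)\<^sup>2 > 0" by (rule one_plus_square_pos)
  have r: "r > 0" "r\<^sup>2 = 1 + (e * s)\<^sup>2" using pos by (auto simp: r_def)
  have ds: "DERIV (\<lambda>s. sqrt (1 + (e * s)\<^sup>2)) s :> e\<^sup>2 * s / r"
    using pos unfolding r_def by (auto intro!: derivative_eq_intros simp: power2_eq_square field_simps)
  have "DERIV (ramp e) s :> (2 * e * r - 2 * (e * s) * (e\<^sup>2 * s / r)) / (r * r)"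
    unfolding ramp_def[abs_def] r_def
    by (rule DERIV_divide) (use ds pos in \<open>auto intro!: derivative_eq_intros simp: r_def\<close>)
  also have "(2 * e * r - 2 * (e * s) * (e\<^sup>2 * s / r)) / (r * r) = 2 * e * (r\<^sup>2 - (e * s)\<^sup>2) / (r\<^sup>2 * r)"
    using r(1) by (simp add: field_simps power2_eq_square)
  also have "\<dots> = ramp' e s" using r(2) by (simp add: ramp'_def r_def)
  finally show ?thesis .
qed

lemma ramp'_continuous: "continuous_on UNIV (ramp' e)"
  unfolding ramp'_def using one_plus_square_pos by (intro continuous_intros) auto

lemma ramp_bound: "\<bar>ramp e s\<bar> \<le> 2"
proof -
  have "\<bar>e * s\<bar> \<le> sqrt (1 + (e * s)\<^sup>2)" by (rule real_le_rsqrt) simp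
  then show ?thesis using one_plus_square_pos[of "e * s"] by (simp add: ramp_def abs_div divide_le_eq)
qed

lemma damp'_le_ramp':
  assumes "e > 0"
  shows "\<bar>damp' e s\<bar> \<le> ramp' e s"
proof -
  define r where "r = sqrt (1 + (e * s)\<^sup>2)"
  have pos: "1 + (e * s)\<^sup>2 > 0" by (rule one_plus_square_pos)
  have r: "r > 0" "r\<^sup>2 = 1 + (e * s)\<^sup>2" using pos by (auto simp: r_def)
  have "\<bar>e * s\<bar> \<le> r" unfolding r_def by (rule real_le_rsqrt) simp
  then have "2 * e * \<bar>e * s\<bar> / (r\<^sup>2 * r\<^sup>2) \<le> 2 * e * r / (r\<^sup>2 * r\<^sup>2)"
    using assms r by (intro divide_right_mono mult_left_mono) auto
  then have "2 * e * \<bar>e * s\<bar> / (r\<^sup>2 * r\<^sup>2) \<le> ramp' e s"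
    unfolding ramp'_def r_def[symmetric] r(2)[symmetric] using r(1) by (simp add: power2_eq_square)
  moreover have "2 * e * \<bar>e * s\<bar> / (r\<^sup>2 * r\<^sup>2) = \<bar>damp' e s\<bar>"
  proof -
    have "damp' e s = - (2 * e * (e * s) / (r\<^sup>2 * r\<^sup>2))"
      unfolding damp'_def r(2) power2_eq_square[of "1 + (e * s)\<^sup>2"] by (simp add: power2_eq_square[of e] mult_ac)
    then show ?thesis using assms by (simp add: abs_div abs_mult)
  qed
  ultimately show ?thesis by simp
qed

lemma damp_tendsto: "(\<lambda>n. damp (eps n) s) \<longlonglongrightarrow> 1"
  and ramp_tendsto: "(\<lambda>n. ramp (eps n) s) \<longlonglongrightarrow> 0"
proof -
  have e: "(\<lambda>n. 1 / real (Suc n)) \<longlonglongrightarrow> 0" by (intro LIMSEQ_Suc lim_1_over_n)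
  have "(\<lambda>n. damp (eps n) s) \<longlonglongrightarrow> 1 / (1 + (0 * s)\<^sup>2)"
    unfolding damp_def by (intro tendsto_intros e) simp
  then show "(\<lambda>n. damp (eps n) s) \<longlonglongrightarrow> 1" by simp
  have "(\<lambda>n. ramp (eps n) s) \<longlonglongrightarrow> 2 * (0 * s) / sqrt (1 + (0 * s)\<^sup>2)"
    unfolding ramp_def by (intro tendsto_intros e) simp
  then show "(\<lambda>n. ramp (eps n) s) \<longlonglongrightarrow> 0" by simp
qed

section \<open>The renormalized equation\<close>

lemma loc_L1_mult_bounded:
  fixes f :: "'a::euclidean_space \<Rightarrow> 'b::{banach, second_countable_topology}"
  assumes "loc_L1 f" "h \<in> borel_measurable borel" "\<And>x. \<bar>h x\<bar> \<le> M"
  shows "loc_L1 (\<lambda>x. h x *\<^sub>R f x)"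
  by (rule loc_L1I_bound[OF assms(1), where M=M])
     (use assms loc_L1_measurable[OF assms(1)] in \<open>auto intro!: mult_right_mono\<close>)

lemma loc_L1_inner_bounded:
  fixes f :: "'a::euclidean_space \<Rightarrow> 'b::euclidean_space"
  assumes "loc_L1 f" "h \<in> borel_measurable borel" "\<And>x. norm (h x) \<le> M"
  shows "loc_L1 (\<lambda>x. f x \<bullet> h x)"
proof (rule loc_L1I_bound[OF assms(1), where M=M])
  fix x
  have "\<bar>f x \<bullet> h x\<bar> \<le> norm (f x) * norm (h x)" by (rule Cauchy_Schwarz_ineq2)
  also have "\<dots> \<le> norm (f x) * M" by (rule mult_left_mono[OF assms(3)]) simp
  finally show "norm (f x \<bullet> h x) \<le> M * norm (f x)" by (simp add: mult.commute)
qed (use assms loc_L1_measurable[OF assms(1)] in auto)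

lemma loc_L1_integrable_compact_support:
  assumes "loc_L1 f" "\<And>x. R < norm x \<Longrightarrow> f x = 0"
  shows "integrable lborel f"
  by (rule loc_L1_integrable_bound[OF assms(1), where R=R and M=1]) (use assms loc_L1_measurable in auto)

text \<open>Mollifying the equation, testing with \<open>damp e (z\<^sub>n) \<phi>\<close> leaves an error carried by
  \<open>damp' e (z\<^sub>n) |\<nabla>z\<^sub>n|^2\<close>, which testing with the monotone function \<open>ramp e (z\<^sub>n) \<theta>\<close> controls
  without any information on \<open>|\<nabla>z|^2\<close>.\<close>
lemma renormalization_error:
  fixes z :: "real ^ 'n \<Rightarrow> real"
  assumes z: "weak_gradient z G" and k: "weak_divergence G k" and e: "e > 0"
    and \<phi>: "C1c \<phi> \<psi>" and \<theta>: "C1c \<theta> \<theta>'" and le: "\<And>x. \<bar>\<phi> x\<bar> \<le> \<theta> x"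
  shows "\<bar>(LBINT x. damp e (z x) *\<^sub>R (G x \<bullet> \<psi> x)) - (LBINT x. damp e (z x) *\<^sub>R (\<phi> x *\<^sub>R k x))\<bar> \<le>
    (LBINT x. ramp e (z x) *\<^sub>R (\<theta> x *\<^sub>R k x)) - (LBINT x. ramp e (z x) *\<^sub>R (G x \<bullet> \<theta>' x))"
proof -
  have l: "loc_L1 z" "loc_L1 G" "loc_L1 k" using z k by (auto simp: weak_gradient_def weak_divergence_def)
  define Z where "Z n = moll n z" for n
  define H where "H n = moll n G" for n
  define K where "K n = moll n k" for n
  have lZ: "L1_loc_lim Z z" "L1_loc_lim H G" "L1_loc_lim K k" unfolding Z_def H_def K_def by (intro moll_L1_loc_lim l)+
  have GZ: "GDERIV (Z n) x :> H n x" for n x unfolding Z_def H_def by (rule weak_gradient_moll[OF z])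
  have cZ: "continuous_on UNIV (Z n)" "continuous_on UNIV (H n)" "continuous_on UNIV (K n)" for n
    unfolding Z_def H_def K_def by (intro moll_continuous l)+
  obtain R M where R: "\<And>x. R < norm x \<Longrightarrow> \<phi> x = 0" "\<And>x. R < norm x \<Longrightarrow> \<psi> x = 0"
    "\<And>x. \<bar>\<phi> x\<bar> \<le> M" "\<And>x. norm (\<psi> x) \<le> M" "continuous_on UNIV \<phi>" "continuous_on UNIV \<psi>" using C1c_E[OF \<phi>] by metis
  obtain R' M' where R': "\<And>x. R' < norm x \<Longrightarrow> \<theta> x = 0" "\<And>x. R' < norm x \<Longrightarrow> \<theta>' x = 0"
    "\<And>x. \<bar>\<theta> x\<bar> \<le> M'" "\<And>x. norm (\<theta>' x) \<le> M'" "continuous_on UNIV \<theta>" "continuous_on UNIV \<theta>'" using C1c_E[OF \<theta>] by metis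
  have dc: "continuous_on UNIV (damp e)" "continuous_on UNIV (ramp e)"
    using DERIV_damp DERIV_ramp by (auto intro!: continuous_at_imp_continuous_on DERIV_isCont)
  have dc': "isCont (damp e) s" "isCont (ramp e) s" for s
    using DERIV_damp DERIV_ramp by (auto intro!: DERIV_isCont)
  have mZ: "z \<in> borel_measurable borel" "Z n \<in> borel_measurable borel" for n
    using l(1) cZ(1) by (auto intro: loc_L1_measurable borel_measurable_continuous_onI)
  have [measurable]: "\<phi> \<in> borel_measurable borel" "\<psi> \<in> borel_measurable borel" "\<theta> \<in> borel_measurable borel" "\<theta>' \<in> borel_measurable borel"
    "damp e \<in> borel_measurable borel" "ramp e \<in> borel_measurable borel"
    using R R' dc by (auto intro: borel_measurable_continuous_onI)
  note [measurable] = mZ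
  have AZ: "AE_subseq_lim (\<lambda>n x. damp e (Z n x)) (\<lambda>x. damp e (z x))" "AE_subseq_lim (\<lambda>n x. ramp e (Z n x)) (\<lambda>x. ramp e (z x))"
    using dc' by (auto intro!: AE_subseq_lim_compose[OF L1_loc_lim_AE_subseq_lim[OF lZ(1)]])
  have in1: "L1_loc_lim (\<lambda>n x. \<psi> x \<bullet> H n x) (\<lambda>x. \<psi> x \<bullet> G x)"
    by (rule L1_loc_lim_inner[OF AE_subseq_lim_const, of _ M]) (use R lZ in auto)
  have in2: "L1_loc_lim (\<lambda>n x. \<phi> x *\<^sub>R K n x) (\<lambda>x. \<phi> x *\<^sub>R k x)"
    by (rule L1_loc_lim_mult[OF AE_subseq_lim_const, of _ M]) (use R lZ in auto)
  have in3: "L1_loc_lim (\<lambda>n x. \<theta>' x \<bullet> H n x) (\<lambda>x. \<theta>' x \<bullet> G x)"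
    by (rule L1_loc_lim_inner[OF AE_subseq_lim_const, of _ M']) (use R' lZ in auto)
  have in4: "L1_loc_lim (\<lambda>n x. \<theta> x *\<^sub>R K n x) (\<lambda>x. \<theta> x *\<^sub>R k x)"
    by (rule L1_loc_lim_mult[OF AE_subseq_lim_const, of _ M']) (use R' lZ in auto)
  have t1: "(\<lambda>n. LBINT x. damp e (Z n x) *\<^sub>R (\<psi> x \<bullet> H n x)) \<longlonglongrightarrow> (LBINT x. damp e (z x) *\<^sub>R (\<psi> x \<bullet> G x))"
    by (rule L1_loc_lim_integral[OF L1_loc_lim_mult[OF AZ(1) _ _ _ _ in1, of 1], of R]) (use R damp_bounds in auto)
  have t2: "(\<lambda>n. LBINT x. damp e (Z n x) *\<^sub>R (\<phi> x *\<^sub>R K n x)) \<longlonglongrightarrow> (LBINT x. damp e (z x) *\<^sub>R (\<phi> x *\<^sub>R k x))"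
    by (rule L1_loc_lim_integral[OF L1_loc_lim_mult[OF AZ(1) _ _ _ _ in2, of 1], of R]) (use R damp_bounds in auto)
  have t3: "(\<lambda>n. LBINT x. ramp e (Z n x) *\<^sub>R (\<theta>' x \<bullet> H n x)) \<longlonglongrightarrow> (LBINT x. ramp e (z x) *\<^sub>R (\<theta>' x \<bullet> G x))"
    by (rule L1_loc_lim_integral[OF L1_loc_lim_mult[OF AZ(2) _ _ _ _ in3, of 2], of R']) (use R' ramp_bound in auto)
  have t4: "(\<lambda>n. LBINT x. ramp e (Z n x) *\<^sub>R (\<theta> x *\<^sub>R K n x)) \<longlonglongrightarrow> (LBINT x. ramp e (z x) *\<^sub>R (\<theta> x *\<^sub>R k x))"
    by (rule L1_loc_lim_integral[OF L1_loc_lim_mult[OF AZ(2) _ _ _ _ in4, of 2], of R']) (use R' ramp_bound in auto)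
  have bound: "\<bar>(LBINT x. damp e (Z n x) *\<^sub>R (\<psi> x \<bullet> H n x)) - (LBINT x. damp e (Z n x) *\<^sub>R (\<phi> x *\<^sub>R K n x))\<bar> \<le>
    (LBINT x. ramp e (Z n x) *\<^sub>R (\<theta> x *\<^sub>R K n x)) - (LBINT x. ramp e (Z n x) *\<^sub>R (\<theta>' x \<bullet> H n x))" for n
  proof -
    \<comment> \<open>The mollified equation tested with \<open>T (Z n x) * \<phi>0 x\<close>. The
      gradient of \<open>T (Z n x)\<close> produces the quadratic term on the right, which is
      harmless for fixed n but has no known limit.\<close>
    have test: "(LBINT x. T (Z n x) *\<^sub>R (\<psi>0 x \<bullet> H n x)) - (LBINT x. T (Z n x) *\<^sub>R (\<phi>0 x *\<^sub>R K n x))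
        = - (LBINT x. \<phi>0 x * T' (Z n x) * (norm (H n x))\<^sup>2)
        \<and> integrable lborel (\<lambda>x. \<phi>0 x * T' (Z n x) * (norm (H n x))\<^sup>2)"
      if C: "C1c \<phi>0 \<psi>0" and T: "\<And>s. DERIV T s :> T' s" "continuous_on UNIV T'" for \<phi>0 \<psi>0 T T'
    proof -
      obtain R where R: "\<And>x. R < norm x \<Longrightarrow> \<phi>0 x = 0" "\<And>x. R < norm x \<Longrightarrow> \<psi>0 x = 0"
        "continuous_on UNIV \<phi>0" "continuous_on UNIV \<psi>0" using C1c_E[OF C] by metis
      have cT: "continuous_on UNIV T" using T(1) by (auto intro!: continuous_at_imp_continuous_on DERIV_isCont)
      have D: "GDERIV (\<lambda>x. T (Z n x)) x :> T' (Z n x) *\<^sub>R H n x" for x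
        by (rule GDERIV_DERIV_compose[OF GZ T(1)])
      have cTZ: "continuous_on UNIV (\<lambda>x. T' (Z n x))" "continuous_on UNIV (\<lambda>x. T (Z n x))"
        using cZ by (auto intro!: continuous_on_compose2[OF T(2)] continuous_on_compose2[OF cT])
      have "C1c (\<lambda>x. T (Z n x) * \<phi>0 x) (\<lambda>x. T (Z n x) *\<^sub>R \<psi>0 x + \<phi>0 x *\<^sub>R (T' (Z n x) *\<^sub>R H n x))"
        by (rule C1c_mult_left[OF C D]) (intro continuous_intros cTZ cZ)
      from weak_divergence_moll[OF k this, of n]
      have eq: "(LBINT x. T (Z n x) *\<^sub>R (\<psi>0 x \<bullet> H n x) + \<phi>0 x * T' (Z n x) * (norm (H n x))\<^sup>2) = (LBINT x. T (Z n x) *\<^sub>R (\<phi>0 x *\<^sub>R K n x))"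
        by (simp add: H_def[symmetric] K_def[symmetric] inner_add_right power2_norm_eq_inner inner_commute mult_ac)
      have i1: "integrable lborel (\<lambda>x. T (Z n x) *\<^sub>R (\<psi>0 x \<bullet> H n x))"
        by (rule loc_L1_integrable_compact_support[OF continuous_loc_L1, of _ R]) (use R in \<open>auto intro!: continuous_intros cTZ cZ\<close>)
      have i2: "integrable lborel (\<lambda>x. \<phi>0 x * T' (Z n x) * (norm (H n x))\<^sup>2)"
        by (rule loc_L1_integrable_compact_support[OF continuous_loc_L1, of _ R]) (use R in \<open>auto intro!: continuous_intros cTZ cZ\<close>)
      show ?thesis using eq i1 i2 by (simp add: Bochner_Integration.integral_add)
    qed
    note d = test[OF \<phi> DERIV_damp[of e] damp'_continuous] and c = test[OF \<theta> DERIV_ramp[of e] ramp'_continuous]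
    \<comment> \<open>The quadratic term for \<open>damp\<close> is dominated by the one for
      \<open>ramp\<close>, and the \<open>ramp\<close> equation expresses the latter through terms
      that are linear in \<open>H n\<close> and \<open>K n\<close>.\<close>
    have "\<bar>LBINT x. \<phi> x * damp' e (Z n x) * (norm (H n x))\<^sup>2\<bar> \<le> (LBINT x. \<bar>\<phi> x * damp' e (Z n x) * (norm (H n x))\<^sup>2\<bar>)"
      by (rule integral_abs_bound)
    also have "\<dots> \<le> (LBINT x. \<theta> x * ramp' e (Z n x) * (norm (H n x))\<^sup>2)"
    proof (rule integral_mono)
      fix x
      have "0 \<le> \<theta> x" using le[of x] by linarith
      then have "\<bar>\<phi> x\<bar> * \<bar>damp' e (Z n x)\<bar> \<le> \<theta> x * ramp' e (Z n x)"
        using le damp'_le_ramp'[OF e] by (intro mult_mono) auto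
      then show "\<bar>\<phi> x * damp' e (Z n x) * (norm (H n x))\<^sup>2\<bar> \<le> \<theta> x * ramp' e (Z n x) * (norm (H n x))\<^sup>2"
        unfolding abs_mult by (simp add: mult_right_mono)
    qed (use c d in auto)
    finally show ?thesis using c d by linarith
  qed
  \<comment> \<open>What is left is linear in \<open>H n\<close> and \<open>K n\<close> with bounded
    coefficients, so local integrability of \<open>G\<close> and \<open>k\<close> is enough for the
    limit.\<close>
  have "\<bar>(LBINT x. damp e (z x) *\<^sub>R (\<psi> x \<bullet> G x)) - (LBINT x. damp e (z x) *\<^sub>R (\<phi> x *\<^sub>R k x))\<bar> \<le>
    (LBINT x. ramp e (z x) *\<^sub>R (\<theta> x *\<^sub>R k x)) - (LBINT x. ramp e (z x) *\<^sub>R (\<theta>' x \<bullet> G x))"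
    by (rule LIMSEQ_le[OF tendsto_rabs[OF tendsto_diff[OF t1 t2]] tendsto_diff[OF t4 t3]]) (use bound in blast)
  then show ?thesis by (simp add: inner_commute)
qed

text \<open>Formally, the equation for \<open>G\<close> tested with
  \<open>T (u x) * \<phi> x\<close>. Two limits are taken in turn: first u is mollified for fixed e,
  where \<open>X2\<close> makes the damped flux locally square integrable and its product with the
  mollified gradient of u converges; then e tends to 0, where \<open>lT\<close> provides the
  majorant.\<close>

theorem renormalized_equation:
  fixes z u :: "real ^ 'n \<Rightarrow> real"
  assumes z: "weak_gradient z G" and k: "weak_divergence G k" and u: "weak_gradient u g" and g2: "loc_L1 (\<lambda>x. (norm (g x))\<^sup>2)"
    and X2: "\<And>e. e > 0 \<Longrightarrow> loc_L1 (\<lambda>x. (norm (damp e (z x) *\<^sub>R G x))\<^sup>2)"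
    and T: "\<And>s. DERIV T s :> T' s" "continuous_on UNIV T'" "\<And>s. \<bar>T s\<bar> \<le> B" "\<And>s. \<bar>T' s\<bar> \<le> B"
    and lT: "loc_L1 (\<lambda>x. T' (u x) * (G x \<bullet> g x))" and \<phi>: "C1c \<phi> \<psi>"
  shows "(LBINT x. T (u x) * (G x \<bullet> \<psi> x) + \<phi> x * (T' (u x) * (G x \<bullet> g x))) = (LBINT x. k x * T (u x) * \<phi> x)"
proof -
  have l: "loc_L1 z" "loc_L1 G" "loc_L1 k" "loc_L1 u" "loc_L1 g" using z k u by (auto simp: weak_gradient_def weak_divergence_def)
  obtain R M where R: "R > 0" "M > 0" "\<And>x. R < norm x \<Longrightarrow> \<phi> x = 0" "\<And>x. R < norm x \<Longrightarrow> \<psi> x = 0"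
    "\<And>x. \<bar>\<phi> x\<bar> \<le> M" "\<And>x. norm (\<psi> x) \<le> M" "continuous_on UNIV \<phi>" "continuous_on UNIV \<psi>" using C1c_E[OF \<phi>] by metis
  have B: "B \<ge> 0" using T(3)[of 0] by linarith
  have cT: "continuous_on UNIV T" using T(1) by (auto intro!: continuous_at_imp_continuous_on DERIV_isCont)
  have cT': "isCont T s" "isCont T' s" for s using cT T(2) by (auto simp: continuous_on_eq_continuous_at)
  have [measurable]: "\<phi> \<in> borel_measurable borel" "\<psi> \<in> borel_measurable borel" "T \<in> borel_measurable borel" "T' \<in> borel_measurable borel"
    "z \<in> borel_measurable borel" "u \<in> borel_measurable borel" "G \<in> borel_measurable borel" "g \<in> borel_measurable borel" "k \<in> borel_measurable borel"
    using R cT T(2) l by (auto intro: borel_measurable_continuous_onI loc_L1_measurable)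
  have mdc: "damp e \<in> borel_measurable borel" "ramp e \<in> borel_measurable borel" for e
    using DERIV_damp DERIV_ramp by (auto intro!: borel_measurable_continuous_onI continuous_at_imp_continuous_on DERIV_isCont)
  note [measurable] = mdc
  \<comment> \<open>On the ball of radius R, which contains the support of \<open>\<phi>\<close>,
    this scale gives \<open>d * norm x \<le> 1/2\<close>, the range in which
    \<open>cutoff_lower\<close> applies.\<close>
  define d where "d = 1 / (2 * R)"
  have d: "d > 0" using R by (simp add: d_def)
  \<comment> \<open>Dominates \<open>T (U n x) * \<phi> x\<close> for all n simultaneously, so the
    error \<open>E e\<close> does not depend on the mollification of u.\<close>
  define \<theta> where "\<theta> x = (2 * (B * M)) * cutoff d x" for x :: "real ^ 'n"
  define \<theta>' where "\<theta>' x = (2 * (B * M)) *\<^sub>R cutoff' d x + cutoff d x *\<^sub>R (0 :: real ^ 'n)" for x :: "real ^ 'n"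
  have \<theta>: "C1c \<theta> \<theta>'" unfolding \<theta>_def[abs_def] \<theta>'_def[abs_def]
    by (rule C1c_mult_left[OF cutoff_C1c[OF d]]) (auto intro: GDERIV_const)
  obtain R' M' where R': "\<And>x. R' < norm x \<Longrightarrow> \<theta> x = 0" "\<And>x. R' < norm x \<Longrightarrow> \<theta>' x = 0"
    "\<And>x. \<bar>\<theta> x\<bar> \<le> M'" "\<And>x. norm (\<theta>' x) \<le> M'" "continuous_on UNIV \<theta>" "continuous_on UNIV \<theta>'" using C1c_E[OF \<theta>] by metis
  have [measurable]: "\<theta> \<in> borel_measurable borel" "\<theta>' \<in> borel_measurable borel"
    using R' by (auto intro: borel_measurable_continuous_onI)
  have dom: "\<bar>t * \<phi> x\<bar> \<le> \<theta> x" if "\<bar>t\<bar> \<le> B" for t x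
  proof (cases "norm x \<le> R")
    case True
    then have "1 \<le> 2 * cutoff d x" using R(1) d by (intro cutoff_lower) (auto simp: d_def)
    then have "(B * M) * 1 \<le> (B * M) * (2 * cutoff d x)" using B R by (intro mult_left_mono) auto
    moreover have "\<bar>t\<bar> * \<bar>\<phi> x\<bar> \<le> B * M" using that R B by (intro mult_mono) auto
    ultimately show ?thesis by (simp add: \<theta>_def abs_mult)
  next
    case False
    then show ?thesis using R(3)[of x] B R cutoff_bounds(1)[of d x] by (simp add: \<theta>_def)
  qed
  define U where "U n = moll n u" for n
  define V where "V n = moll n g" for n
  have lU: "L1_loc_lim U u" "L1_loc_lim V g" "L1_loc_lim (\<lambda>n x. (norm (V n x))\<^sup>2) (\<lambda>x. (norm (g x))\<^sup>2)"
    unfolding U_def V_def by (intro moll_L1_loc_lim moll_square_L1_loc_lim l g2)+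
  have GU: "GDERIV (U n) x :> V n x" for n x unfolding U_def V_def by (rule weak_gradient_moll[OF u])
  have cU: "continuous_on UNIV (U n)" "continuous_on UNIV (V n)" for n
    unfolding U_def V_def by (intro moll_continuous l)+
  have [measurable]: "U n \<in> borel_measurable borel" "V n \<in> borel_measurable borel" for n
    using cU by (auto intro: borel_measurable_continuous_onI)
  have AU: "AE_subseq_lim (\<lambda>n x. T (U n x)) (\<lambda>x. T (u x))" "AE_subseq_lim (\<lambda>n x. T' (U n x)) (\<lambda>x. T' (u x))"
    using cT' by (auto intro!: AE_subseq_lim_compose[OF L1_loc_lim_AE_subseq_lim[OF lU(1)]])
  define E where "E e = (LBINT x. ramp e (z x) *\<^sub>R (\<theta> x *\<^sub>R k x)) - (LBINT x. ramp e (z x) *\<^sub>R (G x \<bullet> \<theta>' x))" for e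
  have step: "\<bar>(LBINT x. damp e (z x) *\<^sub>R (T (u x) * (G x \<bullet> \<psi> x) + \<phi> x * (T' (u x) * (G x \<bullet> g x))))
      - (LBINT x. damp e (z x) *\<^sub>R (k x * T (u x) * \<phi> x))\<bar> \<le> E e" if e: "e > 0" for e
  proof -
    define X where "X x = damp e (z x) *\<^sub>R G x" for x
    have lX: "loc_L1 X" unfolding X_def by (rule loc_L1_mult_bounded[OF l(2), where M=1]) (use damp_bounds in auto)
    have lXV: "L1_loc_lim (\<lambda>n x. X x \<bullet> V n x) (\<lambda>x. X x \<bullet> g x)"
      by (rule L1_loc_lim_square_bilinear[OF bounded_bilinear_inner L1_loc_lim_const[OF lX] L1_loc_lim_const lU(2,3)])
         (use X2[OF e] in \<open>simp add: X_def\<close>)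
    have l1: "L1_loc_lim (\<lambda>n x. T' (U n x) *\<^sub>R (X x \<bullet> V n x)) (\<lambda>x. T' (u x) *\<^sub>R (X x \<bullet> g x))"
      by (rule L1_loc_lim_mult[OF AU(2) _ _ _ _ lXV, of B]) (use T in auto)
    have l2: "L1_loc_lim (\<lambda>n x. \<phi> x *\<^sub>R (T' (U n x) *\<^sub>R (X x \<bullet> V n x))) (\<lambda>x. \<phi> x *\<^sub>R (T' (u x) *\<^sub>R (X x \<bullet> g x)))"
      by (rule L1_loc_lim_mult[OF AE_subseq_lim_const _ _ _ _ l1, of _ M]) (use R in auto)
    have l3: "L1_loc_lim (\<lambda>n x. T (U n x) *\<^sub>R (X x \<bullet> \<psi> x)) (\<lambda>x. T (u x) *\<^sub>R (X x \<bullet> \<psi> x))"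
      by (rule L1_loc_lim_mult[OF AU(1) _ _ _ _ L1_loc_lim_const, of B])
         (use T R in \<open>auto intro!: loc_L1_inner_bounded[OF lX, where M=M]\<close>)
    have t1: "(\<lambda>n. LBINT x. T (U n x) *\<^sub>R (X x \<bullet> \<psi> x) + \<phi> x *\<^sub>R (T' (U n x) *\<^sub>R (X x \<bullet> V n x)))
      \<longlonglongrightarrow> (LBINT x. T (u x) *\<^sub>R (X x \<bullet> \<psi> x) + \<phi> x *\<^sub>R (T' (u x) *\<^sub>R (X x \<bullet> g x)))"
      by (rule L1_loc_lim_integral[OF L1_loc_lim_add[OF l3 l2], of R]) (use R in auto)
    have lk: "loc_L1 (\<lambda>x. damp e (z x) *\<^sub>R (\<phi> x *\<^sub>R k x))"
      by (intro loc_L1_mult_bounded[where M=1] loc_L1_mult_bounded[where M=M] l) (use damp_bounds R in auto)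
    have t2: "(\<lambda>n. LBINT x. T (U n x) *\<^sub>R (damp e (z x) *\<^sub>R (\<phi> x *\<^sub>R k x)))
      \<longlonglongrightarrow> (LBINT x. T (u x) *\<^sub>R (damp e (z x) *\<^sub>R (\<phi> x *\<^sub>R k x)))"
      by (rule L1_loc_lim_integral[OF L1_loc_lim_mult[OF AU(1) _ _ _ _ L1_loc_lim_const[OF lk], of B], of R]) (use R T in auto)
    have b: "\<bar>(LBINT x. T (U n x) *\<^sub>R (X x \<bullet> \<psi> x) + \<phi> x *\<^sub>R (T' (U n x) *\<^sub>R (X x \<bullet> V n x)))
       - (LBINT x. T (U n x) *\<^sub>R (damp e (z x) *\<^sub>R (\<phi> x *\<^sub>R k x)))\<bar> \<le> E e" for n
    proof -
      have D: "GDERIV (\<lambda>x. T (U n x)) x :> T' (U n x) *\<^sub>R V n x" for x by (rule GDERIV_DERIV_compose[OF GU T(1)])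
      have "C1c (\<lambda>x. T (U n x) * \<phi> x) (\<lambda>x. T (U n x) *\<^sub>R \<psi> x + \<phi> x *\<^sub>R (T' (U n x) *\<^sub>R V n x))"
        by (rule C1c_mult_left[OF \<phi> D]) (intro continuous_intros continuous_on_compose2[OF T(2)] cU, auto)
      from renormalization_error[OF z k e this \<theta> dom[OF T(3)]]
      show ?thesis unfolding E_def X_def by (simp add: inner_add_right mult_ac algebra_simps)
    qed
    have "\<bar>(LBINT x. T (u x) *\<^sub>R (X x \<bullet> \<psi> x) + \<phi> x *\<^sub>R (T' (u x) *\<^sub>R (X x \<bullet> g x)))
       - (LBINT x. T (u x) *\<^sub>R (damp e (z x) *\<^sub>R (\<phi> x *\<^sub>R k x)))\<bar> \<le> E e"
      by (rule LIMSEQ_le_const2[OF tendsto_rabs[OF tendsto_diff[OF t1 t2]]]) (use b in blast)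
    then show ?thesis unfolding X_def by (simp add: mult_ac algebra_simps)
  qed
  have AD: "AE_subseq_lim (\<lambda>n x. damp (eps n) (z x)) (\<lambda>x. 1)" "AE_subseq_lim (\<lambda>n x. ramp (eps n) (z x)) (\<lambda>x. 0)"
    by (intro AE_subseq_lim_pointwise damp_tendsto ramp_tendsto)+
  have la: "loc_L1 (\<lambda>x. T (u x) * (G x \<bullet> \<psi> x) + \<phi> x * (T' (u x) * (G x \<bullet> g x)))"
    using loc_L1_add[OF loc_L1_mult_bounded[OF loc_L1_inner_bounded[OF l(2), of \<psi> M], of "\<lambda>x. T (u x)" B] loc_L1_mult_bounded[OF lT, of \<phi> M]]
      T R by simp
  have lb: "loc_L1 (\<lambda>x. k x * T (u x) * \<phi> x)"
    using loc_L1_mult_bounded[OF loc_L1_mult_bounded[OF l(3), of \<phi> M], of "\<lambda>x. T (u x)" B] T R by (simp add: mult_ac)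
  have lc: "loc_L1 (\<lambda>x. \<theta> x *\<^sub>R k x)" by (rule loc_L1_mult_bounded[OF l(3)]) (use R' in auto)
  have ld: "loc_L1 (\<lambda>x. G x \<bullet> \<theta>' x)" by (rule loc_L1_inner_bounded[OF l(2)]) (use R' in auto)
  have t1: "(\<lambda>n. LBINT x. damp (eps n) (z x) *\<^sub>R (T (u x) * (G x \<bullet> \<psi> x) + \<phi> x * (T' (u x) * (G x \<bullet> g x))))
     \<longlonglongrightarrow> (LBINT x. 1 *\<^sub>R (T (u x) * (G x \<bullet> \<psi> x) + \<phi> x * (T' (u x) * (G x \<bullet> g x))))"
    by (rule L1_loc_lim_integral[OF L1_loc_lim_mult[OF AD(1) _ _ _ _ L1_loc_lim_const[OF la], of 1], of R]) (use R damp_bounds in auto)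
  have t2: "(\<lambda>n. LBINT x. damp (eps n) (z x) *\<^sub>R (k x * T (u x) * \<phi> x))
     \<longlonglongrightarrow> (LBINT x. 1 *\<^sub>R (k x * T (u x) * \<phi> x))"
    by (rule L1_loc_lim_integral[OF L1_loc_lim_mult[OF AD(1) _ _ _ _ L1_loc_lim_const[OF lb], of 1], of R]) (use R damp_bounds in auto)
  have t3: "(\<lambda>n. LBINT x. ramp (eps n) (z x) *\<^sub>R (\<theta> x *\<^sub>R k x)) \<longlonglongrightarrow> (LBINT x. 0 *\<^sub>R (\<theta> x *\<^sub>R k x))"
    by (rule L1_loc_lim_integral[OF L1_loc_lim_mult[OF AD(2) _ _ _ _ L1_loc_lim_const[OF lc], of 2], of R']) (use R' ramp_bound in auto)
  have t4: "(\<lambda>n. LBINT x. ramp (eps n) (z x) *\<^sub>R (G x \<bullet> \<theta>' x)) \<longlonglongrightarrow> (LBINT x. 0 *\<^sub>R (G x \<bullet> \<theta>' x))"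
    by (rule L1_loc_lim_integral[OF L1_loc_lim_mult[OF AD(2) _ _ _ _ L1_loc_lim_const[OF ld], of 2], of R']) (use R' ramp_bound in auto)
  \<comment> \<open>The error carries the factor \<open>ramp\<close>, bounded by 2 and tending to 0,
    in front of functions that are integrable because \<open>\<theta>\<close> has bounded
    support.\<close>
  have "(\<lambda>n. E (eps n)) \<longlonglongrightarrow> 0"
    using tendsto_diff[OF t3 t4] by (simp add: E_def)
  from LIMSEQ_le[OF tendsto_rabs[OF tendsto_diff[OF t1 t2]] this]
  have "\<bar>(LBINT x. 1 *\<^sub>R (T (u x) * (G x \<bullet> \<psi> x) + \<phi> x * (T' (u x) * (G x \<bullet> g x)))) - (LBINT x. 1 *\<^sub>R (k x * T (u x) * \<phi> x))\<bar> \<le> 0"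
    using step by auto
  then show ?thesis by simp
qed

section \<open>The Pohozaev identity\<close>

lemma grad_rho_component:
  fixes n defines "c \<equiv> real (Suc n)"
  defines "Z \<equiv> (LBINT y. bump 0 (c *\<^sub>R y + 0 :: real ^ 'n))"
  shows "grad (rho n) (x :: real ^ 'n) $ i = (- 2 * c\<^sup>2 / Z) * (bump 2 (c *\<^sub>R x + 0) * x $ i)"
proof -
  have "GDERIV (\<lambda>x::real^'n. inverse Z * bump 0 (c *\<^sub>R x + 0)) x :>
     inverse Z *\<^sub>R (c *\<^sub>R ((bump (0+2) (c *\<^sub>R x + 0) - real 0 * bump (0+1) (c *\<^sub>R x + 0)) *\<^sub>R (-2) *\<^sub>R (c *\<^sub>R x + 0))) + bump 0 (c *\<^sub>R x + 0) *\<^sub>R 0"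
    by (intro GDERIV_mult GDERIV_const GDERIV_affine GDERIV_bump)
  moreover have "rho n = (\<lambda>x::real^'n. inverse Z * bump 0 (c *\<^sub>R x + 0))"
    by (auto simp: rho_def[abs_def] Z_def c_def divide_inverse mult.commute)
  ultimately have "grad (rho n) x = inverse Z *\<^sub>R (c *\<^sub>R ((bump (0+2) (c *\<^sub>R x + 0) - real 0 * bump (0+1) (c *\<^sub>R x + 0)) *\<^sub>R (-2) *\<^sub>R (c *\<^sub>R x + 0))) + bump 0 (c *\<^sub>R x + 0) *\<^sub>R 0"
    by (intro grad_eq_of_GDERIV) simp
  then show ?thesis by (simp add: divide_inverse power2_eq_square flip: numeral_2_eq_2)
qed

text \<open>The mollifier is radial, so its second derivatives are visibly symmetric.\<close>
lemma rho_second_derivative: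
  fixes n
  defines "D \<equiv> (\<lambda>i x. grad (\<lambda>x::real^'n. grad (rho n) x $ i) x)"
  shows "C1c (\<lambda>x::real^'n. grad (rho n) x $ i) (D i)" and "D i x $ j = D j x $ i"
proof -
  define c where "c = real (Suc n)"
  define Z where "Z = (LBINT y. bump 0 (c *\<^sub>R y + 0 :: real ^ 'n))"
  have "C_k k (\<lambda>x::real^'n. grad (rho n) x $ i)" for k
    using C_k_SucD(2)[OF rho_C_k] .
  moreover have "grad (rho n) x $ i = 0" if "1 / real (Suc n) < norm x" for x :: "real^'n"
    using GDERIV_zero_outside[OF C_k_SucD(1)[OF rho_C_k] rho_zero that] by simp
  ultimately show "C1c (\<lambda>x::real^'n. grad (rho n) x $ i) (D i)"
    unfolding D_def by (rule C_k_imp_C1c)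
  have "GDERIV (\<lambda>x::real^'n. (- 2 * c\<^sup>2 / Z) * (bump 2 (c *\<^sub>R x + 0) * x $ i)) x :>
      (- 2 * c\<^sup>2 / Z) *\<^sub>R (bump 2 (c *\<^sub>R x + 0) *\<^sub>R axis i 1 + x $ i *\<^sub>R (c *\<^sub>R ((bump (2+2) (c *\<^sub>R x + 0) - real 2 * bump (2+1) (c *\<^sub>R x + 0)) *\<^sub>R (-2) *\<^sub>R (c *\<^sub>R x + 0))))
      + (bump 2 (c *\<^sub>R x + 0) * x $ i) *\<^sub>R 0" for i
  proof (intro GDERIV_mult GDERIV_const GDERIV_affine GDERIV_bump)
    show "GDERIV (\<lambda>x::real^'n. x $ i) x :> axis i 1"
      unfolding gderiv_def by (auto simp: inner_axis intro!: bounded_linear_imp_has_derivative bounded_linear_vec_nth)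
  qed
  then have "D i x = (- 2 * c\<^sup>2 / Z) *\<^sub>R (bump 2 (c *\<^sub>R x + 0) *\<^sub>R axis i 1 + x $ i *\<^sub>R (c *\<^sub>R ((bump (2+2) (c *\<^sub>R x + 0) - real 2 * bump (2+1) (c *\<^sub>R x + 0)) *\<^sub>R (-2) *\<^sub>R (c *\<^sub>R x + 0))))
      + (bump 2 (c *\<^sub>R x + 0) * x $ i) *\<^sub>R 0" for i
    unfolding D_def grad_rho_component c_def[symmetric] Z_def[symmetric] by (intro grad_eq_of_GDERIV) simp
  then show "D i x $ j = D j x $ i"
    by (simp add: axis_def)
qed

text \<open>The fields \<open>B j\<close> are the rows of the Hessian of the smooth function
  \<open>moll n v\<close>. Its symmetry is inherited from the second derivatives of the kernel, once
  the weak gradient has been used to move both derivatives onto it.\<close>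

lemma moll_gradient_derivative:
  fixes v :: "real ^ 'n \<Rightarrow> real"
  assumes w: "weak_gradient v a"
  obtains B where "\<And>j x. GDERIV (\<lambda>x. moll n a x $ j) x :> B j x" "\<And>j. continuous_on UNIV (B j)"
    "\<And>i j x. B i x $ j = B j x $ i"
proof -
  have l: "loc_L1 v" "loc_L1 a" using w by (auto simp: weak_gradient_def)
  have [measurable]: "v \<in> borel_measurable borel" "a \<in> borel_measurable borel" using l loc_L1_measurable by auto
  have la: "loc_L1 (\<lambda>x. a x $ j)" for j by (rule loc_L1I_bound[OF l(2), where M=1]) (auto simp: component_le_norm_cart)
  define D where "D i x = grad (\<lambda>x::real^'n. grad (rho n) x $ i) x" for i x
  have D: "C1c (\<lambda>x. grad (rho n) x $ i) (D i)" "D i x $ j = D j x $ i" for i j x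
    unfolding D_def[abs_def] using rho_second_derivative[of n] by auto
  obtain M where M: "\<And>x. norm (grad (rho n) x :: real^'n) \<le> M" and gc: "continuous_on UNIV (grad (rho n) :: real^'n \<Rightarrow> _)"
    using C1c_E[OF rho_C1c[of n]] by metis
  have gz: "grad (rho n) x = 0" if "1 < norm x" for x :: "real^'n"
    using GDERIV_zero_outside[OF C_k_SucD(1)[OF rho_C_k] rho_zero' that] .
  have [measurable]: "(grad (rho n) :: real^'n \<Rightarrow> _) \<in> borel_measurable borel" using gc by (rule borel_measurable_continuous_onI)
  define B where "B j x = (LBINT y. a y $ j *\<^sub>R grad (rho n) (x - y))" for j x
  have far: "1 < norm (x - y)" if "1 + norm x < norm y" for x y :: "real^'n"
    using that norm_triangle_ineq2[of y x] by (simp add: norm_minus_commute)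
  have iB: "integrable lborel (\<lambda>y. a y $ j *\<^sub>R grad (rho n) (x - y))" for j x
    by (rule loc_L1_integrable_bound[OF la[of j], where R="1 + norm x" and M=M])
       (use M gz far in \<open>auto simp: mult.commute[of M] intro!: mult_left_mono\<close>)
  have comp: "moll n a x $ j = (LBINT y. rho n (x - y) * a y $ j)" for j x
    unfolding moll_def using integral_bounded_linear[OF bounded_linear_vec_nth moll_integrable[OF l(2), of n x], of j] by simp
  show ?thesis
  proof
    show "GDERIV (\<lambda>x. moll n a x $ j) x :> B j x" for j x
      unfolding comp B_def by (rule GDERIV_convolution[OF rho_C1c la])
    show "continuous_on UNIV (B j)" for j
      unfolding B_def
    proof (rule integral_param_continuous[OF la[of j], where R=1 and M=M])
      show "continuous_on UNIV (\<lambda>x. a y $ j *\<^sub>R grad (rho n) (x - y))" for y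
        by (intro continuous_intros continuous_on_compose2[OF gc]) auto
    qed (use M gz in \<open>auto simp: mult.commute[of M] intro!: mult_left_mono\<close>)
    show "B i x $ j = B j x $ i" for i j x
    proof -
      have "B i x $ j = (LBINT y. v y * D j (x - y) $ i)" for i j
      proof -
        have bc: "B i x $ j = (LBINT y. grad (rho n) (x - y) $ j * a y $ i)"
          unfolding B_def using integral_bounded_linear[OF bounded_linear_vec_nth[of j] iB[of i x]] by (simp add: mult.commute)
        have C: "C1c (\<lambda>y. grad (rho n) ((-1) *\<^sub>R y + x) $ j) (\<lambda>y. (-1) *\<^sub>R D j ((-1) *\<^sub>R y + x))"
          by (rule C1c_affine[OF D(1)]) simp
        obtain R M where R: "\<And>y. R < norm y \<Longrightarrow> grad (rho n) ((-1) *\<^sub>R y + x) $ j = 0" "\<And>y. R < norm y \<Longrightarrow> (-1) *\<^sub>R D j ((-1) *\<^sub>R y + x) = 0"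
          "\<And>y. \<bar>grad (rho n) ((-1) *\<^sub>R y + x) $ j\<bar> \<le> M" "\<And>y. norm ((-1) *\<^sub>R D j ((-1) *\<^sub>R y + x)) \<le> M"
          using C1c_E[OF C] by metis
        have "continuous_on UNIV (D j)" using D(1)[of j] by (elim C1c_E)
        then have [measurable]: "D j \<in> borel_measurable borel" by (rule borel_measurable_continuous_onI)
        have m: "(\<lambda>y. D j (x - y)) \<in> borel_measurable borel" by measurable
        have i1: "integrable lborel (\<lambda>y. v y *\<^sub>R ((-1) *\<^sub>R D j ((-1) *\<^sub>R y + x)))"
          by (rule loc_L1_integrable_bound[OF l(1), where R=R and M=M])
             (use R m in \<open>auto simp: mult.commute[of M] intro!: mult_left_mono borel_measurable_scaleR\<close>)
        have i2: "integrable lborel (\<lambda>y. grad (rho n) ((-1) *\<^sub>R y + x) $ j *\<^sub>R a y)"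
          by (rule loc_L1_integrable_bound[OF l(2), where R=R and M=M]) (use R in \<open>auto intro!: mult_right_mono\<close>)
        have "(LBINT y. v y *\<^sub>R ((-1) *\<^sub>R D j ((-1) *\<^sub>R y + x))) = - (LBINT y. grad (rho n) ((-1) *\<^sub>R y + x) $ j *\<^sub>R a y)"
          using w C unfolding weak_gradient_def by blast
        from arg_cong[OF this, of "\<lambda>p. p $ i"] show ?thesis
          using integral_bounded_linear[OF bounded_linear_vec_nth i1, of i] integral_bounded_linear[OF bounded_linear_vec_nth i2, of i]
          unfolding bc by simp
      qed
      then show ?thesis using D(2) by simp
    qed
  qed
qed

text \<open>Testing with \<open>\<xi> \<partial>\<^sub>j v\<close>: the inner-variation (stress-energy) identity.\<close>
lemma stress_identity:
  fixes v :: "real ^ 'n \<Rightarrow> real"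
  assumes w: "weak_gradient v a" and d: "weak_divergence a f" and a2: "loc_L1 (\<lambda>x. (norm (a x))\<^sup>2)" and f2: "loc_L1 (\<lambda>x. (norm (f x))\<^sup>2)"
    and C: "C1c \<xi> \<xi>'"
  shows "(LBINT x. \<xi>' x \<bullet> (a x $ j *\<^sub>R a x)) - (LBINT x. (norm (a x))\<^sup>2 *\<^sub>R \<xi>' x) $ j / 2
    = (LBINT x. \<xi> x *\<^sub>R (f x * a x $ j))"
proof -
  have l: "loc_L1 v" "loc_L1 a" "loc_L1 f" using w d by (auto simp: weak_gradient_def weak_divergence_def)
  obtain R where R: "\<And>x. R < norm x \<Longrightarrow> \<xi> x = 0" "\<And>x. R < norm x \<Longrightarrow> \<xi>' x = 0"
    "continuous_on UNIV \<xi>" "continuous_on UNIV \<xi>'" using C1c_E[OF C] by metis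
  have lA: "L1_loc_lim (\<lambda>n. moll n a) a" "L1_loc_lim (\<lambda>n x. (norm (moll n a x))\<^sup>2) (\<lambda>x. (norm (a x))\<^sup>2)"
    "L1_loc_lim (\<lambda>n. moll n f) f" "L1_loc_lim (\<lambda>n x. (norm (moll n f x))\<^sup>2) (\<lambda>x. (norm (f x))\<^sup>2)"
    by (intro moll_L1_loc_lim moll_square_L1_loc_lim l a2 f2)+
  have b1: "bounded_bilinear (\<lambda>(p :: real^'n) (q :: real^'n). p $ j *\<^sub>R q)"
    by (rule bounded_bilinear.comp1[OF bounded_bilinear_scaleR bounded_linear_vec_nth])
  have b2: "bounded_bilinear (\<lambda>(p :: real) (q :: real^'n). p * q $ j)"
    by (rule bounded_bilinear.comp[OF bounded_bilinear_mult bounded_linear_ident bounded_linear_vec_nth])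
  have t1: "(\<lambda>n. LBINT x. \<xi>' x \<bullet> (moll n a x $ j *\<^sub>R moll n a x)) \<longlonglongrightarrow> (LBINT x. \<xi>' x \<bullet> (a x $ j *\<^sub>R a x))"
    by (rule L1_loc_lim_C1c[OF L1_loc_lim_square_bilinear[OF b1 lA(1,2) lA(1,2)] C])
  have t2: "(\<lambda>n. (LBINT x. (norm (moll n a x))\<^sup>2 *\<^sub>R \<xi>' x) $ j) \<longlonglongrightarrow> (LBINT x. (norm (a x))\<^sup>2 *\<^sub>R \<xi>' x) $ j"
    by (rule tendsto_vec_nth[OF L1_loc_lim_scaleR_C1c[OF lA(2) C]])
  have t3: "(\<lambda>n. LBINT x. \<xi> x *\<^sub>R (moll n f x * moll n a x $ j)) \<longlonglongrightarrow> (LBINT x. \<xi> x *\<^sub>R (f x * a x $ j))"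
    by (rule L1_loc_lim_C1c_scaleR[OF L1_loc_lim_square_bilinear[OF b2 lA(3,4) lA(1,2)] C])
  have "(LBINT x. \<xi>' x \<bullet> (moll n a x $ j *\<^sub>R moll n a x)) - (LBINT x. (norm (moll n a x))\<^sup>2 *\<^sub>R \<xi>' x) $ j / 2
    = (LBINT x. \<xi> x *\<^sub>R (moll n f x * moll n a x $ j))" for n
  proof -
    define A where "A = moll n a"
    obtain B where B: "\<And>j x. GDERIV (\<lambda>x. A x $ j) x :> B j x" "\<And>j. continuous_on UNIV (B j)" "\<And>i j x. B i x $ j = B j x $ i"
      using moll_gradient_derivative[OF w, of n] unfolding A_def by metis
    have cA: "continuous_on UNIV A" unfolding A_def by (rule moll_continuous[OF l(2)])
    have "C1c (\<lambda>x. A x $ j * \<xi> x) (\<lambda>x. A x $ j *\<^sub>R \<xi>' x + \<xi> x *\<^sub>R B j x)"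
      by (rule C1c_mult_left[OF C B(1,2)])
    from weak_divergence_moll[OF d this, of n]
    have eq: "(LBINT x. \<xi>' x \<bullet> (A x $ j *\<^sub>R A x) + \<xi> x * (A x \<bullet> B j x)) = (LBINT x. \<xi> x *\<^sub>R (moll n f x * A x $ j))"
      by (simp add: A_def[symmetric] inner_add_right inner_commute mult_ac)
    \<comment> \<open>The gradient of \<open>|A|^2\<close>. By symmetry of the Hessian its j-th
      component is \<open>2 (A x \<bullet> B j x)\<close>, so the second-order term of the tested
      equation is a pure derivative and can be integrated by parts.\<close>
    define Q where "Q x = (\<Sum>i\<in>UNIV. (2 * A x $ i) *\<^sub>R B i x)" for x
    have GQ: "GDERIV (\<lambda>x. (norm (A x))\<^sup>2) x :> Q x" for x
    proof -
      have "((\<lambda>x. \<Sum>i\<in>UNIV. A x $ i * A x $ i) has_derivative (\<lambda>h. \<Sum>i\<in>UNIV. A x $ i * (h \<bullet> B i x) + (h \<bullet> B i x) * A x $ i)) (at x)"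
        using B(1) by (intro has_derivative_sum has_derivative_mult) (simp_all add: gderiv_def)
      moreover have "(\<lambda>h. \<Sum>i\<in>UNIV. A x $ i * (h \<bullet> B i x) + (h \<bullet> B i x) * A x $ i) = (\<lambda>h. h \<bullet> Q x)"
        by (auto simp: Q_def inner_sum_right intro!: sum.cong)
      moreover have "(\<lambda>x. (norm (A x))\<^sup>2) = (\<lambda>x. \<Sum>i\<in>UNIV. A x $ i * A x $ i)"
        by (simp only: power2_norm_eq_inner inner_vec_def inner_real_def)
      ultimately show ?thesis by (simp add: gderiv_def)
    qed
    have cQ: "continuous_on UNIV Q" unfolding Q_def by (intro continuous_intros cA B(2))
    have Qj: "Q x $ j = 2 * (A x \<bullet> B j x)" for x
    proof -
      have "Q x $ j = (\<Sum>i\<in>UNIV. 2 * (A x $ i * B j x $ i))"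
        unfolding Q_def by (simp add: B(3)[of _ x j] mult.assoc)
      then show ?thesis by (simp add: inner_vec_def sum_distrib_left)
    qed
    have iQ: "integrable lborel (\<lambda>x. \<xi> x *\<^sub>R Q x)" and i1: "integrable lborel (\<lambda>x. \<xi>' x \<bullet> (A x $ j *\<^sub>R A x))"
      and i2: "integrable lborel (\<lambda>x. \<xi> x * (A x \<bullet> B j x))"
      by (rule loc_L1_integrable_compact_support[OF continuous_loc_L1, of _ R]; use R in \<open>auto intro!: continuous_intros cA cQ B(2)\<close>)+
    have "(LBINT x. (norm (A x))\<^sup>2 *\<^sub>R \<xi>' x) = - (LBINT x. \<xi> x *\<^sub>R Q x)"
      using weak_gradient_C1[OF GQ cQ] C unfolding weak_gradient_def by blast
    then have "(LBINT x. (norm (A x))\<^sup>2 *\<^sub>R \<xi>' x) $ j = - (LBINT x. \<xi> x * (2 * (A x \<bullet> B j x)))"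
      using integral_bounded_linear[OF bounded_linear_vec_nth iQ, of j] by (simp add: Qj)
    also have "\<dots> = - 2 * (LBINT x. \<xi> x * (A x \<bullet> B j x))"
    proof -
      have "(\<lambda>x. \<xi> x * (2 * (A x \<bullet> B j x))) = (\<lambda>x. 2 * (\<xi> x * (A x \<bullet> B j x)))" by auto
      then show ?thesis by simp
    qed
    finally show ?thesis using eq i1 i2 by (simp add: A_def)
  qed
  then show ?thesis
    using LIMSEQ_unique[OF tendsto_diff[OF t1 tendsto_divide[OF t2 tendsto_const[of 2]]]] t3 by simp
qed

section \<open>Global identities for square integrable data\<close>

lemma integrable_inner_square:
  fixes a b :: "'a::euclidean_space \<Rightarrow> 'b::euclidean_space"
  assumes [measurable]: "a \<in> borel_measurable borel" "b \<in> borel_measurable borel"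
    and "integrable lborel (\<lambda>x. (norm (a x))\<^sup>2)" "integrable lborel (\<lambda>x. (norm (b x))\<^sup>2)"
  shows "integrable lborel (\<lambda>x. norm (a x) * norm (b x))" "integrable lborel (\<lambda>x. a x \<bullet> b x)"
proof -
  have *: "norm (a x) * norm (b x) \<le> (norm (a x))\<^sup>2 + (norm (b x))\<^sup>2" for x
  proof -
    have "0 \<le> (norm (a x) - norm (b x))\<^sup>2" "0 \<le> norm (a x) * norm (b x)" by auto
    then show ?thesis unfolding power2_diff by linarith
  qed
  have i: "integrable lborel (\<lambda>x. (norm (a x))\<^sup>2 + (norm (b x))\<^sup>2)" using assms by auto
  show "integrable lborel (\<lambda>x. norm (a x) * norm (b x))"
    by (rule Bochner_Integration.integrable_bound[OF i]) (use * in auto)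
  show "integrable lborel (\<lambda>x. a x \<bullet> b x)"
    by (rule Bochner_Integration.integrable_bound[OF i])
       (use order_trans[OF Cauchy_Schwarz_ineq2 *] in auto)
qed

text \<open>The stress identity with \<open>\<xi> = x $ j * cutoff e x\<close>, summed over j.
  Because \<open>f x *\<^sub>R a x\<close> is the gradient of \<open>\<Phi>\<close>, the right-hand
  side is minus the integral of \<open>\<Phi>\<close> times the divergence of
  \<open>cutoff e x *\<^sub>R x\<close>; that divergence tends to N as the cutoff is
  removed.\<close>

theorem pohozaev_identity:
  fixes v :: "real ^ 'n \<Rightarrow> real"
  assumes w: "weak_gradient v a" and d: "weak_divergence a f"
    and a2: "integrable lborel (\<lambda>x. (norm (a x))\<^sup>2)" and f2: "integrable lborel (\<lambda>x. (norm (f x))\<^sup>2)"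
    and \<Phi>: "weak_gradient \<Phi> (\<lambda>x. f x *\<^sub>R a x)" "integrable lborel \<Phi>"
  shows "(1 - real CARD('n) / 2) * (LBINT x. (norm (a x))\<^sup>2) = - real CARD('n) * (LBINT x. \<Phi> x)"
proof -
  let ?N = "real CARD('n)"
  have l: "loc_L1 v" "loc_L1 a" "loc_L1 f" "loc_L1 \<Phi>" using w d \<Phi> by (auto simp: weak_gradient_def weak_divergence_def)
  have [measurable]: "a \<in> borel_measurable borel" "f \<in> borel_measurable borel" "\<Phi> \<in> borel_measurable borel"
    using l loc_L1_measurable by auto
  have fa: "integrable lborel (\<lambda>x. \<bar>f x\<bar> * norm (a x))"
  proof -
    have "integrable lborel (\<lambda>x. (norm (norm (a x)))\<^sup>2)" using a2 by simp
    from integrable_inner_square(1)[OF _ _ f2 this] show ?thesis by simp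
  qed
  \<comment> \<open>The coefficient \<open>1 - N/2\<close> collects the identity part of the
    derivative of \<open>cutoff e x *\<^sub>R x\<close>; all other terms on the left contain the
    gradient of the cutoff and vanish in the limit.\<close>
  have local: "(LBINT x. (x \<bullet> a x) * (a x \<bullet> cutoff' e x) + (1 - ?N / 2) * (cutoff e x * (norm (a x))\<^sup>2) - (x \<bullet> cutoff' e x) * (norm (a x))\<^sup>2 / 2)
      = - (LBINT x. \<Phi> x * (x \<bullet> cutoff' e x + ?N * cutoff e x))" if e: "e > 0" for e
  proof -
    define \<xi>' where "\<xi>' j x = x $ j *\<^sub>R cutoff' e x + cutoff e x *\<^sub>R axis j 1" for j and x :: "real^'n"
    have C: "C1c (\<lambda>x. x $ j * cutoff e x) (\<xi>' j)" for j
      unfolding \<xi>'_def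
    proof (rule C1c_mult_left[OF cutoff_C1c[OF e]])
      show "GDERIV (\<lambda>x::real^'n. x $ j) x :> axis j 1" for x
        unfolding gderiv_def by (auto simp: inner_axis intro!: bounded_linear_imp_has_derivative bounded_linear_vec_nth)
    qed simp
    have [measurable]: "\<xi>' j \<in> borel_measurable borel" "(cutoff e :: real^'n \<Rightarrow> real) \<in> borel_measurable borel" "(cutoff' e :: real^'n \<Rightarrow> _) \<in> borel_measurable borel" for j
      using C[of j] cutoff_C1c[OF e] by (auto elim!: C1c_E intro: borel_measurable_continuous_onI)
    have ax: "axis j (1::real) $ j = 1" for j :: 'n by (simp add: axis_def)
    have zero: "\<exists>R M. (\<forall>x. R < norm x \<longrightarrow> \<xi>' j x = 0) \<and> (\<forall>x. norm (\<xi>' j x) \<le> M) \<and> (\<forall>x. R < norm x \<longrightarrow> x $ j * cutoff e x = 0) \<and> (\<forall>x. \<bar>x $ j * cutoff e x\<bar> \<le> M)" for j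
      using C[of j] by (elim C1c_E) blast
    have j: "(LBINT x. \<xi>' j x \<bullet> (a x $ j *\<^sub>R a x) - (norm (a x))\<^sup>2 * \<xi>' j x $ j / 2) = - (LBINT x. \<Phi> x * \<xi>' j x $ j)
       \<and> integrable lborel (\<lambda>x. \<xi>' j x \<bullet> (a x $ j *\<^sub>R a x) - (norm (a x))\<^sup>2 * \<xi>' j x $ j / 2) \<and> integrable lborel (\<lambda>x. \<Phi> x * \<xi>' j x $ j)" for j
    proof -
      obtain R M where R: "\<And>x. R < norm x \<Longrightarrow> \<xi>' j x = 0" "\<And>x. norm (\<xi>' j x) \<le> M" "\<And>x. R < norm x \<Longrightarrow> x $ j * cutoff e x = 0" "\<And>x. \<bar>x $ j * cutoff e x\<bar> \<le> M"
        using zero[of j] by blast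
      have M: "M \<ge> 0" using R(2)[of 0] norm_ge_zero order_trans by blast
      have i1: "integrable lborel (\<lambda>x. \<xi>' j x \<bullet> (a x $ j *\<^sub>R a x))"
      proof (rule Bochner_Integration.integrable_bound[OF integrable_mult_right[OF a2, of M]])
        show "AE x in lborel. norm (\<xi>' j x \<bullet> (a x $ j *\<^sub>R a x)) \<le> norm (M * (norm (a x))\<^sup>2)"
        proof (rule AE_I2)
          fix x
          have "\<bar>\<xi>' j x \<bullet> (a x $ j *\<^sub>R a x)\<bar> \<le> norm (\<xi>' j x) * (\<bar>a x $ j\<bar> * norm (a x))"
            using Cauchy_Schwarz_ineq2[of "\<xi>' j x" "a x $ j *\<^sub>R a x"] by simp
          also have "\<dots> \<le> M * (norm (a x) * norm (a x))"
            using R(2) M by (intro mult_mono mult_right_mono component_le_norm_cart) auto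
          finally show "norm (\<xi>' j x \<bullet> (a x $ j *\<^sub>R a x)) \<le> norm (M * (norm (a x))\<^sup>2)"
            using M by (simp add: power2_eq_square abs_mult)
        qed
      qed measurable
      have i2: "integrable lborel (\<lambda>x. (norm (a x))\<^sup>2 *\<^sub>R \<xi>' j x)"
        by (rule Bochner_Integration.integrable_bound[OF integrable_mult_right[OF a2, of M]])
           (use R(2) M in \<open>auto simp: mult.commute[of M] abs_mult intro!: mult_left_mono\<close>)
      have i3: "integrable lborel (\<lambda>x. \<Phi> x *\<^sub>R \<xi>' j x)"
        by (rule Bochner_Integration.integrable_bound[OF integrable_mult_right[OF \<Phi>(2), of M]])
           (use R(2) M in \<open>auto simp: mult.commute[of M] abs_mult intro!: mult_left_mono\<close>)
      have i4: "integrable lborel (\<lambda>x. (x $ j * cutoff e x) *\<^sub>R (f x *\<^sub>R a x))"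
        by (rule Bochner_Integration.integrable_bound[OF integrable_mult_right[OF fa, of M]])
           (use R(4) M in \<open>auto simp: abs_mult mult.assoc[symmetric] intro!: mult_right_mono\<close>)
      have n2: "(LBINT x. (norm (a x))\<^sup>2 *\<^sub>R \<xi>' j x) $ j = (LBINT x. (norm (a x))\<^sup>2 * \<xi>' j x $ j)"
        "integrable lborel (\<lambda>x. (norm (a x))\<^sup>2 * \<xi>' j x $ j)"
        using integral_bounded_linear[OF bounded_linear_vec_nth i2, of j] integrable_bounded_linear[OF bounded_linear_vec_nth i2, of j] by auto
      have n3: "(LBINT x. \<Phi> x *\<^sub>R \<xi>' j x) $ j = (LBINT x. \<Phi> x * \<xi>' j x $ j)"
        "integrable lborel (\<lambda>x. \<Phi> x * \<xi>' j x $ j)"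
        using integral_bounded_linear[OF bounded_linear_vec_nth i3, of j] integrable_bounded_linear[OF bounded_linear_vec_nth i3, of j] by auto
      have n4: "(LBINT x. (x $ j * cutoff e x) *\<^sub>R (f x *\<^sub>R a x)) $ j = (LBINT x. (x $ j * cutoff e x) *\<^sub>R (f x * a x $ j))"
        using integral_bounded_linear[OF bounded_linear_vec_nth i4, of j] by (simp add: mult.assoc)
      have "(LBINT x. \<xi>' j x \<bullet> (a x $ j *\<^sub>R a x)) - (LBINT x. (norm (a x))\<^sup>2 *\<^sub>R \<xi>' j x) $ j / 2
        = (LBINT x. (x $ j * cutoff e x) *\<^sub>R (f x * a x $ j))"
        by (rule stress_identity[OF w d _ _ C]) (use integrable_imp_loc_L1 a2 f2 in auto)
      moreover have "(LBINT x. \<Phi> x *\<^sub>R \<xi>' j x) = - (LBINT x. (x $ j * cutoff e x) *\<^sub>R (f x *\<^sub>R a x))"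
        using \<Phi>(1) C unfolding weak_gradient_def by blast
      then have "(LBINT x. \<Phi> x *\<^sub>R \<xi>' j x) $ j = - (LBINT x. (x $ j * cutoff e x) *\<^sub>R (f x *\<^sub>R a x)) $ j"
        by simp
      ultimately have "(LBINT x. \<xi>' j x \<bullet> (a x $ j *\<^sub>R a x)) - (LBINT x. (norm (a x))\<^sup>2 * \<xi>' j x $ j) / 2 = - (LBINT x. \<Phi> x * \<xi>' j x $ j)"
        unfolding n2(1) n3(1) n4 by linarith
      then show ?thesis using i1 n2(2) n3(2) by (simp del: inner_scaleR_right)
    qed
    have "(LBINT x. (\<Sum>j\<in>UNIV. \<xi>' j x \<bullet> (a x $ j *\<^sub>R a x) - (norm (a x))\<^sup>2 * \<xi>' j x $ j / 2)) = - (LBINT x. (\<Sum>j\<in>UNIV. \<Phi> x * \<xi>' j x $ j))"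
      using j by (simp add: Bochner_Integration.integral_sum sum_negf del: inner_scaleR_right)
    moreover have "(\<Sum>j\<in>UNIV. \<xi>' j x \<bullet> (a x $ j *\<^sub>R a x) - (norm (a x))\<^sup>2 * \<xi>' j x $ j / 2)
      = (x \<bullet> a x) * (a x \<bullet> cutoff' e x) + (1 - ?N / 2) * (cutoff e x * (norm (a x))\<^sup>2) - (x \<bullet> cutoff' e x) * (norm (a x))\<^sup>2 / 2" for x
    proof -
      have "(\<Sum>j\<in>UNIV. \<xi>' j x \<bullet> (a x $ j *\<^sub>R a x) - (norm (a x))\<^sup>2 * \<xi>' j x $ j / 2) =
        (\<Sum>j\<in>UNIV. (x $ j * a x $ j) * (a x \<bullet> cutoff' e x) + cutoff e x * (a x $ j * a x $ j) - (norm (a x))\<^sup>2 / 2 * (x $ j * cutoff' e x $ j) - (norm (a x))\<^sup>2 / 2 * cutoff e x)"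
        by (rule sum.cong) (auto simp: \<xi>'_def inner_add_left inner_axis inner_axis' inner_commute ax algebra_simps add_divide_distrib)
      also have "\<dots> = (x \<bullet> a x) * (a x \<bullet> cutoff' e x) + cutoff e x * (a x \<bullet> a x) - (norm (a x))\<^sup>2 / 2 * (x \<bullet> cutoff' e x) - ?N * ((norm (a x))\<^sup>2 / 2 * cutoff e x)"
        by (simp add: sum.distrib sum_subtractf inner_vec_def[of x "a x"] inner_vec_def[of "a x" "a x"] inner_vec_def[of x "cutoff' e x"] sum_distrib_right sum_distrib_left)
      finally show ?thesis by (simp add: power2_norm_eq_inner[symmetric] algebra_simps)
    qed
    moreover have "(\<Sum>j\<in>UNIV. \<Phi> x * \<xi>' j x $ j) = \<Phi> x * (x \<bullet> cutoff' e x + ?N * cutoff e x)" for x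
      by (simp add: \<xi>'_def axis_def inner_vec_def sum.distrib flip: sum_distrib_left)
    ultimately show ?thesis by simp
  qed
  have mc: "(cutoff (eps n) :: real^'n \<Rightarrow> real) \<in> borel_measurable borel" "(cutoff' (eps n) :: real^'n \<Rightarrow> _) \<in> borel_measurable borel" for n
    using cutoff_C1c[of "1 / real (Suc n)", where 'a="real^'n"] by (auto elim!: C1c_E intro: borel_measurable_continuous_onI)
  note [measurable] = mc
  have xc: "\<bar>x \<bullet> cutoff' (eps n) x\<bar> \<le> 4" for n and x :: "real^'n"
    by (rule order_trans[OF Cauchy_Schwarz_ineq2 cutoff'_norm_le(2)]) simp
  have t1: "(\<lambda>n. LBINT x. (x \<bullet> a x) * (a x \<bullet> cutoff' (eps n) x) + (1 - ?N / 2) * (cutoff (eps n) x * (norm (a x))\<^sup>2) - (x \<bullet> cutoff' (eps n) x) * (norm (a x))\<^sup>2 / 2)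
    \<longlonglongrightarrow> (LBINT x. (1 - ?N / 2) * (norm (a x))\<^sup>2)"
  \<comment> \<open>In the majorant, 6 = 4 + 2: the bound 4 on
    \<open>norm x * norm (cutoff' e x)\<close> is used once in full and once with the factor
    1/2.\<close>
  proof (rule integral_dominated_convergence[where w="\<lambda>x. (6 + \<bar>1 - ?N / 2\<bar>) * (norm (a x))\<^sup>2"])
    show "AE x in lborel. (\<lambda>n. (x \<bullet> a x) * (a x \<bullet> cutoff' (eps n) x) + (1 - ?N / 2) * (cutoff (eps n) x * (norm (a x))\<^sup>2) - (x \<bullet> cutoff' (eps n) x) * (norm (a x))\<^sup>2 / 2)
      \<longlonglongrightarrow> (1 - ?N / 2) * (norm (a x))\<^sup>2"
    proof (rule AE_I2)
      fix x :: "real^'n"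
      have "(\<lambda>n. (x \<bullet> a x) * (a x \<bullet> cutoff' (eps n) x) + (1 - ?N / 2) * (cutoff (eps n) x * (norm (a x))\<^sup>2) - (x \<bullet> cutoff' (eps n) x) * (norm (a x))\<^sup>2 / 2)
      \<longlonglongrightarrow> (x \<bullet> a x) * (a x \<bullet> 0) + (1 - ?N / 2) * (1 * (norm (a x))\<^sup>2) - 0 * (norm (a x))\<^sup>2 / 2"
        by (intro tendsto_intros cutoff_tendsto cutoff'_tendsto cutoff'_inner_tendsto) auto
      then show "(\<lambda>n. (x \<bullet> a x) * (a x \<bullet> cutoff' (eps n) x) + (1 - ?N / 2) * (cutoff (eps n) x * (norm (a x))\<^sup>2) - (x \<bullet> cutoff' (eps n) x) * (norm (a x))\<^sup>2 / 2)
      \<longlonglongrightarrow> (1 - ?N / 2) * (norm (a x))\<^sup>2" by simp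
    qed
    show "integrable lborel (\<lambda>x. (6 + \<bar>1 - ?N / 2\<bar>) * (norm (a x))\<^sup>2)" using a2 by simp
    fix n
    show "AE x in lborel. norm ((x \<bullet> a x) * (a x \<bullet> cutoff' (eps n) x) + (1 - ?N / 2) * (cutoff (eps n) x * (norm (a x))\<^sup>2) - (x \<bullet> cutoff' (eps n) x) * (norm (a x))\<^sup>2 / 2)
      \<le> (6 + \<bar>1 - ?N / 2\<bar>) * (norm (a x))\<^sup>2"
    proof (rule AE_I2)
      fix x :: "real^'n"
      let ?c = "cutoff (eps n) x" and ?d = "cutoff' (eps n) x" and ?s = "(norm (a x))\<^sup>2"
      have "\<bar>(x \<bullet> a x) * (a x \<bullet> ?d)\<bar> \<le> (norm x * norm (a x)) * (norm (a x) * norm ?d)"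
        unfolding abs_mult by (intro mult_mono Cauchy_Schwarz_ineq2) auto
      also have "\<dots> = (norm x * norm ?d) * ?s" by (simp add: power2_eq_square mult_ac)
      also have "\<dots> \<le> 4 * ?s" by (intro mult_right_mono cutoff'_norm_le) auto
      finally have 1: "\<bar>(x \<bullet> a x) * (a x \<bullet> ?d)\<bar> \<le> 4 * ?s" .
      have "\<bar>1 - ?N / 2\<bar> * (?c * ?s) \<le> \<bar>1 - ?N / 2\<bar> * (1 * ?s)"
        by (intro mult_left_mono mult_right_mono cutoff_bounds) auto
      then have 2: "\<bar>(1 - ?N / 2) * (?c * ?s)\<bar> \<le> \<bar>1 - ?N / 2\<bar> * ?s"
        using cutoff_bounds(1)[of "1 / real (Suc n)" x] by (simp add: abs_mult)
      have 3: "\<bar>(x \<bullet> ?d) * ?s / 2\<bar> \<le> 2 * ?s"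
        using mult_right_mono[OF xc[of x n], of ?s] by (simp add: abs_mult)
      show "norm ((x \<bullet> a x) * (a x \<bullet> ?d) + (1 - ?N / 2) * (?c * ?s) - (x \<bullet> ?d) * ?s / 2) \<le> (6 + \<bar>1 - ?N / 2\<bar>) * ?s"
        using 1 2 3 unfolding real_norm_def distrib_right by linarith
    qed
  qed measurable
  have t2: "(\<lambda>n. LBINT x. \<Phi> x * (x \<bullet> cutoff' (eps n) x + ?N * cutoff (eps n) x)) \<longlonglongrightarrow> (LBINT x. \<Phi> x * ?N)"
  proof (rule integral_dominated_convergence[where w="\<lambda>x. \<bar>\<Phi> x\<bar> * (4 + ?N)"])
    show "AE x in lborel. (\<lambda>n. \<Phi> x * (x \<bullet> cutoff' (eps n) x + ?N * cutoff (eps n) x)) \<longlonglongrightarrow> \<Phi> x * ?N"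
    proof (rule AE_I2)
      fix x :: "real^'n"
      have "(\<lambda>n. \<Phi> x * (x \<bullet> cutoff' (eps n) x + ?N * cutoff (eps n) x)) \<longlonglongrightarrow> \<Phi> x * (0 + ?N * 1)"
        by (intro tendsto_intros cutoff_tendsto cutoff'_inner_tendsto)
      then show "(\<lambda>n. \<Phi> x * (x \<bullet> cutoff' (eps n) x + ?N * cutoff (eps n) x)) \<longlonglongrightarrow> \<Phi> x * ?N" by simp
    qed
    show "integrable lborel (\<lambda>x. \<bar>\<Phi> x\<bar> * (4 + ?N))" using \<Phi>(2) by simp
    fix n
    show "AE x in lborel. norm (\<Phi> x * (x \<bullet> cutoff' (eps n) x + ?N * cutoff (eps n) x)) \<le> \<bar>\<Phi> x\<bar> * (4 + ?N)"
    proof (rule AE_I2)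
      fix x :: "real^'n"
      have "?N * cutoff (eps n) x \<le> ?N * 1" by (intro mult_left_mono cutoff_bounds) simp
      moreover have "0 \<le> ?N * cutoff (eps n) x" by (intro mult_nonneg_nonneg cutoff_bounds) simp
      ultimately have "\<bar>x \<bullet> cutoff' (eps n) x + ?N * cutoff (eps n) x\<bar> \<le> 4 + ?N"
        using xc[of x n] by linarith
      then show "norm (\<Phi> x * (x \<bullet> cutoff' (eps n) x + ?N * cutoff (eps n) x)) \<le> \<bar>\<Phi> x\<bar> * (4 + ?N)"
        unfolding real_norm_def abs_mult by (rule mult_left_mono) simp
    qed
  qed measurable
  have "(LBINT x. (1 - ?N / 2) * (norm (a x))\<^sup>2) = - (LBINT x. \<Phi> x * ?N)"
    using LIMSEQ_unique[OF t1] tendsto_minus[OF t2] local by simp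
  then show ?thesis by (simp add: mult.commute)
qed

text \<open>The test function is \<open>moll n q\<close> times a cutoff; n tends to infinity first.
  The remaining error pairs the gradient of the cutoff, which is at most \<open>4 * e\<close>, with
  the integrable product of \<open>q\<close> and \<open>a\<close>.\<close>

theorem weak_divergence_test_square_integrable:
  fixes q :: "real ^ 'n \<Rightarrow> real"
  assumes d: "weak_divergence a f" and w: "weak_gradient q b"
    and a2: "integrable lborel (\<lambda>x. (norm (a x))\<^sup>2)" and f2: "integrable lborel (\<lambda>x. (norm (f x))\<^sup>2)"
    and q2: "integrable lborel (\<lambda>x. (norm (q x))\<^sup>2)" and b2: "integrable lborel (\<lambda>x. (norm (b x))\<^sup>2)"
  shows "(LBINT x. a x \<bullet> b x) = (LBINT x. f x * q x)"
proof -
  have l: "loc_L1 a" "loc_L1 f" "loc_L1 q" "loc_L1 b" using w d by (auto simp: weak_gradient_def weak_divergence_def)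
  have [measurable]: "a \<in> borel_measurable borel" "f \<in> borel_measurable borel" "q \<in> borel_measurable borel" "b \<in> borel_measurable borel"
    using l loc_L1_measurable by auto
  have lm: "L1_loc_lim (\<lambda>n. moll n q) q" "L1_loc_lim (\<lambda>n x. (norm (moll n q x))\<^sup>2) (\<lambda>x. (norm (q x))\<^sup>2)"
    "L1_loc_lim (\<lambda>n. moll n b) b" "L1_loc_lim (\<lambda>n x. (norm (moll n b x))\<^sup>2) (\<lambda>x. (norm (b x))\<^sup>2)"
    by (intro moll_L1_loc_lim moll_square_L1_loc_lim l integrable_imp_loc_L1 q2 b2)+
  note lc = L1_loc_lim_const[OF l(1)] L1_loc_lim_const[OF integrable_imp_loc_L1[OF a2]] L1_loc_lim_const[OF l(2)] L1_loc_lim_const[OF integrable_imp_loc_L1[OF f2]]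
  have local: "(LBINT x. cutoff' e x \<bullet> (q x *\<^sub>R a x)) + (LBINT x. cutoff e x *\<^sub>R (a x \<bullet> b x)) = (LBINT x. cutoff e x *\<^sub>R (f x * q x))"
    if e: "e > 0" for e
  proof -
    note C = cutoff_C1c[OF e, where 'a="real^'n"]
    have t1: "(\<lambda>n. LBINT x. cutoff' e x \<bullet> (moll n q x *\<^sub>R a x)) \<longlonglongrightarrow> (LBINT x. cutoff' e x \<bullet> (q x *\<^sub>R a x))"
      by (rule L1_loc_lim_C1c[OF L1_loc_lim_square_bilinear[OF bounded_bilinear_scaleR lm(1,2) lc(1,2)] C])
    have t2: "(\<lambda>n. LBINT x. cutoff e x *\<^sub>R (a x \<bullet> moll n b x)) \<longlonglongrightarrow> (LBINT x. cutoff e x *\<^sub>R (a x \<bullet> b x))"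
      by (rule L1_loc_lim_C1c_scaleR[OF L1_loc_lim_square_bilinear[OF bounded_bilinear_inner lc(1,2) lm(3,4)] C])
    have t3: "(\<lambda>n. LBINT x. cutoff e x *\<^sub>R (f x * moll n q x)) \<longlonglongrightarrow> (LBINT x. cutoff e x *\<^sub>R (f x * q x))"
      by (rule L1_loc_lim_C1c_scaleR[OF L1_loc_lim_square_bilinear[OF bounded_bilinear_mult lc(3,4) lm(1,2)] C])
    obtain R M where R: "\<And>x::real^'n. R < norm x \<Longrightarrow> cutoff e x = 0" "\<And>x::real^'n. R < norm x \<Longrightarrow> cutoff' e x = 0"
      "\<And>x::real^'n. norm (cutoff' e x) \<le> M" "continuous_on UNIV (cutoff e :: real^'n \<Rightarrow> _)" "continuous_on UNIV (cutoff' e :: real^'n \<Rightarrow> _)" using C1c_E[OF C] by metis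
    have [measurable]: "(cutoff e :: real^'n \<Rightarrow> _) \<in> borel_measurable borel" "(cutoff' e :: real^'n \<Rightarrow> _) \<in> borel_measurable borel"
      using R by (auto intro: borel_measurable_continuous_onI)
    have ca: "\<bar>cutoff e x\<bar> \<le> 1" for x :: "real^'n" using cutoff_bounds[of e x] by simp
    have "(LBINT x. cutoff' e x \<bullet> (moll n q x *\<^sub>R a x)) + (LBINT x. cutoff e x *\<^sub>R (a x \<bullet> moll n b x)) = (LBINT x. cutoff e x *\<^sub>R (f x * moll n q x))" for n
    proof -
      have la: "loc_L1 (\<lambda>x. moll n q x *\<^sub>R a x)" "loc_L1 (\<lambda>x. a x \<bullet> moll n b x)"
        using L1_loc_limD(1)[OF L1_loc_lim_square_bilinear[OF bounded_bilinear_scaleR lm(1,2) lc(1,2)]]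
          L1_loc_limD(1)[OF L1_loc_lim_square_bilinear[OF bounded_bilinear_inner lc(1,2) lm(3,4)]] by auto
      have i1: "integrable lborel (\<lambda>x. cutoff' e x \<bullet> (moll n q x *\<^sub>R a x))"
        by (rule loc_L1_integrable_compact_support[where R=R]) (use R loc_L1_inner_bounded[OF la(1), of "cutoff' e" M] in \<open>auto simp: inner_commute\<close>)
      have i2: "integrable lborel (\<lambda>x. cutoff e x *\<^sub>R (a x \<bullet> moll n b x))"
        by (rule loc_L1_integrable_compact_support[where R=R]) (use R loc_L1_mult_bounded[OF la(2) _ ca] in auto)
      have "C1c (\<lambda>x. moll n q x * cutoff e x) (\<lambda>x. moll n q x *\<^sub>R cutoff' e x + cutoff e x *\<^sub>R moll n b x)"
        by (rule C1c_mult_left[OF C weak_gradient_moll[OF w] moll_continuous[OF l(4)]])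
      then have "(LBINT x. a x \<bullet> (moll n q x *\<^sub>R cutoff' e x + cutoff e x *\<^sub>R moll n b x)) = (LBINT x. f x * (moll n q x * cutoff e x))"
        using d unfolding weak_divergence_def by blast
      then show ?thesis using i1 i2 by (simp add: inner_add_right inner_commute mult_ac)
    qed
    then show ?thesis using LIMSEQ_unique[OF tendsto_add[OF t1 t2]] t3 by simp
  qed
  have mc: "(cutoff (eps n) :: real^'n \<Rightarrow> real) \<in> borel_measurable borel" "(cutoff' (eps n) :: real^'n \<Rightarrow> _) \<in> borel_measurable borel" for n
    using cutoff_C1c[of "1 / real (Suc n)", where 'a="real^'n"] by (auto elim!: C1c_E intro: borel_measurable_continuous_onI)
  note [measurable] = mc
  have cb: "\<bar>cutoff (eps n) x\<bar> \<le> 1" for n and x :: "real^'n" using cutoff_bounds[of "1 / real (Suc n)" x] by simp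
  have qa: "integrable lborel (\<lambda>x. norm (q x) * norm (a x))"
  proof -
    have "integrable lborel (\<lambda>x. (norm (norm (a x)))\<^sup>2)" using a2 by simp
    from integrable_inner_square(1)[OF _ _ q2 this] show ?thesis by simp
  qed
  have ab: "integrable lborel (\<lambda>x. a x \<bullet> b x)" by (rule integrable_inner_square(2)) (use a2 b2 in auto)
  have fq: "integrable lborel (\<lambda>x. f x * q x)" using integrable_inner_square(2)[of f q] f2 q2 by simp
  have t1: "(\<lambda>n. LBINT x. cutoff' (eps n) x \<bullet> (q x *\<^sub>R a x)) \<longlonglongrightarrow> (\<integral>x. 0 \<partial>(lborel :: (real^'n) measure))"
  proof (rule integral_dominated_convergence[where w="\<lambda>x. 4 * (norm (q x) * norm (a x))"])
    show "AE x in lborel. (\<lambda>n. cutoff' (eps n) x \<bullet> (q x *\<^sub>R a x)) \<longlonglongrightarrow> 0"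
    proof (rule AE_I2)
      fix x :: "real^'n"
      show "(\<lambda>n. cutoff' (eps n) x \<bullet> (q x *\<^sub>R a x)) \<longlonglongrightarrow> 0"
        using tendsto_inner[OF cutoff'_tendsto tendsto_const, of x "q x *\<^sub>R a x"] by simp
    qed
    show "integrable lborel (\<lambda>x. 4 * (norm (q x) * norm (a x)))" using qa by simp
    fix n
    show "AE x in lborel. norm (cutoff' (eps n) x \<bullet> (q x *\<^sub>R a x)) \<le> 4 * (norm (q x) * norm (a x))"
    proof (rule AE_I2)
      fix x :: "real^'n"
      have "norm (cutoff' (eps n) x) \<le> 4 * (eps n)" by (rule cutoff'_norm_le) simp
      also have "\<dots> \<le> 4" by (simp add: field_simps)
      finally have "norm (cutoff' (eps n) x) * norm (q x *\<^sub>R a x) \<le> 4 * norm (q x *\<^sub>R a x)"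
        by (rule mult_right_mono) simp
      then show "norm (cutoff' (eps n) x \<bullet> (q x *\<^sub>R a x)) \<le> 4 * (norm (q x) * norm (a x))"
        using Cauchy_Schwarz_ineq2[of "cutoff' (eps n) x" "q x *\<^sub>R a x"] by simp
    qed
  qed measurable
  have lim: "(\<lambda>n. LBINT x. cutoff (eps n) x *\<^sub>R h x) \<longlonglongrightarrow> (LBINT x. h x)"
    if h: "integrable lborel h" for h :: "real^'n \<Rightarrow> real"
  proof (rule integral_dominated_convergence[where w="\<lambda>x. norm (h x)"])
    have [measurable]: "h \<in> borel_measurable borel" using h by auto
    show "(\<lambda>x. cutoff (eps n) x *\<^sub>R h x) \<in> borel_measurable lborel" for n by measurable
    show "AE x in lborel. (\<lambda>n. cutoff (eps n) x *\<^sub>R h x) \<longlonglongrightarrow> h x"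
    proof (rule AE_I2)
      fix x :: "real^'n"
      show "(\<lambda>n. cutoff (eps n) x *\<^sub>R h x) \<longlonglongrightarrow> h x"
        using tendsto_scaleR[OF cutoff_tendsto tendsto_const, of x "h x"] by simp
    qed
    show "AE x in lborel. norm (cutoff (eps n) x *\<^sub>R h x) \<le> norm (h x)" for n
      using mult_right_mono[OF cb] by (auto simp: abs_mult)
  qed (use h in auto)
  have "(\<integral>x. 0 \<partial>(lborel :: (real^'n) measure)) + (LBINT x. a x \<bullet> b x) = (LBINT x. f x * q x)"
    using LIMSEQ_unique[OF tendsto_add[OF t1 lim[OF ab]]] lim[OF fq] local by simp
  then show ?thesis by simp
qed

section \<open>Solutions of the quasilinear equation\<close>

lemma power2_powr: "((s::real)\<^sup>2) powr e = \<bar>s\<bar> powr (2 * e)"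
proof (cases "s = 0")
  case False
  then have "s\<^sup>2 = \<bar>s\<bar> powr 2" by simp
  then show ?thesis using False by (simp only: powr_powr)
qed simp

lemma powr_le_add_powr:
  fixes s :: real
  assumes "0 \<le> s" "a \<le> b" "b \<le> c"
  shows "s powr b \<le> s powr a + s powr c"
proof (cases "s \<le> 1")
  case True
  then have "s powr b \<le> s powr a" using assms by (cases "s = 0") (auto intro: powr_mono')
  then show ?thesis by (simp add: add_increasing2)
next
  case False
  then have "s powr b \<le> s powr c" using assms by (auto intro: powr_mono)
  then show ?thesis by (simp add: add_increasing)
qed

lemma DERIV_abs_powr:
  fixes s q :: real
  assumes "q > 1"
  shows "DERIV (\<lambda>s. \<bar>s\<bar> powr q) s :> q * (\<bar>s\<bar> powr (q - 2) * s)"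
proof (cases s "0::real" rule: linorder_cases)
  case less
  have "DERIV (\<lambda>s. (- s) powr q) s :> q * ((- s) powr (q - 1) * (-1))"
    using less by (auto intro!: derivative_eq_intros)
  then have "DERIV (\<lambda>s. \<bar>s\<bar> powr q) s :> q * ((- s) powr (q - 1) * (-1))"
    by (rule DERIV_cong_ev[THEN iffD1, rotated 3])
       (use less in \<open>auto simp: eventually_nhds_metric dist_real_def intro!: exI[of _ "-s"]\<close>)
  moreover have "(- s) powr (q - 1) = (- s) powr (q - 2) * (- s)"
    using less powr_add[of "- s" "q - 2" 1] by simp
  ultimately show ?thesis using less by simp
next
  case equal
  have "((\<lambda>h::real. \<bar>h\<bar> powr q / h) \<longlongrightarrow> 0) (at 0)"
  proof (rule Lim_null_comparison)
    show "\<forall>\<^sub>F h in at (0::real). norm (\<bar>h\<bar> powr q / h) \<le> \<bar>h\<bar> powr (q - 1)"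
    proof (rule always_eventually, rule allI)
      fix h :: real
      show "norm (\<bar>h\<bar> powr q / h) \<le> \<bar>h\<bar> powr (q - 1)"
        by (cases "h = 0") (auto simp: powr_diff abs_div)
    qed
    have "((\<lambda>h::real. \<bar>h\<bar> powr (q - 1)) \<longlongrightarrow> \<bar>0\<bar> powr (q - 1)) (at 0)"
      using assms by (intro tendsto_powr' tendsto_intros) auto
    then show "((\<lambda>h::real. \<bar>h\<bar> powr (q - 1)) \<longlongrightarrow> 0) (at 0)" using assms by simp
  qed
  then show ?thesis using equal assms by (simp add: has_field_derivative_iff)
next
  case greater
  have "DERIV (\<lambda>s. s powr q) s :> q * s powr (q - 1)"
    using greater by (auto intro!: derivative_eq_intros)
  then have "DERIV (\<lambda>s. \<bar>s\<bar> powr q) s :> q * s powr (q - 1)"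
    by (rule DERIV_cong_ev[THEN iffD1, rotated 3])
       (use greater in \<open>auto simp: eventually_nhds_metric dist_real_def intro!: exI[of _ s]\<close>)
  moreover have "s powr (q - 1) = s powr (q - 2) * s"
    using greater powr_add[of s "q - 2" 1] by simp
  ultimately show ?thesis using greater by simp
qed

text \<open>Supplies the majorant \<open>L\<close> required by \<open>weak_gradient_chain\<close>
  from the majorant \<open>K\<close> of the derivative.\<close>

lemma abs_le_of_derivative_bound:
  fixes F F' K :: "real \<Rightarrow> real" and s t :: real
  assumes F: "\<And>s. DERIV F s :> F' s" and F0: "F 0 = 0"
    and K: "\<And>s t. \<bar>t\<bar> \<le> \<bar>s\<bar> \<Longrightarrow> \<bar>F' t\<bar> \<le> K s" and t: "\<bar>t\<bar> \<le> \<bar>s\<bar>"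
  shows "\<bar>F t\<bar> \<le> K s * \<bar>s\<bar>"
proof -
  have "\<bar>F' 0\<bar> \<le> K s" by (rule K) simp
  then have K0: "0 \<le> K s" by linarith
  have "norm (F t - F 0) \<le> K s * norm (t - 0)"
  proof (rule field_differentiable_bound[of "cball 0 \<bar>s\<bar>" F F'])
    show "(F has_field_derivative F' z) (at z within cball 0 \<bar>s\<bar>)" for z
      using F by (rule has_field_derivative_at_within)
    show "norm (F' z) \<le> K s" if "z \<in> cball 0 \<bar>s\<bar>" for z using K that by simp
  qed (use t in auto)
  also have "\<dots> \<le> K s * \<bar>s\<bar>" using K0 t by (simp add: mult_left_mono)
  finally show ?thesis using F0 by simp
qed

text \<open>The derivative of the dual change of unknown for quasilinear Schroedinger equations: the
  inverse of its primitive satisfies \<open>h' = 1 / sqrt (1 + 2 h^2)\<close>.\<close>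

definition root_weight :: "real \<Rightarrow> real" where
  "root_weight s = sqrt (1 + 2 * s\<^sup>2)"

lemma root_weight_pos: "1 \<le> root_weight s" "0 < root_weight s" "root_weight s \<noteq> 0"
  and root_weight_square: "(root_weight s)\<^sup>2 = 1 + 2 * s\<^sup>2"
  and root_weight_le: "root_weight s \<le> 1 + 2 * \<bar>s\<bar>"
  and root_weight_mono: "\<bar>t\<bar> \<le> \<bar>s\<bar> \<Longrightarrow> root_weight t \<le> root_weight s"
proof -
  show 1: "1 \<le> root_weight s" by (simp add: root_weight_def)
  then show "0 < root_weight s" "root_weight s \<noteq> 0" by auto
  show "(root_weight s)\<^sup>2 = 1 + 2 * s\<^sup>2" by (simp add: root_weight_def)
  show "root_weight s \<le> 1 + 2 * \<bar>s\<bar>" unfolding root_weight_def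
  proof (rule real_le_lsqrt)
    have "(1 + 2 * \<bar>s\<bar>)\<^sup>2 = 1 + 4 * \<bar>s\<bar> + 4 * s\<^sup>2" by (simp add: power2_eq_square algebra_simps)
    then show "1 + 2 * s\<^sup>2 \<le> (1 + 2 * \<bar>s\<bar>)\<^sup>2" by simp
  qed simp
  assume "\<bar>t\<bar> \<le> \<bar>s\<bar>"
  then have "t\<^sup>2 \<le> s\<^sup>2" by (simp only: abs_le_square_iff)
  then show "root_weight t \<le> root_weight s" unfolding root_weight_def by simp
qed

lemma DERIV_root_weight: "DERIV root_weight s :> 2 * s / root_weight s"
proof -
  have "1 + 2 * s\<^sup>2 > 0" by (simp add: add_pos_nonneg)
  then show ?thesis
    unfolding root_weight_def[abs_def] by (auto intro!: derivative_eq_intros simp: field_simps)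
qed

lemma root_weight_continuous: "continuous_on A root_weight"
  unfolding root_weight_def[abs_def] by (intro continuous_intros)

lemma root_weight_measurable [measurable]: "root_weight \<in> borel_measurable borel"
  by (rule borel_measurable_continuous_onI[OF root_weight_continuous])

definition root_weight_primitive :: "real \<Rightarrow> real" where
  "root_weight_primitive s = s * root_weight s / 2 + arsinh (sqrt 2 * s) / (2 * sqrt 2)"

lemma DERIV_root_weight_primitive: "DERIV root_weight_primitive s :> root_weight s"
proof -
  have r: "sqrt ((sqrt 2 * s)\<^sup>2 + 1) = root_weight s" by (simp add: root_weight_def power_mult_distrib add.commute)
  have "DERIV (\<lambda>s. arsinh (sqrt 2 * s)) s :> 1 / root_weight s * sqrt 2"
    unfolding r[symmetric]
    by (rule DERIV_chain2[OF arsinh_real_has_field_derivative]) (auto intro!: derivative_eq_intros)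
  then have "DERIV (\<lambda>s. arsinh (sqrt 2 * s) / (2 * sqrt 2)) s :> 1 / root_weight s * sqrt 2 / (2 * sqrt 2)"
    by (rule DERIV_cdivide)
  moreover have "DERIV (\<lambda>s. s * root_weight s / 2) s :> (1 * root_weight s + 2 * s / root_weight s * s) / 2"
    by (intro DERIV_cdivide DERIV_mult DERIV_ident DERIV_root_weight)
  ultimately have "DERIV root_weight_primitive s :> (1 * root_weight s + 2 * s / root_weight s * s) / 2 + 1 / root_weight s * sqrt 2 / (2 * sqrt 2)"
    unfolding root_weight_primitive_def[abs_def] by (intro DERIV_add)
  moreover have "(1 * root_weight s + 2 * s / root_weight s * s) / 2 + 1 / root_weight s * sqrt 2 / (2 * sqrt 2)
    = ((root_weight s)\<^sup>2 + (1 + 2 * s\<^sup>2)) / (2 * root_weight s)"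
    using root_weight_pos[of s] by (simp add: field_simps power2_eq_square)
  moreover have "((root_weight s)\<^sup>2 + (1 + 2 * s\<^sup>2)) / (2 * root_weight s) = root_weight s"
    unfolding root_weight_square[symmetric] using root_weight_pos[of s] by (simp add: power2_eq_square)
  ultimately show ?thesis by simp
qed

text \<open>Holds Borel representatives of a critical point and of its weak gradient together with
  one fixed multiplier, all integrals being taken with respect to \<open>lborel\<close>.\<close>

locale quasilinear_solution =
  fixes u :: "real ^ 'n \<Rightarrow> real" and g :: "real ^ 'n \<Rightarrow> real ^ 'n" and p \<mu> :: real
  assumes w: "weak_gradient u g"
    and u2: "integrable lborel (\<lambda>x. (u x)\<^sup>2)"
    and g2: "integrable lborel (\<lambda>x. (norm (g x))\<^sup>2)"
    and ug2: "integrable lborel (\<lambda>x. (u x)\<^sup>2 * (norm (g x))\<^sup>2)"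
    and p_lower: "1 + 4 / real CARD('n) \<le> p" and p_upper: "p \<le> 3 + 4 / real CARD('n)"
    and weak: "\<And>\<phi>. \<phi> \<in> test_functions \<Longrightarrow>
      (LBINT x. g x \<bullet> grad \<phi> x) - \<mu> * (LBINT x. u x * \<phi> x)
      + 2 * (LBINT x. (u x)\<^sup>2 * (g x \<bullet> grad \<phi> x) + u x * (norm (g x))\<^sup>2 * \<phi> x)
      = (LBINT x. \<bar>u x\<bar> powr (p - 1) * u x * \<phi> x)"
begin

abbreviation "mass \<equiv> LBINT x. (u x)\<^sup>2"
abbreviation "dirichlet \<equiv> LBINT x. (norm (g x))\<^sup>2"
abbreviation "quasi \<equiv> LBINT x. (u x)\<^sup>2 * (norm (g x))\<^sup>2"
abbreviation "potential \<equiv> LBINT x. \<bar>u x\<bar> powr (p + 1)"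

lemma N_pos: "real CARD('n) > 0" by simp

lemma p_gt_1: "p > 1"
proof -
  have "4 / real CARD('n) > 0" using N_pos by simp
  then show ?thesis using p_lower by linarith
qed

lemma loc_L1_ug: "loc_L1 u" "loc_L1 g" using w by (auto simp: weak_gradient_def)

lemma measurable_ug [measurable]: "u \<in> borel_measurable borel" "g \<in> borel_measurable borel"
  using loc_L1_ug loc_L1_measurable by auto

text \<open>Allows Gagliardo-Nirenberg to be applied to \<open>u^2\<close>, whose Dirichlet integral
  is four times the quasilinear energy \<open>quasi\<close>.\<close>

lemma weak_gradient_square: "weak_gradient (\<lambda>x. (u x)\<^sup>2) (\<lambda>x. (2 * u x) *\<^sub>R g x)"
proof (rule weak_gradient_chain[OF w, where F="\<lambda>s. s\<^sup>2" and F'="\<lambda>s. 2 * s" and K="\<lambda>s. 2 * \<bar>s\<bar>" and L="\<lambda>s. s\<^sup>2"])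
  have "loc_L1 (\<lambda>x. (u x)\<^sup>2 + (norm (g x))\<^sup>2)" using u2 g2 by (intro integrable_imp_loc_L1) auto
  then show "loc_L1 (\<lambda>x. (2 * \<bar>u x\<bar>) *\<^sub>R g x)"
  proof (rule loc_L1I_bound[where M=1])
    fix x
    have "0 \<le> (\<bar>u x\<bar> - norm (g x))\<^sup>2" by simp
    then show "norm ((2 * \<bar>u x\<bar>) *\<^sub>R g x) \<le> 1 * norm ((u x)\<^sup>2 + (norm (g x))\<^sup>2)"
      by (simp add: power2_diff)
  qed measurable
  show "loc_L1 (\<lambda>x. (u x)\<^sup>2)" using u2 by (rule integrable_imp_loc_L1)
  show "DERIV (\<lambda>s. s\<^sup>2) s :> 2 * s" for s :: real by (auto intro!: derivative_eq_intros)
  show "\<bar>t\<^sup>2\<bar> \<le> s\<^sup>2" if "\<bar>t\<bar> \<le> \<bar>s\<bar>" for s t :: real using that by (simp add: abs_le_square_iff)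
qed (auto intro!: continuous_intros simp: abs_mult)

lemma square_grad: "(norm ((2 * u x) *\<^sub>R g x))\<^sup>2 = 4 * ((u x)\<^sup>2 * (norm (g x))\<^sup>2)"
  by (simp add: power_mult_distrib)

section \<open>Integrability of the powers of u\<close>

lemma mass_nonneg: "0 \<le> mass" by (rule integral_nonneg_AE) simp

text \<open>Gagliardo-Nirenberg for u with q = 2, measured by the mass; the exponent is the smallest
  value that \<open>p + 1\<close> can take.\<close>

lemma middle_power:
  shows "integrable lborel (\<lambda>x. \<bar>u x\<bar> powr (2 + 4 / real CARD('n)))"
    and "mass \<le> m \<Longrightarrow> 0 < m \<Longrightarrow> (LBINT x. \<bar>u x\<bar> powr (2 + 4 / real CARD('n))) \<le> GN 2 (real CARD('n)) * m powr (2 / real CARD('n)) * dirichlet"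
proof -
  have i: "integrable lborel (\<lambda>x. \<bar>u x\<bar> ^ 2)" using u2 by simp
  have e: "2 + 2 * real 2 / real CARD('n) = 2 + 4 / real CARD('n)" by simp
  note gn = gagliardo_nirenberg[OF w _ i _ _ g2, unfolded e]
  have "mass \<le> mass + 1" "0 < mass + 1" using mass_nonneg by linarith+
  then show "integrable lborel (\<lambda>x. \<bar>u x\<bar> powr (2 + 4 / real CARD('n)))" using gn(1)[of "mass + 1"] by simp
  show "mass \<le> m \<Longrightarrow> 0 < m \<Longrightarrow> (LBINT x. \<bar>u x\<bar> powr (2 + 4 / real CARD('n))) \<le> GN 2 (real CARD('n)) * m powr (2 / real CARD('n)) * dirichlet"
    using gn(2)[of m] by simp
qed

text \<open>Gagliardo-Nirenberg for \<open>u^2\<close> with q = 1, since the \<open>L^1\<close> norm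
  of \<open>u^2\<close> is again the mass. The exponent is the largest value of
  \<open>p + 1\<close>, and the power \<open>2/N\<close> of the mass is the same as in
  \<open>middle_power\<close>.\<close>

lemma high_power:
  shows "integrable lborel (\<lambda>x. \<bar>u x\<bar> powr (4 + 4 / real CARD('n)))"
    and "mass \<le> m \<Longrightarrow> 0 < m \<Longrightarrow> (LBINT x. \<bar>u x\<bar> powr (4 + 4 / real CARD('n))) \<le> GN 1 (real CARD('n)) * m powr (2 / real CARD('n)) * (4 * quasi)"
proof -
  have i: "integrable lborel (\<lambda>x. \<bar>(u x)\<^sup>2\<bar> ^ 1)" using u2 by simp
  have i2: "integrable lborel (\<lambda>x. (norm ((2 * u x) *\<^sub>R g x))\<^sup>2)" unfolding square_grad using ug2 by simp
  have e: "\<bar>(u x)\<^sup>2\<bar> powr (2 + 2 * real 1 / real CARD('n)) = \<bar>u x\<bar> powr (4 + 4 / real CARD('n))" for x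
    by (simp add: power2_powr)
  note gn = gagliardo_nirenberg[OF weak_gradient_square _ i _ _ i2, unfolded e square_grad]
  have "mass \<le> mass + 1" "0 < mass + 1" using mass_nonneg by linarith+
  then show "integrable lborel (\<lambda>x. \<bar>u x\<bar> powr (4 + 4 / real CARD('n)))" using gn(1)[of "mass + 1"] by simp
  show "mass \<le> m \<Longrightarrow> 0 < m \<Longrightarrow> (LBINT x. \<bar>u x\<bar> powr (4 + 4 / real CARD('n))) \<le> GN 1 (real CARD('n)) * m powr (2 / real CARD('n)) * (4 * quasi)"
    using gn(2)[of m] by simp
qed

lemma integrable_between:
  assumes "integrable lborel (\<lambda>x. \<bar>u x\<bar> powr a)" "integrable lborel (\<lambda>x. \<bar>u x\<bar> powr c)" "a \<le> b" "b \<le> c"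
  shows "integrable lborel (\<lambda>x. \<bar>u x\<bar> powr b)"
  by (rule Bochner_Integration.integrable_bound[OF Bochner_Integration.integrable_add[OF assms(1,2)]])
     (use powr_le_add_powr[of "\<bar>u x\<bar>" a b c for x] assms in auto)

lemma integrable_square': "integrable lborel (\<lambda>x. \<bar>u x\<bar> powr 2)"
  using u2 by simp

lemma integrable_fourth: "integrable lborel (\<lambda>x. (u x) ^ 4)"
proof -
  have "integrable lborel (\<lambda>x. \<bar>u x\<bar> powr 4)"
    by (rule integrable_between[OF integrable_square' high_power(1)]) auto
  then show ?thesis by (simp add: power_even_abs)
qed

text \<open>A second application to \<open>u^2\<close>, now with q = 2, which is possible once the
  fourth power of u is integrable. This is the integrability that makes \<open>f\<close> square
  integrable.\<close>

lemma top_power: "integrable lborel (\<lambda>x. \<bar>u x\<bar> powr (4 + 8 / real CARD('n)))"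
proof -
  have i: "integrable lborel (\<lambda>x. \<bar>(u x)\<^sup>2\<bar> ^ 2)" using integrable_fourth by simp
  have i2: "integrable lborel (\<lambda>x. (norm ((2 * u x) *\<^sub>R g x))\<^sup>2)" unfolding square_grad using ug2 by simp
  have e: "\<bar>(u x)\<^sup>2\<bar> powr (2 + 2 * real 2 / real CARD('n)) = \<bar>u x\<bar> powr (4 + 8 / real CARD('n))" for x
    by (simp add: power2_powr)
  let ?m = "LBINT x. \<bar>(u x)\<^sup>2\<bar> ^ 2"
  have "0 \<le> ?m" by (rule integral_nonneg_AE) auto
  then have "?m \<le> ?m + 1" "0 < ?m + 1" by linarith+
  from gagliardo_nirenberg(1)[OF weak_gradient_square _ i this i2] show ?thesis unfolding e by simp
qed

lemma integrable_power:
  assumes "2 \<le> b" "b \<le> 4 + 8 / real CARD('n)"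
  shows "integrable lborel (\<lambda>x. \<bar>u x\<bar> powr b)"
  by (rule integrable_between[OF integrable_square' top_power]) (use assms in auto)

lemma integrable_potential: "integrable lborel (\<lambda>x. \<bar>u x\<bar> powr (p + 1))"
proof (rule integrable_power)
  have "4 / real CARD('n) \<le> 8 / real CARD('n)" by (intro divide_right_mono) auto
  then show "p + 1 \<le> 4 + 8 / real CARD('n)" using p_upper by linarith
qed (use p_gt_1 in simp)

section \<open>Growth of the nonlinearity\<close>

definition nl :: "real \<Rightarrow> real" where
  "nl s = \<mu> * s + \<bar>s\<bar> powr (p - 1) * s"

text \<open>An even majorant of \<open>nl\<close>, increasing in \<open>|s|\<close>: the shape that
  \<open>weak_gradient_chain\<close> requires of \<open>K\<close>.\<close>

definition nl_bound :: "real \<Rightarrow> real" where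
  "nl_bound s = \<bar>\<mu>\<bar> * \<bar>s\<bar> + \<bar>s\<bar> powr p"

lemma abs_powr_mult: "\<bar>\<bar>s\<bar> powr (p - 1) * s\<bar> = \<bar>s\<bar> powr p"
proof (cases "s = 0")
  case False
  then show ?thesis using powr_add[of "\<bar>s\<bar>" "p - 1" 1] by (simp add: abs_mult)
qed simp

lemma nl_abs_le: "\<bar>t\<bar> \<le> \<bar>s\<bar> \<Longrightarrow> \<bar>nl t\<bar> \<le> nl_bound s"
proof -
  assume "\<bar>t\<bar> \<le> \<bar>s\<bar>"
  moreover have "\<bar>nl t\<bar> \<le> \<bar>\<mu> * t\<bar> + \<bar>t\<bar> powr p"
    unfolding nl_def abs_powr_mult[symmetric] by (rule abs_triangle_ineq)
  ultimately show ?thesis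
    using powr_mono2[of p "\<bar>t\<bar>" "\<bar>s\<bar>"] mult_left_mono[of "\<bar>t\<bar>" "\<bar>s\<bar>" "\<bar>\<mu>\<bar>"] p_gt_1
    by (simp add: nl_bound_def abs_mult)
qed

lemma nl_bound_nonneg: "0 \<le> nl_bound s" by (simp add: nl_bound_def)

lemma nl_continuous: "continuous_on UNIV nl"
  unfolding nl_def[abs_def] using p_gt_1 by (intro continuous_intros continuous_on_powr') auto

lemma nl_bound_continuous: "continuous_on UNIV nl_bound"
  unfolding nl_bound_def[abs_def] using p_gt_1 by (intro continuous_intros continuous_on_powr') auto

lemma nl_measurable [measurable]: "nl \<in> borel_measurable borel" "nl_bound \<in> borel_measurable borel"
  by (auto intro: borel_measurable_continuous_onI nl_continuous nl_bound_continuous)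

text \<open>For \<open>|s| > 1\<close> the denominator lowers the exponent \<open>2 p\<close> to
  \<open>2 p - 2\<close>, which is at most \<open>4 + 8/N\<close> precisely by the upper bound on p;
  for \<open>|s| \<le> 1\<close> the square \<open>s^2\<close> dominates because
  \<open>2 p \<ge> 2\<close>.\<close>

lemma nl_bound_quotient: "(nl_bound s / root_weight s)\<^sup>2 \<le> 2 * \<mu>\<^sup>2 * s\<^sup>2 + 2 * (s\<^sup>2 + \<bar>s\<bar> powr (4 + 8 / real CARD('n)))"
proof -
  have le: "\<bar>s\<bar> powr (2 * p) / (1 + 2 * s\<^sup>2) \<le> s\<^sup>2 + \<bar>s\<bar> powr (4 + 8 / real CARD('n))"
  proof (cases "\<bar>s\<bar> \<le> 1")
    case True
    have "\<bar>s\<bar> powr (2 * p) / (1 + 2 * s\<^sup>2) \<le> \<bar>s\<bar> powr (2 * p) / 1"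
      by (intro divide_left_mono) (auto simp: add_pos_nonneg)
    also have "\<dots> \<le> \<bar>s\<bar> powr 2" using powr_mono'[of 2 "2 * p" "\<bar>s\<bar>"] True p_gt_1 by (cases "s = 0") auto
    finally show ?thesis by (simp add: add_increasing2)
  next
    case False
    then have s: "s \<noteq> 0" by auto
    have "\<bar>s\<bar> powr (2 * p) / (1 + 2 * s\<^sup>2) \<le> \<bar>s\<bar> powr (2 * p) / s\<^sup>2"
      using s by (intro divide_left_mono) (auto simp: add_pos_nonneg)
    also have "\<dots> = \<bar>s\<bar> powr (2 * p - 2)" using s by (simp add: powr_diff)
    also have "\<dots> \<le> \<bar>s\<bar> powr (4 + 8 / real CARD('n))"
      using False p_upper by (intro powr_mono) (auto simp: field_simps)
    finally show ?thesis by (simp add: add_increasing)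
  qed
  have "(nl_bound s)\<^sup>2 \<le> 2 * (\<bar>\<mu>\<bar> * \<bar>s\<bar>)\<^sup>2 + 2 * (\<bar>s\<bar> powr p)\<^sup>2"
    unfolding nl_bound_def using zero_le_power2[of "\<bar>\<mu>\<bar> * \<bar>s\<bar> - \<bar>s\<bar> powr p"] unfolding power2_diff power2_sum by linarith
  also have "(\<bar>s\<bar> powr p)\<^sup>2 = \<bar>s\<bar> powr (2 * p)"
    by (simp add: power2_eq_square powr_add[symmetric])
  finally have "(nl_bound s / root_weight s)\<^sup>2 \<le> (2 * \<mu>\<^sup>2 * s\<^sup>2 + 2 * \<bar>s\<bar> powr (2 * p)) / (1 + 2 * s\<^sup>2)"
    unfolding power_divide root_weight_square by (intro divide_right_mono) (auto simp: power_mult_distrib)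
  also have "\<dots> = (2 * \<mu>\<^sup>2 * s\<^sup>2) / (1 + 2 * s\<^sup>2) + 2 * (\<bar>s\<bar> powr (2 * p) / (1 + 2 * s\<^sup>2))"
    by (simp add: add_divide_distrib)
  also have "(2 * \<mu>\<^sup>2 * s\<^sup>2) / (1 + 2 * s\<^sup>2) \<le> (2 * \<mu>\<^sup>2 * s\<^sup>2) / 1"
    by (intro divide_left_mono) (auto simp: add_pos_nonneg)
  finally show ?thesis using le by simp
qed

lemma integrable_nl_bound_quotient: "integrable lborel (\<lambda>x. (nl_bound (u x) / root_weight (u x))\<^sup>2)"
proof (rule Bochner_Integration.integrable_bound)
  show "integrable lborel (\<lambda>x. 2 * \<mu>\<^sup>2 * (u x)\<^sup>2 + 2 * ((u x)\<^sup>2 + \<bar>u x\<bar> powr (4 + 8 / real CARD('n))))"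
    using u2 top_power by simp
qed (use nl_bound_quotient in \<open>auto intro: order_trans[OF _ abs_ge_self]\<close>)

text \<open>\<open>A\<close> is the gradient of \<open>v = root_weight_primitive u\<close>, the unknown of the dual semilinear
  equation \<open>- \<Delta>v = f\<close>; \<open>G\<close> below is the gradient of \<open>z = u + 2/3 u^3\<close>, and \<open>- \<Delta>z = k\<close> is the
  original equation.\<close>
definition A :: "real ^ 'n \<Rightarrow> real ^ 'n" where
  "A x = root_weight (u x) *\<^sub>R g x"

definition f :: "real ^ 'n \<Rightarrow> real" where
  "f x = nl (u x) / root_weight (u x)"

lemma measurable_Af [measurable]: "A \<in> borel_measurable borel" "f \<in> borel_measurable borel"
  unfolding A_def[abs_def] f_def[abs_def] by measurable

lemma norm_A: "(norm (A x))\<^sup>2 = (norm (g x))\<^sup>2 + 2 * ((u x)\<^sup>2 * (norm (g x))\<^sup>2)"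
  by (simp add: A_def power_mult_distrib root_weight_square algebra_simps)

lemma A2: "integrable lborel (\<lambda>x. (norm (A x))\<^sup>2)"
  unfolding norm_A using g2 ug2 by simp

lemma f2: "integrable lborel (\<lambda>x. (norm (f x))\<^sup>2)"
proof (rule Bochner_Integration.integrable_bound[OF integrable_nl_bound_quotient])
  show "AE x in lborel. norm ((norm (f x))\<^sup>2) \<le> norm ((nl_bound (u x) / root_weight (u x))\<^sup>2)"
  proof (rule AE_I2)
    fix x
    have "\<bar>f x\<bar> \<le> nl_bound (u x) / root_weight (u x)"
      unfolding f_def using nl_abs_le[of "u x" "u x"] root_weight_pos[of "u x"] by (simp add: abs_div divide_right_mono)
    then have "\<bar>f x\<bar>\<^sup>2 \<le> (nl_bound (u x) / root_weight (u x))\<^sup>2" by (rule power_mono) simp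
    then show "norm ((norm (f x))\<^sup>2) \<le> norm ((nl_bound (u x) / root_weight (u x))\<^sup>2)" by simp
  qed
qed measurable

lemma loc_L1_A: "loc_L1 A" and loc_L1_f: "loc_L1 f"
  by (rule loc_L1_square; use A2 f2 in simp)+

lemma weak_gradient_v: "weak_gradient (\<lambda>x. root_weight_primitive (u x)) A"
  unfolding A_def[abs_def]
proof (rule weak_gradient_chain[OF w DERIV_root_weight_primitive root_weight_continuous, where K=root_weight and L="\<lambda>s. root_weight s * \<bar>s\<bar>"])
  have K: "\<bar>root_weight t\<bar> \<le> root_weight s" if "\<bar>t\<bar> \<le> \<bar>s\<bar>" for s t
    using root_weight_mono[OF that] root_weight_pos[of t] by simp
  then show "\<And>s t. \<bar>t\<bar> \<le> \<bar>s\<bar> \<Longrightarrow> \<bar>root_weight t\<bar> \<le> root_weight s" .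
  show "loc_L1 (\<lambda>x. root_weight (u x) *\<^sub>R g x)" using loc_L1_A by (simp add: A_def[abs_def])
  show "\<bar>root_weight_primitive t\<bar> \<le> root_weight s * \<bar>s\<bar>" if "\<bar>t\<bar> \<le> \<bar>s\<bar>" for s t
    by (rule abs_le_of_derivative_bound[OF DERIV_root_weight_primitive _ K that]) (auto simp: root_weight_primitive_def)
  have "loc_L1 (\<lambda>x. \<bar>u x\<bar> + 2 * (u x)\<^sup>2)"
    using loc_L1_add[OF loc_L1_norm[OF loc_L1_ug(1)] integrable_imp_loc_L1[OF integrable_mult_right[OF u2, of 2]]] by simp
  then show "loc_L1 (\<lambda>x. root_weight (u x) * \<bar>u x\<bar>)"
  proof (rule loc_L1I_bound[where M=1])
    fix x
    have "root_weight (u x) * \<bar>u x\<bar> \<le> (1 + 2 * \<bar>u x\<bar>) * \<bar>u x\<bar>"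
      by (intro mult_right_mono root_weight_le) auto
    then show "norm (root_weight (u x) * \<bar>u x\<bar>) \<le> 1 * norm (\<bar>u x\<bar> + 2 * (u x)\<^sup>2)"
      using root_weight_pos[of "u x"] by (simp add: algebra_simps power2_eq_square)
  qed measurable
qed measurable

section \<open>The original equation in divergence form\<close>

definition z :: "real ^ 'n \<Rightarrow> real" where
  "z x = u x + 2 / 3 * (u x) ^ 3"

definition G :: "real ^ 'n \<Rightarrow> real ^ 'n" where
  "G x = (1 + 2 * (u x)\<^sup>2) *\<^sub>R g x"

definition k :: "real ^ 'n \<Rightarrow> real" where
  "k x = nl (u x) - 2 * (u x * (norm (g x))\<^sup>2)"

lemma measurable_zGk [measurable]: "z \<in> borel_measurable borel" "G \<in> borel_measurable borel" "k \<in> borel_measurable borel"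
  unfolding z_def[abs_def] G_def[abs_def] k_def[abs_def] by measurable

lemma loc_L1_u2g: "loc_L1 (\<lambda>x. (u x)\<^sup>2 *\<^sub>R g x)"
proof (rule loc_L1I_bound[where M=1])
  show "loc_L1 (\<lambda>x. (u x)\<^sup>2 + (u x)\<^sup>2 * (norm (g x))\<^sup>2)" using u2 ug2 by (intro integrable_imp_loc_L1) auto
  fix x
  have "norm (g x) \<le> 1 + (norm (g x))\<^sup>2"
  proof -
    have "0 \<le> (norm (g x) - 1)\<^sup>2" by simp
    then have "2 * norm (g x) \<le> 1 + (norm (g x))\<^sup>2" by (simp add: power2_diff)
    then show ?thesis using norm_ge_zero[of "g x"] by linarith
  qed
  from mult_left_mono[OF this, of "(u x)\<^sup>2"]
  show "norm ((u x)\<^sup>2 *\<^sub>R g x) \<le> 1 * norm ((u x)\<^sup>2 + (u x)\<^sup>2 * (norm (g x))\<^sup>2)"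
    by (simp add: algebra_simps)
qed measurable

lemma loc_L1_G: "loc_L1 G"
  using loc_L1_add[OF loc_L1_ug(2) loc_L1_scaleR[OF loc_L1_u2g, of 2]] by (simp add: G_def[abs_def] scaleR_add_left)

lemma loc_L1_ug2: "loc_L1 (\<lambda>x. u x * (norm (g x))\<^sup>2)"
proof (rule loc_L1I_bound[where M=1])
  show "loc_L1 (\<lambda>x. (norm (g x))\<^sup>2 + (u x)\<^sup>2 * (norm (g x))\<^sup>2)" using g2 ug2 by (intro integrable_imp_loc_L1) auto
  fix x
  have "\<bar>u x\<bar> \<le> 1 + (u x)\<^sup>2"
    using zero_le_power2[of "\<bar>u x\<bar> - 1"] abs_ge_zero[of "u x"] unfolding power2_diff by simp
  from mult_right_mono[OF this, of "(norm (g x))\<^sup>2"]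
  show "norm (u x * (norm (g x))\<^sup>2) \<le> 1 * norm ((norm (g x))\<^sup>2 + (u x)\<^sup>2 * (norm (g x))\<^sup>2)"
    by (simp add: algebra_simps abs_mult)
qed measurable

lemma loc_L1_up: "loc_L1 (\<lambda>x. \<bar>u x\<bar> powr (p - 1) * u x)"
proof (rule loc_L1I_bound[where M=1])
  show "loc_L1 (\<lambda>x. 1 + \<bar>u x\<bar> powr (p + 1))"
    by (intro loc_L1_add loc_L1_const integrable_imp_loc_L1[OF integrable_potential])
  fix x
  have "\<bar>u x\<bar> powr p \<le> 1 + \<bar>u x\<bar> powr (p + 1)"
    using powr_le_add_powr[of "\<bar>u x\<bar>" 0 p "p + 1"] p_gt_1 by (cases "u x = 0") auto
  then show "norm (\<bar>u x\<bar> powr (p - 1) * u x) \<le> 1 * norm (1 + \<bar>u x\<bar> powr (p + 1))"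
    unfolding real_norm_def abs_powr_mult by simp
qed measurable

lemma loc_L1_k: "loc_L1 k"
  using loc_L1_diff[OF loc_L1_add[OF loc_L1_scaleR[OF loc_L1_ug(1), of \<mu>] loc_L1_up] loc_L1_scaleR[OF loc_L1_ug2, of 2]]
  by (simp add: k_def[abs_def] nl_def)

lemma weak_gradient_z: "weak_gradient z G"
  unfolding z_def[abs_def] G_def[abs_def]
proof (rule weak_gradient_chain[OF w, where F="\<lambda>s. s + 2 / 3 * s ^ 3" and F'="\<lambda>s. 1 + 2 * s\<^sup>2" and K="\<lambda>s. 1 + 2 * s\<^sup>2" and L="\<lambda>s. (1 + 2 * s\<^sup>2) * \<bar>s\<bar>"])
  show D: "DERIV (\<lambda>s. s + 2 / 3 * s ^ 3) s :> 1 + 2 * s\<^sup>2" for s :: real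
    by (auto intro!: derivative_eq_intros)
  show K: "\<bar>1 + 2 * t\<^sup>2\<bar> \<le> 1 + 2 * s\<^sup>2" if "\<bar>t\<bar> \<le> \<bar>s\<bar>" for s t :: real
    using that by (simp add: abs_le_square_iff)
  show "loc_L1 (\<lambda>x. (1 + 2 * (u x)\<^sup>2) *\<^sub>R g x)" using loc_L1_G by (simp add: G_def[abs_def])
  show "\<bar>t + 2 / 3 * t ^ 3\<bar> \<le> (1 + 2 * s\<^sup>2) * \<bar>s\<bar>" if "\<bar>t\<bar> \<le> \<bar>s\<bar>" for s t :: real
    by (rule abs_le_of_derivative_bound[OF D _ K that]) auto
  have "loc_L1 (\<lambda>x. \<bar>u x\<bar> + 2 * ((u x)\<^sup>2 + (u x) ^ 4))"
    using loc_L1_add[OF loc_L1_norm[OF loc_L1_ug(1)] integrable_imp_loc_L1[OF integrable_mult_right[OF Bochner_Integration.integrable_add[OF u2 integrable_fourth], of 2]]] by simp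
  then show "loc_L1 (\<lambda>x. (1 + 2 * (u x)\<^sup>2) * \<bar>u x\<bar>)"
  proof (rule loc_L1I_bound[where M=1])
    fix x
    have "\<bar>u x\<bar> \<le> 1 + (u x)\<^sup>2"
      using zero_le_power2[of "\<bar>u x\<bar> - 1"] abs_ge_zero[of "u x"] unfolding power2_diff by simp
    from mult_left_mono[OF this, of "(u x)\<^sup>2"]
    show "norm ((1 + 2 * (u x)\<^sup>2) * \<bar>u x\<bar>) \<le> 1 * norm (\<bar>u x\<bar> + 2 * ((u x)\<^sup>2 + (u x) ^ 4))"
      by (simp add: algebra_simps abs_mult flip: power_add)
  qed measurable
qed (auto intro!: continuous_intros)

text \<open>A regrouping of \<open>weak\<close>: the term with \<open>2 u^2\<close> joins the flux,
  and \<open>2 u |g|^2\<close> moves to the right-hand side. Because of the latter, only local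
  integrability of \<open>k\<close> is available.\<close>

lemma weak_divergence_G: "weak_divergence G k"
proof (rule weak_divergence_of_test_functions[OF loc_L1_G loc_L1_k])
  fix \<phi> :: "real ^ 'n \<Rightarrow> real" assume t: "\<phi> \<in> test_functions"
  obtain R M where R: "\<And>x. R < norm x \<Longrightarrow> \<phi> x = 0" "\<And>x. R < norm x \<Longrightarrow> grad \<phi> x = 0"
    "\<And>x. \<bar>\<phi> x\<bar> \<le> M" "\<And>x. norm (grad \<phi> x) \<le> M" "continuous_on UNIV \<phi>" "continuous_on UNIV (grad \<phi>)"
    using C1c_E[OF test_function_C1c[OF t]] by metis
  have m: "\<phi> \<in> borel_measurable borel" "grad \<phi> \<in> borel_measurable borel" using R by (auto intro: borel_measurable_continuous_onI)
  have i1: "integrable lborel (\<lambda>x. g x \<bullet> grad \<phi> x)"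
    by (rule loc_L1_integrable_compact_support[OF loc_L1_inner_bounded[OF loc_L1_ug(2) m(2) R(4)], of R]) (use R in auto)
  have i2: "integrable lborel (\<lambda>x. u x * \<phi> x)"
    by (rule loc_L1_integrable_compact_support[where R=R]) (use R loc_L1_mult_bounded[OF loc_L1_ug(1) m(1) R(3)] in \<open>auto simp: mult.commute\<close>)
  have i3: "integrable lborel (\<lambda>x. (u x)\<^sup>2 * (g x \<bullet> grad \<phi> x))"
    by (rule loc_L1_integrable_compact_support[where R=R]) (use R loc_L1_inner_bounded[OF loc_L1_u2g m(2) R(4)] in auto)
  have i4: "integrable lborel (\<lambda>x. u x * (norm (g x))\<^sup>2 * \<phi> x)"
    by (rule loc_L1_integrable_compact_support[where R=R]) (use R loc_L1_mult_bounded[OF loc_L1_ug2 m(1) R(3)] in \<open>auto simp: mult.commute\<close>)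
  have i5: "integrable lborel (\<lambda>x. \<bar>u x\<bar> powr (p - 1) * u x * \<phi> x)"
    by (rule loc_L1_integrable_compact_support[where R=R]) (use R loc_L1_mult_bounded[OF loc_L1_up m(1) R(3)] in \<open>auto simp: mult.commute\<close>)
  have "(LBINT x. G x \<bullet> grad \<phi> x) = (LBINT x. g x \<bullet> grad \<phi> x + 2 * ((u x)\<^sup>2 * (g x \<bullet> grad \<phi> x)))"
    by (rule Bochner_Integration.integral_cong) (auto simp: G_def algebra_simps inner_add_left)
  also have "\<dots> = (LBINT x. g x \<bullet> grad \<phi> x) + 2 * (LBINT x. (u x)\<^sup>2 * (g x \<bullet> grad \<phi> x))"
    using i1 i3 by simp
  finally have 1: "(LBINT x. G x \<bullet> grad \<phi> x) = (LBINT x. g x \<bullet> grad \<phi> x) + 2 * (LBINT x. (u x)\<^sup>2 * (g x \<bullet> grad \<phi> x))" .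
  have "(LBINT x. k x * \<phi> x) = (LBINT x. \<mu> * (u x * \<phi> x) + \<bar>u x\<bar> powr (p - 1) * u x * \<phi> x - 2 * (u x * (norm (g x))\<^sup>2 * \<phi> x))"
    by (rule Bochner_Integration.integral_cong) (auto simp: k_def nl_def algebra_simps)
  also have "\<dots> = \<mu> * (LBINT x. u x * \<phi> x) + (LBINT x. \<bar>u x\<bar> powr (p - 1) * u x * \<phi> x) - 2 * (LBINT x. u x * (norm (g x))\<^sup>2 * \<phi> x)"
    using i2 i4 i5 by simp
  finally have 2: "(LBINT x. k x * \<phi> x) = \<mu> * (LBINT x. u x * \<phi> x) + (LBINT x. \<bar>u x\<bar> powr (p - 1) * u x * \<phi> x) - 2 * (LBINT x. u x * (norm (g x))\<^sup>2 * \<phi> x)" .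
  show "(LBINT x. G x \<bullet> grad \<phi> x) = (LBINT x. k x * \<phi> x)"
    using weak[OF t] i3 i4 unfolding 1 2 by simp
qed

text \<open>Formally the equation for z divided by \<open>root_weight (u x)\<close>, that is, tested
  with \<open>\<phi> x / root_weight (u x)\<close>. The flux \<open>G\<close> is the square of the
  weight times \<open>g\<close>, so one factor of the weight is left and gives \<open>A\<close>;
  \<open>renormalized_equation\<close> makes this rigorous.\<close>

lemma weak_divergence_A: "weak_divergence A f"
  unfolding weak_divergence_def
proof (intro conjI loc_L1_A loc_L1_f allI impI)
  fix \<phi> :: "real ^ 'n \<Rightarrow> real" and \<psi> assume C: "C1c \<phi> \<psi>"
  obtain R M where R: "\<And>x. R < norm x \<Longrightarrow> \<phi> x = 0" "\<And>x. R < norm x \<Longrightarrow> \<psi> x = 0"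
    "\<And>x. \<bar>\<phi> x\<bar> \<le> M" "\<And>x. norm (\<psi> x) \<le> M" "continuous_on UNIV \<phi>" "continuous_on UNIV \<psi>"
    using C1c_E[OF C] by metis
  have m: "\<phi> \<in> borel_measurable borel" "\<psi> \<in> borel_measurable borel" using R by (auto intro: borel_measurable_continuous_onI)
  \<comment> \<open>With this \<open>T\<close> the term \<open>T'(u) G \<bullet> \<nabla>u\<close> cancels the non-variational part \<open>2 u |\<nabla>u|^2\<close> of \<open>k\<close>.\<close>
  define T where "T s = 1 / root_weight s" for s
  define T' where "T' s = - 2 * s / (root_weight s) ^ 3" for s
  have r: "root_weight s > 0" "root_weight s \<noteq> 0" for s using root_weight_pos by auto
  have DT: "DERIV T s :> T' s" for s
  proof -
    have "DERIV T s :> - (2 * s / root_weight s) / (root_weight s)\<^sup>2"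
      unfolding T_def[abs_def] using r(2)[of s] by (auto intro!: derivative_eq_intros DERIV_root_weight simp: power2_eq_square)
    then show ?thesis by (simp add: T'_def power2_eq_square power3_eq_cube mult.assoc)
  qed
  have cT': "continuous_on UNIV T'" unfolding T'_def using r by (intro continuous_intros root_weight_continuous) auto
  have bT: "\<bar>T s\<bar> \<le> 1" for s using root_weight_pos[of s] by (simp add: T_def)
  have bT': "\<bar>T' s\<bar> \<le> 1" for s
  proof -
    have "2 * \<bar>s\<bar> \<le> 1 + s\<^sup>2" using zero_le_power2[of "\<bar>s\<bar> - 1"] unfolding power2_diff power2_abs by simp
    then have "2 * \<bar>s\<bar> \<le> 1 + 2 * s\<^sup>2" using zero_le_power2[of s] by linarith
    also have "\<dots> = (root_weight s)\<^sup>2 * 1" by (simp add: root_weight_square)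
    also have "\<dots> \<le> (root_weight s)\<^sup>2 * root_weight s" using root_weight_pos[of s] by (intro mult_left_mono) auto
    finally have "2 * \<bar>s\<bar> \<le> (root_weight s) ^ 3" by (simp add: power2_eq_square power3_eq_cube)
    then show ?thesis using r(1)[of s] by (simp add: T'_def abs_div abs_mult)
  qed
  have q: "T' (u x) * (G x \<bullet> g x) = - 2 * (u x * (norm (g x))\<^sup>2) / root_weight (u x)" for x
  proof -
    have "G x \<bullet> g x = (root_weight (u x))\<^sup>2 * (norm (g x))\<^sup>2" by (simp add: G_def root_weight_square power2_norm_eq_inner)
    then show ?thesis using r(2)[of "u x"] by (simp add: T'_def power2_eq_square power3_eq_cube)
  qed
  have lq: "loc_L1 (\<lambda>x. (1 / root_weight (u x)) *\<^sub>R (u x * (norm (g x))\<^sup>2))"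
    by (rule loc_L1_mult_bounded[OF loc_L1_ug2, where M=1]) (use bT in \<open>auto simp: T_def\<close>)
  have lT: "loc_L1 (\<lambda>x. T' (u x) * (G x \<bullet> g x))"
    unfolding q using loc_L1_scaleR[OF lq, of "-2"] by (simp add: mult.assoc)
  \<comment> \<open>From \<open>z = u (1 + 2/3 u^2)\<close> follows \<open>u^2 \<le> z^2\<close>, so
    the quadratic decay of \<open>damp e (z x)\<close> absorbs the factor \<open>1 + 2 u^2\<close>
    of \<open>G\<close> at the price of the constant \<open>1 + 2 / e^2\<close>.\<close>
  have X2: "loc_L1 (\<lambda>x. (norm (damp e (z x) *\<^sub>R G x))\<^sup>2)" if e: "e > 0" for e
  proof (rule loc_L1I_bound[OF integrable_imp_loc_L1[OF g2], where M="(1 + 2 / e\<^sup>2)\<^sup>2"])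
    fix x
    have "(u x)\<^sup>2 \<le> (z x)\<^sup>2"
    proof -
      have "z x = u x * (1 + 2 / 3 * (u x)\<^sup>2)" by (simp add: z_def algebra_simps power2_eq_square power3_eq_cube)
      then have "(z x)\<^sup>2 = (u x)\<^sup>2 * (1 + 2 / 3 * (u x)\<^sup>2)\<^sup>2" by (simp add: power_mult_distrib)
      moreover have "(u x)\<^sup>2 * 1 \<le> (u x)\<^sup>2 * (1 + 2 / 3 * (u x)\<^sup>2)\<^sup>2"
        by (intro mult_left_mono one_le_power) auto
      ultimately show ?thesis by simp
    qed
    moreover have "1 + 2 * (z x)\<^sup>2 \<le> (1 + 2 / e\<^sup>2) * (1 + (e * z x)\<^sup>2)"
      using e by (simp add: field_simps power_mult_distrib)
    ultimately have "1 + 2 * (u x)\<^sup>2 \<le> (1 + 2 / e\<^sup>2) * (1 + (e * z x)\<^sup>2)" by linarith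
    then have d: "damp e (z x) * (1 + 2 * (u x)\<^sup>2) \<le> 1 + 2 / e\<^sup>2"
      using one_plus_square_pos[of "e * z x"] by (simp add: damp_def pos_divide_le_eq)
    have "norm (damp e (z x) *\<^sub>R G x) = (damp e (z x) * (1 + 2 * (u x)\<^sup>2)) * norm (g x)"
      using damp_bounds(1)[of e "z x"] by (simp add: G_def)
    also have "\<dots> \<le> (1 + 2 / e\<^sup>2) * norm (g x)" by (intro mult_right_mono d) auto
    finally have "(norm (damp e (z x) *\<^sub>R G x))\<^sup>2 \<le> ((1 + 2 / e\<^sup>2) * norm (g x))\<^sup>2" by (rule power_mono) simp
    then show "norm ((norm (damp e (z x) *\<^sub>R G x))\<^sup>2) \<le> (1 + 2 / e\<^sup>2)\<^sup>2 * norm ((norm (g x))\<^sup>2)"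
      by (simp add: power_mult_distrib)
  next
    have [measurable]: "damp e \<in> borel_measurable borel"
      using DERIV_damp by (auto intro!: borel_measurable_continuous_onI continuous_at_imp_continuous_on DERIV_isCont)
    show "(\<lambda>x. (norm (damp e (z x) *\<^sub>R G x))\<^sup>2) \<in> borel_measurable borel" by measurable
  qed
  have main: "(LBINT x. T (u x) * (G x \<bullet> \<psi> x) + \<phi> x * (T' (u x) * (G x \<bullet> g x))) = (LBINT x. k x * T (u x) * \<phi> x)"
    by (rule renormalized_equation[OF weak_gradient_z weak_divergence_G w integrable_imp_loc_L1[OF g2] X2 DT cT' bT bT' lT C])
  have TG: "T (u x) * (G x \<bullet> \<psi> x) = A x \<bullet> \<psi> x" for x
  proof -
    have "G x = (root_weight (u x))\<^sup>2 *\<^sub>R g x" by (simp add: G_def root_weight_square)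
    then show ?thesis using r(2)[of "u x"] by (simp add: T_def A_def power2_eq_square)
  qed
  have kT: "k x * T (u x) * \<phi> x = f x * \<phi> x + \<phi> x * (T' (u x) * (G x \<bullet> g x))" for x
    unfolding q by (simp add: k_def T_def f_def algebra_simps diff_divide_distrib)
  have i1: "integrable lborel (\<lambda>x. A x \<bullet> \<psi> x)"
    by (rule loc_L1_integrable_compact_support[OF loc_L1_inner_bounded[OF loc_L1_A m(2) R(4)], of R]) (use R in auto)
  have i2: "integrable lborel (\<lambda>x. f x * \<phi> x)"
    by (rule loc_L1_integrable_compact_support[where R=R]) (use R loc_L1_mult_bounded[OF loc_L1_f m(1) R(3)] in \<open>auto simp: mult.commute\<close>)
  have i3: "integrable lborel (\<lambda>x. \<phi> x * (T' (u x) * (G x \<bullet> g x)))"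
    by (rule loc_L1_integrable_compact_support[where R=R]) (use R loc_L1_mult_bounded[OF lT m(1) R(3)] in auto)
  show "(LBINT x. A x \<bullet> \<psi> x) = (LBINT x. f x * \<phi> x)"
    using main i1 i2 i3 unfolding TG kT by simp
qed

text \<open>In \<open>f x *\<^sub>R A x\<close> the weights cancel and leave
  \<open>nl (u x) *\<^sub>R g x\<close>, the gradient of \<open>?F (u x)\<close>. So the primitive
  needed by \<open>pohozaev_identity\<close> is the primitive of the original nonlinearity evaluated
  at u.\<close>

lemma pohozaev: "(1 - real CARD('n) / 2) * (dirichlet + 2 * quasi) = - (real CARD('n)) * (\<mu> * mass / 2 + potential / (p + 1))"
proof -
  let ?F = "\<lambda>s. \<mu> * s\<^sup>2 / 2 + \<bar>s\<bar> powr (p + 1) / (p + 1)"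
  have D: "DERIV ?F s :> nl s" for s
  proof -
    have "DERIV (\<lambda>s. \<bar>s\<bar> powr (p + 1) / (p + 1)) s :> (p + 1) * (\<bar>s\<bar> powr (p + 1 - 2) * s) / (p + 1)"
      by (intro DERIV_cdivide DERIV_abs_powr) (use p_gt_1 in simp)
    moreover have "DERIV (\<lambda>s. \<mu> * s\<^sup>2 / 2) s :> \<mu> * s" by (auto intro!: derivative_eq_intros)
    ultimately have "DERIV ?F s :> \<mu> * s + (p + 1) * (\<bar>s\<bar> powr (p + 1 - 2) * s) / (p + 1)" by (intro DERIV_add)
    moreover have "\<mu> * s + (p + 1) * (\<bar>s\<bar> powr (p + 1 - 2) * s) / (p + 1) = nl s"
      using p_gt_1 by (simp add: nl_def)
    ultimately show ?thesis by simp
  qed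
  have "weak_gradient (\<lambda>x. ?F (u x)) (\<lambda>x. nl (u x) *\<^sub>R g x)"
  proof (rule weak_gradient_chain[OF w D nl_continuous nl_abs_le _ nl_measurable(2), where L="\<lambda>s. nl_bound s * \<bar>s\<bar>"])
    show "\<bar>?F t\<bar> \<le> nl_bound s * \<bar>s\<bar>" if "\<bar>t\<bar> \<le> \<bar>s\<bar>" for s t
      by (rule abs_le_of_derivative_bound[OF D _ nl_abs_le that]) auto
    have e: "nl_bound s * \<bar>s\<bar> = \<bar>\<mu>\<bar> * s\<^sup>2 + \<bar>s\<bar> powr (p + 1)" for s
      by (cases "s = 0") (auto simp: nl_bound_def powr_add power2_eq_square algebra_simps)
    show "loc_L1 (\<lambda>x. nl_bound (u x) * \<bar>u x\<bar>)"
      unfolding e using u2 integrable_potential by (intro integrable_imp_loc_L1) auto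
    \<comment> \<open>Inserting the weight writes the norm of
      \<open>nl_bound (u x) *\<^sub>R g x\<close> as a product of two square integrable functions,
      \<open>nl_bound (u x) / root_weight (u x)\<close> and \<open>norm (A x)\<close>.\<close>
    have "integrable lborel (\<lambda>x. (nl_bound (u x) / root_weight (u x))\<^sup>2 + (norm (A x))\<^sup>2)"
      using integrable_nl_bound_quotient A2 by simp
    then show "loc_L1 (\<lambda>x. nl_bound (u x) *\<^sub>R g x)"
    proof (rule loc_L1I_bound[OF integrable_imp_loc_L1, where M=1])
      fix x
      let ?r = "root_weight (u x)" and ?b = "nl_bound (u x)"
      have r: "?r > 0" using root_weight_pos by simp
      have "norm (?b *\<^sub>R g x) = (?b / ?r) * norm (A x)"
        using r nl_bound_nonneg[of "u x"] by (simp add: A_def)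
      also have "\<dots> \<le> (?b / ?r)\<^sup>2 + (norm (A x))\<^sup>2"
      proof -
        have "0 \<le> (?b / ?r - norm (A x))\<^sup>2" "0 \<le> (?b / ?r) * norm (A x)" using r nl_bound_nonneg[of "u x"] by auto
        then show ?thesis unfolding power2_diff by linarith
      qed
      finally show "norm (?b *\<^sub>R g x) \<le> 1 * norm ((?b / ?r)\<^sup>2 + (norm (A x))\<^sup>2)" by simp
    qed measurable
  qed
  moreover have "nl (u x) *\<^sub>R g x = f x *\<^sub>R A x" for x
    using root_weight_pos[of "u x"] by (simp add: f_def A_def)
  ultimately have F: "weak_gradient (\<lambda>x. ?F (u x)) (\<lambda>x. f x *\<^sub>R A x)" by simp
  have iF: "integrable lborel (\<lambda>x. ?F (u x))" using u2 integrable_potential by simp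
  have "(LBINT x. (norm (A x))\<^sup>2) = dirichlet + 2 * quasi" unfolding norm_A using g2 ug2 by simp
  moreover have "(LBINT x. ?F (u x)) = \<mu> * mass / 2 + potential / (p + 1)" using u2 integrable_potential by simp
  ultimately show ?thesis using pohozaev_identity[OF weak_gradient_v weak_divergence_A A2 f2 F iF] by simp
qed

text \<open>Testing the original equation with u corresponds to testing the dual equation with
  \<open>u x * root_weight (u x)\<close>, which together with its gradient is square
  integrable.\<close>

lemma nehari: "dirichlet + 4 * quasi = \<mu> * mass + potential"
proof -
  let ?F = "\<lambda>s. s * root_weight s" and ?F' = "\<lambda>s. (1 + 4 * s\<^sup>2) / root_weight s"
  have r: "root_weight s > 0" "root_weight s \<noteq> 0" for s using root_weight_pos by auto
  have D: "DERIV ?F s :> ?F' s" for s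
  proof -
    have "DERIV ?F s :> 1 * root_weight s + 2 * s / root_weight s * s"
      by (intro DERIV_mult DERIV_ident DERIV_root_weight)
    moreover have "1 * root_weight s + 2 * s / root_weight s * s = ((root_weight s)\<^sup>2 + 2 * s\<^sup>2) / root_weight s"
      using r(2)[of s] by (simp add: field_simps power2_eq_square)
    ultimately show ?thesis by (simp add: root_weight_square add.commute)
  qed
  \<comment> \<open>A bound by the weight itself, so that the gradient
    \<open>?F' (u x) *\<^sub>R g x\<close> is controlled by \<open>A\<close>.\<close>
  have F'le: "\<bar>?F' s\<bar> \<le> 2 * root_weight s" for s
  proof -
    have "1 + 4 * s\<^sup>2 \<le> 2 * (root_weight s)\<^sup>2" by (simp add: root_weight_square)
    then have "(1 + 4 * s\<^sup>2) / root_weight s \<le> 2 * root_weight s"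
      using r(1)[of s] by (simp add: pos_divide_le_eq power2_eq_square mult.assoc)
    moreover have "0 \<le> (1 + 4 * s\<^sup>2) / root_weight s" using r(1)[of s] by simp
    ultimately show ?thesis by simp
  qed
  have K: "\<bar>?F' t\<bar> \<le> 2 * root_weight s" if "\<bar>t\<bar> \<le> \<bar>s\<bar>" for s t
    using F'le[of t] root_weight_mono[OF that] by simp
  have iu: "integrable lborel (\<lambda>x. (norm (u x * root_weight (u x)))\<^sup>2)"
  proof -
    have "(norm (u x * root_weight (u x)))\<^sup>2 = (u x)\<^sup>2 + 2 * (u x) ^ 4" for x
      by (simp add: power_mult_distrib root_weight_square algebra_simps flip: power_add)
    then show ?thesis using u2 integrable_fourth by simp
  qed
  have W: "weak_gradient (\<lambda>x. u x * root_weight (u x)) (\<lambda>x. ?F' (u x) *\<^sub>R g x)"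
  proof (rule weak_gradient_chain[OF w D _ K, where L="\<lambda>s. \<bar>s\<bar> * root_weight s"])
    show "continuous_on UNIV ?F'" using r by (intro continuous_intros root_weight_continuous) auto
    show "loc_L1 (\<lambda>x. (2 * root_weight (u x)) *\<^sub>R g x)" using loc_L1_scaleR[OF loc_L1_A, of 2] by (simp add: A_def)
    show "\<bar>t * root_weight t\<bar> \<le> \<bar>s\<bar> * root_weight s" if "\<bar>t\<bar> \<le> \<bar>s\<bar>" for s t
      unfolding abs_mult using that root_weight_mono[OF that] r(1)[of t] by (intro mult_mono) auto
    have "loc_L1 (\<lambda>x. u x * root_weight (u x))" by (rule loc_L1_square[OF _ iu]) measurable
    from loc_L1_norm[OF this] show "loc_L1 (\<lambda>x. \<bar>u x\<bar> * root_weight (u x))"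
      using r(1) by (simp add: abs_mult abs_of_pos)
  qed measurable
  have b2: "integrable lborel (\<lambda>x. (norm (?F' (u x) *\<^sub>R g x))\<^sup>2)"
  proof (rule Bochner_Integration.integrable_bound[OF integrable_mult_right[OF A2, of 4]])
    show "AE x in lborel. norm ((norm (?F' (u x) *\<^sub>R g x))\<^sup>2) \<le> norm (4 * (norm (A x))\<^sup>2)"
    proof (rule AE_I2)
      fix x
      have "norm (?F' (u x) *\<^sub>R g x) \<le> 2 * norm (A x)"
        unfolding norm_scaleR A_def using mult_right_mono[OF F'le[of "u x"] norm_ge_zero[of "g x"]] r(1)[of "u x"] by simp
      from power_mono[OF this, of 2] show "norm ((norm (?F' (u x) *\<^sub>R g x))\<^sup>2) \<le> norm (4 * (norm (A x))\<^sup>2)"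
        by (simp add: power_mult_distrib)
    qed
  qed measurable
  have main: "(LBINT x. A x \<bullet> (?F' (u x) *\<^sub>R g x)) = (LBINT x. f x * (u x * root_weight (u x)))"
    by (rule weak_divergence_test_square_integrable[OF weak_divergence_A W A2 f2 iu b2])
  have e1: "A x \<bullet> (?F' (u x) *\<^sub>R g x) = (norm (g x))\<^sup>2 + 4 * ((u x)\<^sup>2 * (norm (g x))\<^sup>2)" for x
  proof -
    have "A x \<bullet> (?F' (u x) *\<^sub>R g x) = (root_weight (u x) * ?F' (u x)) * (norm (g x))\<^sup>2"
      by (simp add: A_def power2_norm_eq_inner)
    also have "root_weight (u x) * ?F' (u x) = 1 + 4 * (u x)\<^sup>2" using r(2)[of "u x"] by simp
    finally show ?thesis by (simp add: algebra_simps)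
  qed
  have e2: "f x * (u x * root_weight (u x)) = \<mu> * (u x)\<^sup>2 + \<bar>u x\<bar> powr (p + 1)" for x
  proof -
    have "\<bar>u x\<bar> powr (p - 1) * (u x)\<^sup>2 = \<bar>u x\<bar> powr (p + 1)"
    proof (cases "u x = 0")
      case False
      then have "\<bar>u x\<bar> powr (p - 1) * (u x)\<^sup>2 = \<bar>u x\<bar> powr (p - 1) * \<bar>u x\<bar> powr 2" by simp
      also have "\<dots> = \<bar>u x\<bar> powr (p - 1 + 2)" by (rule powr_add[symmetric])
      finally show ?thesis by (simp add: add.commute)
    qed simp
    note pw = this
    have "f x * (u x * root_weight (u x)) = nl (u x) * u x"
      using r(2)[of "u x"] by (simp add: f_def)
    also have "\<dots> = \<mu> * (u x)\<^sup>2 + \<bar>u x\<bar> powr (p - 1) * (u x)\<^sup>2"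
      by (simp add: nl_def distrib_right power2_eq_square mult.assoc)
    finally show ?thesis unfolding pw .
  qed
  show ?thesis using main unfolding e1 e2 using g2 ug2 u2 integrable_potential by simp
qed

text \<open>\<open>N/2\<close> times the Nehari identity plus the Pohozaev identity: this
  combination is the one in which \<open>\<mu> * mass\<close> cancels, so nothing about the
  multiplier survives.\<close>

theorem virial: "dirichlet + ((real CARD('n)) + 2) * quasi = (real CARD('n)) * (p - 1) / (2 * (p + 1)) * potential"
proof -
  have "dirichlet + ((real CARD('n)) + 2) * quasi = real CARD('n) / 2 * (dirichlet + 4 * quasi) + (1 - real CARD('n) / 2) * (dirichlet + 2 * quasi)"
    by (simp add: algebra_simps)
  also have "\<dots> = real CARD('n) / 2 * (\<mu> * mass + potential) - (real CARD('n)) * (\<mu> * mass / 2 + potential / (p + 1))"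
    unfolding pohozaev nehari by simp
  also have "\<dots> = (real CARD('n)) * (p - 1) / (2 * (p + 1)) * potential"
    using p_gt_1 by (simp add: field_simps)
  finally show ?thesis .
qed

text \<open>If the right-hand side \<open>\<theta>\<close> were below 1, the virial identity and the
  two endpoint inequalities would give
  \<open>dirichlet + quasi \<le> \<theta> * (dirichlet + quasi)\<close>, hence
  \<open>dirichlet = 0\<close>, hence \<open>u = 0\<close> almost everywhere.\<close>

theorem mass_lower_bound:
  assumes pos: "mass > 0"
  shows "1 \<le> real CARD('n) / 2 * (GN 2 (real CARD('n)) + 4 * GN 1 (real CARD('n))) * mass powr (2 / real CARD('n))"
proof (rule ccontr)
  define \<theta> where "\<theta> = real CARD('n) / 2 * (GN 2 (real CARD('n)) + 4 * GN 1 (real CARD('n))) * mass powr (2 / real CARD('n))"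
  assume "\<not> 1 \<le> \<theta>"
  then have lt: "\<theta> < 1" by (simp add: \<theta>_def)
  have GN: "GN q (real CARD('n)) \<ge> 0" for q by (simp add: GN_def)
  have nn: "dirichlet \<ge> 0" "quasi \<ge> 0" "potential \<ge> 0" by (auto intro!: integral_nonneg_AE)
  have "potential \<le> (LBINT x. \<bar>u x\<bar> powr (2 + 4 / real CARD('n)) + \<bar>u x\<bar> powr (4 + 4 / real CARD('n)))"
    using p_lower p_upper middle_power(1) high_power(1) integrable_potential
    by (intro integral_mono powr_le_add_powr) auto
  also have "\<dots> \<le> GN 2 (real CARD('n)) * mass powr (2 / real CARD('n)) * dirichlet + GN 1 (real CARD('n)) * mass powr (2 / real CARD('n)) * (4 * quasi)"
    using middle_power high_power pos by (simp add: add_mono)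
  also have "\<dots> \<le> (GN 2 (real CARD('n)) + 4 * GN 1 (real CARD('n))) * mass powr (2 / real CARD('n)) * (dirichlet + quasi)"
  proof -
    have "0 \<le> GN 2 (real CARD('n)) * mass powr (2 / real CARD('n)) * quasi" "0 \<le> GN 1 (real CARD('n)) * mass powr (2 / real CARD('n)) * dirichlet"
      using GN nn by auto
    then show ?thesis by (simp add: algebra_simps)
  qed
  finally have P: "potential \<le> (GN 2 (real CARD('n)) + 4 * GN 1 (real CARD('n))) * mass powr (2 / real CARD('n)) * (dirichlet + quasi)" .
  \<comment> \<open>Estimating \<open>(p - 1) / (p + 1)\<close> by 1 frees the final constant from
    p.\<close>
  have "real CARD('n) * (p - 1) / (2 * (p + 1)) \<le> real CARD('n) / 2"
  proof -
    have "real CARD('n) * (p - 1) / (2 * (p + 1)) = real CARD('n) / 2 * ((p - 1) / (p + 1))" by simp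
    also have "\<dots> \<le> real CARD('n) / 2 * 1" using p_gt_1 by (intro mult_left_mono) auto
    finally show ?thesis by simp
  qed
  then have "dirichlet + ((real CARD('n)) + 2) * quasi \<le> real CARD('n) / 2 * potential"
    unfolding virial using nn(3) by (rule mult_right_mono)
  also have "\<dots> \<le> real CARD('n) / 2 * ((GN 2 (real CARD('n)) + 4 * GN 1 (real CARD('n))) * mass powr (2 / real CARD('n)) * (dirichlet + quasi))"
    by (rule mult_left_mono[OF P]) simp
  finally have "dirichlet + ((real CARD('n)) + 2) * quasi \<le> \<theta> * (dirichlet + quasi)" by (simp add: \<theta>_def mult_ac)
  moreover have "dirichlet + quasi \<le> dirichlet + ((real CARD('n)) + 2) * quasi"
    using nn(2) by (simp add: algebra_simps)
  ultimately have "dirichlet + quasi \<le> \<theta> * (dirichlet + quasi)" by linarith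
  then have "(1 - \<theta>) * (dirichlet + quasi) \<le> 0" by (simp add: left_diff_distrib)
  then have "dirichlet + quasi \<le> 0" using lt by (simp add: mult_le_0_iff)
  then have "dirichlet = 0" using nn(1,2) by linarith
  \<comment> \<open>With \<open>dirichlet = 0\<close>, the Gagliardo-Nirenberg bound at the lower
    exponent forces u to vanish almost everywhere, against \<open>mass > 0\<close>.\<close>
  then have "(LBINT x. \<bar>u x\<bar> powr (2 + 4 / real CARD('n))) \<le> 0" using middle_power(2)[of mass] pos by simp
  moreover have "0 \<le> (LBINT x. \<bar>u x\<bar> powr (2 + 4 / real CARD('n)))" by (rule integral_nonneg_AE) simp
  ultimately have "(LBINT x. \<bar>u x\<bar> powr (2 + 4 / real CARD('n))) = 0" by simp
  then have "AE x in lborel. \<bar>u x\<bar> powr (2 + 4 / real CARD('n)) = 0"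
    using integral_nonneg_eq_0_iff_AE[OF middle_power(1)] by simp
  then have "AE x in lborel. (u x)\<^sup>2 = 0" by eventually_elim simp
  then have "mass = 0" by (rule integral_eq_zero_AE)
  then show False using pos by simp
qed

end

section \<open>Nonexistence of critical points with small mass\<close>

lemma lebesgue_borel_representative:
  fixes f :: "'a::euclidean_space \<Rightarrow> real ^ 'm"
  assumes "f \<in> borel_measurable lebesgue"
  shows "\<exists>f'\<in>borel_measurable borel. AE x in lebesgue. f x = f' x"
proof -
  have "\<exists>h\<in>borel_measurable lborel. AE x in lborel. f x $ i = h x" for i
    by (rule completion_ex_borel_measurable_real) (rule borel_measurable_vec_nth[OF assms])
  then obtain h where h: "\<And>i. h i \<in> borel_measurable lborel" "\<And>i. AE x in lborel. f x $ i = h i x" by metis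
  have "(\<lambda>x. \<Sum>i\<in>UNIV. h i x *\<^sub>R (axis i 1 :: real ^ 'm)) \<in> borel_measurable borel" using h(1) by (auto intro!: borel_measurable_sum borel_measurable_scaleR)
  moreover have "(\<lambda>x. \<Sum>i\<in>UNIV. h i x *\<^sub>R (axis i 1 :: real ^ 'm)) = (\<lambda>x. \<chi> i. h i x)"
    using basis_expansion[of "\<chi> i. h i x" for x] by (simp add: scalar_mult_eq_scaleR)
  moreover have "AE x in lborel. f x = (\<chi> i. h i x)"
  proof -
    have "AE x in lborel. \<forall>i\<in>UNIV. f x $ i = h i x" by (rule AE_finite_allI) (use h(2) in auto)
    then show ?thesis by eventually_elim (simp add: vec_eq_iff)
  qed
  ultimately show ?thesis by (intro bexI[of _ "\<lambda>x. \<chi> i. h i x"]) (auto intro: AE_completion)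
qed

lemma lebesgue_transfer:
  fixes h h' :: "'a::euclidean_space \<Rightarrow> 'b::{banach, second_countable_topology}"
  assumes "AE x in lebesgue. h x = h' x" "h \<in> borel_measurable lebesgue" "h' \<in> borel_measurable borel"
  shows "integrable lebesgue h \<longleftrightarrow> integrable lborel h'" "integral\<^sup>L lebesgue h = integral\<^sup>L lborel h'"
proof -
  have m: "h' \<in> borel_measurable lborel" "h' \<in> borel_measurable lebesgue" using assms(3) by (auto intro: measurable_completion)
  show "integrable lebesgue h \<longleftrightarrow> integrable lborel h'"
    using integrable_cong_AE[OF assms(2) m(2) assms(1)] integrable_completion[OF m(1)] by simp
  show "integral\<^sup>L lebesgue h = integral\<^sup>L lborel h'"
    using integral_cong_AE[OF assms(2) m(2) assms(1)] integral_completion[OF m(1)] by simp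
qed

text \<open>A pointwise limit of the restrictions to balls of integer radius, which at each point
  are eventually constant.\<close>

lemma locally_integrable_measurable:
  fixes f :: "real ^ 'n \<Rightarrow> 'b::{banach, second_countable_topology}"
  assumes "locally_integrable f"
  shows "f \<in> borel_measurable lebesgue"
proof (rule borel_measurable_LIMSEQ_metric)
  fix n
  have "set_integrable lebesgue (cball 0 (real n)) f" using assms by (simp add: locally_integrable_def)
  then show "(\<lambda>x. indicator (cball 0 (real n)) x *\<^sub>R f x) \<in> borel_measurable lebesgue"
    by (auto simp: set_integrable_def)
next
  fix x :: "real ^ 'n"
  obtain n0 where "norm x \<le> real n0" using real_arch_simple by blast
  then have "eventually (\<lambda>n. indicator (cball 0 (real n)) x *\<^sub>R f x = f x) sequentially"
    unfolding eventually_sequentially by (intro exI[of _ n0]) (auto simp: indicator_def)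
  then show "(\<lambda>n. indicator (cball 0 (real n)) x *\<^sub>R f x) \<longlonglongrightarrow> f x" by (rule tendsto_eventually)
qed

lemma locally_integrable_loc_L1:
  fixes f f' :: "real ^ 'n \<Rightarrow> 'b::{banach, second_countable_topology}"
  assumes f: "locally_integrable f" and e: "AE x in lebesgue. f x = f' x" and m: "f' \<in> borel_measurable borel"
  shows "loc_L1 f'"
  unfolding loc_L1_def
proof (intro conjI m allI)
  fix R
  have i: "integrable lebesgue (\<lambda>x. indicat_real (cball 0 R) x *\<^sub>R f x)"
    using f by (auto simp: locally_integrable_def set_integrable_def)
  have ae: "AE x in lebesgue. indicat_real (cball 0 R) x *\<^sub>R f x = indicat_real (cball 0 R) x *\<^sub>R f' x"
    using e by eventually_elim simp
  have "(\<lambda>x. indicat_real (cball 0 R) x *\<^sub>R f' x) \<in> borel_measurable borel"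
    by (intro borel_measurable_scaleR borel_measurable_indicator m) auto
  then show "integrable lborel (\<lambda>x. indicat_real (cball 0 R) x *\<^sub>R f' x)"
    using lebesgue_transfer(1)[OF ae borel_measurable_integrable[OF i]] i by simp
qed

lemma has_weak_gradient_imp_weak_gradient:
  fixes u u' :: "real ^ 'n \<Rightarrow> real"
  assumes w: "has_weak_gradient u g" and u: "AE x in lebesgue. u x = u' x" "u' \<in> borel_measurable borel"
    and g: "AE x in lebesgue. g x = g' x" "g' \<in> borel_measurable borel"
  shows "weak_gradient u' g'"
proof (rule weak_gradient_of_test_functions)
  have l: "locally_integrable u" "locally_integrable g" using w by (auto simp: has_weak_gradient_def)
  note [measurable] = locally_integrable_measurable[OF l(1)] locally_integrable_measurable[OF l(2)] u(2) g(2)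
  show "loc_L1 u'" "loc_L1 g'" using locally_integrable_loc_L1 l u g by blast+
  fix \<phi> :: "real ^ 'n \<Rightarrow> real" and i assume t: "\<phi> \<in> test_functions"
  have "continuous_on UNIV \<phi>" "continuous_on UNIV (grad \<phi>)" using test_function_C1c[OF t] by (auto elim!: C1c_E)
  then have mb: "\<phi> \<in> borel_measurable borel" "grad \<phi> \<in> borel_measurable borel" by (auto intro: borel_measurable_continuous_onI)
  then have ml: "\<phi> \<in> borel_measurable lebesgue" "grad \<phi> \<in> borel_measurable lebesgue" by (auto intro: measurable_completion)
  note [measurable] = mb ml
  have "AE x in lebesgue. u x * grad \<phi> x $ i = u' x * grad \<phi> x $ i" using u(1) by eventually_elim simp
  then have "(\<integral>x. u x * grad \<phi> x $ i \<partial>lebesgue) = (LBINT x. u' x * grad \<phi> x $ i)"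
    by (rule lebesgue_transfer(2)) measurable
  moreover have "AE x in lebesgue. g x $ i * \<phi> x = g' x $ i * \<phi> x" using g(1) by eventually_elim simp
  then have "(\<integral>x. g x $ i * \<phi> x \<partial>lebesgue) = (LBINT x. g' x $ i * \<phi> x)"
    by (rule lebesgue_transfer(2)) measurable
  ultimately show "(LBINT x. u' x * grad \<phi> x $ i) = - (LBINT x. g' x $ i * \<phi> x)"
    using w t by (simp add: has_weak_gradient_def)
qed

text \<open>Moves a critical point to Borel representatives, on which the locale can be interpreted,
  and reads off \<open>mass_lower_bound\<close> with \<open>mass = c\<close>.\<close>

lemma critical_point_mass_bound:
  fixes u :: "real ^ 'n \<Rightarrow> real"
  assumes crit: "constrained_critical_point p c u" and c: "c > 0"
    and p: "p \<in> {1 + 4 / real CARD('n) .. 3 + 4 / real CARD('n)}"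
  shows "1 \<le> real CARD('n) / 2 * (GN 2 (real CARD('n)) + 4 * GN 1 (real CARD('n))) * c powr (2 / real CARD('n))"
proof -
  obtain \<mu> where H: "u \<in> H1" and i4: "integrable lebesgue (\<lambda>x. \<bar>u x\<bar>\<^sup>2 * (norm (weak_grad u x))\<^sup>2)"
    and mass: "(\<integral>x. \<bar>u x\<bar>\<^sup>2 \<partial>lebesgue) = c" and weak: "weak_solution p \<mu> u"
    using crit by (auto simp: constrained_critical_point_def sigma_def)
  define g where "g = weak_grad u"
  obtain g0 where g0: "has_weak_gradient u g0" "square_integrable g0" and su: "square_integrable u"
    using H by (auto simp: H1_def)
  \<comment> \<open>The chosen \<open>weak_grad u\<close> is a weak gradient because one exists. Its
    square integrability does not come with the choice; it is transferred from \<open>g0\<close> by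
    almost everywhere uniqueness.\<close>
  have wu: "has_weak_gradient u g" unfolding g_def weak_grad_def by (rule someI[of "has_weak_gradient u", OF g0(1)])
  have mu: "u \<in> borel_measurable lebesgue" using su by (simp add: square_integrable_def)
  have mg: "g \<in> borel_measurable lebesgue" using wu locally_integrable_measurable by (auto simp: has_weak_gradient_def)
  have mg0: "g0 \<in> borel_measurable lebesgue" using g0 by (simp add: square_integrable_def)
  obtain u' where u': "u' \<in> borel_measurable borel" "AE x in lebesgue. u x = u' x"
    using completion_ex_borel_measurable_real[OF mu] by (auto intro: AE_completion)
  obtain g' where g': "g' \<in> borel_measurable borel" "AE x in lebesgue. g x = g' x"
    using lebesgue_borel_representative[OF mg] by blast
  obtain g0' where g0': "g0' \<in> borel_measurable borel" "AE x in lebesgue. g0 x = g0' x"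
    using lebesgue_borel_representative[OF mg0] by blast
  note [measurable] = mu mg mg0 u'(1) g'(1) g0'(1)
  have w: "weak_gradient u' g'" by (rule has_weak_gradient_imp_weak_gradient[OF wu u'(2,1) g'(2,1)])
  have w0: "weak_gradient u' g0'" by (rule has_weak_gradient_imp_weak_gradient[OF g0(1) u'(2,1) g0'(2,1)])
  have "integrable lebesgue (\<lambda>x. (norm (u x))\<^sup>2)" using su by (simp add: square_integrable_def)
  then have u2: "integrable lborel (\<lambda>x. (u' x)\<^sup>2)"
    by (subst lebesgue_transfer(1)[symmetric, of "\<lambda>x. (norm (u x))\<^sup>2"]) (use u'(2) in \<open>auto elim!: eventually_mono\<close>)
  have "integrable lborel (\<lambda>x. (norm (g0' x))\<^sup>2)"
    by (subst lebesgue_transfer(1)[symmetric, of "\<lambda>x. (norm (g0 x))\<^sup>2"])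
       (use g0'(2) g0(2) in \<open>auto elim!: eventually_mono simp: square_integrable_def\<close>)
  then have g2: "integrable lborel (\<lambda>x. (norm (g' x))\<^sup>2)"
    by (rule integrable_cong_AE_imp) (use weak_gradient_unique[OF w w0] in \<open>auto elim!: eventually_mono\<close>)
  have both: "AE x in lebesgue. u x = u' x \<and> g x = g' x" using u'(2) g'(2) by eventually_elim simp
  \<comment> \<open>Stated for an arbitrary integrand in u, g and x, so that each integral of the
    definitions is transferred by a single instance.\<close>
  have ae: "AE x in lebesgue. F (u x) (g x) x = F (u' x) (g' x) x" for F :: "real \<Rightarrow> real ^ 'n \<Rightarrow> real ^ 'n \<Rightarrow> real"
    using both by eventually_elim simp
  have ug2: "integrable lborel (\<lambda>x. (u' x)\<^sup>2 * (norm (g' x))\<^sup>2)"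
    using lebesgue_transfer(1)[OF ae[of "\<lambda>a b x. \<bar>a\<bar>\<^sup>2 * (norm b)\<^sup>2"]] i4 by (simp add: g_def[symmetric])
  have m': "(LBINT x. (u' x)\<^sup>2) = c"
    using lebesgue_transfer(2)[OF ae[of "\<lambda>a b x. \<bar>a\<bar>\<^sup>2"]] mass by simp
  interpret quasilinear_solution u' g' p \<mu>
  proof
    fix \<phi> :: "real ^ 'n \<Rightarrow> real" assume t: "\<phi> \<in> test_functions"
    have "continuous_on UNIV \<phi>" "continuous_on UNIV (grad \<phi>)" using test_function_C1c[OF t] by (auto elim!: C1c_E)
    then have mb: "\<phi> \<in> borel_measurable borel" "grad \<phi> \<in> borel_measurable borel" by (auto intro: borel_measurable_continuous_onI)
    then have ml: "\<phi> \<in> borel_measurable lebesgue" "grad \<phi> \<in> borel_measurable lebesgue" by (auto intro: measurable_completion)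
    note [measurable] = mb ml
    have "(\<integral>x. g x \<bullet> grad \<phi> x \<partial>lebesgue) = (LBINT x. g' x \<bullet> grad \<phi> x)"
      using lebesgue_transfer(2)[OF ae[of "\<lambda>a b x. b \<bullet> grad \<phi> x"]] by simp
    moreover have "(\<integral>x. u x * \<phi> x \<partial>lebesgue) = (LBINT x. u' x * \<phi> x)"
      using lebesgue_transfer(2)[OF ae[of "\<lambda>a b x. a * \<phi> x"]] by simp
    moreover have "(\<integral>x. \<bar>u x\<bar>\<^sup>2 * (g x \<bullet> grad \<phi> x) + u x * (norm (g x))\<^sup>2 * \<phi> x \<partial>lebesgue) =
      (LBINT x. (u' x)\<^sup>2 * (g' x \<bullet> grad \<phi> x) + u' x * (norm (g' x))\<^sup>2 * \<phi> x)"
      using lebesgue_transfer(2)[OF ae[of "\<lambda>a b x. \<bar>a\<bar>\<^sup>2 * (b \<bullet> grad \<phi> x) + a * (norm b)\<^sup>2 * \<phi> x"]] by simp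
    moreover have "(\<integral>x. \<bar>u x\<bar> powr (p - 1) * u x * \<phi> x \<partial>lebesgue) = (LBINT x. \<bar>u' x\<bar> powr (p - 1) * u' x * \<phi> x)"
      using lebesgue_transfer(2)[OF ae[of "\<lambda>a b x. \<bar>a\<bar> powr (p - 1) * a * \<phi> x"]] by simp
    ultimately show "(LBINT x. g' x \<bullet> grad \<phi> x) - \<mu> * (LBINT x. u' x * \<phi> x)
      + 2 * (LBINT x. (u' x)\<^sup>2 * (g' x \<bullet> grad \<phi> x) + u' x * (norm (g' x))\<^sup>2 * \<phi> x)
      = (LBINT x. \<bar>u' x\<bar> powr (p - 1) * u' x * \<phi> x)"
      using weak t unfolding weak_solution_def g_def[symmetric] by fastforce
  qed (use w u2 g2 ug2 p in auto)
  show ?thesis using mass_lower_bound c unfolding m' by simp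
qed

theorem theorem1p6:
  fixes p :: real
  assumes "p \<in> {1 + 4 / real CARD('n) .. 3 + 4 / real CARD('n)}"
  shows "\<exists>c_hat>0. \<forall>c\<in>{0<..<c_hat}.
           \<not> (\<exists>u :: real ^ 'n \<Rightarrow> real. constrained_critical_point p c u)"
proof -
  let ?N = "real CARD('n)"
  define D where "D = ?N / 2 * (GN 2 ?N + 4 * GN 1 ?N)"
  have "GN q ?N > 0" for q by (simp add: GN_def add_pos_nonneg)
  then have D: "D > 0" by (simp add: D_def add_pos_pos)
  \<comment> \<open>The solution of \<open>D * c powr (2 / N) = 1\<close>; below it the lower bound
    on the mass fails.\<close>
  define c_hat where "c_hat = (1 / D) powr (?N / 2)"
  have "\<not> constrained_critical_point p c u" if c: "c \<in> {0<..<c_hat}" for c and u :: "real ^ 'n \<Rightarrow> real"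
  proof
    assume "constrained_critical_point p c u"
    then have "1 \<le> D * c powr (2 / ?N)"
      using critical_point_mass_bound assms c unfolding D_def by auto
    moreover have "c powr (2 / ?N) < c_hat powr (2 / ?N)" using c by (intro powr_less_mono2) auto
    moreover have "c_hat powr (2 / ?N) = 1 / D" using D by (simp add: c_hat_def powr_powr)
    ultimately show False using D by (simp add: field_simps)
  qed
  moreover have "c_hat > 0" using D by (simp add: c_hat_def)
  ultimately show ?thesis by blast
qed

end
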